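(* Let $\mathbf X$ be a random vector in $\mathbb R^d$ that is multivariate regularly varying with index $\alpha>1$ and angular measure $S$, let $\mathbf X_1,\mathbf X_2,\dots$ be iid copies of $\mathbf X$, and let $(R_j,\mathbf\Theta_j)=(\|\mathbf X_j\|,\mathbf X_j/\|\mathbf X_j\|)$. Let $\{r_n\}$ be a sequence of thresholds with $r_n\to\infty$, let $p_n=\mathbb P(\|\mathbf X\|>r_n)$, $\hat p_n=\frac1n\sum_{j=1}^n\mathbf 1_{\{R_j>r_n\}}$, and let $\mu$ be a (Borel) measure on $\mathbb R^{d+1}=\mathbb R\times\mathbb R^d$. Let $T_n=\int_{\mathbb R^{d+1}}|C_n(s,t)|^2\mu(ds,dt)$ be the conditional empirical distance covariance between $R/r_n$ and $\mathbf\Theta$ given $R>r_n$ (defined in the context). (1) Assume that $np_n\to\infty$ and that $$\int_{\mathbb R^{d+1}}(1\wedge|s|^{\beta})(1\wedge|t|^2)\,\mu(ds,dt)<\infty\quad\text{for some }1<\beta<2\wedge\alpha .$$ Then $T_n\to0$ in probability as $n\to\infty$. (2) If, in addition to the assumptions of (1), $\{r_n\}$ satisfies $$np_n\int_{\mathbb R^{d+1}}\bigl|\varphi_{\frac{R}{r_n},\Theta|r_n}(s,t)-\varphi_{\frac{R}{r_n}|r_n}(s)\,\varphi_{\Theta|r_n}(t)\bigr|^2\mu(ds,dt)\to0,$$ then $$n\hat p_nT_n\xrightarrow{d}\int_{\mathbb R^{d+1}}|Q(s,t)|^2\,\mu(ds,dt),$$ where $Q$ is a centered (complex-valued) Gaussian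 process on $\mathbb R^{d+1}$ with covariance function $$\mathrm{cov}(Q(s,t),Q(s',t'))=\bigl(\varphi_R(s-s')-\varphi_R(s)\varphi_R(-s')\bigr)\bigl(\varphi_\Theta(t-t')-\varphi_\Theta(t)\varphi_\Theta(-t')\bigr).$$
   Context: Fix a norm $\|\cdot\|$ on $\mathbb R^d$ with unit sphere $\mathbb S^{d-1}$, and write $(R,\mathbf\Theta)=(\|\mathbf X\|,\mathbf X/\|\mathbf X\|)$. $\mathbf X$ is multivariate regularly varying with index $\alpha>0$ and angular (probability) measure $S$ on $\mathbb S^{d-1}$ if $\mathbb P(R>r)=L(r)r^{-\alpha}$ with $L$ slowly varying at infinity and, as $r\to\infty$, $$\mathbb P[(R/r,\mathbf\Theta)\in\cdot\mid R>r]\to\nu_\alpha\times S\quad\text{weakly on }[1,\infty)\times\mathbb S^{d-1},$$ where $\nu_\alpha(x,\infty)=x^{-\alpha}$ for $x\ge1$. For $s\in\mathbb R$, $t\in\mathbb R^d$ define the conditional empirical characteristic function $$\hat\varphi_{\frac{R}{r_n},\Theta|r_n}(s,t)=\frac{1}{\sum_{j=1}^n\mathbf 1_{\{R_j>r_n\}}}\sum_{j=1}^ne^{isR_j/r_n+it^T\mathbf\Theta_j}\mathbf 1_{\{R_j>r_n\}},$$ with marginals $\hat\varphi_{\frac{R}{r_n}|r_n}(s)=\hat\varphi_{\frac{R}{r_n},\Theta|r_n}(s,0)$ and $\hat\varphi_{\Theta|r_n}(t)=\hat\varphi_{\frac{R}{r_n},\Theta|r_n}(0,t)$, and $$C_n(s,t)=\hat\varphi_{\frac{R}{r_n},\Theta|r_n}(s,t)-\hat\varphi_{\frac{R}{r_n}|r_n}(s)\,\hat\varphi_{\Theta|r_n}(t).$$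 (On the event $\hat p_n=0$, set $T_n=0$.) The theoretical counterparts are $$\varphi_{\frac{R}{r_n},\Theta|r_n}(s,t)=\mathbb E\bigl[e^{isR/r_n+it^T\mathbf\Theta}\mid R>r_n\bigr],\quad \varphi_{\frac{R}{r_n}|r_n}(s)=\varphi_{\frac{R}{r_n},\Theta|r_n}(s,0),\quad \varphi_{\Theta|r_n}(t)=\varphi_{\frac{R}{r_n},\Theta|r_n}(0,t).$$ The limiting characteristic functions are $$\varphi_R(s)=\int_1^\infty e^{isr}\alpha r^{-\alpha-1}dr,\qquad \varphi_\Theta(t)=\int_{\mathbb S^{d-1}}e^{it^T\theta}S(d\theta).$$ For complex-valued centered $Q$, $\mathrm{cov}(Q(s,t),Q(s',t'))=\mathbb E[Q(s,t)\overline{Q(s',t')}]$, and $Q$ satisfies $Q(-s,-t)=\overline{Q(s,t)}$. $a\wedge b=\min(a,b)$; $|t|$ is the Euclidean norm. *)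

theory Defs
  imports "HOL-Probability.Probability"
begin

text \<open>
  Throughout, \<open>nm\<close> is an arbitrary norm on \<open>\<real>\<^sup>d\<close>; the library function \<open>norm\<close> is the Euclidean one.
\<close>

definition is_norm :: "('a::real_vector \<Rightarrow> real) \<Rightarrow> bool" where
  "is_norm nm \<longleftrightarrow>
     (\<forall>x. nm x = 0 \<longleftrightarrow> x = 0) \<and>
     (\<forall>x y. nm (x + y) \<le> nm x + nm y) \<and>
     (\<forall>c x. nm (c *\<^sub>R x) = \<bar>c\<bar> * nm x)"

definition unit_sphere :: "('a::real_vector \<Rightarrow> real) \<Rightarrow> 'a set" where
  "unit_sphere nm = {x. nm x = 1}"

text \<open>\<open>angle nm 0 = 0\<close>; this value never matters once the threshold is nonnegative.\<close>

definition angle :: "('a::real_vector \<Rightarrow> real) \<Rightarrow> 'a \<Rightarrow> 'a" where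
  "angle nm x = (1 / nm x) *\<^sub>R x"

section \<open>Regular variation\<close>

definition slowly_varying :: "(real \<Rightarrow> real) \<Rightarrow> bool" where
  "slowly_varying L \<longleftrightarrow>
     L \<in> borel_measurable (restrict_space borel {0<..}) \<and>
     (\<forall>x>0. L x > 0) \<and>
     (\<forall>c>0. ((\<lambda>x. L (c * x) / L x) \<longlongrightarrow> 1) at_top)"

text \<open>
  Weak convergence, along a filter, of Borel measures that are carried by the subspace \<open>A\<close>:
  the test functions are the bounded continuous functions on \<open>A\<close>.
\<close>

definition weak_conv_on ::
    "'a::topological_space set \<Rightarrow> ('i \<Rightarrow> 'a measure) \<Rightarrow> 'a measure \<Rightarrow> 'i filter \<Rightarrow> bool" where
  "weak_conv_on A Ms N F \<longleftrightarrow>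
     (\<forall>f :: 'a \<Rightarrow> real. continuous_on A f \<longrightarrow> bounded (f ` A) \<longrightarrow>
        ((\<lambda>i. LINT x:A|Ms i. f x) \<longlongrightarrow> (LINT x:A|N. f x)) F)"

definition nu :: "real \<Rightarrow> real measure" where
  "nu \<alpha> = density lborel (\<lambda>x. ennreal (indicator {1..} x * (\<alpha> * x powr (- \<alpha> - 1))))"

lemma emeasure_nu:
  assumes "\<alpha> > 0" "x \<ge> 1"
  shows "emeasure (nu \<alpha>) {x<..} = ennreal (x powr (- \<alpha>))"
proof -
  have "emeasure (nu \<alpha>) {x<..} =
      (\<integral>\<^sup>+y. ennreal (indicator {1..} y * (\<alpha> * y powr (- \<alpha> - 1))) * indicator {x<..} y \<partial>lborel)"
    unfolding nu_def by (subst emeasure_density) auto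
  also have "\<dots> = (\<integral>\<^sup>+y. ennreal (\<alpha> * y powr (- \<alpha> - 1)) * indicator {x..} y \<partial>lborel)"
    using assms AE_lborel_singleton[of x]
    by (intro nn_integral_cong_AE) (auto split: split_indicator)
  also have "\<dots> = ennreal (0 - (- (x powr (- \<alpha>))))"
  proof (rule nn_integral_FTC_atLeast)
    show "((\<lambda>y. - (y powr - \<alpha>)) \<longlongrightarrow> 0) at_top"
      using tendsto_minus[OF tendsto_neg_powr[OF _ filterlim_ident, of "- \<alpha>"]] assms by simp
  qed (use assms in \<open>auto intro!: derivative_eq_intros simp: algebra_simps\<close>)
  finally show ?thesis by simp
qed

definition multivariate_regularly_varying ::
    "'w measure \<Rightarrow> ((real^'d) \<Rightarrow> real) \<Rightarrow> real \<Rightarrow> (real^'d) measure \<Rightarrow> ('w \<Rightarrow> real^'d) \<Rightarrow> bool" where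
  "multivariate_regularly_varying M nm \<alpha> S X \<longleftrightarrow>
     X \<in> borel_measurable M \<and> \<alpha> > 0 \<and>
     prob_space S \<and> sets S = sets borel \<and> (AE \<theta> in S. \<theta> \<in> unit_sphere nm) \<and>
     (\<exists>L. slowly_varying L \<and>
        (\<forall>r>0. measure M {\<omega> \<in> space M. nm (X \<omega>) > r} = L r * r powr (- \<alpha>))) \<and>
     weak_conv_on ({1..} \<times> unit_sphere nm)
       (\<lambda>r. distr (uniform_measure M {\<omega> \<in> space M. nm (X \<omega>) > r}) borel
          (\<lambda>\<omega>. (nm (X \<omega>) / r, angle nm (X \<omega>))))
       (nu \<alpha> \<Otimes>\<^sub>M S) at_top"

section \<open>Characteristic functions and the empirical distance covariance\<close>

definition exceed_prob :: "'w measure \<Rightarrow> ((real^'d) \<Rightarrow> real) \<Rightarrow> ('w \<Rightarrow> real^'d) \<Rightarrow> real \<Rightarrow> real" where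
  "exceed_prob M nm X r = measure M {\<omega> \<in> space M. nm (X \<omega>) > r}"

text \<open>In \<open>cond_cf\<close>, \<open>uniform_measure M A\<close> is the conditional probability given the event \<open>A\<close>.\<close>

definition cond_cf ::
    "'w measure \<Rightarrow> ((real^'d) \<Rightarrow> real) \<Rightarrow> ('w \<Rightarrow> real^'d) \<Rightarrow> real \<Rightarrow> real \<Rightarrow> real^'d \<Rightarrow> complex" where
  "cond_cf M nm X r s t =
     (CLINT \<omega>|uniform_measure M {\<omega> \<in> space M. nm (X \<omega>) > r}.
        iexp (s * (nm (X \<omega>) / r) + t \<bullet> angle nm (X \<omega>)))"

definition cf_R :: "real \<Rightarrow> real \<Rightarrow> complex" where
  "cf_R \<alpha> s = (CLINT r:{1..}|lborel. iexp (s * r) * complex_of_real (\<alpha> * r powr (- \<alpha> - 1)))"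

definition cf_Theta :: "(real^'d) measure \<Rightarrow> real^'d \<Rightarrow> complex" where
  "cf_Theta S t = (CLINT \<theta>|S. iexp (t \<bullet> \<theta>))"

text \<open>
  The empirical quantities are functions of the sample \<open>x 1, \<dots>, x n\<close> and of the threshold \<open>r\<close>.
\<close>

definition p_hat :: "((real^'d) \<Rightarrow> real) \<Rightarrow> nat \<Rightarrow> real \<Rightarrow> (nat \<Rightarrow> real^'d) \<Rightarrow> real" where
  "p_hat nm n r x = (1 / real n) * (\<Sum>j=1..n. if nm (x j) > r then 1 else 0)"

definition emp_cf ::
    "((real^'d) \<Rightarrow> real) \<Rightarrow> nat \<Rightarrow> real \<Rightarrow> (nat \<Rightarrow> real^'d) \<Rightarrow> real \<Rightarrow> real^'d \<Rightarrow> complex" where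
  "emp_cf nm n r x s t =
     (1 / (\<Sum>j=1..n. if nm (x j) > r then 1 else 0)) *
     (\<Sum>j=1..n. if nm (x j) > r then iexp (s * (nm (x j) / r) + t \<bullet> angle nm (x j)) else 0)"

definition emp_C ::
    "((real^'d) \<Rightarrow> real) \<Rightarrow> nat \<Rightarrow> real \<Rightarrow> (nat \<Rightarrow> real^'d) \<Rightarrow> real \<Rightarrow> real^'d \<Rightarrow> complex" where
  "emp_C nm n r x s t = emp_cf nm n r x s t - emp_cf nm n r x s 0 * emp_cf nm n r x 0 t"

text \<open>
  When \<open>\<mu>\<close> integrates \<open>(1 \<and> \<bar>s\<bar>\<^sup>\<beta>) (1 \<and> \<bar>t\<bar>\<^sup>2)\<close> for some \<open>\<beta> < 2\<close>, the nonnegative function under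
  the integral is dominated by a (sample-dependent) multiple of that function, so the Bochner
  integral is the true value.
\<close>

definition emp_dcov ::
    "((real^'d) \<Rightarrow> real) \<Rightarrow> (real \<times> (real^'d)) measure \<Rightarrow> nat \<Rightarrow> real \<Rightarrow> (nat \<Rightarrow> real^'d) \<Rightarrow> real" where
  "emp_dcov nm \<mu> n r x =
     (if p_hat nm n r x = 0 then 0
      else LINT (s, t)|\<mu>. (cmod (emp_C nm n r x s t))\<^sup>2)"

section \<open>Modes of convergence\<close>

text \<open>
  Measurability is part of both notions, because \<open>measure\<close> and \<open>distr\<close> take default values on
  non-measurable arguments. The limit variable may live on a different probability space.
\<close>

definition tendsto_in_probability ::
    "'w measure \<Rightarrow> (nat \<Rightarrow> 'w \<Rightarrow> real) \<Rightarrow> real \<Rightarrow> bool" where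
  "tendsto_in_probability M Y c \<longleftrightarrow>
     (\<forall>n. Y n \<in> borel_measurable M) \<and>
     (\<forall>\<epsilon>>0. (\<lambda>n. measure M {\<omega> \<in> space M. \<bar>Y n \<omega> - c\<bar> > \<epsilon>}) \<longlonglongrightarrow> 0)"

definition tendsto_in_distribution ::
    "'w measure \<Rightarrow> (nat \<Rightarrow> 'w \<Rightarrow> real) \<Rightarrow> 'v measure \<Rightarrow> ('v \<Rightarrow> real) \<Rightarrow> bool" where
  "tendsto_in_distribution M Y P Z \<longleftrightarrow>
     (\<forall>n. Y n \<in> borel_measurable M) \<and> Z \<in> borel_measurable P \<and>
     weak_conv_m (\<lambda>n. distr M borel (Y n)) (distr P borel Z)"

section \<open>Gaussian processes\<close>

text \<open>Degenerate normal distributions are included.\<close>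

definition gaussian_variable :: "'w measure \<Rightarrow> ('w \<Rightarrow> real) \<Rightarrow> bool" where
  "gaussian_variable M Y \<longleftrightarrow>
     Y \<in> borel_measurable M \<and>
     ((\<exists>m. AE \<omega> in M. Y \<omega> = m) \<or>
      (\<exists>m \<sigma>. \<sigma> > 0 \<and> distributed M lborel Y (\<lambda>y. ennreal (normal_density m \<sigma> y))))"

text \<open>
  Joint Gaussianity refers to the real and imaginary parts of all the \<open>Q z\<close>; no circular symmetry
  is imposed.
\<close>

definition centered_complex_gaussian_process ::
    "'w measure \<Rightarrow> ('i \<Rightarrow> 'w \<Rightarrow> complex) \<Rightarrow> bool" where
  "centered_complex_gaussian_process P Q \<longleftrightarrow>
     prob_space P \<and>
     (\<forall>z. Q z \<in> borel_measurable P) \<and>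
     (\<forall>J a b. finite J \<longrightarrow>
        gaussian_variable P (\<lambda>\<omega>. \<Sum>z\<in>J. a z * Re (Q z \<omega>) + b z * Im (Q z \<omega>))) \<and>
     (\<forall>z. (CLINT \<omega>|P. Q z \<omega>) = 0)"

text \<open>
  The covariance and the reflection identity together determine the finite-dimensional
  distributions of \<open>Q\<close>, so the choice of the probability space carrying \<open>Q\<close> is immaterial. Joint
  measurability makes \<open>\<integral>\<bar>Q\<bar>\<^sup>2 d\<mu>\<close> meaningful.
\<close>

definition limit_process ::
    "real \<Rightarrow> (real^'d) measure \<Rightarrow> 'w measure \<Rightarrow> (real \<times> (real^'d) \<Rightarrow> 'w \<Rightarrow> complex) \<Rightarrow> bool" where
  "limit_process \<alpha> S P Q \<longleftrightarrow>
     centered_complex_gaussian_process P Q \<and>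
     (\<lambda>(z, \<omega>). Q z \<omega>) \<in> borel_measurable (borel \<Otimes>\<^sub>M P) \<and>
     (\<forall>z. \<forall>\<omega>\<in>space P. Q (- z) \<omega> = cnj (Q z \<omega>)) \<and>
     (\<forall>s t s' t'. (CLINT \<omega>|P. Q (s, t) \<omega> * cnj (Q (s', t') \<omega>)) =
        (cf_R \<alpha> (s - s') - cf_R \<alpha> s * cf_R \<alpha> (- s')) *
        (cf_Theta S (t - t') - cf_Theta S t * cf_Theta S (- t')))"

end

theory Submission
  imports Defs "HOL-Real_Asymp.Real_Asymp"
begin

text \<open>
  Write \<open>N\<close> for the number of exceedances, \<open>a\<^sub>n = n p\<^sub>n\<close>, \<open>A\<close> and \<open>B\<close> for the characters
  \<open>exp(isR/r\<^sub>n)\<close> and \<open>exp(it\<^sup>T\<Theta>)\<close>, and \<open>a\<close>, \<open>b\<close> for their conditional means. Then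
  \<open>C\<^sub>n = (1/N) \<Sum> (A - a) (B - b) - (1/N\<^sup>2) \<Sum> (A - a) \<Sum> (B - b)\<close>, the sums running over the exceedances.
  The first sum, centred and divided by \<open>\<surd>a\<^sub>n\<close>, is a row sum \<open>G\<^sub>n\<close> of iid variables, while the
  product of the two other sums is of smaller order. The \<open>\<beta>\<close>-th moments of the exceedance laws are
  uniformly bounded, so all second moments are at most a constant multiple of the weight
  \<open>w = (1 \<and> \<bar>s\<bar>\<^sup>\<beta>) (1 \<and> \<bar>t\<bar>\<^sup>2)\<close>; replacing \<open>\<mu>\<close> by the finite measure \<open>w d\<mu>\<close> and \<open>G\<^sub>n\<close> by
  \<open>G\<^sub>n / \<surd>w\<close> makes them bounded.

  The convergence of \<open>\<integral>\<bar>G\<^sub>n\<bar>\<^sup>2 d\<mu>\<close> needs no tightness in a function space. Averaging over an auxiliary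
  Gaussian vector turns \<open>exp(-l \<Sum> \<bar>G\<^sub>n(z\<^sub>i)\<bar>\<^sup>2)\<close> into characteristic functions of linear combinations of
  the \<open>G\<^sub>n(z\<^sub>i)\<close>, which converge by the central limit theorem for rows. The resulting mixed Laplace
  transforms are integrated over the \<open>z\<^sub>i\<close>; they determine the moments of
  \<open>\<integral>(1 - exp(-\<epsilon> \<bar>G\<^sub>n\<bar>\<^sup>2))/\<epsilon>\<close>, a bounded approximation to \<open>\<integral>\<bar>G\<^sub>n\<bar>\<^sup>2\<close>.
\<close>

text \<open>Three obstacles shape the proof. First, \<open>R\<close> need not have a second moment,
  since \<alpha> may be below 2. For \<beta> at most 2 the bound |exp(iu) - 1|^2 \<le> 4 min(1,
  |u|^\<beta>) trades the square for a \<beta>-th moment, which regular variation bounds uniformly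
  over high thresholds; this is the origin of the exponent in the weight. Second, radius and angle
  are dependent at every finite threshold, so centring leaves a deterministic bias next to
  \<open>G n\<close>. Asymptotic independence sends the unscaled bias to 0, which suffices for (1);
  the extra assumption of (2) removes the bias scaled by the square root of \<open>a n\<close>.
  Third, \<open>Q\<close> has to be exhibited, jointly measurable and with the reflection identity
  at every sample point. It is expanded in one fixed Gaussian sequence by a pivoted factorisation of
  its covariance along a dense sequence of pivots, and both properties can be read off the
  expansion. Finally, \<mu> may have infinite mass where s = 0 or t = 0. All integrands vanish
  there, so the passage to the finite measure is exact and every use of Fubini takes place over that
  measure.\<close>

section \<open>Convergence in distribution from Laplace transforms\<close>

text \<open>An exchange of limits: the approximating sequence may depend on e, and only its own
  convergence is required, as long as the approximation error is small for all large n at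
  once.\<close>

lemma tendsto_approxI:
  fixes a :: "'b \<Rightarrow> 'a::metric_space"
  assumes "\<And>e. e > 0 \<Longrightarrow> \<exists>b l. (b \<longlongrightarrow> l) F \<and> (\<forall>\<^sub>F n in F. dist (a n) (b n) \<le> e) \<and> dist c l \<le> e"
  shows "(a \<longlongrightarrow> c) F"
proof (rule tendstoI)
  fix e :: real assume "e > 0"
  then have "e / 4 > 0" by simp
  from assms[OF this] obtain b l where *: "(b \<longlongrightarrow> l) F" "\<forall>\<^sub>F n in F. dist (a n) (b n) \<le> e / 4"
    "dist c l \<le> e / 4"
    by blast
  have "\<forall>\<^sub>F n in F. dist (b n) l < e / 4" using *(1) \<open>e / 4 > 0\<close> unfolding tendsto_iff by blast
  with *(2) show "\<forall>\<^sub>F n in F. dist (a n) c < e"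
  proof eventually_elim
    case (elim n)
    have "dist (a n) c \<le> dist (a n) (b n) + dist (b n) l + dist c l"
      by (metis dist_commute dist_triangle_le add.commute add_left_mono dist_triangle order_trans)
    then show ?case using elim *(3) \<open>e > 0\<close> by linarith
  qed
qed

text \<open>On a compact interval polynomials are uniformly dense by Weierstrass, and the mean of a
  polynomial is a combination of moments. The uniform error transfers to both expectations, so no
  determinacy condition on the moments arises.\<close>

lemma moments_imp_integral_tendsto:
  fixes X :: "nat \<Rightarrow> 'w \<Rightarrow> real" and Y :: "'v \<Rightarrow> real"
  assumes "prob_space M" "prob_space P"
    and [measurable]: "\<And>n. X n \<in> borel_measurable M" "Y \<in> borel_measurable P"
    and X: "\<And>n \<omega>. \<omega> \<in> space M \<Longrightarrow> X n \<omega> \<in> {0..B}" and Y: "\<And>\<omega>. \<omega> \<in> space P \<Longrightarrow> Y \<omega> \<in> {0..B}"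
    and mom: "\<And>k::nat. (\<lambda>n. \<integral>\<omega>. X n \<omega> ^ k \<partial>M) \<longlonglongrightarrow> (\<integral>\<omega>. Y \<omega> ^ k \<partial>P)"
    and h: "continuous_on {0..B} (h :: real \<Rightarrow> real)"
  shows "(\<lambda>n. \<integral>\<omega>. h (X n \<omega>) \<partial>M) \<longlonglongrightarrow> (\<integral>\<omega>. h (Y \<omega>) \<partial>P)"
proof -
  interpret M: prob_space M by fact
  interpret P: prob_space P by fact
  obtain \<omega>0 where "\<omega>0 \<in> space P" using P.not_empty by blast
  with Y have B: "B \<ge> 0" by fastforce
  \<comment> \<open>Clamping extends h from {0..B} to a continuous, hence Borel, function on the
    line without changing it on the range of the variables.\<close>
  define h' where "h' = (\<lambda>x. h (max 0 (min B x)))"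
  have "continuous_on UNIV h'" unfolding h'_def
    by (rule continuous_on_compose2[OF h]) (use B in \<open>auto intro!: continuous_intros\<close>)
  then have [measurable]: "h' \<in> borel_measurable borel" by (rule borel_measurable_continuous_onI)
  have hX: "h (X n \<omega>) = h' (X n \<omega>)" if "\<omega> \<in> space M" for n \<omega> using X[OF that, of n] by (simp add: h'_def)
  have hY: "h (Y \<omega>) = h' (Y \<omega>)" if "\<omega> \<in> space P" for \<omega> using Y[OF that] by (simp add: h'_def)
  have approx: "\<bar>(\<integral>\<omega>. h' (Z \<omega>) \<partial>K) - (\<integral>\<omega>. g (Z \<omega>) \<partial>K)\<bar> \<le> e"
    if K: "prob_space K" and [measurable]: "Z \<in> borel_measurable K" "g \<in> borel_measurable borel"
      and Z: "\<And>\<omega>. \<omega> \<in> space K \<Longrightarrow> Z \<omega> \<in> {0..B}"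
      and g: "\<And>x. x \<in> {0..B} \<Longrightarrow> \<bar>h x - g x\<bar> < e" for K :: "'k measure" and Z g e
  proof -
    interpret K: prob_space K by fact
    obtain C where C: "\<And>x. x \<in> {0..B} \<Longrightarrow> norm (h x) \<le> C"
      using compact_imp_bounded[OF compact_continuous_image[OF h compact_Icc]]
      unfolding bounded_iff by (metis image_eqI)
    have "integrable K (\<lambda>\<omega>. h' (Z \<omega>))"
    proof (rule K.integrable_const_bound)
      show "AE \<omega> in K. norm (h' (Z \<omega>)) \<le> C" using C B by (simp add: h'_def)
    qed simp
    moreover have "integrable K (\<lambda>\<omega>. g (Z \<omega>))"
    proof (intro K.integrable_const_bound[of _ "C + e"])
      show "AE x in K. norm (g (Z x)) \<le> C + e"
      proof (rule AE_I2)
        fix \<omega> assume "\<omega> \<in> space K"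
        from C[OF Z[OF this]] g[OF Z[OF this]] show "norm (g (Z \<omega>)) \<le> C + e" by simp
      qed
    qed auto
    ultimately have "\<bar>(\<integral>\<omega>. h' (Z \<omega>) \<partial>K) - (\<integral>\<omega>. g (Z \<omega>) \<partial>K)\<bar> = \<bar>\<integral>\<omega>. h' (Z \<omega>) - g (Z \<omega>) \<partial>K\<bar>" by simp
    also have "\<dots> \<le> (\<integral>\<omega>. \<bar>h' (Z \<omega>) - g (Z \<omega>)\<bar> \<partial>K)" by (rule integral_abs_bound)
    also have "\<dots> \<le> (\<integral>\<omega>. e \<partial>K)"
    proof (rule integral_mono_AE)
      show "integrable K (\<lambda>\<omega>. \<bar>h' (Z \<omega>) - g (Z \<omega>)\<bar>)"
        by (intro integrable_abs Bochner_Integration.integrable_diff) fact+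
      show "AE \<omega> in K. \<bar>h' (Z \<omega>) - g (Z \<omega>)\<bar> \<le> e"
      proof (rule AE_I2)
        fix \<omega> assume "\<omega> \<in> space K"
        from g[OF Z[OF this]] Z[OF this] show "\<bar>h' (Z \<omega>) - g (Z \<omega>)\<bar> \<le> e" by (simp add: h'_def)
      qed
    qed simp
    finally show ?thesis by (simp add: K.prob_space)
  qed
  have "(\<lambda>n. \<integral>\<omega>. h' (X n \<omega>) \<partial>M) \<longlonglongrightarrow> (\<integral>\<omega>. h' (Y \<omega>) \<partial>P)"
  proof (rule tendsto_approxI)
    fix e :: real assume "e > 0"
    then obtain g where g: "real_polynomial_function g" "\<And>x. x \<in> {0..B} \<Longrightarrow> \<bar>h x - g x\<bar> < e"
      using Stone_Weierstrass_real_polynomial_function[OF compact_Icc h] by blast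
    then obtain a n where g_eq: "g = (\<lambda>x. \<Sum>i\<le>n. a i * x ^ i)"
      unfolding real_polynomial_function_iff_sum by blast
    have [measurable]: "g \<in> borel_measurable borel" unfolding g_eq by measurable
    have int: "(\<integral>\<omega>. g (Z \<omega>) \<partial>K) = (\<Sum>i\<le>n. a i * (\<integral>\<omega>. Z \<omega> ^ i \<partial>K))"
      if "prob_space K" and [measurable]: "Z \<in> borel_measurable K"
      and Z: "\<And>\<omega>. \<omega> \<in> space K \<Longrightarrow> Z \<omega> \<in> {0..B}" for K :: "'k measure" and Z
    proof -
      interpret K: prob_space K by fact
      have "integrable K (\<lambda>\<omega>. Z \<omega> ^ i)" for i
        by (rule K.integrable_const_bound[of _ "B ^ i"]) (use Z in \<open>auto intro!: AE_I2 power_mono\<close>)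
      then show ?thesis unfolding g_eq by (subst Bochner_Integration.integral_sum) auto
    qed
    show "\<exists>b l. b \<longlonglongrightarrow> l \<and> (\<forall>\<^sub>F n in sequentially. dist (\<integral>\<omega>. h' (X n \<omega>) \<partial>M) (b n)
      \<le> e) \<and> dist (\<integral>\<omega>. h' (Y \<omega>) \<partial>P) l \<le> e"
    proof (intro exI conjI always_eventually allI)
      show "(\<lambda>n. \<integral>\<omega>. g (X n \<omega>) \<partial>M) \<longlonglongrightarrow> (\<integral>\<omega>. g (Y \<omega>) \<partial>P)"
        using X Y by (subst (1 2) int)
          (auto intro!: tendsto_intros mom M.prob_space_axioms P.prob_space_axioms)
    qed (use X Y g in \<open>auto simp: dist_real_def intro!: approx M.prob_space_axioms P.prob_space_axioms\<close>)
  qed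
  also have "(\<lambda>n. \<integral>\<omega>. h' (X n \<omega>) \<partial>M) = (\<lambda>n. \<integral>\<omega>. h (X n \<omega>) \<partial>M)"
    using hX by (auto intro!: ext Bochner_Integration.integral_cong)
  also have "(\<integral>\<omega>. h' (Y \<omega>) \<partial>P) = (\<integral>\<omega>. h (Y \<omega>) \<partial>P)"
    using hY by (auto intro!: Bochner_Integration.integral_cong)
  finally show ?thesis .
qed

text \<open>The Laplace transform at an integer k is the k-th moment of exp(-V), a variable with
  values in [0, 1], so the method of moments on [0, 1] applies. Ramp functions of V are then
  continuous functions of exp(-V), and ramps suffice for weak convergence.\<close>

lemma laplace_tendsto_imp_weak_conv:
  fixes V :: "nat \<Rightarrow> 'w \<Rightarrow> real" and W :: "'v \<Rightarrow> real"
  assumes M: "prob_space M" and P: "prob_space P"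
    and [measurable]: "\<And>n. V n \<in> borel_measurable M" "W \<in> borel_measurable P"
    and V: "\<And>n \<omega>. \<omega> \<in> space M \<Longrightarrow> V n \<omega> \<ge> 0" and W: "\<And>\<omega>. \<omega> \<in> space P \<Longrightarrow> W \<omega> \<ge> 0"
    and lap: "\<And>l. l > 0 \<Longrightarrow> (\<lambda>n. \<integral>\<omega>. exp (- l * V n \<omega>) \<partial>M) \<longlonglongrightarrow> (\<integral>\<omega>. exp (- l * W \<omega>) \<partial>P)"
  shows "weak_conv_m (\<lambda>n. distr M borel (V n)) (distr P borel W)"
proof -
  interpret M: prob_space M by fact
  interpret P: prob_space P by fact
  have step: "(\<lambda>n. integral\<^sup>L (distr M borel (V n)) (cts_step x y))
    \<longlonglongrightarrow> integral\<^sup>L (distr P borel W) (cts_step x y)"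
    if "x < y" for x y
  proof -
    \<comment> \<open>The ramp is already 0 beyond y, so cutting u off at exp(-y - 1) changes no
      value; it keeps the logarithm away from 0 and makes h continuous at u = 0.\<close>
    define h where "h = (\<lambda>u::real. cts_step x y (- ln (max u (exp (- y - 1)))))"
    have cts: "continuous_on UNIV (cts_step x y)"
      using cts_step_uniformly_continuous[OF \<open>x < y\<close>] uniformly_continuous_imp_continuous by blast
    have "continuous_on {0..1} h" unfolding h_def
    proof (rule continuous_on_compose2[OF cts, where f = "\<lambda>u. - ln (max u (exp (- y - 1)))"])
      have "max u (exp (- y - 1)) \<noteq> 0" for u :: real
        using exp_gt_zero[of "- y - 1"] by linarith
      then show "continuous_on {0..1} (\<lambda>u. - ln (max u (exp (- y - 1))))"
        by (intro continuous_intros) auto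
    qed auto
    have h: "h (exp (- v)) = cts_step x y v" for v
    proof (cases "v \<le> y + 1")
      case False
      then have "max (exp (- v)) (exp (- y - 1)) = exp (- y - 1)" by (intro max_absorb2) auto
      then show ?thesis using False \<open>x < y\<close> by (simp add: h_def cts_step_def)
    qed (simp add: h_def max_absorb1)
    have "(\<lambda>n. \<integral>\<omega>. h (exp (- V n \<omega>)) \<partial>M) \<longlonglongrightarrow> (\<integral>\<omega>. h (exp (- W \<omega>)) \<partial>P)"
    proof (rule moments_imp_integral_tendsto[OF M P, where B = 1 and h = h
        and X = "\<lambda>n \<omega>. exp (- V n \<omega>)" and Y = "\<lambda>\<omega>. exp (- W \<omega>)"])
      fix k :: nat
      show "(\<lambda>n. \<integral>\<omega>. exp (- V n \<omega>) ^ k \<partial>M) \<longlonglongrightarrow> (\<integral>\<omega>. exp (- W \<omega>) ^ k \<partial>P)"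
      proof (cases "k = 0")
        case False
        with lap[of "real k"] show ?thesis by (simp add: exp_of_nat_mult[symmetric])
      qed (simp add: M.prob_space P.prob_space)
    qed (use V W in \<open>auto intro: \<open>continuous_on {0..1} h\<close>\<close>)
    then show ?thesis
      using borel_measurable_continuous_onI[OF cts] by (simp add: integral_distr h)
  qed
  show ?thesis
    by (rule integral_cts_step_conv_imp_weak_conv[OF _ _ step])
      (auto simp: real_distribution_def real_distribution_axioms_def intro!: M.prob_space_distr P.prob_space_distr)
qed

section \<open>Independent standard Gaussian sequences\<close>

text \<open>This space is used twice: as the auxiliary randomisation that linearises squared moduli,
  and as the probability space that carries the limit process.\<close>

definition std_gaussian_seq :: "(nat \<Rightarrow> real) measure" where
  "std_gaussian_seq = PiM UNIV (\<lambda>_. std_normal_distribution)"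

lemma prob_space_std_gaussian_seq: "prob_space std_gaussian_seq"
  unfolding std_gaussian_seq_def using prob_space_normal_density[of 1 0]
  by (intro prob_space_PiM) simp

lemma sets_std_gaussian_seq: "sets std_gaussian_seq = sets (PiM UNIV (\<lambda>_. borel))"
  unfolding std_gaussian_seq_def by (intro sets_PiM_cong) auto

lemma measurable_std_gaussian_seq_component [measurable]:
  "(\<lambda>g. g k) \<in> borel_measurable std_gaussian_seq"
  unfolding measurable_cong_sets[OF sets_std_gaussian_seq refl] by measurable

lemma std_gaussian_seq_char:
  "(CLINT g|std_gaussian_seq. iexp (\<Sum>k<n. c k * g k)) = exp (- (\<Sum>k<n. (c k)\<^sup>2) / 2)"
proof -
  interpret P: prob_space std_gaussian_seq by (rule prob_space_std_gaussian_seq)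
  interpret N: prob_space "std_normal_distribution" by (rule prob_space_normal_density) simp
  interpret PP: product_prob_space "\<lambda>_::nat. std_normal_distribution" UNIV ..
  have comp: "distr std_gaussian_seq borel (\<lambda>g. g k) = std_normal_distribution" for k
  proof -
    have "distr std_gaussian_seq borel (\<lambda>g. g k) = distr std_gaussian_seq std_normal_distribution (\<lambda>g. g k)"
      by (rule distr_cong) auto
    with PP.PiM_component[of k] show ?thesis unfolding std_gaussian_seq_def by simp
  qed
  have "P.indep_vars (\<lambda>_. std_normal_distribution) (\<lambda>k g. g k) UNIV"
  proof (subst P.indep_vars_iff_distr_eq_PiM)
    show "distr std_gaussian_seq (Pi\<^sub>M UNIV (\<lambda>_. std_normal_distribution)) (\<lambda>x. \<lambda>i\<in>UNIV. x i) =
      Pi\<^sub>M UNIV (\<lambda>i. distr std_gaussian_seq std_normal_distribution (\<lambda>g. g i))"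
      using PP.PiM_component unfolding std_gaussian_seq_def by (simp add: restrict_def)
  qed auto
  then have "P.indep_vars (\<lambda>_. borel) (\<lambda>k g. c k * g k) {..<n}"
    by (rule P.indep_vars_compose2[OF P.indep_vars_subset]) simp_all
  then have "char (distr std_gaussian_seq borel (\<lambda>g. \<Sum>k<n. c k * g k)) 1 =
      (\<Prod>k<n. char (distr std_gaussian_seq borel (\<lambda>g. c k * g k)) 1)"
    by (rule P.char_distr_sum)
  also have "\<dots> = (\<Prod>k<n. char std_normal_distribution (c k))"
  proof (rule prod.cong[OF refl])
    fix k
    have "char (distr std_gaussian_seq borel (\<lambda>g. c k * g k)) 1
      = char (distr std_gaussian_seq borel (\<lambda>g. g k)) (c k)"
      by (simp add: char_def integral_distr)
    then show "char (distr std_gaussian_seq borel (\<lambda>g. c k * g k)) 1 = char std_normal_distribution (c k)"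
      by (simp only: comp)
  qed
  also have "\<dots> = exp (- (\<Sum>k<n. (c k)\<^sup>2) / 2)"
    by (simp add: char_std_normal_distribution exp_sum[symmetric] sum_negf sum_divide_distrib flip: of_real_prod)
  finally show ?thesis by (simp add: char_def integral_distr)
qed

section \<open>Laplace transforms of integrated squared processes\<close>

text \<open>A Gaussian density in q is itself a characteristic function of a Gaussian vector. Even
  coordinates of g multiply real parts and odd ones imaginary parts; the sign in
  \<open>Complex\<close> turns Re(u q) into a sum of the two, and the variance 2\<epsilon> cancels
  the factor 1/2 in the exponent.\<close>

lemma exp_neg_sum_sq_eq_gaussian_average:
  assumes "\<epsilon> \<ge> 0"
  shows "complex_of_real (exp (- \<epsilon> * (\<Sum>i<k. (cmod (q i))\<^sup>2))) =
    (CLINT g|std_gaussian_seq. iexp (\<Sum>i<k. Re (Complex (sqrt (2 * \<epsilon>) * g (2 * i)) (- sqrt (2 * \<epsilon>) * g (2 * i + 1)) * q i)))"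
proof -
  define c where "c m = sqrt (2 * \<epsilon>) * (if even m then Re (q (m div 2)) else Im (q (m div 2)))" for m
  have 1: "(\<Sum>m<2 * k. c m * g m)
    = (\<Sum>i<k. Re (Complex (sqrt (2 * \<epsilon>) * g (2 * i)) (- sqrt (2 * \<epsilon>) * g (2 * i + 1)) * q i))" for g
    by (induction k) (auto simp: c_def algebra_simps)
  have 2: "(\<Sum>m<2 * k. (c m)\<^sup>2) = 2 * \<epsilon> * (\<Sum>i<k. (cmod (q i))\<^sup>2)"
    using assms by (induction k) (auto simp: c_def algebra_simps cmod_power2)
  show ?thesis using std_gaussian_seq_char[of c "2 * k"] by (simp add: 1 2)
qed

lemma expectation_exp_neg_sum_sq:
  assumes "prob_space M" and [measurable]: "\<And>i. i < k \<Longrightarrow> q i \<in> borel_measurable M" and "\<epsilon> \<ge> 0"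
  shows "complex_of_real (\<integral>\<omega>. exp (- \<epsilon> * (\<Sum>i<k. (cmod (q i \<omega>))\<^sup>2)) \<partial>M) =
    (CLINT g|std_gaussian_seq. CLINT \<omega>|M.
      iexp (\<Sum>i<k. Re (Complex (sqrt (2 * \<epsilon>) * g (2 * i)) (- sqrt (2 * \<epsilon>) * g (2 * i + 1)) * q i \<omega>)))"
proof -
  interpret M: prob_space M by fact
  interpret P: prob_space std_gaussian_seq by (rule prob_space_std_gaussian_seq)
  interpret PM: pair_prob_space std_gaussian_seq M ..
  let ?f = "\<lambda>g \<omega>. iexp (\<Sum>i<k. Re (Complex (sqrt (2 * \<epsilon>) * g (2 * i)) (- sqrt (2 * \<epsilon>) * g (2 * i
    + 1)) * q i \<omega>))"
  have "integrable (std_gaussian_seq \<Otimes>\<^sub>M M) (case_prod ?f)"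
    by (rule PM.P.integrable_const_bound[where B = 1]) (auto simp: case_prod_unfold)
  then have "(CLINT \<omega>|M. CLINT g|std_gaussian_seq. ?f g \<omega>) = (CLINT g|std_gaussian_seq. CLINT \<omega>|M. ?f g \<omega>)"
    by (rule PM.Fubini_integral)
  then show ?thesis
    unfolding exp_neg_sum_sq_eq_gaussian_average[OF \<open>\<epsilon> \<ge> 0\<close>, symmetric] integral_complex_of_real .
qed

text \<open>For each fixed g the inner expectation is a characteristic function of a linear
  combination, with coefficients made from g, so it converges by assumption. It is bounded by 1, and
  dominated convergence over g finishes the argument.\<close>

lemma char_tendsto_imp_laplace_tendsto:
  fixes G :: "nat \<Rightarrow> nat \<Rightarrow> 'w \<Rightarrow> complex" and Q :: "nat \<Rightarrow> 'v \<Rightarrow> complex"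
  assumes M: "prob_space M" and P: "prob_space P"
    and [measurable]: "\<And>n i. i < k \<Longrightarrow> G n i \<in> borel_measurable M" "\<And>i. i < k \<Longrightarrow> Q i \<in> borel_measurable P"
    and char: "\<And>u. (\<lambda>n. CLINT \<omega>|M. iexp (\<Sum>i<k. Re (u i * G n i \<omega>)))
      \<longlonglongrightarrow> (CLINT \<omega>|P. iexp (\<Sum>i<k. Re (u i * Q i \<omega>)))"
    and "\<epsilon> \<ge> 0"
  shows "(\<lambda>n. \<integral>\<omega>. exp (- \<epsilon> * (\<Sum>i<k. (cmod (G n i \<omega>))\<^sup>2)) \<partial>M) \<longlonglongrightarrow> (\<integral>\<omega>. exp (- \<epsilon> * (\<Sum>i<k. (cmod (Q i \<omega>))\<^sup>2)) \<partial>P)"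
proof -
  interpret M: prob_space M by fact
  interpret P: prob_space P by fact
  interpret S: prob_space std_gaussian_seq by (rule prob_space_std_gaussian_seq)
  have bound: "cmod (CLINT \<omega>|K. iexp (f \<omega>)) \<le> 1" if "prob_space K" for K :: "'k measure" and f
  proof -
    interpret K: prob_space K by fact
    have "cmod (CLINT \<omega>|K. iexp (f \<omega>)) \<le> (\<integral>\<omega>. cmod (iexp (f \<omega>)) \<partial>K)"
      by (rule integral_norm_bound)
    then show ?thesis by (simp add: K.prob_space)
  qed
  have E: "complex_of_real (\<integral>\<omega>. exp (- \<epsilon> * (\<Sum>i<k. (cmod (H i \<omega>))\<^sup>2)) \<partial>K) =
      (CLINT g|std_gaussian_seq. CLINT \<omega>|K. iexp (\<Sum>i<k. Re (Complex (sqrt (2 * \<epsilon>) * g (2 * i)) (- sqrt (2 * \<epsilon>) * g (2 * i + 1)) * H i \<omega>)))"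
    if "prob_space K" "\<forall>i<k. H i \<in> borel_measurable K" for K :: "'k measure" and H
    by (rule expectation_exp_neg_sum_sq) (use that \<open>\<epsilon> \<ge> 0\<close> in auto)
  have "\<forall>i<k. G n i \<in> borel_measurable M" for n by auto
  note EG = E[OF M this]
  have "\<forall>i<k. Q i \<in> borel_measurable P" by auto
  note EQ = E[OF P this]
  have "(\<lambda>n. complex_of_real (\<integral>\<omega>. exp (- \<epsilon> * (\<Sum>i<k. (cmod (G n i \<omega>))\<^sup>2)) \<partial>M)) \<longlonglongrightarrow> 
      complex_of_real (\<integral>\<omega>. exp (- \<epsilon> * (\<Sum>i<k. (cmod (Q i \<omega>))\<^sup>2)) \<partial>P)"
    unfolding EG EQ
  proof (rule integral_dominated_convergence[where w = "\<lambda>_. 1"], goal_cases)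
    case 4
    show ?case by (intro AE_I2 char)
  next
    case (5 n)
    show ?case by (intro AE_I2 bound[OF M])
  qed auto
  then show ?thesis by (simp only: tendsto_of_real_iff)
qed

text \<open>The function (1 - exp(-\<epsilon>x))/\<epsilon> is the bounded substitute for x. Lying
  below x, it gives the truncation error a sign, so that error can be measured by its mean.\<close>

lemma one_minus_exp_bounds:
  fixes x :: real assumes "x \<ge> 0" "\<epsilon> > 0"
  shows "0 \<le> (1 - exp (- \<epsilon> * x)) / \<epsilon>" "(1 - exp (- \<epsilon> * x)) / \<epsilon> \<le> x"
proof -
  have "1 + (- \<epsilon> * x) \<le> exp (- \<epsilon> * x)" by (rule exp_ge_add_one_self)
  then show "(1 - exp (- \<epsilon> * x)) / \<epsilon> \<le> x" using assms by (simp add: field_simps)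
qed (use assms in auto)

lemma exp_neg_lipschitz:
  fixes x y :: real assumes "x \<ge> 0" "y \<ge> 0"
  shows "\<bar>exp (- x) - exp (- y)\<bar> \<le> \<bar>x - y\<bar>"
proof -
  have *: "exp (- x) - exp (- y) \<le> y - x" if "x \<le> y" "x \<ge> 0" for x y :: real
  proof -
    have "exp (- x) - exp (- y) = exp (- x) * (1 - exp (- (y - x)))"
      by (simp add: algebra_simps flip: exp_add)
    also have "\<dots> \<le> 1 * (y - x)"
    proof (rule mult_mono)
      show "1 - exp (- (y - x)) \<le> y - x" using exp_ge_add_one_self[of "- (y - x)"] by linarith
    qed (use that in auto)
    finally show ?thesis by simp
  qed
  show ?thesis
    using *[of x y] *[of y x] assms by (cases "x \<le> y") (auto simp: abs_if)
qed

text \<open>Second moments bounded uniformly in z, together with a finite N, give integrability on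
  the product space; the remaining claims are sections of this by Fubini.\<close>

lemma AE_integrable_second_moment_process:
  fixes H :: "'z \<Rightarrow> 'w \<Rightarrow> complex"
  assumes "finite_measure N" "prob_space M"
    and H [measurable]: "(\<lambda>(z, \<omega>). H z \<omega>) \<in> borel_measurable (N \<Otimes>\<^sub>M M)"
    and int: "\<And>z. z \<in> space N \<Longrightarrow> integrable M (\<lambda>\<omega>. (cmod (H z \<omega>))\<^sup>2)"
    and C: "\<And>z. z \<in> space N \<Longrightarrow> (\<integral>\<omega>. (cmod (H z \<omega>))\<^sup>2 \<partial>M) \<le> C"
  shows "integrable (N \<Otimes>\<^sub>M M) (\<lambda>(z, \<omega>). (cmod (H z \<omega>))\<^sup>2)"
    and "AE \<omega> in M. integrable N (\<lambda>z. (cmod (H z \<omega>))\<^sup>2)"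
    and "(\<integral>\<omega>. (\<integral>z. (cmod (H z \<omega>))\<^sup>2 \<partial>N) \<partial>M) \<le> C * measure N (space N)"
    and "integrable M (\<lambda>\<omega>. \<integral>z. (cmod (H z \<omega>))\<^sup>2 \<partial>N)"
proof -
  interpret M: prob_space M by fact
  interpret N: finite_measure N by fact
  interpret NM: pair_sigma_finite N M ..
  interpret MN: pair_sigma_finite M N ..
  have m [measurable]: "(\<lambda>z. \<integral>\<omega>. (cmod (H z \<omega>))\<^sup>2 \<partial>M) \<in> borel_measurable N"
    by (rule M.borel_measurable_lebesgue_integral) (simp add: case_prod_unfold, measurable)
  have i: "integrable N (\<lambda>z. \<integral>\<omega>. (cmod (H z \<omega>))\<^sup>2 \<partial>M)"
    by (rule N.integrable_const_bound[of _ C]) (use C in auto)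
  show 1: "integrable (N \<Otimes>\<^sub>M M) (\<lambda>(z, \<omega>). (cmod (H z \<omega>))\<^sup>2)"
    by (rule NM.Fubini_integrable) (use i int in \<open>auto simp: case_prod_unfold\<close>)
  then have 2: "integrable (M \<Otimes>\<^sub>M N) (\<lambda>(\<omega>, z). (cmod (H z \<omega>))\<^sup>2)"
    using NM.integrable_product_swap[OF 1] by (simp add: case_prod_unfold)
  from MN.AE_integrable_fst'[OF 2] show "AE \<omega> in M. integrable N (\<lambda>z. (cmod (H z \<omega>))\<^sup>2)" by simp
  from MN.integrable_fst'[OF 2] show "integrable M (\<lambda>\<omega>. \<integral>z. (cmod (H z \<omega>))\<^sup>2 \<partial>N)" by simp
  have "(\<integral>\<omega>. (\<integral>z. (cmod (H z \<omega>))\<^sup>2 \<partial>N) \<partial>M) = (\<integral>z. (\<integral>\<omega>. (cmod (H z \<omega>))\<^sup>2 \<partial>M) \<partial>N)"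
    by (rule NM.Fubini_integral) (use 1 in \<open>simp add: case_prod_unfold\<close>)
  also have "\<dots> \<le> (\<integral>z. C \<partial>N)" by (rule integral_mono) (use C i in auto)
  finally show "(\<integral>\<omega>. (\<integral>z. (cmod (H z \<omega>))\<^sup>2 \<partial>N) \<partial>M) \<le> C * measure N (space N)" by (simp add: mult.commute)
qed

text \<open>The map x -> exp(-l x) is l-Lipschitz on the half-line, and the two arguments differ by
  the N-integral of a nonnegative truncation error. Taking expectations and swapping the integrals
  leaves a bound that involves only one-point laws of H.\<close>

lemma laplace_bounded_approx:
  fixes H :: "'z \<Rightarrow> 'w \<Rightarrow> complex"
  assumes N: "finite_measure N" and M: "prob_space M"
    and H [measurable]: "(\<lambda>(z, \<omega>). H z \<omega>) \<in> borel_measurable (N \<Otimes>\<^sub>M M)"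
    and int: "\<And>z. z \<in> space N \<Longrightarrow> integrable M (\<lambda>\<omega>. (cmod (H z \<omega>))\<^sup>2)"
    and C: "\<And>z. z \<in> space N \<Longrightarrow> (\<integral>\<omega>. (cmod (H z \<omega>))\<^sup>2 \<partial>M) \<le> C"
    and \<epsilon>: "\<epsilon> > 0" and l: "l > 0"
  shows "\<bar>(\<integral>\<omega>. exp (- l * (\<integral>z. (cmod (H z \<omega>))\<^sup>2 \<partial>N)) \<partial>M)
      - (\<integral>\<omega>. exp (- (l / \<epsilon>) * (measure N (space N) - (\<integral>z. exp (- \<epsilon> * (cmod (H z \<omega>))\<^sup>2) \<partial>N))) \<partial>M)\<bar>
    \<le> l * (\<integral>z. (\<integral>\<omega>. (cmod (H z \<omega>))\<^sup>2 \<partial>M) - (1 - (\<integral>\<omega>. exp (- \<epsilon> * (cmod (H z \<omega>))\<^sup>2) \<partial>M)) / \<epsilon> \<partial>N)"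
proof -
  interpret M: prob_space M by fact
  interpret N: finite_measure N by fact
  interpret NM: pair_sigma_finite N M ..
  interpret MN: pair_sigma_finite M N ..
  have A: "integrable (N \<Otimes>\<^sub>M M) (\<lambda>(z, \<omega>). (cmod (H z \<omega>))\<^sup>2)" "AE \<omega> in M. integrable N (\<lambda>z. (cmod (H z \<omega>))\<^sup>2)"
    by (rule AE_integrable_second_moment_process[OF N M H int C], assumption+)+
  let ?B = "measure N (space N)"
  let ?D = "\<lambda>z \<omega>. (cmod (H z \<omega>))\<^sup>2 - (1 - exp (- \<epsilon> * (cmod (H z \<omega>))\<^sup>2)) / \<epsilon>"
  let ?V = "\<lambda>\<omega>. \<integral>z. (cmod (H z \<omega>))\<^sup>2 \<partial>N" and ?J = "\<lambda>\<omega>. \<integral>z. exp (- \<epsilon> * (cmod (H z \<omega>))\<^sup>2) \<partial>N"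
  have [measurable]: "?V \<in> borel_measurable M" "?J \<in> borel_measurable M"
    by (auto intro!: N.borel_measurable_lebesgue_integral simp: case_prod_unfold)
  have e1: "exp (- (\<epsilon> * x\<^sup>2)) \<le> 1" for x :: real using \<epsilon> by simp
  have iD: "integrable (N \<Otimes>\<^sub>M M) (\<lambda>(z, \<omega>). ?D z \<omega>)"
  proof (rule Bochner_Integration.integrable_bound[OF A(1)])
    show "AE x in N \<Otimes>\<^sub>M M. norm (case x of (z, \<omega>) \<Rightarrow> ?D z \<omega>) \<le> norm (case x of (z, \<omega>) \<Rightarrow> (cmod (H z \<omega>))\<^sup>2)"
      using one_minus_exp_bounds[OF _ \<epsilon>] by (auto simp: case_prod_unfold)
  qed (auto simp: case_prod_unfold)
  have iD': "integrable (M \<Otimes>\<^sub>M N) (\<lambda>(\<omega>, z). ?D z \<omega>)"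
    using NM.integrable_product_swap[OF iD] by (simp add: case_prod_unfold)
  have iJ: "integrable N (\<lambda>z. exp (- \<epsilon> * (cmod (H z \<omega>))\<^sup>2))" if "\<omega> \<in> space M" for \<omega>
    using that \<epsilon> by (intro N.integrable_const_bound[of _ 1]) (auto simp: zero_le_mult_iff)
  have iE: "integrable M (\<lambda>\<omega>. exp (- \<epsilon> * (cmod (H z \<omega>))\<^sup>2))" if "z \<in> space N" for z
    using that \<epsilon> by (intro M.integrable_const_bound[of _ 1]) (auto simp: zero_le_mult_iff)
  have J: "?J \<omega> \<le> ?B" if "\<omega> \<in> space M" for \<omega>
  proof -
    have "?J \<omega> \<le> (\<integral>z. 1 \<partial>N)"
      by (rule integral_mono[OF iJ[OF that]]) (use \<epsilon> in \<open>auto simp: zero_le_mult_iff\<close>)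
    then show ?thesis by simp
  qed
  have i1: "integrable M (\<lambda>\<omega>. exp (- l * ?V \<omega>))"
    using l by (intro M.integrable_const_bound[of _ 1]) auto
  have i2: "integrable M (\<lambda>\<omega>. exp (- (l / \<epsilon>) * (?B - ?J \<omega>)))"
    using l \<epsilon> J by (intro M.integrable_const_bound[of _ 1])
      (auto intro!: AE_I2 divide_nonpos_pos mult_nonneg_nonneg)
  have "\<bar>(\<integral>\<omega>. exp (- l * ?V \<omega>) \<partial>M) - (\<integral>\<omega>. exp (- (l / \<epsilon>) * (?B - ?J \<omega>)) \<partial>M)\<bar>
      = \<bar>\<integral>\<omega>. exp (- l * ?V \<omega>) - exp (- (l / \<epsilon>) * (?B - ?J \<omega>)) \<partial>M\<bar>"
    by (subst Bochner_Integration.integral_diff[OF i1 i2]) simp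
  also have "\<dots> \<le> (\<integral>\<omega>. \<bar>exp (- l * ?V \<omega>) - exp (- (l / \<epsilon>) * (?B - ?J \<omega>))\<bar> \<partial>M)" by (rule integral_abs_bound)
  also have "\<dots> \<le> (\<integral>\<omega>. l * (\<integral>z. ?D z \<omega> \<partial>N) \<partial>M)"
  proof (rule integral_mono_AE)
    show "integrable M (\<lambda>\<omega>. l * (\<integral>z. ?D z \<omega> \<partial>N))"
      using MN.integrable_fst'[OF iD'] by (intro integrable_mult_right) simp
    show "AE \<omega> in M. \<bar>exp (- l * ?V \<omega>) - exp (- (l / \<epsilon>) * (?B - ?J \<omega>))\<bar> \<le> l * (\<integral>z. ?D z \<omega> \<partial>N)"
      using A(2) AE_space
    proof eventually_elim
      case (elim \<omega>)
      have "(\<integral>z. (1 - exp (- \<epsilon> * (cmod (H z \<omega>))\<^sup>2)) / \<epsilon> \<partial>N) = (?B - ?J \<omega>) / \<epsilon>"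
        using iJ[OF elim(2)] by (subst integral_divide_zero, subst Bochner_Integration.integral_diff) auto
      moreover have "integrable N (\<lambda>z. (1 - exp (- \<epsilon> * (cmod (H z \<omega>))\<^sup>2)) / \<epsilon>)" using iJ[OF elim(2)] by auto
      ultimately have D: "(\<integral>z. ?D z \<omega> \<partial>N) = ?V \<omega> - (?B - ?J \<omega>) / \<epsilon>" using elim(1)
        by (subst Bochner_Integration.integral_diff) auto
      have "(\<integral>z. ?D z \<omega> \<partial>N) \<ge> 0"
        using one_minus_exp_bounds[OF _ \<epsilon>] by (intro Bochner_Integration.integral_nonneg) auto
      have "\<bar>exp (- (l * ?V \<omega>)) - exp (- (l * ((?B - ?J \<omega>) / \<epsilon>)))\<bar> \<le> \<bar>l * ?V \<omega> - l * ((?B - ?J \<omega>) / \<epsilon>)\<bar>"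
        using l \<epsilon> J[OF elim(2)] by (intro exp_neg_lipschitz) auto
      also have "\<dots> = l * (\<integral>z. ?D z \<omega> \<partial>N)" using \<open>(\<integral>z. ?D z \<omega> \<partial>N) \<ge> 0\<close> l unfolding D
        by (simp only: right_diff_distrib[symmetric] abs_mult abs_of_nonneg abs_of_pos)
      finally show ?case by simp
    qed
  qed (use i1 i2 in auto)
  also have "\<dots> = l * (\<integral>z. (\<integral>\<omega>. ?D z \<omega> \<partial>M) \<partial>N)"
    using NM.Fubini_integral[of ?D] iD by simp
  also have "(\<integral>z. (\<integral>\<omega>. ?D z \<omega> \<partial>M) \<partial>N) = (\<integral>z. (\<integral>\<omega>. (cmod (H z \<omega>))\<^sup>2 \<partial>M) - (1
    - (\<integral>\<omega>. exp (- \<epsilon> * (cmod (H z \<omega>))\<^sup>2) \<partial>M)) / \<epsilon> \<partial>N)"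
  proof (rule Bochner_Integration.integral_cong[OF refl])
    fix z assume z: "z \<in> space N"
    have "(\<integral>\<omega>. (1 - exp (- \<epsilon> * (cmod (H z \<omega>))\<^sup>2)) / \<epsilon> \<partial>M) = (1 - (\<integral>\<omega>. exp (- \<epsilon> * (cmod (H z \<omega>))\<^sup>2) \<partial>M)) / \<epsilon>"
      using iE[OF z] by (subst integral_divide_zero, subst Bochner_Integration.integral_diff)
        (auto simp: M.prob_space)
    moreover have "integrable M (\<lambda>\<omega>. (1 - exp (- \<epsilon> * (cmod (H z \<omega>))\<^sup>2)) / \<epsilon>)" using iE[OF z] by auto
    ultimately show "(\<integral>\<omega>. ?D z \<omega> \<partial>M) = (\<integral>\<omega>. (cmod (H z \<omega>))\<^sup>2 \<partial>M) - (1
      - (\<integral>\<omega>. exp (- \<epsilon> * (cmod (H z \<omega>))\<^sup>2) \<partial>M)) / \<epsilon>"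
      using int[OF z] by (subst Bochner_Integration.integral_diff) auto
  qed
  finally show ?thesis .
qed

text \<open>A k-th power of an integral is a k-fold integral over independent points. The list
  \<open>zs\<close> holds the points already split off, and k counts the factors still to be split.
  With \<open>zs = []\<close> and k = 1 it is the plain integral.\<close>

definition exp_moment ::
    "'z measure \<Rightarrow> real \<Rightarrow> nat \<Rightarrow> ('z \<Rightarrow> 'w \<Rightarrow> complex) \<Rightarrow> 'z list \<Rightarrow> 'w \<Rightarrow> real" where
  "exp_moment N \<epsilon> k H zs \<omega> =
     exp (- \<epsilon> * (\<Sum>z\<leftarrow>zs. (cmod (H z \<omega>))\<^sup>2)) * (\<integral>z. exp (- \<epsilon> * (cmod (H z \<omega>))\<^sup>2) \<partial>N) ^ k"

text \<open>Induction on k with \<open>zs\<close> arbitrary: Fubini pulls one factor out as an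
  integral over a new point z, the induction hypothesis for \<open>z # zs\<close> gives convergence
  for each z, and the bound B^k on the finite measure N allows dominated convergence. At k = 0 only
  finitely many points are left.\<close>

lemma laplace_mixed_moments_tendsto:
  fixes G :: "nat \<Rightarrow> 'z \<Rightarrow> 'w \<Rightarrow> complex" and Q :: "'z \<Rightarrow> 'v \<Rightarrow> complex"
  assumes N: "finite_measure N" and M: "prob_space M" and P: "prob_space P"
    and G [measurable]: "\<And>n. (\<lambda>(z, \<omega>). G n z \<omega>) \<in> borel_measurable (N \<Otimes>\<^sub>M M)"
    and Q [measurable]: "(\<lambda>(z, \<omega>). Q z \<omega>) \<in> borel_measurable (N \<Otimes>\<^sub>M P)"
    and fdd: "\<And>zs. set zs \<subseteq> space N \<Longrightarrow>
      (\<lambda>n. \<integral>\<omega>. exp (- \<epsilon> * (\<Sum>z\<leftarrow>zs. (cmod (G n z \<omega>))\<^sup>2)) \<partial>M) \<longlonglongrightarrow> (\<integral>\<omega>. exp (- \<epsilon> * (\<Sum>z\<leftarrow>zs. (cmod (Q z \<omega>))\<^sup>2)) \<partial>P)"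
    and \<epsilon>: "\<epsilon> > 0" and zs: "set zs \<subseteq> space N"
  shows "(\<lambda>n. \<integral>\<omega>. exp (- \<epsilon> * (\<Sum>z\<leftarrow>zs. (cmod (G n z \<omega>))\<^sup>2)) * (\<integral>z. exp (- \<epsilon> * (cmod (G n z \<omega>))\<^sup>2) \<partial>N) ^ k \<partial>M)
    \<longlonglongrightarrow> (\<integral>\<omega>. exp (- \<epsilon> * (\<Sum>z\<leftarrow>zs. (cmod (Q z \<omega>))\<^sup>2)) * (\<integral>z. exp (- \<epsilon> * (cmod (Q z \<omega>))\<^sup>2) \<partial>N) ^ k \<partial>P)"
  using zs
proof (induction k arbitrary: zs)
  case 0
  then show ?case using fdd by simp
next
  case (Suc k)
  interpret N: finite_measure N by fact
  let ?B = "measure N (space N)"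
  note F_def = exp_moment_def
  have F: "(\<integral>\<omega>. exp (- \<epsilon> * (\<Sum>z\<leftarrow>zs. (cmod (H z \<omega>))\<^sup>2)) * (\<integral>z. exp (- \<epsilon> * (cmod (H z \<omega>))\<^sup>2) \<partial>N) ^ Suc k \<partial>K)
      = (\<integral>z. (\<integral>\<omega>. exp_moment N \<epsilon> k H (z # zs) \<omega> \<partial>K) \<partial>N)"
    and bnd: "z \<in> space N \<Longrightarrow> \<bar>\<integral>\<omega>. exp_moment N \<epsilon> k H (z # zs) \<omega> \<partial>K\<bar> \<le> ?B ^ k"
    and Fm: "(\<lambda>z. \<integral>\<omega>. exp_moment N \<epsilon> k H (z # zs) \<omega> \<partial>K) \<in> borel_measurable N"
    if K: "prob_space K" and [measurable]: "(\<lambda>(z, \<omega>). H z \<omega>) \<in> borel_measurable (N \<Otimes>\<^sub>M K)"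
    for H :: "'z \<Rightarrow> 'k \<Rightarrow> complex" and K z
  proof -
    interpret K: prob_space K by fact
    interpret NK: pair_sigma_finite N K ..
    have [measurable]: "(\<lambda>\<omega>. \<Sum>z\<leftarrow>zs. (cmod (H z \<omega>))\<^sup>2) \<in> borel_measurable K"
      using Suc.prems by (induction zs) auto
    have [measurable]: "(\<lambda>\<omega>. \<integral>z. exp (- \<epsilon> * (cmod (H z \<omega>))\<^sup>2) \<partial>N) \<in> borel_measurable K"
      by (auto intro!: N.borel_measurable_lebesgue_integral simp: case_prod_unfold)
    have Fpm [measurable]: "(\<lambda>(z, \<omega>). exp_moment N \<epsilon> k H (z # zs) \<omega>) \<in> borel_measurable (N \<Otimes>\<^sub>M K)"
      unfolding F_def by (simp add: case_prod_unfold) measurable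
    show "(\<lambda>z. \<integral>\<omega>. exp_moment N \<epsilon> k H (z # zs) \<omega> \<partial>K) \<in> borel_measurable N" by measurable
    have J: "\<bar>\<integral>z. exp (- \<epsilon> * (cmod (H z \<omega>))\<^sup>2) \<partial>N\<bar> \<le> ?B" if "\<omega> \<in> space K" for \<omega>
    proof -
      have "\<bar>\<integral>z. exp (- \<epsilon> * (cmod (H z \<omega>))\<^sup>2) \<partial>N\<bar> \<le> (\<integral>z. \<bar>exp (- \<epsilon> * (cmod (H z \<omega>))\<^sup>2)\<bar> \<partial>N)"
        by (rule integral_abs_bound)
      also have "\<dots> \<le> (\<integral>z. 1 \<partial>N)"
        using \<epsilon> that by (intro integral_mono N.integrable_const_bound[of _ 1]) (auto simp: zero_le_mult_iff)
      finally show ?thesis by simp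
    qed
    have Fb: "\<bar>exp_moment N \<epsilon> k H (z # zs) \<omega>\<bar> \<le> ?B ^ k" if "\<omega> \<in> space K" for z \<omega>
    proof -
      have "(\<Sum>z\<leftarrow>z # zs. (cmod (H z \<omega>))\<^sup>2) \<ge> 0" by (rule sum_list_nonneg) auto
      then have "\<bar>exp_moment N \<epsilon> k H (z # zs) \<omega>\<bar> \<le> 1 * ?B ^ k" unfolding F_def abs_mult power_abs
        using \<epsilon> J[OF that] by (intro mult_mono power_mono) (auto intro!: mult_nonneg_nonneg)
      then show ?thesis by simp
    qed
    show "\<bar>\<integral>\<omega>. exp_moment N \<epsilon> k H (z # zs) \<omega> \<partial>K\<bar> \<le> ?B ^ k" if "z \<in> space N"
    proof -
      have "\<bar>\<integral>\<omega>. exp_moment N \<epsilon> k H (z # zs) \<omega> \<partial>K\<bar> \<le> (\<integral>\<omega>. \<bar>exp_moment N \<epsilon> k H (z # zs) \<omega>\<bar> \<partial>K)"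
        by (rule integral_abs_bound)
      also have "\<dots> \<le> (\<integral>\<omega>. ?B ^ k \<partial>K)"
        using that Fb by (intro integral_mono K.integrable_const_bound[of _ "?B ^ k"]) auto
      finally show ?thesis by (simp add: K.prob_space)
    qed
    have "integrable (N \<Otimes>\<^sub>M K) (\<lambda>(z, \<omega>). exp_moment N \<epsilon> k H (z # zs) \<omega>)"
      by (rule finite_measure.integrable_const_bound[of _ _ "?B ^ k"])
         (use Fb in \<open>auto intro!: finite_measure_pair_measure N.finite_measure_axioms K.finite_measure_axioms AE_I2 simp: space_pair_measure\<close>)
    then have "(\<integral>z. (\<integral>\<omega>. exp_moment N \<epsilon> k H (z # zs) \<omega> \<partial>K) \<partial>N)
      = (\<integral>\<omega>. (\<integral>z. exp_moment N \<epsilon> k H (z # zs) \<omega> \<partial>N) \<partial>K)"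
      by (rule NK.Fubini_integral[symmetric])
    also have "\<dots> = (\<integral>\<omega>. exp (- \<epsilon> * (\<Sum>z\<leftarrow>zs. (cmod (H z \<omega>))\<^sup>2)) * (\<integral>z. exp (- \<epsilon> * (cmod (H z \<omega>))\<^sup>2) \<partial>N) ^ Suc k \<partial>K)"
    proof (rule Bochner_Integration.integral_cong[OF refl])
      fix \<omega>
      have "exp_moment N \<epsilon> k H (z # zs) \<omega> = exp (- \<epsilon> * (cmod (H z \<omega>))\<^sup>2) *
          (exp (- \<epsilon> * (\<Sum>z\<leftarrow>zs. (cmod (H z \<omega>))\<^sup>2)) * (\<integral>z. exp (- \<epsilon> * (cmod (H z \<omega>))\<^sup>2) \<partial>N) ^ k)" for z
        by (simp add: F_def distrib_left flip: exp_add)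
      then show "(\<integral>z. exp_moment N \<epsilon> k H (z # zs) \<omega> \<partial>N)
        = exp (- \<epsilon> * (\<Sum>z\<leftarrow>zs. (cmod (H z \<omega>))\<^sup>2)) * (\<integral>z. exp (- \<epsilon> * (cmod (H z \<omega>))\<^sup>2) \<partial>N) ^ Suc k"
        by (simp add: mult.commute mult.left_commute)
    qed
    finally show "(\<integral>\<omega>. exp (- \<epsilon> * (\<Sum>z\<leftarrow>zs. (cmod (H z \<omega>))\<^sup>2)) * (\<integral>z. exp (- \<epsilon> * (cmod (H z \<omega>))\<^sup>2) \<partial>N) ^ Suc k \<partial>K)
      = (\<integral>z. (\<integral>\<omega>. exp_moment N \<epsilon> k H (z # zs) \<omega> \<partial>K) \<partial>N)" by simp
  qed
  show ?case unfolding F[OF M G] F[OF P Q]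
  proof (rule integral_dominated_convergence[where w = "\<lambda>_. ?B ^ k"])
    show "AE z in N. (\<lambda>n. \<integral>\<omega>. exp_moment N \<epsilon> k (G n) (z # zs) \<omega> \<partial>M)
      \<longlonglongrightarrow> (\<integral>\<omega>. exp_moment N \<epsilon> k Q (z # zs) \<omega> \<partial>P)"
    proof (rule AE_I2)
      fix z assume "z \<in> space N"
      with Suc.IH[of "z # zs"] Suc.prems show "(\<lambda>n. \<integral>\<omega>. exp_moment N \<epsilon> k (G n) (z # zs) \<omega> \<partial>M)
        \<longlonglongrightarrow> (\<integral>\<omega>. exp_moment N \<epsilon> k Q (z # zs) \<omega> \<partial>P)"
        unfolding F_def by simp
    qed
  qed (auto intro!: Fm bnd M P)
qed

text \<open>The mean error of the bounded substitute at z. It is split into a second moment and a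
  one-point Laplace transform so that its limit in n can be taken term by term.\<close>

definition truncation_defect :: "real \<Rightarrow> 'w measure \<Rightarrow> ('z \<Rightarrow> 'w \<Rightarrow> complex) \<Rightarrow> 'z \<Rightarrow> real" where
  "truncation_defect \<epsilon> K H z =
     (\<integral>\<omega>. (cmod (H z \<omega>))\<^sup>2 \<partial>K) - (1 - (\<integral>\<omega>. exp (- \<epsilon> * (cmod (H z \<omega>))\<^sup>2) \<partial>K)) / \<epsilon>"

text \<open>Convergence of second moments at each z takes the place of uniform integrability. It
  forces the truncation error of \<open>G n\<close> to approach that of Q, so an \<epsilon> chosen
  for Q alone works for all large n. For this \<epsilon> the truncated integrals are bounded and
  converge through their moments.\<close>

theorem integral_process_laplace_tendsto:
  fixes G :: "nat \<Rightarrow> 'z \<Rightarrow> 'w \<Rightarrow> complex" and Q :: "'z \<Rightarrow> 'v \<Rightarrow> complex"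
  assumes N: "finite_measure N" and M: "prob_space M" and P: "prob_space P"
    and G [measurable]: "\<And>n. (\<lambda>(z, \<omega>). G n z \<omega>) \<in> borel_measurable (N \<Otimes>\<^sub>M M)"
    and Q [measurable]: "(\<lambda>(z, \<omega>). Q z \<omega>) \<in> borel_measurable (N \<Otimes>\<^sub>M P)"
    and intG: "\<And>n z. z \<in> space N \<Longrightarrow> integrable M (\<lambda>\<omega>. (cmod (G n z \<omega>))\<^sup>2)"
    and intQ: "\<And>z. z \<in> space N \<Longrightarrow> integrable P (\<lambda>\<omega>. (cmod (Q z \<omega>))\<^sup>2)"
    and CG: "\<And>n z. z \<in> space N \<Longrightarrow> (\<integral>\<omega>. (cmod (G n z \<omega>))\<^sup>2 \<partial>M) \<le> C"
    and mom: "\<And>z. z \<in> space N \<Longrightarrow> (\<lambda>n. \<integral>\<omega>. (cmod (G n z \<omega>))\<^sup>2 \<partial>M) \<longlonglongrightarrow> (\<integral>\<omega>. (cmod (Q z \<omega>))\<^sup>2 \<partial>P)"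
    and char: "\<And>k (z :: nat \<Rightarrow> 'z) u. (\<And>i. i < k \<Longrightarrow> z i \<in> space N) \<Longrightarrow>
      (\<lambda>n. CLINT \<omega>|M. iexp (\<Sum>i<k. Re (u i * G n (z i) \<omega>))) \<longlonglongrightarrow> (CLINT \<omega>|P. iexp (\<Sum>i<k. Re (u i * Q (z i) \<omega>)))"
    and l: "l > 0"
  shows "(\<lambda>n. \<integral>\<omega>. exp (- l * (\<integral>z. (cmod (G n z \<omega>))\<^sup>2 \<partial>N)) \<partial>M)
    \<longlonglongrightarrow> (\<integral>\<omega>. exp (- l * (\<integral>z. (cmod (Q z \<omega>))\<^sup>2 \<partial>N)) \<partial>P)"
proof -
  interpret M: prob_space M by fact
  interpret P: prob_space P by fact
  interpret N: finite_measure N by fact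
  let ?B = "measure N (space N)"
  have CQ: "(\<integral>\<omega>. (cmod (Q z \<omega>))\<^sup>2 \<partial>P) \<le> C" if "z \<in> space N" for z
    by (rule LIMSEQ_le_const2[OF mom[OF that]]) (use CG that in auto)
  have e1: "(\<integral>\<omega>. exp (- \<epsilon> * (cmod (H z \<omega>))\<^sup>2) \<partial>K) \<le> 1"
    if "prob_space K" "\<epsilon> > 0" for \<epsilon> and H :: "'z \<Rightarrow> 'k \<Rightarrow> complex" and K z
  proof -
    interpret K: prob_space K by fact
    show ?thesis
    proof (cases "integrable K (\<lambda>\<omega>. exp (- \<epsilon> * (cmod (H z \<omega>))\<^sup>2))")
      case True
      then have "(\<integral>\<omega>. exp (- \<epsilon> * (cmod (H z \<omega>))\<^sup>2) \<partial>K) \<le> (\<integral>\<omega>. 1 \<partial>K)"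
        using \<open>\<epsilon> > 0\<close> by (intro integral_mono) auto
      then show ?thesis by (simp add: K.prob_space)
    qed (simp add: not_integrable_integral_eq)
  qed
  note d_def = truncation_defect_def
  have d_eq: "truncation_defect \<epsilon> K H z = (\<integral>\<omega>. (cmod (H z \<omega>))\<^sup>2 - (1 - exp (- \<epsilon> * (cmod (H z \<omega>))\<^sup>2)) / \<epsilon> \<partial>K)"
    and d_bd: "\<bar>truncation_defect \<epsilon> K H z\<bar> \<le> C"
    if "prob_space K" "\<epsilon> > 0" and [measurable]: "H z \<in> borel_measurable K"
      and i: "integrable K (\<lambda>\<omega>. (cmod (H z \<omega>))\<^sup>2)" and c: "(\<integral>\<omega>. (cmod (H z \<omega>))\<^sup>2 \<partial>K) \<le> C"
    for \<epsilon> and K :: "'k measure" and H :: "'z \<Rightarrow> 'k \<Rightarrow> complex" and z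
  proof -
    interpret K: prob_space K by fact
    have *: "integrable K (\<lambda>\<omega>. exp (- \<epsilon> * (cmod (H z \<omega>))\<^sup>2))"
      using \<open>\<epsilon> > 0\<close> by (intro K.integrable_const_bound[of _ 1]) auto
    then show eq: "truncation_defect \<epsilon> K H z = (\<integral>\<omega>. (cmod (H z \<omega>))\<^sup>2 - (1
      - exp (- \<epsilon> * (cmod (H z \<omega>))\<^sup>2)) / \<epsilon> \<partial>K)"
      using i by (simp add: d_def K.prob_space)
    have "truncation_defect \<epsilon> K H z \<ge> 0" unfolding eq
      using one_minus_exp_bounds[OF _ \<open>\<epsilon> > 0\<close>] by (intro Bochner_Integration.integral_nonneg) auto
    moreover have "(1 - (\<integral>\<omega>. exp (- \<epsilon> * (cmod (H z \<omega>))\<^sup>2) \<partial>K)) / \<epsilon> \<ge> 0"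
      using e1[OF \<open>prob_space K\<close> \<open>\<epsilon> > 0\<close>, of H z] \<open>\<epsilon> > 0\<close> by simp
    then have "truncation_defect \<epsilon> K H z \<le> C" using c unfolding d_def by linarith
    ultimately show "\<bar>truncation_defect \<epsilon> K H z\<bar> \<le> C" by simp
  qed
  have dm [measurable]: "truncation_defect \<epsilon> K H \<in> borel_measurable N"
    if "prob_space K" and [measurable]: "(\<lambda>(z, \<omega>). H z \<omega>) \<in> borel_measurable (N \<Otimes>\<^sub>M K)"
    for \<epsilon> and K :: "'k measure" and H :: "'z \<Rightarrow> 'k \<Rightarrow> complex"
  proof -
    interpret K: prob_space K by fact
    have "(\<lambda>z. truncation_defect \<epsilon> K H z) \<in> borel_measurable N" unfolding d_def by measurable
    then show ?thesis by simp
  qed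
  have Gz [measurable]: "G n z \<in> borel_measurable M" if "z \<in> space N" for n z
    using measurable_compose[OF measurable_Pair1'[OF that] G] by simp
  have Qz [measurable]: "Q z \<in> borel_measurable P" if "z \<in> space N" for z
    using measurable_compose[OF measurable_Pair1'[OF that] Q] by simp
  have fdd: "(\<lambda>n. \<integral>\<omega>. exp (- \<epsilon> * (\<Sum>z\<leftarrow>zs. (cmod (G n z \<omega>))\<^sup>2)) \<partial>M)
    \<longlonglongrightarrow> (\<integral>\<omega>. exp (- \<epsilon> * (\<Sum>z\<leftarrow>zs. (cmod (Q z \<omega>))\<^sup>2)) \<partial>P)"
    if "\<epsilon> > 0" "set zs \<subseteq> space N" for \<epsilon> zs
  proof -
    have z: "zs ! i \<in> space N" if "i < length zs" for i using that \<open>set zs \<subseteq> space N\<close>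
      by (meson nth_mem subsetD)
    have "(\<lambda>n. \<integral>\<omega>. exp (- \<epsilon> * (\<Sum>i<length zs. (cmod (G n (zs ! i) \<omega>))\<^sup>2)) \<partial>M) \<longlonglongrightarrow>
        (\<integral>\<omega>. exp (- \<epsilon> * (\<Sum>i<length zs. (cmod (Q (zs ! i) \<omega>))\<^sup>2)) \<partial>P)"
    proof (rule char_tendsto_imp_laplace_tendsto[OF M P], goal_cases)
      case 3
      show ?case by (rule char) (rule z)
    qed (use z \<open>\<epsilon> > 0\<close> in auto)
    then show ?thesis by (simp add: sum_list_sum_nth atLeast0LessThan)
  qed
  show ?thesis
  proof (rule tendsto_approxI)
    fix e :: real assume "e > 0"
    \<comment> \<open>The level \<epsilon> = 1/(j + 1) is selected from the limit process alone. The
      truncation error tends to 0 pointwise below the integrable |Q|^2, and its mean tends to 0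
      below the constant C.\<close>
    have "(\<lambda>j. \<integral>z. truncation_defect (1 / real (Suc j)) P Q z \<partial>N) \<longlonglongrightarrow> (\<integral>z. 0 \<partial>N)"
    proof (rule integral_dominated_convergence[where w = "\<lambda>_. C"])
      show "AE z in N. (\<lambda>j. truncation_defect (1 / real (Suc j)) P Q z) \<longlonglongrightarrow> 0"
      proof (rule AE_I2)
        fix z assume z: "z \<in> space N"
        have "(\<lambda>j. \<integral>\<omega>. (cmod (Q z \<omega>))\<^sup>2 - (1
          - exp (- (1 / real (Suc j)) * (cmod (Q z \<omega>))\<^sup>2)) / (1 / real (Suc j)) \<partial>P) \<longlonglongrightarrow> (\<integral>\<omega>. 0 \<partial>P)"
        proof (rule integral_dominated_convergence[OF _ _ intQ[OF z]])
          have "(\<lambda>j. x - (1 - exp (- (1 / real (Suc j)) * x)) / (1 / real (Suc j))) \<longlonglongrightarrow> 0" for x :: real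
          proof -
            have "(\<lambda>j. x - (1 - exp (- (1 / real j) * x)) / (1 / real j)) \<longlonglongrightarrow> 0" 
              by (cases "x = 0") (real_asymp+)
            then show ?thesis by (rule LIMSEQ_Suc)
          qed
          then show "AE \<omega> in P. (\<lambda>j. (cmod (Q z \<omega>))\<^sup>2 - (1
            - exp (- (1 / real (Suc j)) * (cmod (Q z \<omega>))\<^sup>2)) / (1 / real (Suc j))) \<longlonglongrightarrow> 0"
            by blast
          show "AE \<omega> in P. norm ((cmod (Q z \<omega>))\<^sup>2 - (1
            - exp (- (1 / real (Suc j)) * (cmod (Q z \<omega>))\<^sup>2)) / (1 / real (Suc j))) \<le> (cmod (Q z \<omega>))\<^sup>2" for j
            using one_minus_exp_bounds[of _ "1 / real (Suc j)"] by (intro AE_I2) (simp del: of_nat_Suc)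
        qed (use z in auto)
        then show "(\<lambda>j. truncation_defect (1 / real (Suc j)) P Q z) \<longlonglongrightarrow> 0"
          using z by (subst d_eq) (auto intro: intQ CQ P)
      qed
    qed (auto intro!: d_bd P intQ CQ dm Q)
    then have "(\<lambda>j. l * (\<integral>z. truncation_defect (1 / real (Suc j)) P Q z \<partial>N)) \<longlonglongrightarrow> 0"
      by (auto intro: tendsto_mult_right_zero)
    then have "\<forall>\<^sub>F j in sequentially. l * (\<integral>z. truncation_defect (1 / real (Suc j)) P Q z \<partial>N) < e"
      using \<open>e > 0\<close> by (rule order_tendstoD)
    then obtain j where "l * (\<integral>z. truncation_defect (1 / real (Suc j)) P Q z \<partial>N) < e"
      using eventually_happens'[OF sequentially_bot] by blast
    moreover define \<epsilon> where "\<epsilon> = 1 / real (Suc j)"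
    ultimately have \<epsilon>: "\<epsilon> > 0" "l * (\<integral>z. truncation_defect \<epsilon> P Q z \<partial>N) < e" by auto
    \<comment> \<open>With \<epsilon> fixed, both terms of the defect converge at every z, so the
      smallness obtained for Q is inherited by \<open>G n\<close> for large n.\<close>
    have "(\<lambda>n. \<integral>z. truncation_defect \<epsilon> M (G n) z \<partial>N) \<longlonglongrightarrow> (\<integral>z. truncation_defect \<epsilon> P Q z \<partial>N)"
    proof (rule integral_dominated_convergence[where w = "\<lambda>_. C"])
      show "AE z in N. (\<lambda>n. truncation_defect \<epsilon> M (G n) z) \<longlonglongrightarrow> truncation_defect \<epsilon> P Q z"
        unfolding d_def using fdd[OF \<epsilon>(1), of "[_]"] \<epsilon> by (intro AE_I2 tendsto_intros mom) auto
    qed (use \<epsilon> in \<open>auto intro!: d_bd M P intG CG dm Q G\<close>)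
    then have "(\<lambda>n. l * (\<integral>z. truncation_defect \<epsilon> M (G n) z \<partial>N)) \<longlonglongrightarrow> l * (\<integral>z. truncation_defect \<epsilon> P Q z \<partial>N)"
      by (intro tendsto_intros)
    then have ev: "\<forall>\<^sub>F n in sequentially. l * (\<integral>z. truncation_defect \<epsilon> M (G n) z \<partial>N) < e"
      using \<epsilon>(2) by (rule order_tendstoD)
    \<comment> \<open>The approximating Laplace transform is a continuous function of a single
      variable with values in [0, B], so convergence of the moments of that variable is
      enough.\<close>
    define h where "h x = exp (- (l / \<epsilon>) * (?B - x))" for x
    note J_def = exp_moment_def
    have Jm: "exp_moment N \<epsilon> 1 H [] \<in> borel_measurable K" "\<omega> \<in> space K \<Longrightarrow> exp_moment N \<epsilon> 1 H [] \<omega> \<in> {0..?B}"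
      if "prob_space K" and [measurable]: "(\<lambda>(z, \<omega>). H z \<omega>) \<in> borel_measurable (N \<Otimes>\<^sub>M K)"
      for K :: "'k measure" and H :: "'z \<Rightarrow> 'k \<Rightarrow> complex" and \<omega>
    proof -
      have "(\<lambda>\<omega>. \<integral>z. exp (- \<epsilon> * (cmod (H z \<omega>))\<^sup>2) \<partial>N) \<in> borel_measurable K"
        by (auto intro!: N.borel_measurable_lebesgue_integral simp: case_prod_unfold)
      then show "exp_moment N \<epsilon> 1 H [] \<in> borel_measurable K" unfolding J_def[abs_def] by simp
      assume "\<omega> \<in> space K"
      then have "(\<integral>z. exp (- \<epsilon> * (cmod (H z \<omega>))\<^sup>2) \<partial>N) \<le> (\<integral>z. 1 \<partial>N)"
        using \<epsilon> by (intro integral_mono N.integrable_const_bound[of _ 1])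
          (auto simp: J_def zero_le_mult_iff)
      moreover have "exp_moment N \<epsilon> 1 H [] \<omega> \<ge> 0" unfolding J_def by simp
      ultimately show "exp_moment N \<epsilon> 1 H [] \<omega> \<in> {0..?B}" by (simp add: J_def)
    qed
    show "\<exists>b L. b
      \<longlonglongrightarrow> L \<and> (\<forall>\<^sub>F n in sequentially. dist (\<integral>\<omega>. exp (- l * (\<integral>z. (cmod (G n z \<omega>))\<^sup>2 \<partial>N)) \<partial>M) (b n) \<le> e) \<and>
        dist (\<integral>\<omega>. exp (- l * (\<integral>z. (cmod (Q z \<omega>))\<^sup>2 \<partial>N)) \<partial>P) L \<le> e"
    proof (intro exI conjI)
      show "(\<lambda>n. \<integral>\<omega>. h (exp_moment N \<epsilon> 1 (G n) [] \<omega>) \<partial>M) \<longlonglongrightarrow> (\<integral>\<omega>. h (exp_moment N \<epsilon> 1 Q [] \<omega>) \<partial>P)"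
      proof (rule moments_imp_integral_tendsto[OF M P, where h = h
        and X = "\<lambda>n. exp_moment N \<epsilon> 1 (G n) []" and Y = "exp_moment N \<epsilon> 1 Q []" and B = ?B])
        show "(\<lambda>n. \<integral>\<omega>. exp_moment N \<epsilon> 1 (G n) [] \<omega> ^ k \<partial>M) \<longlonglongrightarrow> (\<integral>\<omega>. exp_moment N \<epsilon> 1 Q [] \<omega> ^ k \<partial>P)" for k
          using laplace_mixed_moments_tendsto[OF N M P G Q fdd[OF \<epsilon>(1)] \<epsilon>(1), of "[]" k]
          by (simp add: exp_moment_def)
        show "continuous_on {0..?B} h" unfolding h_def by (intro continuous_intros)
      qed (rule Jm(1)[OF M G] Jm(1)[OF P Q] | erule Jm(2)[OF M G] Jm(2)[OF P Q])+
      show "\<forall>\<^sub>F n in sequentially. dist (\<integral>\<omega>. exp (- l * (\<integral>z. (cmod (G n z \<omega>))\<^sup>2 \<partial>N)) \<partial>M) (\<integral>\<omega>. h (exp_moment N \<epsilon> 1 (G n) [] \<omega>) \<partial>M)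
        \<le> e"
        using ev
      proof eventually_elim
        case (elim n)
        have "dist (\<integral>\<omega>. exp (- l * (\<integral>z. (cmod (G n z \<omega>))\<^sup>2 \<partial>N)) \<partial>M) (\<integral>\<omega>. h (exp_moment N \<epsilon> 1 (G n) [] \<omega>) \<partial>M)
          \<le> l * (\<integral>z. truncation_defect \<epsilon> M (G n) z \<partial>N)"
          unfolding dist_real_def h_def J_def d_def power_one_right sum_list.Nil list.map mult_zero_right exp_zero mult_1
          by (rule laplace_bounded_approx[OF N M G intG CG \<epsilon>(1) l])
        with elim show ?case by simp
      qed
      have "dist (\<integral>\<omega>. exp (- l * (\<integral>z. (cmod (Q z \<omega>))\<^sup>2 \<partial>N)) \<partial>P) (\<integral>\<omega>. h (exp_moment N \<epsilon> 1 Q [] \<omega>) \<partial>P)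
        \<le> l * (\<integral>z. truncation_defect \<epsilon> P Q z \<partial>N)"
        unfolding dist_real_def h_def J_def d_def power_one_right sum_list.Nil list.map mult_zero_right exp_zero mult_1
        by (rule laplace_bounded_approx[OF N P Q intQ CQ \<epsilon>(1) l])
      with \<epsilon>(2) show "dist (\<integral>\<omega>. exp (- l * (\<integral>z. (cmod (Q z \<omega>))\<^sup>2 \<partial>N)) \<partial>P) (\<integral>\<omega>. h (exp_moment N \<epsilon> 1 Q [] \<omega>) \<partial>P)
        \<le> e" by simp
    qed
  qed
qed

section \<open>Gaussian fields with a given covariance\<close>

definition psd_kernel :: "('i \<Rightarrow> 'i \<Rightarrow> real) \<Rightarrow> bool" where
  "psd_kernel K \<longleftrightarrow> (\<forall>x y. K x y = K y x) \<and>
     (\<forall>A c. finite A \<longrightarrow> 0 \<le> (\<Sum>x\<in>A. \<Sum>y\<in>A. c x * c y * K x y))"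

lemma psd_kernel_sym: "psd_kernel K \<Longrightarrow> K x y = K y x"
  by (auto simp: psd_kernel_def)

lemma psd_kernel_sum_nonneg:
  "psd_kernel K \<Longrightarrow> finite A \<Longrightarrow> 0 \<le> (\<Sum>x\<in>A. \<Sum>y\<in>A. c x * c y * K x y)"
  unfolding psd_kernel_def by (elim conjE) (drule spec, drule spec, erule mp)

lemma psd_kernel_diag: "psd_kernel K \<Longrightarrow> 0 \<le> K x x"
  using psd_kernel_sum_nonneg[of K "{x}" "\<lambda>_. 1"] by simp

lemma psd_kernel_pair:
  assumes "psd_kernel K"
  shows "0 \<le> a\<^sup>2 * K x x + 2 * a * b * K x y + b\<^sup>2 * K y y"
proof (cases "x = y")
  case True
  have "0 \<le> (a + b)\<^sup>2 * K x x" using psd_kernel_diag[OF assms] by simp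
  with True show ?thesis by (simp add: algebra_simps power2_eq_square)
next
  case False
  have "0 \<le> (\<Sum>z\<in>{x,y}. \<Sum>w\<in>{x,y}. (if z = x then a else b) * (if w = x then a else b) * K z w)"
    by (rule psd_kernel_sum_nonneg[OF assms]) simp
  with False psd_kernel_sym[OF assms, of y x] show ?thesis by (simp add: algebra_simps power2_eq_square)
qed

lemma psd_kernel_cauchy_schwarz:
  assumes K: "psd_kernel K"
  shows "(K x y)\<^sup>2 \<le> K x x * K y y"
proof (cases "K x x = 0")
  case True
  have "K x y = 0"
  proof (rule ccontr)
    assume "K x y \<noteq> 0"
    \<comment> \<open>This coefficient makes the quadratic form equal to -1: with
      \<open>K x x = 0\<close> the form is affine in the coefficient of x.\<close>
    with psd_kernel_pair[OF K, of "- (K y y + 1) / (2 * K x y)" x 1 y] True show False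
      by (simp add: field_simps)
  qed
  with True show ?thesis by simp
next
  case False
  with psd_kernel_diag[OF K, of x] have "K x x > 0" by simp
  \<comment> \<open>The minimising ratio of the two coefficients, with denominators cleared.\<close>
  have "0 \<le> (K x y)\<^sup>2 * K x x + 2 * (K x y) * (- K x x) * K x y + (- K x x)\<^sup>2 * K y y"
    by (rule psd_kernel_pair[OF K])
  also have "\<dots> = K x x * (K x x * K y y - (K x y)\<^sup>2)" by (simp add: power2_eq_square algebra_simps)
  finally show ?thesis using \<open>K x x > 0\<close> by (simp add: zero_le_mult_iff)
qed

text \<open>The quadratic form of the Schur complement at c is the form of K at c plus a multiple t
  of the unit vector at v, minimised over t. If \<open>K v v = 0\<close>, division by zero makes the
  correction 0 and the kernel stays as it was.\<close>

lemma psd_kernel_schur_complement: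
  fixes K :: "'a \<Rightarrow> 'a \<Rightarrow> real"
  assumes K: "psd_kernel K"
  shows "psd_kernel (\<lambda>x y. K x y - K x v * K y v / K v v)"
  unfolding psd_kernel_def
proof (intro conjI allI impI)
  fix A :: "'a set" and c :: "'a \<Rightarrow> real" assume A: "finite A"
  define s where "s = (\<Sum>x\<in>A. c x * K x v)"
  have eq: "(\<Sum>x\<in>A. \<Sum>y\<in>A. c x * c y * (K x y - K x v * K y v / K v v))
      = (\<Sum>x\<in>A. \<Sum>y\<in>A. c x * c y * K x y) - s\<^sup>2 / K v v"
    by (simp add: s_def power2_eq_square sum_product sum_subtractf sum_divide_distrib algebra_simps)
  show "0 \<le> (\<Sum>x\<in>A. \<Sum>y\<in>A. c x * c y * (K x y - K x v * K y v / K v v))"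
  proof (cases "K v v = 0")
    case True
    then show ?thesis unfolding eq using psd_kernel_sum_nonneg[OF K A] by simp
  next
    case False
    \<comment> \<open>The minimiser of t -> form + 2ts + t^2 \<open>K v v\<close>. The coefficient
      at v is added to an existing one, because v may or may not belong to A.\<close>
    define t where "t = - s / K v v"
    define c' where "c' x = (if x \<in> A then c x else 0) + (if x = v then t else 0)" for x
    have lin: "(\<Sum>x\<in>insert v A. c' x * f x) = (\<Sum>x\<in>A. c x * f x) + t * f v" for f
    proof -
      have "(\<Sum>x\<in>insert v A. c' x * f x) =
          (\<Sum>x\<in>insert v A. (if x \<in> A then c x * f x else 0)) + (\<Sum>x\<in>insert v A. if x = v then t * f x else 0)"
        unfolding sum.distrib[symmetric] c'_def by (intro sum.cong) (auto simp: algebra_simps)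
      also have "(\<Sum>x\<in>insert v A. (if x \<in> A then c x * f x else 0)) = (\<Sum>x\<in>A. c x * f x)"
        using A by (intro sum.mono_neutral_cong_right) auto
      finally show ?thesis using A by simp
    qed
    have "0 \<le> (\<Sum>x\<in>insert v A. \<Sum>y\<in>insert v A. c' x * c' y * K x y)"
      using A by (intro psd_kernel_sum_nonneg[OF K]) simp
    also have "\<dots> = (\<Sum>x\<in>insert v A. c' x * (\<Sum>y\<in>insert v A. c' y * K x y))"
      by (simp only: sum_distrib_left mult.assoc)
    also have "\<dots> = (\<Sum>x\<in>A. c x * ((\<Sum>y\<in>A. c y * K x y) + t * K x v)) + t * ((\<Sum>y\<in>A. c y * K v y) + t * K v v)"
      unfolding lin ..
    also have "(\<Sum>y\<in>A. c y * K v y) = s"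
      unfolding s_def by (intro sum.cong) (auto simp: psd_kernel_sym[OF K, of v])
    also have "(\<Sum>x\<in>A. c x * ((\<Sum>y\<in>A. c y * K x y) + t * K x v)) = (\<Sum>x\<in>A. \<Sum>y\<in>A. c x * c y * K x y) + t * s"
      by (simp add: s_def distrib_left sum.distrib sum_distrib_left mult_ac)
    also have "t * (s + t * K v v) = 0" using False by (simp add: t_def)
    also have "t * s = - (s\<^sup>2 / K v v)" by (simp add: t_def power2_eq_square)
    finally show ?thesis unfolding eq by simp
  qed
next
  fix x y
  show "K x y - K x v * K y v / K v v = K y x - K y v * K x v / K v v"
    unfolding psd_kernel_sym[OF K, of x y] by (simp add: mult.commute)
qed

text \<open>Newton basis (pivoted Cholesky factorisation) of a kernel with pivots \<open>v\<close>.\<close>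

primrec newton_residual :: "('i \<Rightarrow> 'i \<Rightarrow> real) \<Rightarrow> (nat \<Rightarrow> 'i) \<Rightarrow> nat \<Rightarrow> 'i \<Rightarrow> 'i \<Rightarrow> real" where
  "newton_residual K v 0 = K"
| "newton_residual K v (Suc n) = (\<lambda>x y. newton_residual K v n x y
     - newton_residual K v n x (v n) * newton_residual K v n y (v n) / newton_residual K v n (v n) (v n))"

text \<open>A zero pivot, which occurs for repeated or redundant points, gives the feature 0 by
  division by zero, so the expansion needs no pivot selection.\<close>

definition newton_feature :: "('i \<Rightarrow> 'i \<Rightarrow> real) \<Rightarrow> (nat \<Rightarrow> 'i) \<Rightarrow> nat \<Rightarrow> 'i \<Rightarrow> real" where
  "newton_feature K v n x = newton_residual K v n x (v n) / sqrt (newton_residual K v n (v n) (v n))"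

definition std_gaussian_partial :: "(nat \<Rightarrow> 'i \<Rightarrow> real) \<Rightarrow> ('i \<Rightarrow> nat) \<Rightarrow> 'i \<Rightarrow> (nat \<Rightarrow> real) \<Rightarrow> real" where
  "std_gaussian_partial c N x g = (\<Sum>k<N x. c k x * g k)"

text \<open>Truncation level at which the residual variance is at most \<open>4\<^sup>-\<^sup>j\<close>, so that the partial sums
  converge almost surely along these levels.\<close>

definition newton_level :: "('i \<Rightarrow> 'i \<Rightarrow> real) \<Rightarrow> (nat \<Rightarrow> 'i) \<Rightarrow> nat \<Rightarrow> 'i \<Rightarrow> nat" where
  "newton_level K v j x = (LEAST n. newton_residual K v n x x \<le> (1 / 4) ^ j)"

text \<open>The value 0 off the convergence set makes the field defined for every g and jointly
  measurable, since the convergence set is measurable in both arguments together.\<close>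

definition gaussian_field :: "('i \<Rightarrow> 'i \<Rightarrow> real) \<Rightarrow> (nat \<Rightarrow> 'i) \<Rightarrow> 'i \<Rightarrow> (nat \<Rightarrow> real) \<Rightarrow> real" where
  "gaussian_field K v x g =
     (if convergent (\<lambda>j. std_gaussian_partial (newton_feature K v) (newton_level K v j) x g)
      then lim (\<lambda>j. std_gaussian_partial (newton_feature K v) (newton_level K v j) x g) else 0)"

text \<open>Every recursion step is linear in the first argument. The factor s = 0 serves points
  where the kernel vanishes, and s = 1 or -1 serves the reflection z -> -z.\<close>

lemma newton_residual_scale:
  assumes "\<And>y. K x' y = s * K x y"
  shows "newton_residual K v n x' y = s * newton_residual K v n x y"
  by (induction n arbitrary: y) (simp_all add: assms right_diff_distrib)

text \<open>The vanishing holds for every g and not merely almost surely, which lets each path be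
  integrated over \<mu> or over the finite measure alike.\<close>

lemma gaussian_field_zero:
  assumes "\<And>y. K x y = 0"
  shows "gaussian_field K v x g = 0"
proof -
  have "newton_feature K v n x = 0" for n
    using newton_residual_scale[of K x 0 x] assms by (simp add: newton_feature_def)
  then show ?thesis by (simp add: gaussian_field_def std_gaussian_partial_def)
qed

text \<open>Uniqueness of characteristic functions identifies the law with that of a scaled standard
  normal variable, from which the moments are transported; v = 0 is the point mass at 0.\<close>

lemma gaussian_measure_from_char:
  assumes "prob_space P" and [measurable]: "Y \<in> borel_measurable P" and v: "v \<ge> 0"
    and char: "\<And>t. (CLINT \<omega>|P. iexp (t * Y \<omega>)) = exp (- (v * t\<^sup>2) / 2)"
  shows "distr P borel Y = distr std_normal_distribution borel (\<lambda>x. sqrt v * x)"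
    and "integrable P (\<lambda>\<omega>. (Y \<omega>)\<^sup>2)" "(\<integral>\<omega>. (Y \<omega>)\<^sup>2 \<partial>P) = v"
    and "integrable P Y" "(\<integral>\<omega>. Y \<omega> \<partial>P) = 0"
proof -
  interpret P: prob_space P by fact
  interpret N: prob_space "std_normal_distribution" by (rule prob_space_normal_density) simp
  show eq: "distr P borel Y = distr std_normal_distribution borel (\<lambda>x. sqrt v * x)"
  proof (rule Levy_uniqueness)
    show "char (distr P borel Y) = char (distr std_normal_distribution borel (\<lambda>x. sqrt v * x))"
    proof
      fix t
      have "char (distr std_normal_distribution borel (\<lambda>x. sqrt v * x)) t
        = char std_normal_distribution (t * sqrt v)"
        unfolding char_def by (subst integral_distr) (auto simp: mult.assoc)
      also have "\<dots> = exp (- (v * t\<^sup>2) / 2)" using v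
        by (simp add: char_std_normal_distribution power_mult_distrib mult.commute)
      finally show "char (distr P borel Y) t
        = char (distr std_normal_distribution borel (\<lambda>x. sqrt v * x)) t"
        using char[of t] by (simp add: char_def integral_distr)
    qed
  qed (auto simp: real_distribution_def real_distribution_axioms_def intro!: P.prob_space_distr N.prob_space_distr)
  have iff: "integrable P (\<lambda>\<omega>. f (Y \<omega>)) \<longleftrightarrow> integrable std_normal_distribution (\<lambda>x. f (sqrt v * x))"
    and int: "(\<integral>\<omega>. f (Y \<omega>) \<partial>P) = (\<integral>x. f (sqrt v * x) \<partial>std_normal_distribution)"
    if [measurable]: "f \<in> borel_measurable borel" for f :: "real \<Rightarrow> real"
    using integrable_distr_eq[of Y P borel f] integral_distr[of Y P borel f]
      integrable_distr_eq[of "\<lambda>x. sqrt v * x" std_normal_distribution borel f]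
      integral_distr[of "\<lambda>x. sqrt v * x" std_normal_distribution borel f] by (auto simp: eq)
  have 1: "integrable std_normal_distribution (\<lambda>x. x)"
    using integrable_std_normal_distribution_moment[of 1] by simp
  have 2: "integrable std_normal_distribution (\<lambda>x. x\<^sup>2)"
    using integrable_std_normal_distribution_moment[of 2] by simp
  have 3: "(\<integral>x. x \<partial>std_normal_distribution) = 0"
    using integral_std_normal_distribution_moment_odd[of 1] by simp
  have 4: "(\<integral>x. x\<^sup>2 \<partial>std_normal_distribution) = 1" using std_normal_distribution_even_moments[of 1]
    by (simp add: has_bochner_integral_iff)
  show "integrable P (\<lambda>\<omega>. (Y \<omega>)\<^sup>2)" "(\<integral>\<omega>. (Y \<omega>)\<^sup>2 \<partial>P) = v"
    using iff[of "\<lambda>y. y\<^sup>2"] int[of "\<lambda>y. y\<^sup>2"] 2 4 v by (auto simp: power_mult_distrib)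
  have "integrable std_normal_distribution (\<lambda>x. sqrt v * x)" using 1 by (rule integrable_mult_right)
  moreover have id: "(\<lambda>y. y) \<in> borel_measurable (borel :: real measure)" by simp
  ultimately show "integrable P Y" using iff[of "\<lambda>y. y", OF id] by (simp only:)
  show "(\<integral>\<omega>. Y \<omega> \<partial>P) = 0"
    unfolding int[of "\<lambda>y. y", OF id] by (simp only: integral_mult_right_zero 3 mult_zero_right)
qed

section \<open>Construction of the field by truncated expansions\<close>

text \<open>The expression in \<open>dense\<close> is the squared canonical distance, the mean
  square of the increment of the field from x to the pivot. Density of the pivots in this distance
  makes the expansion exhaust the variance at every point.\<close>

locale separable_psd_kernel =
  fixes K :: "'i::topological_space \<Rightarrow> 'i \<Rightarrow> real" and v :: "nat \<Rightarrow> 'i"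
  assumes psd: "psd_kernel K"
    and measurable_kernel [measurable]: "\<And>y. (\<lambda>x. K x y) \<in> borel_measurable borel"
    and measurable_diag [measurable]: "(\<lambda>x. K x x) \<in> borel_measurable borel"
    and dense: "\<And>x e. e > 0 \<Longrightarrow> \<exists>j. K x x - 2 * K x (v j) + K (v j) (v j) < e"
begin

abbreviation "R \<equiv> newton_residual K v"
abbreviation "c \<equiv> newton_feature K v"
abbreviation "level \<equiv> newton_level K v"
abbreviation "W \<equiv> gaussian_field K v"
abbreviation "S j \<equiv> std_gaussian_partial c (level j)"

lemma psd_R: "psd_kernel (R n)"
proof (induction n)
  case (Suc n)
  show ?case unfolding newton_residual.simps(2) by (rule psd_kernel_schur_complement[OF Suc.IH])
qed (simp add: psd)

lemma R_Suc: "R (Suc n) x y = R n x y - c n x * c n y"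
proof -
  have "sqrt (R n (v n) (v n)) * sqrt (R n (v n) (v n)) = R n (v n) (v n)"
    using psd_kernel_diag[OF psd_R] by simp
  then show ?thesis by (simp add: newton_feature_def)
qed

declare newton_residual.simps(2) [simp del]

lemma R_eq: "R n x y = K x y - (\<Sum>k<n. c k x * c k y)"
  by (induction n) (auto simp: R_Suc)

text \<open>A step with nonzero pivot annihilates the row of its pivot, and later steps subtract
  multiples of zero from it. If the pivot value is 0, the row is already zero by
  Cauchy-Schwarz.\<close>

lemma R_pivot: "j < n \<Longrightarrow> R n (v j) y = 0"
proof (induction n arbitrary: y)
  case (Suc n)
  show ?case
  proof (cases "j = n")
    case True
    show ?thesis
    proof (cases "R n (v n) (v n) = 0")
      case 0: True
      then show ?thesis
        using psd_kernel_cauchy_schwarz[OF psd_R, of n "v n" y] True by (simp add: newton_residual.simps(2))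
    next
      case False
      then show ?thesis using True psd_kernel_sym[OF psd_R, of n "v n" y]
        by (simp add: newton_residual.simps(2))
    qed
  next
    case False
    with Suc show ?thesis by (simp add: newton_residual.simps(2))
  qed
qed simp

lemma R_diag_antimono: "m \<le> n \<Longrightarrow> R n x x \<le> R m x x"
proof (induction rule: dec_induct)
  case (step n)
  have "0 \<le> c n x * c n x" by simp
  with step show ?case unfolding R_Suc by linarith
qed simp

lemma R_diag_le: "R n x x \<le> K x x"
  using R_diag_antimono[of 0 n x] by simp

text \<open>The canonical distance of the residual is at most that of K, the difference being a sum
  of squares. Once pivot j has been used, the residual distance from x to \<open>v j\<close> is just
  \<open>R n x x\<close>, and some pivot is as close to x as desired.\<close>

lemma R_diag_tendsto: "(\<lambda>n. R n x x) \<longlonglongrightarrow> 0"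
proof (rule LIMSEQ_I)
  fix e :: real assume "e > 0"
  with dense obtain j where j: "K x x - 2 * K x (v j) + K (v j) (v j) < e" by blast
  have "norm (R n x x - 0) < e" if "n \<ge> Suc j" for n
  proof -
    have "R n x x - 2 * R n x (v j) + R n (v j) (v j) \<le> K x x - 2 * K x (v j) + K (v j) (v j)"
    proof -
      have "(\<Sum>k<n. (c k x)\<^sup>2) - 2 * (\<Sum>k<n. c k x * c k (v j)) + (\<Sum>k<n. (c k (v j))\<^sup>2) = (\<Sum>k<n. (c k x
        - c k (v j))\<^sup>2)"
        by (simp add: power2_diff sum_subtractf sum.distrib sum_distrib_left algebra_simps)
      moreover have "\<dots> \<ge> 0" by (rule sum_nonneg) simp
      ultimately show ?thesis by (simp add: R_eq power2_eq_square)
    qed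
    moreover have "R n x (v j) = 0" "R n (v j) (v j) = 0"
      using R_pivot[of j n] that psd_kernel_sym[OF psd_R, of n x] by auto
    ultimately show ?thesis using j psd_kernel_diag[OF psd_R, of n x] by simp
  qed
  then show "\<exists>no. \<forall>n\<ge>no. norm (R n x x - 0) < e" by blast
qed

lemma R_level: "R (level j x) x x \<le> (1 / 4) ^ j"
proof -
  have "\<forall>\<^sub>F n in sequentially. R n x x < (1 / 4) ^ j"
    by (rule order_tendstoD[OF R_diag_tendsto]) simp
  then obtain n where "R n x x \<le> (1 / 4) ^ j"
    using eventually_happens'[OF sequentially_bot] less_imp_le by blast
  then show ?thesis unfolding newton_level_def by (rule LeastI)
qed

lemma level_mono: "level j x \<le> level (Suc j) x"
proof -
  have "R (level (Suc j) x) x x \<le> (1 / 4) ^ j"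
    using R_level[of "Suc j" x] power_decreasing[of j "Suc j" "1 / 4 :: real"] by linarith
  then show ?thesis unfolding newton_level_def[of _ _ j] by (rule Least_le)
qed

text \<open>Partial sums at x and y have different lengths and share only the first min of the two.
  At that length one diagonal residual is at most 4^-j and the other is bounded by the kernel, which
  is enough for Cauchy-Schwarz.\<close>

lemma R_levels_tendsto: "(\<lambda>j. R (min (level j x) (level j y)) x y) \<longlonglongrightarrow> 0"
proof -
  have "(R (min (level j x) (level j y)) x y)\<^sup>2 \<le> (1 / 4) ^ j * (K x x + K y y)" for j
  proof -
    let ?n = "min (level j x) (level j y)"
    have n: "R ?n x x \<le> (1 / 4) ^ j \<or> R ?n y y \<le> (1 / 4) ^ j"
      using R_level by (auto simp: min_def)
    have k: "0 \<le> R ?n x x" "0 \<le> R ?n y y" "R ?n x x \<le> K x x" "R ?n y y \<le> K y y"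
      using psd_kernel_diag[OF psd_R] R_diag_le by auto
    have "(R ?n x y)\<^sup>2 \<le> R ?n x x * R ?n y y" by (rule psd_kernel_cauchy_schwarz[OF psd_R])
    also have "\<dots> \<le> (1 / 4) ^ j * (K x x + K y y)"
      using n
    proof
      assume "R ?n x x \<le> (1 / 4) ^ j"
      then show ?thesis using k by (intro mult_mono) auto
    next
      assume "R ?n y y \<le> (1 / 4) ^ j"
      then have "R ?n y y * R ?n x x \<le> (1 / 4) ^ j * (K x x + K y y)" using k by (intro mult_mono) auto
      then show ?thesis by (simp add: mult.commute)
    qed
    finally show ?thesis .
  qed
  then have le: "\<forall>\<^sub>F j in sequentially. (R (min (level j x) (level j y)) x y)\<^sup>2 \<le> (1 / 4) ^ j * (K x x
    + K y y)"
    by (intro always_eventually allI)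
  have ge: "\<forall>\<^sub>F j in sequentially. 0 \<le> (R (min (level j x) (level j y)) x y)\<^sup>2" by simp
  have "(\<lambda>j. (1 / 4) ^ j * (K x x + K y y)) \<longlonglongrightarrow> 0"
    by (intro tendsto_mult_left_zero LIMSEQ_power_zero) simp
  then have "(\<lambda>j. (R (min (level j x) (level j y)) x y)\<^sup>2) \<longlonglongrightarrow> 0"
    by (rule tendsto_sandwich[OF ge le tendsto_const])
  then have "(\<lambda>j. sqrt ((R (min (level j x) (level j y)) x y)\<^sup>2)) \<longlonglongrightarrow> sqrt 0"
    by (rule tendsto_real_sqrt)
  then show ?thesis by (simp add: tendsto_rabs_zero_iff)
qed

lemma R_measurable [measurable]:
  "(\<lambda>x. R n x y) \<in> borel_measurable borel" "(\<lambda>x. R n x x) \<in> borel_measurable borel"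
proof -
  have "(\<forall>y. (\<lambda>x. R n x y) \<in> borel_measurable borel) \<and> (\<lambda>x. R n x x) \<in> borel_measurable borel"
  proof (induction n)
    case (Suc n)
    then have [measurable]: "\<And>y. (\<lambda>x. R n x y) \<in> borel_measurable borel"
      "(\<lambda>x. R n x x) \<in> borel_measurable borel"
      by auto
    show ?case unfolding newton_residual.simps(2) by measurable
  qed auto
  then show "(\<lambda>x. R n x y) \<in> borel_measurable borel" "(\<lambda>x. R n x x) \<in> borel_measurable borel" by auto
qed

lemma c_measurable [measurable]: "c k \<in> borel_measurable borel"
  unfolding newton_feature_def[abs_def] by measurable

lemma level_measurable [measurable]: "level j \<in> measurable borel (count_space UNIV)"
  unfolding newton_level_def[abs_def] by measurable

lemma S_measurable [measurable]: "(\<lambda>(x, g). S j x g) \<in> borel_measurable (borel \<Otimes>\<^sub>M std_gaussian_seq)"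
proof -
  have "(\<lambda>p. (\<lambda>n p. \<Sum>k<n. c k (fst p) * snd p k) (level j (fst p)) p) \<in> borel_measurable (borel \<Otimes>\<^sub>M std_gaussian_seq)"
    by (rule measurable_compose_countable) measurable
  then show ?thesis by (simp add: case_prod_unfold std_gaussian_partial_def)
qed

lemma W_measurable [measurable]: "(\<lambda>(x, g). W x g) \<in> borel_measurable (borel \<Otimes>\<^sub>M std_gaussian_seq)"
proof -
  have m: "\<And>j. (\<lambda>p. S j (fst p) (snd p)) \<in> borel_measurable (borel \<Otimes>\<^sub>M std_gaussian_seq)"
    using S_measurable by (simp add: case_prod_unfold)
  have [measurable]: "Measurable.pred (borel \<Otimes>\<^sub>M std_gaussian_seq) (\<lambda>p. convergent (\<lambda>j. S j (fst p) (snd p)))"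
    unfolding Cauchy_convergent_iff[symmetric] pred_def using sets_Collect_Cauchy[OF m] by simp
  have [measurable]: "(\<lambda>p. lim (\<lambda>j. S j (fst p) (snd p))) \<in> borel_measurable (borel \<Otimes>\<^sub>M std_gaussian_seq)"
    by (rule borel_measurable_lim_metric[OF m])
  show ?thesis unfolding gaussian_field_def case_prod_unfold by measurable
qed

text \<open>All sums are padded with zero coefficients to a common length m. In the square of the
  combined coefficients only indices below both lengths survive, whence the minimum.\<close>

lemma partial_char:
  assumes "finite A"
  shows "(CLINT g|std_gaussian_seq. iexp (\<Sum>i\<in>A. a i * (\<Sum>k<N i. c k (x i) * g k)))
    = exp (- (\<Sum>i\<in>A. \<Sum>i'\<in>A. a i * a i' * (\<Sum>k<min (N i) (N i'). c k (x i) * c k (x i'))) / 2)"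
proof -
  define m where "m = (\<Sum>i\<in>A. N i)"
  have m: "N i \<le> m" if "i \<in> A" for i
    unfolding m_def by (rule member_le_sum[OF that]) (use assms in auto)
  define b where "b k = (\<Sum>i\<in>A. a i * (if k < N i then c k (x i) else 0))" for k
  have 1: "(\<Sum>i\<in>A. a i * (\<Sum>k<N i. c k (x i) * g k)) = (\<Sum>k<m. b k * g k)" for g :: "nat \<Rightarrow> real"
  proof -
    have "(\<Sum>k<N i. c k (x i) * g k) = (\<Sum>k<m. (if k < N i then c k (x i) else 0) * g k)" if "i \<in> A" for i
      using m[OF that] by (intro sum.mono_neutral_cong_left) auto
    then have "(\<Sum>i\<in>A. a i * (\<Sum>k<N i. c k (x i) * g k))
      = (\<Sum>i\<in>A. \<Sum>k<m. a i * ((if k < N i then c k (x i) else 0) * g k))"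
      by (simp add: sum_distrib_left)
    also have "\<dots> = (\<Sum>k<m. b k * g k)"
      unfolding b_def sum_distrib_right by (subst sum.swap) (simp add: mult.assoc)
    finally show ?thesis .
  qed
  have 2: "(\<Sum>k<m. (b k)\<^sup>2) = (\<Sum>i\<in>A. \<Sum>i'\<in>A. a i * a i' * (\<Sum>k<min (N i) (N i'). c k (x i) * c k (x i')))"
  proof -
    have "(\<Sum>k<m. (b k)\<^sup>2)
      = (\<Sum>k<m. \<Sum>i\<in>A. \<Sum>i'\<in>A. a i * a i' * ((if k < N i then c k (x i) else 0) * (if k < N i' then c k (x i') else 0)))"
      unfolding b_def power2_eq_square sum_product by (intro sum.cong refl) (simp add: mult_ac)
    also have "\<dots> = (\<Sum>i\<in>A. \<Sum>i'\<in>A. \<Sum>k<m. a i * a i' * ((if k < N i then c k (x i) else 0) * (if k < N i' then c k (x i') else 0)))"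
      by (subst sum.swap) (intro sum.cong refl, subst sum.swap, rule refl)
    also have "\<dots> = (\<Sum>i\<in>A. \<Sum>i'\<in>A. a i * a i' * (\<Sum>k<min (N i) (N i'). c k (x i) * c k (x i')))"
      unfolding sum_distrib_left[symmetric]
    proof (intro sum.cong refl, goal_cases)
      case (1 i i')
      have "(\<Sum>k<m. (if k < N i then c k (x i) else 0) * (if k < N i' then c k (x i') else 0))
        = (\<Sum>k<min (N i) (N i'). c k (x i) * c k (x i'))"
        using m[OF 1(1)] m[OF 1(2)] by (intro sum.mono_neutral_cong_right) auto
      then show ?case by simp
    qed
    finally show ?thesis .
  qed
  show ?thesis unfolding 1 using std_gaussian_seq_char[of b m] by (simp add: 2)
qed

text \<open>Between consecutive levels the variance of the increment is at most 4^-j, so its mean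
  modulus is at most 2^-j. These are summable, and the telescoping series converges absolutely
  almost surely.\<close>

lemma AE_S_convergent: "AE g in std_gaussian_seq. convergent (\<lambda>j. S j x g)"
proof -
  interpret P: prob_space std_gaussian_seq by (rule prob_space_std_gaussian_seq)
  define D where "D j g = S (Suc j) x g - S j x g" for j g
  have [measurable]: "D j \<in> borel_measurable std_gaussian_seq" for j unfolding D_def by measurable
  define s where "s j = (\<Sum>k=level j x..<level (Suc j) x. (c k x)\<^sup>2)" for j
  have s0: "s j \<ge> 0" for j unfolding s_def by (rule sum_nonneg) simp
  have split: "(\<Sum>k<level (Suc j) x. f k) = (\<Sum>k<level j x. f k)
    + (\<Sum>k=level j x..<level (Suc j) x. f k)" for f :: "nat \<Rightarrow> real" and j
    using level_mono[of j x] by (simp add: lessThan_atLeast0 sum.atLeastLessThan_concat)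
  have char: "(CLINT g|std_gaussian_seq. iexp (t * D j g)) = exp (- (s j * t\<^sup>2) / 2)" for j t
  proof -
    define b where "b k = (if k < level j x then 0 else t * c k x)" for k
    have "t * D j g = (\<Sum>k<level (Suc j) x. b k * g k)" for g
      unfolding D_def std_gaussian_partial_def split by (simp add: b_def sum_distrib_left mult.assoc)
    moreover have "(\<Sum>k<level (Suc j) x. (b k)\<^sup>2) = s j * t\<^sup>2"
      unfolding split by (simp add: b_def s_def power_mult_distrib sum_distrib_left mult.commute)
    ultimately show ?thesis using std_gaussian_seq_char[of b "level (Suc j) x"] by simp
  qed
  have iD2: "integrable std_gaussian_seq (\<lambda>g. (D j g)\<^sup>2)" and E2: "(\<integral>g. (D j g)\<^sup>2 \<partial>std_gaussian_seq) = s j"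
    and iD: "integrable std_gaussian_seq (\<lambda>g. \<bar>D j g\<bar>)" for j
    using gaussian_measure_from_char(2,3,4)[OF P.prob_space_axioms \<open>D j \<in> _\<close> s0 char] by simp_all
  have s4: "s j \<le> (1 / 4) ^ j" for j
  proof -
    have "R (level (Suc j) x) x x = R (level j x) x x - s j"
      unfolding R_eq split by (simp add: s_def power2_eq_square)
    then show ?thesis using R_level[of j x] psd_kernel_diag[OF psd_R, of "level (Suc j) x" x] by linarith
  qed
  have E: "(\<integral>g. \<bar>D j g\<bar> \<partial>std_gaussian_seq) \<le> (1 / 2) ^ j" for j
  proof -
    \<comment> \<open>The arithmetic-geometric inequality with weight 2^j balances the variance 4^-j
      against 2^-j, each half contributing at most half of 2^-j.\<close>
    have "(\<integral>g. \<bar>D j g\<bar> \<partial>std_gaussian_seq) \<le> (\<integral>g. (2 ^ j * (D j g)\<^sup>2 + (1 / 2) ^ j) / 2 \<partial>std_gaussian_seq)"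
    proof (rule integral_mono)
      fix g
      have "0 \<le> 2 ^ j * (\<bar>D j g\<bar> - (1 / 2) ^ j)\<^sup>2" by simp
      also have "\<dots> = 2 ^ j * (D j g)\<^sup>2 - 2 * \<bar>D j g\<bar> * (2 ^ j * (1 / 2) ^ j)
        + (2 ^ j * (1 / 2) ^ j) * (1 / 2) ^ j"
        by (simp add: power2_eq_square algebra_simps)
      also have "2 ^ j * (1 / 2) ^ j = (1::real)" by (simp add: power_mult_distrib[symmetric])
      finally show "\<bar>D j g\<bar> \<le> (2 ^ j * (D j g)\<^sup>2 + (1 / 2) ^ j) / 2" by simp
    qed (use iD iD2 in simp_all)
    also have "\<dots> = (2 ^ j * s j + (1 / 2) ^ j) / 2" using iD2[of j] E2[of j] by (simp add: P.prob_space)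
    also have "\<dots> \<le> (2 ^ j * (1 / 4) ^ j + (1 / 2) ^ j) / 2" using s4[of j] by simp
    also have "2 ^ j * (1 / 4) ^ j = (1 / 2 :: real) ^ j" by (simp add: power_mult_distrib[symmetric])
    finally show ?thesis by simp
  qed
  have "(\<integral>\<^sup>+g. (\<Sum>j. ennreal \<bar>D j g\<bar>) \<partial>std_gaussian_seq) = (\<Sum>j. \<integral>\<^sup>+g. ennreal \<bar>D j g\<bar> \<partial>std_gaussian_seq)"
    by (rule nn_integral_suminf) measurable
  also have "\<dots> \<le> (\<Sum>j. ennreal ((1 / 2) ^ j))"
  proof (intro suminf_le summableI)
    fix j
    have "(\<integral>\<^sup>+g. ennreal \<bar>D j g\<bar> \<partial>std_gaussian_seq) = ennreal (\<integral>g. \<bar>D j g\<bar> \<partial>std_gaussian_seq)"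
      using iD[of j] by (intro nn_integral_eq_integral) auto
    then show "(\<integral>\<^sup>+g. ennreal \<bar>D j g\<bar> \<partial>std_gaussian_seq) \<le> ennreal ((1 / 2) ^ j)"
      using E[of j] by (simp add: ennreal_leI)
  qed
  also have "\<dots> < \<infinity>"
  proof -
    have "summable (\<lambda>j. (1 / 2 :: real) ^ j)" by (rule summable_geometric) simp
    from suminf_ennreal2[OF _ this] have "(\<Sum>j. ennreal ((1 / 2) ^ j)) = ennreal (\<Sum>j. (1 / 2) ^ j)"
      by (metis zero_le_power zero_le_divide_1_iff zero_le_numeral)
    then show ?thesis by (simp only: infinity_ennreal_def ennreal_less_top)
  qed
  finally have "AE g in std_gaussian_seq. (\<Sum>j. ennreal \<bar>D j g\<bar>) \<noteq> \<infinity>"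
    by (intro nn_integral_PInf_AE) auto
  then show ?thesis
  proof eventually_elim
    case (elim g)
    then have "summable (\<lambda>j. \<bar>D j g\<bar>)" by (intro summable_suminf_not_top) auto
    then have "summable (\<lambda>j. D j g)" by (rule summable_rabs_cancel)
    then have "convergent (\<lambda>n. \<Sum>j<n. D j g)" by (simp add: summable_iff_convergent)
    then have "convergent (\<lambda>n. S n x g - S 0 x g)"
      unfolding D_def sum_lessThan_telescope[of "\<lambda>j. S j x g"] .
    then show ?case by (simp add: convergent_diff_const_right_iff)
  qed
qed

lemma AE_S_tendsto: "AE g in std_gaussian_seq. (\<lambda>j. S j x g) \<longlonglongrightarrow> W x g"
  using AE_S_convergent[of x] by eventually_elim (simp add: gaussian_field_def convergent_LIMSEQ_iff)

text \<open>Both sides are limits of the characteristic function of the partial sums: one by almost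
  sure convergence, the other because their covariances are \<open>K\<close> minus the residuals at
  the smaller level.\<close>

theorem gaussian_field_char:
  assumes A: "finite A"
  shows "(CLINT g|std_gaussian_seq. iexp (\<Sum>i\<in>A. a i * W (x i) g))
    = exp (- (\<Sum>i\<in>A. \<Sum>i'\<in>A. a i * a i' * K (x i) (x i')) / 2)"
proof (rule LIMSEQ_unique)
  interpret P: prob_space std_gaussian_seq by (rule prob_space_std_gaussian_seq)
  have "AE g in std_gaussian_seq. \<forall>i\<in>A. (\<lambda>j. S j (x i) g) \<longlonglongrightarrow> W (x i) g"
    using A AE_S_tendsto by (intro AE_finite_allI)
  then have "AE g in std_gaussian_seq. (\<lambda>j. iexp (\<Sum>i\<in>A. a i * S j (x i) g)) \<longlonglongrightarrow> iexp (\<Sum>i\<in>A. a i * W (x i) g)"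
    by eventually_elim (intro tendsto_intros, auto)
  then show "(\<lambda>j. CLINT g|std_gaussian_seq. iexp (\<Sum>i\<in>A. a i * S j (x i) g))
    \<longlonglongrightarrow> (CLINT g|std_gaussian_seq. iexp (\<Sum>i\<in>A. a i * W (x i) g))"
    by (intro integral_dominated_convergence[where w = "\<lambda>_. 1"]) auto
  have "(\<Sum>k<m. c k y * c k z) = K y z - R m y z" for m y z by (simp add: R_eq)
  then have eq: "(CLINT g|std_gaussian_seq. iexp (\<Sum>i\<in>A. a i * S j (x i) g))
      = exp (- (\<Sum>i\<in>A. \<Sum>i'\<in>A. a i * a i' * (K (x i) (x i') - R (min (level j (x i)) (level j (x i'))) (x i) (x i'))) / 2)" for j
    unfolding std_gaussian_partial_def partial_char[OF A] by simp
  have "(\<lambda>j. exp (- (\<Sum>i\<in>A. \<Sum>i'\<in>A. a i * a i' * (K (x i) (x i')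
    - R (min (level j (x i)) (level j (x i'))) (x i) (x i'))) / 2))
      \<longlonglongrightarrow> exp (- (\<Sum>i\<in>A. \<Sum>i'\<in>A. a i * a i' * (K (x i) (x i') - 0)) / 2)"
    by (intro tendsto_intros R_levels_tendsto) auto
  then show "(\<lambda>j. CLINT g|std_gaussian_seq. iexp (\<Sum>i\<in>A. a i * S j (x i) g))
    \<longlonglongrightarrow> exp (- (\<Sum>i\<in>A. \<Sum>i'\<in>A. a i * a i' * K (x i) (x i')) / 2)"
    unfolding eq by (intro tendsto_of_real) simp
qed

text \<open>The levels depend only on diagonal residuals, which do not see the sign, while all
  features are multiplied by s. The partial sums, and therefore the paths, agree up to the factor s
  for every g.\<close>

lemma gaussian_field_sign:
  assumes s: "\<bar>s\<bar> = 1" and K: "\<And>y. K x' y = s * K x y"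
  shows "W x' g = s * W x g"
proof -
  have R: "R n x' y = s * R n x y" for n y by (rule newton_residual_scale[of K, OF K])
  have "R n x' x' = R n x x" for n
  proof -
    have "R n x' x' = s * (s * R n x x)" using R psd_kernel_sym[OF psd_R] by metis
    then show ?thesis using s by (auto simp: abs_if split: if_splits)
  qed
  then have "level j x' = level j x" for j by (simp add: newton_level_def)
  moreover have "c k x' = s * c k x" for k using R by (simp add: newton_feature_def)
  ultimately have S: "S j x' g = s * S j x g" for j
    by (simp add: std_gaussian_partial_def sum_distrib_left mult.assoc)
  have "s \<noteq> 0" using s by auto
  then have iff: "convergent (\<lambda>j. s * S j x g) \<longleftrightarrow> convergent (\<lambda>j. S j x g)"
    by (rule convergent_mult_const_iff)
  show ?thesis
  proof (cases "convergent (\<lambda>j. S j x g)")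
    case True
    then have "(\<lambda>j. s * S j x g) \<longlonglongrightarrow> s * lim (\<lambda>j. S j x g)"
      by (intro tendsto_intros) (simp add: convergent_LIMSEQ_iff)
    then have "lim (\<lambda>j. s * S j x g) = s * lim (\<lambda>j. S j x g)" by (rule limI)
    with True iff S show ?thesis by (simp add: gaussian_field_def)
  qed (use iff S in \<open>simp add: gaussian_field_def\<close>)
qed

end

section \<open>Sums of bounded iid variables\<close>

lemma psd_kernel_integral:
  fixes F :: "'b \<Rightarrow> 'w \<Rightarrow> real"
  assumes "\<And>x y. integrable D (\<lambda>\<omega>. F x \<omega> * F y \<omega>)"
  shows "psd_kernel (\<lambda>x y. \<integral>\<omega>. F x \<omega> * F y \<omega> \<partial>D)"
  unfolding psd_kernel_def
proof (intro conjI allI impI)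
  fix A :: "'b set" and c :: "'b \<Rightarrow> real"
  assume A: "finite A"
  have "(\<Sum>x\<in>A. \<Sum>y\<in>A. c x * c y * (\<integral>\<omega>. F x \<omega> * F y \<omega> \<partial>D))
    = (\<integral>\<omega>. (\<Sum>x\<in>A. \<Sum>y\<in>A. c x * c y * (F x \<omega> * F y \<omega>)) \<partial>D)"
    using assms by simp
  also have "\<dots> = (\<integral>\<omega>. (\<Sum>x\<in>A. c x * F x \<omega>)\<^sup>2 \<partial>D)"
    by (simp add: power2_eq_square sum_product mult_ac)
  finally show "0 \<le> (\<Sum>x\<in>A. \<Sum>y\<in>A. c x * c y * (\<integral>\<omega>. F x \<omega> * F y \<omega> \<partial>D))" by simp
qed (simp add: mult.commute)

text \<open>Cauchy-Schwarz for the two-point Gram kernel of the moduli, indexed by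
  \<open>bool\<close>.\<close>

lemma norm_integral_mult_sq_le:
  fixes u v :: "'a \<Rightarrow> complex"
  assumes [measurable]: "u \<in> borel_measurable D" "v \<in> borel_measurable D"
    and u: "integrable D (\<lambda>x. (cmod (u x))\<^sup>2)" and v: "integrable D (\<lambda>x. (cmod (v x))\<^sup>2)"
  shows "(cmod (\<integral>x. u x * v x \<partial>D))\<^sup>2 \<le> (\<integral>x. (cmod (u x))\<^sup>2 \<partial>D) * (\<integral>x. (cmod (v x))\<^sup>2 \<partial>D)"
proof -
  define F where "F b x = (if b then cmod (u x) else cmod (v x))" for b x
  have uv: "integrable D (\<lambda>x. cmod (u x) * cmod (v x))"
  proof (rule Bochner_Integration.integrable_bound)
    show "integrable D (\<lambda>x. (cmod (u x))\<^sup>2 + (cmod (v x))\<^sup>2)" using u v by simp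
    show "AE x in D. norm (cmod (u x) * cmod (v x)) \<le> norm ((cmod (u x))\<^sup>2 + (cmod (v x))\<^sup>2)"
    proof (rule AE_I2)
      fix x
      have "2 * (cmod (u x) * cmod (v x)) \<le> (cmod (u x))\<^sup>2 + (cmod (v x))\<^sup>2"
        using sum_squares_bound[of "cmod (u x)" "cmod (v x)"] by simp
      moreover have "0 \<le> cmod (u x) * cmod (v x)" by simp
      ultimately show "norm (cmod (u x) * cmod (v x)) \<le> norm ((cmod (u x))\<^sup>2 + (cmod (v x))\<^sup>2)"
        unfolding real_norm_def by linarith
    qed
  qed simp
  have "integrable D (\<lambda>x. F b x * F b' x)" for b b'
    using uv u v by (cases b; cases b') (simp_all add: F_def power2_eq_square mult.commute)
  from psd_kernel_cauchy_schwarz[OF psd_kernel_integral[of D F, OF this], of True False]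
  have "(\<integral>x. cmod (u x) * cmod (v x) \<partial>D)\<^sup>2 \<le> (\<integral>x. (cmod (u x))\<^sup>2 \<partial>D) * (\<integral>x. (cmod (v x))\<^sup>2 \<partial>D)"
    by (simp add: F_def power2_eq_square)
  moreover have "cmod (\<integral>x. u x * v x \<partial>D) \<le> (\<integral>x. cmod (u x) * cmod (v x) \<partial>D)"
    using integral_norm_bound[of D "\<lambda>x. u x * v x"] by (simp add: norm_mult)
  then have "(cmod (\<integral>x. u x * v x \<partial>D))\<^sup>2 \<le> (\<integral>x. cmod (u x) * cmod (v x) \<partial>D)\<^sup>2" by (rule power_mono) simp
  ultimately show ?thesis by linarith
qed

lemma borel_measurable_cnj [measurable (raw)]:
  "f \<in> borel_measurable M \<Longrightarrow> (\<lambda>x. cnj (f x)) \<in> borel_measurable M"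
  by (rule borel_measurable_continuous_on[of cnj]) (auto intro!: continuous_intros)

lemma norm_mult_le_mult:
  fixes x y :: "'a::real_normed_div_algebra"
  shows "norm x \<le> B \<Longrightarrow> norm y \<le> C \<Longrightarrow> norm (x * y) \<le> B * C"
  unfolding norm_mult by (rule mult_mono) (auto intro: order_trans[OF norm_ge_zero])

context prob_space
begin

text \<open>A class closed under sums, products and conjugation, so that integrability of the
  fourth-order products below follows from introduction rules.\<close>

definition bounded_rv :: "('a \<Rightarrow> 'b::{banach, second_countable_topology}) \<Rightarrow> bool" where
  "bounded_rv f \<longleftrightarrow> f \<in> borel_measurable M \<and> (\<exists>B. \<forall>\<omega>\<in>space M. norm (f \<omega>) \<le> B)"

lemma bounded_rvI: "f \<in> borel_measurable M \<Longrightarrow> (\<And>\<omega>. \<omega> \<in> space M \<Longrightarrow> norm (f \<omega>) \<le> B) \<Longrightarrow> bounded_rv f"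
  by (auto simp: bounded_rv_def)

lemma bounded_rv_integrable: "bounded_rv f \<Longrightarrow> integrable M f"
  unfolding bounded_rv_def by (auto intro!: integrable_const_bound)

lemma bounded_rv_measurable: "bounded_rv f \<Longrightarrow> f \<in> borel_measurable M"
  by (simp add: bounded_rv_def)

lemma bounded_rv_const: "bounded_rv (\<lambda>_. c)"
  by (rule bounded_rvI[where B = "norm c"]) auto

lemma bounded_rv_add:
  assumes "bounded_rv f" "bounded_rv g"
  shows "bounded_rv (\<lambda>\<omega>. f \<omega> + g \<omega>)"
proof -
  from assms obtain B C where "\<And>\<omega>. \<omega> \<in> space M \<Longrightarrow> norm (f \<omega>) \<le> B" "\<And>\<omega>. \<omega> \<in> space M \<Longrightarrow> norm (g \<omega>) \<le> C"
    by (auto simp: bounded_rv_def)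
  then have "norm (f \<omega> + g \<omega>) \<le> B + C" if "\<omega> \<in> space M" for \<omega>
    using that by (intro norm_triangle_mono) auto
  moreover have "(\<lambda>\<omega>. f \<omega> + g \<omega>) \<in> borel_measurable M"
    using assms[THEN bounded_rv_measurable] by (rule borel_measurable_add)
  ultimately show ?thesis by (intro bounded_rvI[where B = "B + C"])
qed

lemma bounded_rv_mult:
  fixes f g :: "'a \<Rightarrow> 'b::{banach, second_countable_topology, real_normed_div_algebra}"
  assumes "bounded_rv f" "bounded_rv g"
  shows "bounded_rv (\<lambda>\<omega>. f \<omega> * g \<omega>)"
proof -
  from assms obtain B C where *: "\<And>\<omega>. \<omega> \<in> space M \<Longrightarrow> norm (f \<omega>) \<le> B" "\<And>\<omega>. \<omega> \<in> space M \<Longrightarrow> norm (g \<omega>) \<le> C"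
    by (auto simp: bounded_rv_def)
  have "norm (f \<omega> * g \<omega>) \<le> B * C" if "\<omega> \<in> space M" for \<omega>
    by (rule norm_mult_le_mult[OF *(1)[OF that] *(2)[OF that]])
  moreover have "(\<lambda>\<omega>. f \<omega> * g \<omega>) \<in> borel_measurable M"
    using assms[THEN bounded_rv_measurable] by (rule borel_measurable_times)
  ultimately show ?thesis by (intro bounded_rvI[where B = "B * C"])
qed

lemma bounded_rv_sum:
  "(\<And>i. i \<in> I \<Longrightarrow> bounded_rv (f i)) \<Longrightarrow> bounded_rv (\<lambda>\<omega>. \<Sum>i\<in>I. f i \<omega>)"
  by (induction I rule: infinite_finite_induct) (auto intro: bounded_rv_add bounded_rv_const)

lemma bounded_rv_cnj: "bounded_rv f \<Longrightarrow> bounded_rv (\<lambda>\<omega>. cnj (f \<omega>))"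
  by (auto simp: bounded_rv_def)

lemma bounded_rv_cmod_sq: "bounded_rv f \<Longrightarrow> bounded_rv (\<lambda>\<omega>. (cmod (f \<omega>))\<^sup>2)"
  unfolding power2_eq_square by (rule bounded_rv_mult) (auto simp: bounded_rv_def)

lemma bounded_rv_Re: "bounded_rv f \<Longrightarrow> bounded_rv (\<lambda>\<omega>. Re (f \<omega>))"
  unfolding bounded_rv_def by (auto intro: order_trans[OF abs_Re_le_cmod])

lemmas bounded_rv_intros = bounded_rv_const bounded_rv_add bounded_rv_mult bounded_rv_sum bounded_rv_cnj
  bounded_rv_cmod_sq bounded_rv_Re

end

locale iid_sample = prob_space M for M :: "'w measure" +
  fixes A :: "'a measure" and Xs :: "nat \<Rightarrow> 'w \<Rightarrow> 'a" and D :: "'a measure"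
  assumes indep: "indep_vars (\<lambda>_. A) Xs {1..}"
    and law: "\<And>j. j \<ge> 1 \<Longrightarrow> distr M A (Xs j) = D"
begin

declare One_nat_def [simp del]

lemma rv [measurable]: "j \<ge> 1 \<Longrightarrow> Xs j \<in> measurable M A"
  using indep by (auto simp: indep_vars_def)

lemma sets_D [measurable_cong]: "sets D = sets A"
  using law[of 1] by auto

sublocale D: prob_space D
  using prob_space_distr[OF rv[of 1]] law[of 1] by simp

lemma expectation_sample:
  fixes u :: "'a \<Rightarrow> 'b::{banach, second_countable_topology}"
  assumes "u \<in> borel_measurable A" "j \<ge> 1"
  shows "(\<integral>\<omega>. u (Xs j \<omega>) \<partial>M) = (\<integral>x. u x \<partial>D)"
  using integral_distr[OF rv[OF assms(2)] assms(1)] law[OF assms(2)] by simp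

abbreviation "psum u n x \<equiv> (\<Sum>j=1..n. u (x j))"

lemma psum_bounded_rv:
  fixes u :: "'a \<Rightarrow> 'b::{second_countable_topology, banach}"
  assumes [measurable]: "u \<in> borel_measurable A" and u: "\<And>x. norm (u x) \<le> B"
  shows "bounded_rv (\<lambda>\<omega>. psum u n (\<lambda>j. Xs j \<omega>))" "bounded_rv (\<lambda>\<omega>. u (Xs (Suc n) \<omega>))"
proof -
  have 1: "bounded_rv (\<lambda>\<omega>. u (Xs j \<omega>))" if "j \<ge> 1" for j
    by (rule bounded_rvI[of _ B]) (use that u in auto)
  then show "bounded_rv (\<lambda>\<omega>. u (Xs (Suc n) \<omega>))" by simp
  show "bounded_rv (\<lambda>\<omega>. psum u n (\<lambda>j. Xs j \<omega>))" by (rule bounded_rv_sum) (use 1 in auto)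
qed

text \<open>The restriction condition says that F depends only on the first n coordinates; the
  blocks {1..n} and {Suc n} of the sample are independent.\<close>

lemma expectation_past_mult:
  fixes F :: "(nat \<Rightarrow> 'a) \<Rightarrow> complex" and u :: "'a \<Rightarrow> complex"
  assumes [measurable]: "F \<in> borel_measurable (PiM {1..n} (\<lambda>_. A))" "u \<in> borel_measurable A"
    and F: "\<And>x. F (restrict x {1..n}) = F x"
    and bdd: "bounded_rv (\<lambda>\<omega>. F (\<lambda>j. Xs j \<omega>))" and u: "\<And>x. cmod (u x) \<le> B"
  shows "(\<integral>\<omega>. F (\<lambda>j. Xs j \<omega>) * u (Xs (Suc n) \<omega>) \<partial>M) = (\<integral>\<omega>. F (\<lambda>j. Xs j \<omega>) \<partial>M) * (\<integral>x. u x \<partial>D)"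
proof -
  have "indep_var (PiM {1..n} (\<lambda>_. A)) (\<lambda>\<omega>. restrict (\<lambda>i. Xs i \<omega>) {1..n})
      (PiM {Suc n} (\<lambda>_. A)) (\<lambda>\<omega>. restrict (\<lambda>i. Xs i \<omega>) {Suc n})"
    by (rule indep_var_restrict[OF indep]) auto
  from indep_var_compose[OF this, of F borel "\<lambda>x. u (x (Suc n))" borel]
  have "indep_var borel (\<lambda>\<omega>. F (\<lambda>j. Xs j \<omega>)) borel (\<lambda>\<omega>. u (Xs (Suc n) \<omega>))"
    by (simp add: comp_def F)
  moreover have "integrable M (\<lambda>\<omega>. u (Xs (Suc n) \<omega>))"
    by (rule bounded_rv_integrable[OF psum_bounded_rv(2)]) (use u in auto)
  ultimately show ?thesis
    using indep_var_lebesgue_integral[OF _ bounded_rv_integrable[OF bdd], of "\<lambda>\<omega>. u (Xs (Suc n) \<omega>)"]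
      expectation_sample[of u "Suc n"] by simp
qed

context
  fixes u v :: "'a \<Rightarrow> complex" and B
  assumes meas [measurable]: "u \<in> borel_measurable A" "v \<in> borel_measurable A"
    and bd: "\<And>x. cmod (u x) \<le> B" "\<And>x. cmod (v x) \<le> B"
    and mean: "(\<integral>x. u x \<partial>D) = 0" "(\<integral>x. v x \<partial>D) = 0"
begin

lemmas sum_bounded = psum_bounded_rv[OF meas(1) bd(1)] psum_bounded_rv[OF meas(2) bd(2)]

text \<open>The product is bilinear, without conjugate: v = cnj u yields the second moment, and
  general u and v yield the mixed term in the fourth-order bound.\<close>

lemma expectation_psum_mult:
  "(\<integral>\<omega>. psum u n (\<lambda>j. Xs j \<omega>) * psum v n (\<lambda>j. Xs j \<omega>) \<partial>M) = of_nat n * (\<integral>x. u x * v x \<partial>D)"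
proof (induction n)
  case (Suc n)
  let ?U = "\<lambda>\<omega>. psum u n (\<lambda>j. Xs j \<omega>)" and ?V = "\<lambda>\<omega>. psum v n (\<lambda>j. Xs j \<omega>)"
  let ?u = "\<lambda>\<omega>. u (Xs (Suc n) \<omega>)" and ?v = "\<lambda>\<omega>. v (Xs (Suc n) \<omega>)"
  have i: "integrable M (\<lambda>\<omega>. ?U \<omega> * ?V \<omega>)" "integrable M (\<lambda>\<omega>. ?U \<omega> * ?v \<omega>)"
    "integrable M (\<lambda>\<omega>. ?V \<omega> * ?u \<omega>)" "integrable M (\<lambda>\<omega>. ?u \<omega> * ?v \<omega>)"
    by (intro bounded_rv_integrable bounded_rv_intros sum_bounded)+
  have "(\<integral>\<omega>. psum u (Suc n) (\<lambda>j. Xs j \<omega>) * psum v (Suc n) (\<lambda>j. Xs j \<omega>) \<partial>M)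
      = (\<integral>\<omega>. ?U \<omega> * ?V \<omega> + ?U \<omega> * ?v \<omega> + ?V \<omega> * ?u \<omega> + ?u \<omega> * ?v \<omega> \<partial>M)"
    by (simp add: algebra_simps)
  also have "\<dots> = (\<integral>\<omega>. ?U \<omega> * ?V \<omega> \<partial>M) + (\<integral>\<omega>. ?U \<omega> * ?v \<omega> \<partial>M) + (\<integral>\<omega>. ?V \<omega> * ?u \<omega> \<partial>M) + (\<integral>\<omega>. ?u \<omega> * ?v \<omega> \<partial>M)"
    using i by simp
  also have "(\<integral>\<omega>. ?U \<omega> * ?v \<omega> \<partial>M) = 0"
    using expectation_past_mult[of "psum u n" n v B] by (simp add: sum_bounded bd mean)
  also have "(\<integral>\<omega>. ?V \<omega> * ?u \<omega> \<partial>M) = 0"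
    using expectation_past_mult[of "psum v n" n u B] by (simp add: sum_bounded bd mean)
  also have "(\<integral>\<omega>. ?u \<omega> * ?v \<omega> \<partial>M) = (\<integral>x. u x * v x \<partial>D)"
    by (rule expectation_sample) auto
  finally show ?case using Suc.IH by (simp add: algebra_simps)
qed simp

end

lemma expectation_cmod_psum_sq:
  fixes u :: "'a \<Rightarrow> complex"
  assumes [measurable]: "u \<in> borel_measurable A" and "\<And>x. cmod (u x) \<le> B" and "(\<integral>x. u x \<partial>D) = 0"
  shows "(\<integral>\<omega>. (cmod (psum u n (\<lambda>j. Xs j \<omega>)))\<^sup>2 \<partial>M) = n * (\<integral>x. (cmod (u x))\<^sup>2 \<partial>D)"
proof -
  have "(\<integral>\<omega>. psum u n (\<lambda>j. Xs j \<omega>) * psum (\<lambda>x. cnj (u x)) n (\<lambda>j. Xs j \<omega>) \<partial>M)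
    = of_nat n * (\<integral>x. u x * cnj (u x) \<partial>D)"
    by (rule expectation_psum_mult) (use assms in auto)
  then have "complex_of_real (\<integral>\<omega>. (cmod (psum u n (\<lambda>j. Xs j \<omega>)))\<^sup>2 \<partial>M)
    = complex_of_real (n * (\<integral>x. (cmod (u x))\<^sup>2 \<partial>D))"
    by (simp only: integral_complex_of_real[symmetric] complex_norm_square of_real_mult of_real_of_nat_eq cnj_sum)
  then show ?thesis by (simp only: of_real_eq_iff)
qed

text \<open>Induction on n. In the expansion of the new product, every term that contains the new
  observation through a single centred factor has mean 0. What remains is |E(uv)|^2, bounded by
  Cauchy-Schwarz, and products of second moments.\<close>

lemma expectation_cmod_psum_mult_sq_le:
  fixes u v :: "'a \<Rightarrow> complex"
  assumes meas [measurable]: "u \<in> borel_measurable A" "v \<in> borel_measurable A"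
    and bd: "\<And>x. cmod (u x) \<le> B" "\<And>x. cmod (v x) \<le> B"
    and mean: "(\<integral>x. u x \<partial>D) = 0" "(\<integral>x. v x \<partial>D) = 0"
  shows "(\<integral>\<omega>. (cmod (psum u n (\<lambda>j. Xs j \<omega>) * psum v n (\<lambda>j. Xs j \<omega>)))\<^sup>2 \<partial>M)
    \<le> 3 * real n * (\<integral>x. (cmod (u x * v x))\<^sup>2 \<partial>D) + 4 * (real n)\<^sup>2 * ((\<integral>x. (cmod (u x))\<^sup>2 \<partial>D) * (\<integral>x. (cmod (v x))\<^sup>2 \<partial>D))"
proof (induction n)
  case (Suc n)
  let ?a = "\<integral>x. (cmod (u x))\<^sup>2 \<partial>D" and ?b = "\<integral>x. (cmod (v x))\<^sup>2 \<partial>D" and ?c = "\<integral>x. (cmod (u x * v x))\<^sup>2 \<partial>D"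
  let ?e = "\<integral>x. u x * v x \<partial>D"
  let ?U = "\<lambda>\<omega>. psum u n (\<lambda>j. Xs j \<omega>)" and ?V = "\<lambda>\<omega>. psum v n (\<lambda>j. Xs j \<omega>)"
  let ?u = "\<lambda>\<omega>. u (Xs (Suc n) \<omega>)" and ?v = "\<lambda>\<omega>. v (Xs (Suc n) \<omega>)"
  note sb = psum_bounded_rv[OF meas(1) bd(1)] psum_bounded_rv[OF meas(2) bd(2)]
  have bdd: "cmod (u x * v x) \<le> B * B" "(cmod (u x))\<^sup>2 \<le> B * B" "(cmod (v x))\<^sup>2 \<le> B * B" for x
    using norm_mult_le_mult[OF bd(1)[of x] bd(2)[of x]] norm_mult_le_mult[OF bd(1)[of x] bd(1)[of x]]
      norm_mult_le_mult[OF bd(2)[of x] bd(2)[of x]] by (auto simp: power2_eq_square norm_mult)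
  have mean_cnj: "(\<integral>x. cnj (u x) \<partial>D) = 0" "(\<integral>x. cnj (v x) \<partial>D) = 0" using mean by simp_all
  \<comment> \<open>The cross terms with U V are kept exactly, because two of them have mean 0. Only
    the square of the three new terms is estimated, at the cost of the factor 3.\<close>
  have pointwise: "(cmod ((U + a) * (V + b)))\<^sup>2 \<le> (cmod (U * V))\<^sup>2
      + 2 * Re (U * V * cnj V * cnj a) + 2 * Re (U * V * cnj U * cnj b) + 2 * Re (U * V * cnj (a * b))
      + 3 * Re (V * cnj V * of_real ((cmod a)\<^sup>2)) + 3 * Re (U * cnj U * of_real ((cmod b)\<^sup>2)) + 3 * (cmod (a * b))\<^sup>2" for U V a b :: complex
  proof -
    have sq: "(cmod (x + y + z))\<^sup>2 \<le> 3 * (cmod x)\<^sup>2 + 3 * (cmod y)\<^sup>2 + 3 * (cmod z)\<^sup>2" for x y z :: complex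
    proof -
      have "cmod (x + y + z) \<le> cmod x + cmod y + cmod z"
        by (meson norm_triangle_le norm_triangle_ineq add_mono order_refl order_trans)
      then have "(cmod (x + y + z))\<^sup>2 \<le> (cmod x + cmod y + cmod z)\<^sup>2" by (rule power_mono) simp
      also have "\<dots> \<le> 3 * (cmod x)\<^sup>2 + 3 * (cmod y)\<^sup>2 + 3 * (cmod z)\<^sup>2"
        using sum_squares_bound[of "cmod x" "cmod y"] sum_squares_bound[of "cmod x"
          "cmod z"] sum_squares_bound[of "cmod y" "cmod z"]
        by (simp add: power2_eq_square algebra_simps)
      finally show ?thesis .
    qed
    have expand: "(cmod (x + y))\<^sup>2 = (cmod x)\<^sup>2 + 2 * Re (x * cnj y) + (cmod y)\<^sup>2" for x y :: complex
      unfolding cmod_power2 by (simp add: power2_eq_square algebra_simps)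
    have prod: "(U + a) * (V + b) = U * V + (a * V + U * b + a * b)" by (simp add: algebra_simps)
    have cross: "Re (U * V * cnj (a * V + U * b + a * b)) = Re (U * V * cnj V * cnj a)
      + Re (U * V * cnj U * cnj b) + Re (U * V * cnj (a * b))"
      unfolding plus_complex.sel(1)[symmetric] by (rule arg_cong[where f = Re]) (simp add: algebra_simps)
    have diag: "Re (V * cnj V * of_real ((cmod a)\<^sup>2)) = (cmod (a * V))\<^sup>2"
      "Re (U * cnj U * of_real ((cmod b)\<^sup>2)) = (cmod (U * b))\<^sup>2"
      by (simp_all only: complex_norm_square[symmetric] of_real_mult[symmetric] Re_complex_of_real norm_mult power_mult_distrib mult.commute)
    have combine: "x + 2 * (r1 + r2 + r3) + t \<le> x + 2 * r1 + 2 * r2 + 2 * r3 + 3 * p + 3 * q + 3 * r"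
      if "t \<le> 3 * p + 3 * q + 3 * r" for x r1 r2 r3 t p q r :: real
      using that by simp
    show ?thesis unfolding prod diag expand[of "U * V"] cross by (rule combine[OF sq])
  qed
  note bi = bounded_rv_integrable bounded_rv_intros sb
  have past: "F \<in> borel_measurable (PiM {1..n} (\<lambda>_. A)) \<Longrightarrow> h \<in> borel_measurable A
    \<Longrightarrow> (\<And>x. F (restrict x {1..n}) = F x) \<Longrightarrow>
      bounded_rv (\<lambda>\<omega>. F (\<lambda>j. Xs j \<omega>)) \<Longrightarrow> (\<And>x. cmod (h x) \<le> C) \<Longrightarrow>
      (\<integral>\<omega>. Re (F (\<lambda>j. Xs j \<omega>) * h (Xs (Suc n) \<omega>)) \<partial>M) = Re ((\<integral>\<omega>. F (\<lambda>j. Xs j \<omega>) \<partial>M) * (\<integral>x. h x \<partial>D))" for F h C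
  proof -
    assume *: "F \<in> borel_measurable (PiM {1..n} (\<lambda>_. A))" "h \<in> borel_measurable A"
      "\<And>x. F (restrict x {1..n}) = F x"
      "bounded_rv (\<lambda>\<omega>. F (\<lambda>j. Xs j \<omega>))" "\<And>x. cmod (h x) \<le> C"
    have "bounded_rv (\<lambda>\<omega>. F (\<lambda>j. Xs j \<omega>) * h (Xs (Suc n) \<omega>))"
      by (intro bounded_rv_mult *(4) psum_bounded_rv(2)[OF *(2,5)])
    from bounded_rv_integrable[OF this] show ?thesis
      using expectation_past_mult[OF *] by (subst integral_Re) auto
  qed
  have V: "(\<integral>\<omega>. ?V \<omega> * cnj (?V \<omega>) \<partial>M) = of_nat n * of_real ?b"
    and U: "(\<integral>\<omega>. ?U \<omega> * cnj (?U \<omega>) \<partial>M) = of_nat n * of_real ?a"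
    using expectation_cmod_psum_sq[OF meas(2) bd(2) mean(2), of n] expectation_cmod_psum_sq[OF meas(1) bd(1) mean(1), of n]
    by (simp_all only: integral_complex_of_real complex_norm_square[symmetric] of_real_mult of_real_of_nat_eq)
  have t1: "(\<integral>\<omega>. Re (?U \<omega> * ?V \<omega> * cnj (?V \<omega>) * cnj (?u \<omega>)) \<partial>M) = 0"
    using past[of "\<lambda>x. psum u n x * psum v n x * cnj (psum v n x)" "\<lambda>x. cnj (u x)" B] mean_cnj bd
    by (simp add: bi del: cnj_sum)
  have t2: "(\<integral>\<omega>. Re (?U \<omega> * ?V \<omega> * cnj (?U \<omega>) * cnj (?v \<omega>)) \<partial>M) = 0"
    using past[of "\<lambda>x. psum u n x * psum v n x * cnj (psum u n x)" "\<lambda>x. cnj (v x)" B] mean_cnj bd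
    by (simp add: bi del: cnj_sum)
  have t3: "(\<integral>\<omega>. Re (?U \<omega> * ?V \<omega> * cnj (?u \<omega> * ?v \<omega>)) \<partial>M) = n * (cmod ?e)\<^sup>2"
  proof -
    have "(\<integral>\<omega>. Re (?U \<omega> * ?V \<omega> * cnj (?u \<omega> * ?v \<omega>)) \<partial>M)
      = Re ((\<integral>\<omega>. ?U \<omega> * ?V \<omega> \<partial>M) * (\<integral>x. cnj (u x * v x) \<partial>D))"
      by (rule past[of "\<lambda>x. psum u n x * psum v n x" "\<lambda>x. cnj (u x * v x)" "B * B"])
        (use bdd in \<open>auto simp: bi simp del: complex_cnj_mult\<close>)
    also have "(\<integral>x. cnj (u x * v x) \<partial>D) = cnj ?e" by (simp del: complex_cnj_mult)
    also have "(\<integral>\<omega>. ?U \<omega> * ?V \<omega> \<partial>M) = of_nat n * ?e" by (rule expectation_psum_mult[OF meas bd mean])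
    also have "of_nat n * ?e * cnj ?e = of_real (n * (cmod ?e)\<^sup>2)"
      by (simp only: of_real_mult complex_norm_square of_real_of_nat_eq mult.assoc)
    finally show ?thesis by simp
  qed
  have t4: "(\<integral>\<omega>. Re (?V \<omega> * cnj (?V \<omega>) * of_real ((cmod (?u \<omega>))\<^sup>2)) \<partial>M) = n * ?b * ?a"
    using past[of "\<lambda>x. psum v n x * cnj (psum v n x)" "\<lambda>x. of_real ((cmod (u x))\<^sup>2)" "B * B"] bdd
    by (simp add: bi V norm_power del: cnj_sum of_real_power)
  have t5: "(\<integral>\<omega>. Re (?U \<omega> * cnj (?U \<omega>) * of_real ((cmod (?v \<omega>))\<^sup>2)) \<partial>M) = n * ?a * ?b"
    using past[of "\<lambda>x. psum u n x * cnj (psum u n x)" "\<lambda>x. of_real ((cmod (v x))\<^sup>2)" "B * B"] bdd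
    by (simp add: bi U norm_power del: cnj_sum of_real_power)
  have t6: "(\<integral>\<omega>. (cmod (?u \<omega> * ?v \<omega>))\<^sup>2 \<partial>M) = ?c"
    by (rule expectation_sample) auto
  have bR: "bounded_rv (\<lambda>\<omega>. complex_of_real ((cmod (f \<omega>))\<^sup>2))" if "bounded_rv f" for f
    using bounded_rv_mult[OF that bounded_rv_cnj[OF that]] by (simp only: complex_norm_square)
  have e: "(cmod ?e)\<^sup>2 \<le> ?a * ?b"
    by (rule norm_integral_mult_sq_le) (use bdd in \<open>auto intro!: D.integrable_const_bound[of _ "B * B"]\<close>)
  have "(\<integral>\<omega>. (cmod (psum u (Suc n) (\<lambda>j. Xs j \<omega>) * psum v (Suc n) (\<lambda>j. Xs j \<omega>)))\<^sup>2 \<partial>M)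
      = (\<integral>\<omega>. (cmod ((?U \<omega> + ?u \<omega>) * (?V \<omega> + ?v \<omega>)))\<^sup>2 \<partial>M)" by simp
  also have "\<dots> \<le> (\<integral>\<omega>. (cmod (?U \<omega> * ?V \<omega>))\<^sup>2
      + 2 * Re (?U \<omega> * ?V \<omega> * cnj (?V \<omega>) * cnj (?u \<omega>)) + 2 * Re (?U \<omega> * ?V \<omega> * cnj (?U \<omega>) * cnj (?v \<omega>)) + 2 * Re (?U \<omega> * ?V \<omega> * cnj (?u \<omega> * ?v \<omega>))
      + 3 * Re (?V \<omega> * cnj (?V \<omega>) * of_real ((cmod (?u \<omega>))\<^sup>2)) + 3 * Re (?U \<omega> * cnj (?U \<omega>) * of_real ((cmod (?v \<omega>))\<^sup>2)) + 3 * (cmod (?u \<omega> * ?v \<omega>))\<^sup>2 \<partial>M)"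
    by (intro integral_mono pointwise bi bR)
  also have "\<dots> = (\<integral>\<omega>. (cmod (?U \<omega> * ?V \<omega>))\<^sup>2 \<partial>M)
      + 2 * (\<integral>\<omega>. Re (?U \<omega> * ?V \<omega> * cnj (?V \<omega>) * cnj (?u \<omega>)) \<partial>M) + 2 * (\<integral>\<omega>. Re (?U \<omega> * ?V \<omega> * cnj (?U \<omega>) * cnj (?v \<omega>)) \<partial>M) + 2 * (\<integral>\<omega>. Re (?U \<omega> * ?V \<omega> * cnj (?u \<omega> * ?v \<omega>)) \<partial>M)
      + 3 * (\<integral>\<omega>. Re (?V \<omega> * cnj (?V \<omega>) * of_real ((cmod (?u \<omega>))\<^sup>2)) \<partial>M) + 3 * (\<integral>\<omega>. Re (?U \<omega> * cnj (?U \<omega>) * of_real ((cmod (?v \<omega>))\<^sup>2)) \<partial>M) + 3 * (\<integral>\<omega>. (cmod (?u \<omega> * ?v \<omega>))\<^sup>2 \<partial>M)"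
  proof -
    have split: "(\<integral>\<omega>. f1 \<omega> + 2 * f2 \<omega> + 2 * f3 \<omega> + 2 * f4 \<omega> + 3 * f5 \<omega> + 3 * f6 \<omega> + 3 * f7 \<omega> \<partial>M)
      = integral\<^sup>L M f1 + 2 * integral\<^sup>L M f2 +
        2 * integral\<^sup>L M f3 + 2 * integral\<^sup>L M f4 + 3 * integral\<^sup>L M f5 + 3 * integral\<^sup>L M f6 + 3 * integral\<^sup>L M f7"
      if "integrable M f1" "integrable M f2" "integrable M f3" "integrable M f4" "integrable M f5"
        "integrable M f6" "integrable M f7"
      for f1 f2 f3 f4 f5 f6 f7 :: "'w \<Rightarrow> real"
      using that by simp
    show ?thesis by (rule split; intro bi bR)
  qed
  also have "\<dots> = (\<integral>\<omega>. (cmod (?U \<omega> * ?V \<omega>))\<^sup>2 \<partial>M) + 2 * (n * (cmod ?e)\<^sup>2) + 3 * (n * ?b * ?a)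
    + 3 * (n * ?a * ?b) + 3 * ?c"
    unfolding t1 t2 t3 t4 t5 t6 by simp
  also have "\<dots> \<le> (3 * real n * ?c + 4 * (real n)\<^sup>2 * (?a * ?b)) + 2 * (n * (?a * ?b))
    + 3 * (n * ?b * ?a) + 3 * (n * ?a * ?b) + 3 * ?c"
  proof -
    have "2 * (n * (cmod ?e)\<^sup>2) \<le> 2 * (n * (?a * ?b))" using mult_left_mono[OF e, of "real n"] by simp
    then show ?thesis using Suc.IH by (intro add_mono order_refl)
  qed
  also have "\<dots> = 3 * real (Suc n) * ?c + (4 * (real n)\<^sup>2 + 8 * n) * (?a * ?b)"
    by (simp add: algebra_simps)
  \<comment> \<open>The increment 4(n + 1)^2 - 4n^2 = 8n + 4 absorbs the 8n collected above: 2n from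
    the squared mean and 3n twice from the mixed second moments. This fixes the constant 4.\<close>
  also have "\<dots> \<le> 3 * real (Suc n) * ?c + 4 * (real (Suc n))\<^sup>2 * (?a * ?b)"
    by (intro add_left_mono mult_right_mono) (auto simp: power2_eq_square algebra_simps)
  finally show ?case .
qed simp

lemma expectation_iexp_psum:
  fixes h :: "'a \<Rightarrow> real"
  assumes [measurable]: "h \<in> borel_measurable A"
  shows "(CLINT \<omega>|M. iexp (psum h n (\<lambda>j. Xs j \<omega>))) = (CLINT x|D. iexp (h x)) ^ n"
proof (induction n)
  case (Suc n)
  have "(CLINT \<omega>|M. iexp (psum h (Suc n) (\<lambda>j. Xs j \<omega>)))
    = (CLINT \<omega>|M. iexp (psum h n (\<lambda>j. Xs j \<omega>)) * iexp (h (Xs (Suc n) \<omega>)))"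
    by (simp add: distrib_left exp_add)
  also have "\<dots> = (CLINT \<omega>|M. iexp (psum h n (\<lambda>j. Xs j \<omega>))) * (CLINT x|D. iexp (h x))"
  proof (rule expectation_past_mult[where F = "\<lambda>x. iexp (psum h n x)" and B = 1])
    show "bounded_rv (\<lambda>\<omega>. iexp (psum h n (\<lambda>j. Xs j \<omega>)))"
      by (rule bounded_rvI[where B = 1]) (auto simp del: of_real_sum)
  qed (auto simp del: of_real_sum)
  finally show ?case using Suc.IH by (simp add: mult.commute)
qed (simp add: prob_space)

end

lemma iexp_quadratic_bound:
  "norm (iexp y - (1 + \<i> * of_real y - of_real (y\<^sup>2) / 2)) \<le> \<bar>y\<bar> ^ 3 / 6"
proof -
  have "(\<Sum>k\<le>2. (\<i> * complex_of_real y) ^ k / fact k) = 1 + \<i> * of_real y - of_real (y\<^sup>2) / 2"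
    by (simp add: numeral_2_eq_2 power2_eq_square mult_ac)
  then show ?thesis using iexp_approx1[of y 2] by (simp add: numeral_3_eq_3 fact_numeral del: of_real_power)
qed

lemma exp_neg_linear_bound:
  fixes x :: real assumes "x \<ge> 0"
  shows "\<bar>(1 - x) - exp (- x)\<bar> \<le> x\<^sup>2"
proof -
  have "exp (- x) \<le> 1 / (1 + x)"
    using exp_ge_add_one_self[of x] assms by (simp add: exp_minus field_simps)
  also have "\<dots> \<le> 1 - x + x\<^sup>2"
  proof -
    have "1 \<le> (1 - x + x\<^sup>2) * (1 + x)" using assms by (simp add: algebra_simps power2_eq_square)
    then show ?thesis using assms by (simp add: pos_divide_le_eq)
  qed
  finally show ?thesis using exp_ge_add_one_self[of "- x"] by linarith
qed

text \<open>The summands vary with n but are bounded by B, so after division by the square root of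
  \<open>a n\<close> the third absolute moment is at most that small quantity times the second. A
  Taylor expansion per summand then has total error O(a^-1/2) + O(1/n).\<close>

lemma (in iid_sample) row_clt_char:
  fixes h :: "nat \<Rightarrow> 'a \<Rightarrow> real"
  assumes h [measurable]: "\<And>n. h n \<in> borel_measurable A" and B: "\<And>n x. \<bar>h n x\<bar> \<le> B"
    and mean: "\<And>n. (\<integral>x. h n x \<partial>D) = 0"
    and a: "filterlim a at_top sequentially"
    and var: "(\<lambda>n. real n * (\<integral>x. (h n x)\<^sup>2 \<partial>D) / a n) \<longlonglongrightarrow> v"
  shows "(\<lambda>n. CLINT \<omega>|M. iexp ((1 / sqrt (a n)) * (\<Sum>j=1..n. h n (Xs j \<omega>)))) \<longlonglongrightarrow> exp (- v / 2)"
proof -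
  define s where "s n = real n * (\<integral>x. (h n x)\<^sup>2 \<partial>D) / a n" for n
  define z where "z n = (CLINT x|D. iexp ((1 / sqrt (a n)) * h n x))" for n
  \<comment> \<open>The n-th root of exp(-s n / 2), so that n-th powers of two numbers in the unit
    disc are compared, with error at most n times their difference.\<close>
  define w where "w n = exp (- (s n / (2 * real n)))" for n
  have eq: "(CLINT \<omega>|M. iexp ((1 / sqrt (a n)) * (\<Sum>j=1..n. h n (Xs j \<omega>)))) = z n ^ n" for n
    using expectation_iexp_psum[of "\<lambda>x. (1 / sqrt (a n)) * h n x" n]
    unfolding z_def sum_distrib_left[symmetric] by simp
  have B0: "B \<ge> 0" using B[of 0 undefined] by linarith
  have diff: "norm (z n ^ n - complex_of_real (w n) ^ n) \<le> B * s n / (6 * sqrt (a n))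
    + (s n)\<^sup>2 / (4 * real n)"
    if n: "n \<ge> 1" and an: "a n > 0" for n
  proof -
    let ?y = "\<lambda>x. (1 / sqrt (a n)) * h n x"
    have y2: "(\<integral>x. (?y x)\<^sup>2 \<partial>D) = s n / n" using n an by (simp add: s_def power_mult_distrib power_divide)
    have s0: "s n \<ge> 0" unfolding s_def using an by simp
    have iy: "integrable D (\<lambda>x. (?y x)\<^sup>2)" "integrable D ?y" "integrable D (\<lambda>x. iexp (?y x))"
    proof -
      have "(h n x)\<^sup>2 \<le> B\<^sup>2" for x using power_mono[OF B[of n x], of 2] by simp
      then have "integrable D (\<lambda>x. (h n x)\<^sup>2)" by (intro D.integrable_const_bound[of _ "B\<^sup>2"]) auto
      then show "integrable D (\<lambda>x. (?y x)\<^sup>2)" by (simp add: power_divide)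
      have "integrable D (h n)" using B by (intro D.integrable_const_bound[of _ B]) auto
      then show "integrable D ?y" by simp
      show "integrable D (\<lambda>x. iexp (?y x))" by (intro D.integrable_const_bound[of _ 1]) auto
    qed
    have zn: "norm (z n) \<le> 1"
    proof -
      have "norm (z n) \<le> (\<integral>x. cmod (iexp (?y x)) \<partial>D)" unfolding z_def by (rule integral_norm_bound)
      then show ?thesis by (simp add: D.prob_space)
    qed
    have "(CLINT x|D. iexp (?y x) - (1 + \<i> * of_real (?y x) - of_real ((?y x)\<^sup>2) / 2)) = z n - (1
      + \<i> * of_real (\<integral>x. ?y x \<partial>D) - of_real (\<integral>x. (?y x)\<^sup>2 \<partial>D) / 2)"
      unfolding z_def using iy by (simp add: D.prob_space del: of_real_mult of_real_power of_real_divide)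
    also have "(\<integral>x. ?y x \<partial>D) = 0" using mean[of n] by simp
    finally have "norm (z n - of_real (1 - s n / (2 * n))) = norm (CLINT x|D. iexp (?y x) - (1
      + \<i> * of_real (?y x) - of_real ((?y x)\<^sup>2) / 2))"
      unfolding y2 by (simp add: mult.commute)
    also have "\<dots> \<le> (\<integral>x. B / (6 * sqrt (a n)) * (?y x)\<^sup>2 \<partial>D)"
    proof (rule order_trans[OF integral_norm_bound integral_mono])
      fix x
      have "norm (iexp (?y x) - (1 + \<i> * of_real (?y x) - of_real ((?y x)\<^sup>2) / 2)) \<le> \<bar>?y x\<bar> ^ 3 / 6"
        by (rule iexp_quadratic_bound)
      also have "\<dots> = \<bar>h n x\<bar> / sqrt (a n) * (?y x)\<^sup>2 / 6" using an
        by (simp add: power3_eq_cube power2_eq_square abs_mult abs_divide mult_ac)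
      also have "\<dots> \<le> B / sqrt (a n) * (?y x)\<^sup>2 / 6" using B[of n x] an
        by (intro divide_right_mono mult_right_mono) auto
      finally show "norm (iexp (?y x) - (1 + \<i> * of_real (?y x) - of_real ((?y x)\<^sup>2) / 2))
        \<le> B / (6 * sqrt (a n)) * (?y x)\<^sup>2" by simp
    qed (use iy in \<open>auto simp del: of_real_mult of_real_power of_real_divide\<close>)
    also have "\<dots> = B / (6 * sqrt (a n)) * (s n / n)" using y2 by simp
    finally have 1: "norm (z n - of_real (1 - s n / (2 * n))) \<le> B / (6 * sqrt (a n)) * (s n / n)" .
    have 2: "norm (of_real (1 - s n / (2 * n)) - complex_of_real (w n)) \<le> (s n / (2 * n))\<^sup>2"
      unfolding w_def using exp_neg_linear_bound[of "s n / (2 * real n)"] s0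
      by (simp only: of_real_diff[symmetric] norm_of_real) simp
    have "norm (z n ^ n - complex_of_real (w n) ^ n) \<le> n * norm (z n - complex_of_real (w n))"
      by (rule norm_power_diff[OF zn]) (use s0 in \<open>simp add: w_def\<close>)
    also have "norm (z n - complex_of_real (w n)) \<le> B / (6 * sqrt (a n)) * (s n / n) + (s n / (2 * n))\<^sup>2"
      using norm_triangle_mono[OF 1 2] by simp
    finally have "norm (z n ^ n - complex_of_real (w n) ^ n) \<le> n * (B / (6 * sqrt (a n)) * (s n / n)
      + (s n / (2 * n))\<^sup>2)"
      by (simp add: mult_left_mono)
    also have "\<dots> = B * s n / (6 * sqrt (a n)) + (s n)\<^sup>2 / (4 * real n)" using n
      by (simp add: field_simps power2_eq_square)
    finally show ?thesis .
  qed
  have s: "s \<longlonglongrightarrow> v" using var by (simp add: s_def[abs_def])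
  have sq: "filterlim (\<lambda>n. 6 * sqrt (a n)) at_top sequentially"
    by (intro filterlim_tendsto_pos_mult_at_top[OF tendsto_const] filterlim_compose[OF sqrt_at_top a]) auto
  have n4: "filterlim (\<lambda>n. 4 * real n) at_top sequentially"
    by (intro filterlim_tendsto_pos_mult_at_top[OF tendsto_const] filterlim_real_sequentially) auto
  have "(\<lambda>n. B * s n / (6 * sqrt (a n)) + (s n)\<^sup>2 / (4 * real n)) \<longlonglongrightarrow> 0 + 0"
    by (intro tendsto_add real_tendsto_divide_at_top[OF tendsto_mult[OF tendsto_const s] sq]
        real_tendsto_divide_at_top[OF tendsto_power[OF s] n4])
  then have lim0: "(\<lambda>n. B * s n / (6 * sqrt (a n)) + (s n)\<^sup>2 / (4 * real n)) \<longlonglongrightarrow> 0" by simp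
  have "\<forall>\<^sub>F n in sequentially. a n > 0" using a by (auto simp: filterlim_at_top_dense)
  then have "\<forall>\<^sub>F n in sequentially. norm (z n ^ n - complex_of_real (w n) ^ n)
    \<le> B * s n / (6 * sqrt (a n)) + (s n)\<^sup>2 / (4 * real n)"
    using eventually_ge_at_top[of 1] by eventually_elim (rule diff)
  from Lim_null_comparison[OF this lim0]
  have "(\<lambda>n. z n ^ n - complex_of_real (w n) ^ n) \<longlonglongrightarrow> 0" .
  moreover have "(\<lambda>n. complex_of_real (w n) ^ n) \<longlonglongrightarrow> complex_of_real (exp (- v / 2))"
  proof (rule Lim_transform_eventually)
    show "(\<lambda>n. complex_of_real (exp (- s n / 2))) \<longlonglongrightarrow> complex_of_real (exp (- v / 2))"
      using s by (intro tendsto_intros) auto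
    show "\<forall>\<^sub>F n in sequentially. complex_of_real (exp (- s n / 2)) = complex_of_real (w n) ^ n"
      using eventually_ge_at_top[of 1]
      by eventually_elim (simp add: w_def exp_of_nat_mult[symmetric] flip: of_real_power)
  qed
  ultimately have "(\<lambda>n. z n ^ n - complex_of_real (w n) ^ n + complex_of_real (w n) ^ n) \<longlonglongrightarrow> 0
    + complex_of_real (exp (- v / 2))"
    by (rule tendsto_add)
  then show ?thesis unfolding eq by simp
qed

section \<open>Laws of exceedances\<close>

context
  fixes nm :: "'a::euclidean_space \<Rightarrow> real"
  assumes nm: "is_norm nm"
begin

lemma is_norm_zero_iff: "nm x = 0 \<longleftrightarrow> x = 0"
  and is_norm_triangle: "nm (x + y) \<le> nm x + nm y"
  and is_norm_scale: "nm (c *\<^sub>R x) = \<bar>c\<bar> * nm x"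
  using nm by (auto simp: is_norm_def)

lemma is_norm_nonneg: "0 \<le> nm x"
  using is_norm_triangle[of x "- x"] is_norm_scale[of "-1" x] is_norm_zero_iff[of 0] by simp

lemma is_norm_le_norm: "nm x \<le> (\<Sum>b\<in>Basis. nm b) * norm x"
proof -
  have "nm (\<Sum>b\<in>B. (x \<bullet> b) *\<^sub>R b) \<le> (\<Sum>b\<in>B. \<bar>x \<bullet> b\<bar> * nm b)" if "finite B" for B
    using that
  proof induction
    case (insert b B)
    then show ?case using is_norm_triangle[of "(x \<bullet> b) *\<^sub>R b" "\<Sum>b\<in>B. (x \<bullet> b) *\<^sub>R b"]
      by (simp add: is_norm_scale)
  qed (use is_norm_zero_iff[of 0] in simp)
  from this[of Basis] have "nm x \<le> (\<Sum>b\<in>Basis. \<bar>x \<bullet> b\<bar> * nm b)" by (simp add: euclidean_representation)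
  also have "\<dots> \<le> (\<Sum>b\<in>Basis. norm x * nm b)"
    by (intro sum_mono mult_right_mono Basis_le_norm is_norm_nonneg)
  finally show ?thesis by (simp add: sum_distrib_left mult.commute)
qed

lemma is_norm_continuous: "continuous_on UNIV nm"
proof -
  let ?K = "\<Sum>b\<in>Basis. nm b"
  have K: "?K \<ge> 0" by (intro sum_nonneg is_norm_nonneg)
  have diff: "\<bar>nm x - nm y\<bar> \<le> ?K * norm (x - y)" for x y
    using is_norm_triangle[of "x - y" y] is_norm_triangle[of "y - x" x] is_norm_le_norm[of "x - y"]
      is_norm_le_norm[of "y - x"] by (simp add: norm_minus_commute abs_le_iff)
  have "isCont nm x" for x
  proof -
    have "((\<lambda>y. ?K * norm (y - x)) \<longlongrightarrow> ?K * norm (x - x)) (at x)" by (intro tendsto_intros)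
    then have lim: "((\<lambda>y. ?K * norm (y - x)) \<longlongrightarrow> 0) (at x)" by simp
    have "((\<lambda>y. nm y - nm x) \<longlongrightarrow> 0) (at x)"
    proof (rule Lim_null_comparison[rotated])
      show "\<forall>\<^sub>F y in at x. norm (nm y - nm x) \<le> ?K * norm (y - x)"
        by (rule always_eventually) (simp add: diff)
    qed (rule lim)
    then show ?thesis by (simp add: isCont_def LIM_zero_iff)
  qed
  then show ?thesis by (simp add: continuous_at_imp_continuous_on)
qed

lemma is_norm_measurable: "nm \<in> borel_measurable borel"
  by (rule borel_measurable_continuous_onI[OF is_norm_continuous])

lemma angle_measurable: "angle nm \<in> borel_measurable borel"
proof -
  note is_norm_measurable [measurable]
  show ?thesis unfolding angle_def[abs_def] by measurable
qed

text \<open>The continuous function \<open>nm\<close> attains a positive minimum on the compact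
  Euclidean sphere, and T is its inverse. It bounds the Euclidean length of the angles.\<close>

lemma norm_le_is_norm: "\<exists>T>0. \<forall>x. norm x \<le> T * nm x"
proof -
  have ne: "sphere (0::'a) 1 \<noteq> {}" by simp
  obtain x0 where x0: "x0 \<in> sphere 0 1" "\<And>x. x \<in> sphere 0 1 \<Longrightarrow> nm x0 \<le> nm x"
    using continuous_attains_inf[OF compact_sphere ne continuous_on_subset[OF is_norm_continuous]] by blast
  have "nm x0 > 0" using x0(1) is_norm_nonneg[of x0] is_norm_zero_iff[of x0] by (auto simp: less_le)
  moreover have "norm x \<le> 1 / nm x0 * nm x" for x
  proof (cases "x = 0")
    case False
    then have "nm x0 \<le> nm ((1 / norm x) *\<^sub>R x)" by (intro x0(2)) simp
    also have "\<dots> = nm x / norm x" by (simp add: is_norm_scale)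
    finally show ?thesis using False \<open>nm x0 > 0\<close> by (simp add: field_simps)
  qed (use is_norm_zero_iff[of 0] in simp)
  ultimately show ?thesis by (intro exI[of _ "1 / nm x0"]) auto
qed

lemma is_norm_angle: "x \<noteq> 0 \<Longrightarrow> nm (angle nm x) = 1"
  using is_norm_zero_iff[of x] is_norm_nonneg[of x] by (simp add: angle_def is_norm_scale)

lemma closed_unit_sphere: "closed (unit_sphere nm)"
proof -
  have "closed (nm -` {1})" by (rule closed_vimage[OF closed_singleton is_norm_continuous])
  then show ?thesis by (simp add: unit_sphere_def vimage_def)
qed

end

lemma fst_borel_measurable [measurable]: "(fst :: 'a::second_countable_topology \<times> 'b::second_countable_topology \<Rightarrow> 'a) \<in> borel_measurable borel"
  and snd_borel_measurable [measurable]: "(snd :: 'a::second_countable_topology \<times> 'b::second_countable_topology \<Rightarrow> 'b) \<in> borel_measurable borel"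
  by (auto intro!: borel_measurable_continuous_onI continuous_intros)

lemma integral_uniform_measure:
  fixes f :: "'a \<Rightarrow> 'b::{banach, second_countable_topology}"
  assumes "prob_space M" and A [measurable]: "A \<in> sets M" and p: "measure M A > 0"
    and [measurable]: "f \<in> borel_measurable M"
  shows "(\<integral>x. f x \<partial>uniform_measure M A) = (1 / measure M A) *\<^sub>R (\<integral>x. indicator A x *\<^sub>R f x \<partial>M)"
proof -
  interpret prob_space M by fact
  have "uniform_measure M A = density M (\<lambda>x. ennreal (indicator A x / measure M A))"
    unfolding uniform_measure_def
  proof (rule density_cong)
    have "1 / ennreal (measure M A) = ennreal (1 / measure M A)"
      using divide_ennreal[of 1 "measure M A"] p by simp
    then show "AE x in M. indicator A x / emeasure M A = ennreal (indicator A x / measure M A)"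
      by (intro AE_I2) (simp add: emeasure_eq_measure split: split_indicator)
  qed measurable
  then have "(\<integral>x. f x \<partial>uniform_measure M A) = (\<integral>x. (indicator A x / measure M A) *\<^sub>R f x \<partial>M)"
    using p by (simp add: integral_density)
  also have "\<dots> = (\<integral>x. (1 / measure M A) *\<^sub>R (indicator A x *\<^sub>R f x) \<partial>M)" by simp
  also have "\<dots> = (1 / measure M A) *\<^sub>R (\<integral>x. indicator A x *\<^sub>R f x \<partial>M)" by (rule integral_scaleR_right)
  finally show ?thesis .
qed

definition exceed_law :: "'w measure \<Rightarrow> ((real^'d) \<Rightarrow> real) \<Rightarrow> ('w \<Rightarrow> real^'d) \<Rightarrow> real \<Rightarrow> (real \<times> (real^'d)) measure" where
  "exceed_law M nm X r = distr (uniform_measure M {\<omega> \<in> space M. nm (X \<omega>) > r}) borel (\<lambda>\<omega>. (nm (X \<omega>) / r, angle nm (X \<omega>)))"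

locale exceedance = prob_space M for M :: "'w measure" +
  fixes nm :: "real^'d \<Rightarrow> real" and X :: "'w \<Rightarrow> real^'d" and r :: real
  assumes nm: "is_norm nm" and X_measurable [measurable]: "X \<in> borel_measurable M"
    and r_pos: "r > 0" and p_pos: "exceed_prob M nm X r > 0"
begin

lemmas nm_measurable [measurable] = is_norm_measurable[OF nm]
lemmas angle_measurable' [measurable] = angle_measurable[OF nm]

abbreviation "p \<equiv> exceed_prob M nm X r"
abbreviation "\<kappa> \<equiv> exceed_law M nm X r"
abbreviation "Exc \<equiv> {\<omega> \<in> space M. nm (X \<omega>) > r}"
abbreviation "U \<equiv> uniform_measure M Exc"

lemma prob_space_U: "prob_space U"
  using p_pos by (intro prob_space_uniform_measure) (auto simp: emeasure_eq_measure exceed_prob_def)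

lemma map_measurable:
  "(\<lambda>\<omega>. (nm (X \<omega>) / r, angle nm (X \<omega>))) \<in> borel_measurable U"
  "(\<lambda>\<omega>. (nm (X \<omega>) / r, angle nm (X \<omega>))) \<in> borel_measurable M"
proof -
  show 1: "(\<lambda>\<omega>. (nm (X \<omega>) / r, angle nm (X \<omega>))) \<in> borel_measurable M"
    by (rule borel_measurable_Pair) measurable
  then show "(\<lambda>\<omega>. (nm (X \<omega>) / r, angle nm (X \<omega>))) \<in> borel_measurable U"
    unfolding measurable_cong_sets[OF sets_uniform_measure refl] .
qed

lemma prob_space_exceed_law: "prob_space \<kappa>"
  unfolding exceed_law_def by (rule prob_space.prob_space_distr[OF prob_space_U map_measurable(1)])

lemma sets_exceed_law [measurable_cong]: "sets \<kappa> = sets borel"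
  by (simp add: exceed_law_def)

lemma integral_exceed_law:
  fixes g :: "real \<times> (real^'d) \<Rightarrow> 'b::{banach, second_countable_topology}"
  assumes [measurable]: "g \<in> borel_measurable borel"
  shows "(\<integral>x. (if nm x > r then g (nm x / r, angle nm x) else 0) \<partial>distr M borel X) = p *\<^sub>R (\<integral>y. g y \<partial>\<kappa>)"
proof -
  have m: "(\<lambda>\<omega>. g (nm (X \<omega>) / r, angle nm (X \<omega>))) \<in> borel_measurable M"
    by (rule measurable_compose[OF map_measurable(2)]) measurable
  have m2: "(\<lambda>x. g (nm x / r, angle nm x)) \<in> borel_measurable borel"
  proof (rule measurable_compose[where N = borel and g = g])
    show "(\<lambda>x. (nm x / r, angle nm x)) \<in> borel_measurable borel" by (rule borel_measurable_Pair) measurable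
  qed measurable
  have "(\<integral>y. g y \<partial>\<kappa>) = (\<integral>\<omega>. g (nm (X \<omega>) / r, angle nm (X \<omega>)) \<partial>U)"
    unfolding exceed_law_def by (rule integral_distr) (auto intro: map_measurable)
  also have "\<dots> = (1 / p) *\<^sub>R (\<integral>\<omega>. indicator Exc \<omega> *\<^sub>R g (nm (X \<omega>) / r, angle nm (X \<omega>)) \<partial>M)"
    unfolding exceed_prob_def
    by (rule integral_uniform_measure[OF prob_space_axioms _ p_pos[unfolded exceed_prob_def] m]) measurable
  also have "(\<integral>\<omega>. indicator Exc \<omega> *\<^sub>R g (nm (X \<omega>) / r, angle nm (X \<omega>)) \<partial>M)
      = (\<integral>\<omega>. (if nm (X \<omega>) > r then g (nm (X \<omega>) / r, angle nm (X \<omega>)) else 0) \<partial>M)"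
    by (rule Bochner_Integration.integral_cong) (auto split: split_indicator)
  also have "\<dots> = (\<integral>x. (if nm x > r then g (nm x / r, angle nm x) else 0) \<partial>distr M borel X)"
    using m2 by (subst integral_distr) auto
  finally show ?thesis using p_pos by simp
qed

lemma AE_exceed_law: "AE y in \<kappa>. fst y > 1 \<and> nm (snd y) = 1"
proof -
  have "AE \<omega> in U. nm (X \<omega>) / r > 1 \<and> nm (angle nm (X \<omega>)) = 1"
  proof (rule AE_uniform_measureI)
    show "AE \<omega> in M. \<omega> \<in> Exc \<longrightarrow> nm (X \<omega>) / r > 1 \<and> nm (angle nm (X \<omega>)) = 1"
    proof (intro AE_I2 impI)
      fix \<omega> assume "\<omega> \<in> Exc"
      then have "nm (X \<omega>) > r" by simp
      then have "X \<omega> \<noteq> 0" using r_pos is_norm_zero_iff[OF nm, of "X \<omega>"] by auto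
      then show "nm (X \<omega>) / r > 1 \<and> nm (angle nm (X \<omega>)) = 1"
        using \<open>nm (X \<omega>) > r\<close> r_pos is_norm_angle[OF nm] by simp
    qed
  qed measurable
  then show ?thesis unfolding exceed_law_def
    by (subst AE_distr_iff[OF map_measurable(1)]) simp_all
qed

lemma cond_cf_exceed_law:
  "cond_cf M nm X r s t = (CLINT y|\<kappa>. iexp (s * fst y + t \<bullet> snd y))"
  unfolding exceed_law_def cond_cf_def
  by (subst integral_distr[OF map_measurable(1)]) simp_all

lemma measure_exceed_law:
  assumes "c \<ge> 1"
  shows "measure \<kappa> {y. fst y > c} = exceed_prob M nm X (c * r) / p"
proof -
  have "measure \<kappa> {y. fst y > c} = measure U {\<omega> \<in> space M. nm (X \<omega>) / r > c}"
    unfolding exceed_law_def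
    by (subst measure_distr[OF map_measurable(1)]) (auto intro!: arg_cong[where f = "measure U"])
  also have "\<dots> = measure M (Exc \<inter> {\<omega> \<in> space M. nm (X \<omega>) / r > c}) / measure M Exc"
    by (rule measure_uniform_measure) (use p_pos in \<open>auto simp: exceed_prob_def emeasure_eq_measure\<close>)
  also have "Exc \<inter> {\<omega> \<in> space M. nm (X \<omega>) / r > c} = {\<omega> \<in> space M. nm (X \<omega>) > c * r}"
  proof -
    have "r \<le> c * r" using assms r_pos by simp
    then have "r < x" if "c * r < x" for x using that by linarith
    then show ?thesis using r_pos by (auto simp: pos_less_divide_eq)
  qed
  finally show ?thesis by (simp add: exceed_prob_def)
qed

text \<open>Doubling makes the tail at 2^k at most 2^(-\<gamma>k), while the integrand is at most
  2^\<beta> 2^(\<beta>k) on the k-th dyadic shell. The series is geometric with ratio q = 2^(\<beta>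
  - \<gamma>) < 1, and its sum does not depend on r.\<close>

lemma exceed_law_moment:
  assumes \<beta>: "0 < \<beta>" "\<beta> < \<gamma>"
    and doubling: "\<And>k. exceed_prob M nm X (2 ^ Suc k * r) \<le> 2 powr (- \<gamma>) * exceed_prob M nm X (2 ^ k * r)"
  shows "(\<integral>\<^sup>+y. ennreal (fst y powr \<beta>) \<partial>\<kappa>) \<le> ennreal (2 powr \<beta> / (1 - 2 powr (\<beta> - \<gamma>)))"
proof -
  have dec: "exceed_prob M nm X (2 ^ k * r) \<le> (2 powr (- \<gamma>)) ^ k * p" for k
  proof (induction k)
    case (Suc k)
    have "exceed_prob M nm X (2 ^ Suc k * r) \<le> 2 powr (- \<gamma>) * exceed_prob M nm X (2 ^ k * r)"
      by (rule doubling)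
    also have "\<dots> \<le> 2 powr (- \<gamma>) * ((2 powr (- \<gamma>)) ^ k * p)" by (intro mult_left_mono Suc) simp
    finally show ?case by (simp add: mult.assoc)
  qed simp
  define q where "q = 2 powr (\<beta> - \<gamma>)"
  have q: "0 < q" "q < 1"
    using powr_less_mono[of "\<beta> - \<gamma>" 0 2] \<beta> by (simp_all add: q_def)
  have pw: "x powr \<beta> \<le> 2 powr \<beta> * (2 powr \<beta>) ^ k" if "x \<le> 2 ^ Suc k" "x > 0" for x :: real and k
  proof -
    have "x powr \<beta> \<le> (2 ^ Suc k) powr \<beta>" using that \<beta> by (intro powr_mono2) auto
    also have "(2 ^ Suc k) powr \<beta> = 2 powr \<beta> * (2 powr \<beta>) ^ k"
    proof -
      have "(2 ^ Suc k) powr \<beta> = (2 powr real (Suc k)) powr \<beta>" by (subst powr_realpow) simp_all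
      also have "\<dots> = (2 powr \<beta>) powr real (Suc k)" by (simp only: powr_powr mult.commute)
      also have "\<dots> = (2 powr \<beta>) ^ Suc k" by (rule powr_realpow) simp
      finally show ?thesis by simp
    qed
    finally show ?thesis .
  qed
  have "(\<integral>\<^sup>+y. ennreal (fst y powr \<beta>) \<partial>\<kappa>)
    \<le> (\<integral>\<^sup>+y. (\<Sum>k. ennreal (2 powr \<beta> * (2 powr \<beta>) ^ k) * indicator {y. fst y > 2 ^ k} y) \<partial>\<kappa>)"
  proof (rule nn_integral_mono_AE)
    show "AE y in \<kappa>. ennreal (fst y powr \<beta>)
      \<le> (\<Sum>k. ennreal (2 powr \<beta> * (2 powr \<beta>) ^ k) * indicator {y. fst y > 2 ^ k} y)"
      using AE_exceed_law
    proof eventually_elim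
      case (elim y)
      \<comment> \<open>The dyadic shell of the radius. Minimality of k gives the strict lower
        bound, except for k = 0, where it is the almost sure inequality
        \<open>fst y > 1\<close>.\<close>
      define k where "k = (LEAST k. fst y \<le> 2 ^ Suc k)"
      obtain k0 where "fst y < 2 ^ k0" using real_arch_pow[of 2 "fst y"] by auto
      then have ex: "fst y \<le> 2 ^ Suc k0" by (simp add: less_imp_le order_trans[of _ "2 ^ k0"])
      have k1: "fst y \<le> 2 ^ Suc k" unfolding k_def
        by (rule LeastI[where P = "\<lambda>k. fst y \<le> 2 ^ Suc k", OF ex])
      have k2: "fst y > 2 ^ k"
      proof (cases k)
        case (Suc j)
        then have "\<not> fst y \<le> 2 ^ Suc j" unfolding k_def by (intro not_less_Least) simp
        then show ?thesis using Suc by simp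
      qed (use elim in simp)
      have "ennreal (fst y powr \<beta>)
        \<le> (\<Sum>k\<in>{k}. ennreal (2 powr \<beta> * (2 powr \<beta>) ^ k) * indicator {y. fst y > 2 ^ k} y)"
        using pw[OF k1] elim k2 by (simp add: ennreal_leI)
      also have "\<dots> \<le> (\<Sum>k. ennreal (2 powr \<beta> * (2 powr \<beta>) ^ k) * indicator {y. fst y > 2 ^ k} y)"
        by (rule sum_le_suminf) auto
      finally show ?case .
    qed
  qed
  also have "\<dots> = (\<Sum>k. ennreal (2 powr \<beta> * (2 powr \<beta>) ^ k) * emeasure \<kappa> {y. fst y > 2 ^ k})"
  proof (subst nn_integral_suminf)
    have [measurable]: "{y :: real \<times> (real^'d). fst y > c} \<in> sets borel" for c by measurable
    show "(\<lambda>y. ennreal (2 powr \<beta> * (2 powr \<beta>) ^ k) * indicator {y. fst y > 2 ^ k} y) \<in> borel_measurable \<kappa>"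
      for k by measurable
    show "(\<Sum>k. \<integral>\<^sup>+y. ennreal (2 powr \<beta> * (2 powr \<beta>) ^ k) * indicator {y. fst y > 2 ^ k} y \<partial>\<kappa>)
      = (\<Sum>k. ennreal (2 powr \<beta> * (2 powr \<beta>) ^ k) * emeasure \<kappa> {y. fst y > 2 ^ k})"
      by (intro suminf_cong nn_integral_cmult_indicator) measurable
  qed
  also have "\<dots> \<le> (\<Sum>k. ennreal (2 powr \<beta> * q ^ k))"
  proof (intro suminf_le summableI)
    fix k
    interpret \<kappa>: prob_space \<kappa> by (rule prob_space_exceed_law)
    have "emeasure \<kappa> {y. fst y > 2 ^ k} = ennreal (exceed_prob M nm X (2 ^ k * r) / p)"
      using measure_exceed_law[of "2 ^ k"] by (simp add: \<kappa>.emeasure_eq_measure)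
    also have "\<dots> \<le> ennreal ((2 powr (- \<gamma>)) ^ k)" using dec[of k] p_pos
      by (intro ennreal_leI) (simp add: pos_divide_le_eq)
    finally have "ennreal (2 powr \<beta> * (2 powr \<beta>) ^ k) * emeasure \<kappa> {y. fst y > 2 ^ k}
      \<le> ennreal (2 powr \<beta> * (2 powr \<beta>) ^ k) * ennreal ((2 powr (- \<gamma>)) ^ k)"
      by (rule mult_left_mono) simp
    also have "\<dots> = ennreal (2 powr \<beta> * q ^ k)"
      by (simp add: q_def ennreal_mult[symmetric] mult.assoc flip: power_mult_distrib powr_add)
    finally show "ennreal (2 powr \<beta> * (2 powr \<beta>) ^ k) * emeasure \<kappa> {y. fst y > 2 ^ k}
      \<le> ennreal (2 powr \<beta> * q ^ k)" .
  qed
  also have "\<dots> = ennreal (2 powr \<beta> * (1 / (1 - q)))"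
  proof (rule suminf_ennreal_eq)
    show "(\<lambda>k. 2 powr \<beta> * q ^ k) sums (2 powr \<beta> * (1 / (1 - q)))"
      using q by (intro sums_mult geometric_sums) auto
  qed (use q in auto)
  finally show ?thesis by (simp add: q_def)
qed

end

section \<open>The kernel of the distance covariance\<close>

definition cf_fst :: "(real \<times> 'v::euclidean_space) measure \<Rightarrow> real \<Rightarrow> complex" where
  "cf_fst \<kappa> s = (CLINT y|\<kappa>. iexp (s * fst y))"

definition cf_snd :: "(real \<times> 'v::euclidean_space) measure \<Rightarrow> 'v \<Rightarrow> complex" where
  "cf_snd \<kappa> t = (CLINT y|\<kappa>. iexp (t \<bullet> snd y))"

definition dcov_fst :: "(real \<times> 'v::euclidean_space) measure \<Rightarrow> real \<Rightarrow> real \<Rightarrow> complex" where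
  "dcov_fst \<kappa> s x = iexp (s * x) - cf_fst \<kappa> s"

definition dcov_snd :: "(real \<times> 'v::euclidean_space) measure \<Rightarrow> 'v \<Rightarrow> 'v \<Rightarrow> complex" where
  "dcov_snd \<kappa> t \<theta> = iexp (t \<bullet> \<theta>) - cf_snd \<kappa> t"

definition dcov_kernel :: "(real \<times> 'v::euclidean_space) measure \<Rightarrow> real \<times> 'v \<Rightarrow> real \<times> 'v \<Rightarrow> complex" where
  "dcov_kernel \<kappa> z y = dcov_fst \<kappa> (fst z) (fst y) * dcov_snd \<kappa> (snd z) (snd y)"

text \<open>Because both factors are centred, this is the joint characteristic function minus the
  product of the marginal ones, that is, the theoretical counterpart of the empirical
  \<open>C\<close>.\<close>

definition dcov_mean :: "(real \<times> 'v::euclidean_space) measure \<Rightarrow> real \<times> 'v \<Rightarrow> complex" where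
  "dcov_mean \<kappa> z = (CLINT y|\<kappa>. dcov_kernel \<kappa> z y)"

definition dcov_weight :: "real \<Rightarrow> real \<times> 'v::euclidean_space \<Rightarrow> real" where
  "dcov_weight \<beta> z = min 1 (\<bar>fst z\<bar> powr \<beta>) * min 1 ((norm (snd z))\<^sup>2)"

lemma norm_iexp_minus_one_le: "cmod (iexp x - 1) \<le> \<bar>x\<bar>"
  using iexp_approx1[of x 0] by simp

lemma cmod_diff_one_le_2: "cmod z \<le> 1 \<Longrightarrow> cmod w \<le> 1 \<Longrightarrow> cmod (z - w) \<le> 2"
  using norm_triangle_ineq4[of z w] by linarith

locale pair_law = prob_space \<kappa> for \<kappa> :: "(real \<times> 'v::euclidean_space) measure" +
  assumes sets_law [measurable_cong]: "sets \<kappa> = sets borel"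
begin

lemma integral_iexp_norm_le: "cmod (CLINT y|\<kappa>. iexp (f y)) \<le> 1"
proof -
  have "cmod (CLINT y|\<kappa>. iexp (f y)) \<le> (\<integral>y. cmod (iexp (f y)) \<partial>\<kappa>)" by (rule integral_norm_bound)
  then show ?thesis by (simp add: prob_space)
qed

lemma cf_norm_le: "cmod (cf_fst \<kappa> s) \<le> 1" "cmod (cf_snd \<kappa> t) \<le> 1"
  unfolding cf_fst_def cf_snd_def by (rule integral_iexp_norm_le)+

lemma dcov_norm_le: "cmod (dcov_fst \<kappa> s x) \<le> 2" "cmod (dcov_snd \<kappa> t \<theta>) \<le> 2"
  unfolding dcov_fst_def dcov_snd_def by (intro cmod_diff_one_le_2 cf_norm_le; simp)+

lemma dcov_kernel_norm_le: "cmod (dcov_kernel \<kappa> z y) \<le> 4"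
  unfolding dcov_kernel_def using norm_mult_le_mult[OF dcov_norm_le] by fastforce

lemma integral_iexp_continuous:
  assumes [measurable]: "\<And>x. f x \<in> borel_measurable borel"
    and f: "\<And>y. continuous_on UNIV (\<lambda>x :: 'x::metric_space. f x y)"
  shows "continuous_on UNIV (\<lambda>x. CLINT y|\<kappa>. iexp (f x y))"
  unfolding continuous_on_sequentially
proof (intro allI ballI impI)
  fix x and a :: 'x assume *: "(\<forall>n. x n \<in> UNIV) \<and> x \<longlonglongrightarrow> a"
  have "(\<lambda>n. f (x n) y) \<longlonglongrightarrow> f a y" for y
    using f[of y] * by (auto simp: continuous_on_eq_continuous_at intro: isCont_tendsto_compose)
  then show "((\<lambda>x. CLINT y|\<kappa>. iexp (f x y)) \<circ> x) \<longlonglongrightarrow> (CLINT y|\<kappa>. iexp (f a y))"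
    unfolding comp_def
    by (intro integral_dominated_convergence[where w = "\<lambda>_. 1"]) (auto intro!: AE_I2 tendsto_intros)
qed

lemma cf_continuous: "continuous_on UNIV (cf_fst \<kappa>)" "continuous_on UNIV (cf_snd \<kappa>)"
proof -
  have "continuous_on UNIV (\<lambda>s. cf_fst \<kappa> s)" unfolding cf_fst_def
    by (rule integral_iexp_continuous) (measurable, intro continuous_intros)
  moreover have "continuous_on UNIV (\<lambda>t. cf_snd \<kappa> t)" unfolding cf_snd_def
    by (rule integral_iexp_continuous) (measurable, intro continuous_intros)
  ultimately show "continuous_on UNIV (cf_fst \<kappa>)" "continuous_on UNIV (cf_snd \<kappa>)" by simp_all
qed

lemma dcov_fst_continuous: "continuous_on UNIV (\<lambda>p. dcov_fst \<kappa> (fst p) (snd p))"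
  unfolding dcov_fst_def
  by (intro continuous_intros continuous_on_compose2[OF cf_continuous(1)]) auto

lemma dcov_snd_continuous: "continuous_on UNIV (\<lambda>p. dcov_snd \<kappa> (fst p) (snd p))"
  unfolding dcov_snd_def
  by (intro continuous_intros continuous_on_compose2[OF cf_continuous(2)]) auto

text \<open>Joint continuity in (z, y) is the source of the joint measurability of
  \<open>G n\<close> in the index and the sample point.\<close>

lemma dcov_kernel_continuous: "continuous_on UNIV (\<lambda>p. dcov_kernel \<kappa> (fst p) (snd p))"
  unfolding dcov_kernel_def
  by (intro continuous_on_mult
        continuous_on_compose2[OF dcov_fst_continuous,
          where f = "\<lambda>p. (fst (fst p), fst (snd p))", simplified]
        continuous_on_compose2[OF dcov_snd_continuous,
          where f = "\<lambda>p. (snd (fst p), snd (snd p))", simplified])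
     (auto intro!: continuous_intros)

lemma dcov_kernel_continuous1: "continuous_on UNIV (\<lambda>y. dcov_kernel \<kappa> z y)"
  "continuous_on UNIV (\<lambda>z. dcov_kernel \<kappa> z y)"
proof -
  have "continuous_on UNIV (\<lambda>y. (z, y))" "continuous_on UNIV (\<lambda>z. (z, y))" by (intro continuous_intros)+
  from continuous_on_compose2[OF dcov_kernel_continuous this(1)] continuous_on_compose2[OF dcov_kernel_continuous this(2)]
  show "continuous_on UNIV (\<lambda>y. dcov_kernel \<kappa> z y)" "continuous_on UNIV (\<lambda>z. dcov_kernel \<kappa> z y)" by simp_all
qed

lemma dcov_measurable [measurable]:
  "dcov_fst \<kappa> s \<in> borel_measurable borel" "dcov_snd \<kappa> t \<in> borel_measurable borel"
    "dcov_kernel \<kappa> z \<in> borel_measurable borel"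
  unfolding dcov_kernel_def[abs_def] dcov_fst_def[abs_def] dcov_snd_def[abs_def] by measurable

lemma dcov_integrable: "integrable \<kappa> (\<lambda>y. dcov_fst \<kappa> s (fst y))"
  "integrable \<kappa> (\<lambda>y. dcov_snd \<kappa> t (snd y))" "integrable \<kappa> (dcov_kernel \<kappa> z)"
    "integrable \<kappa> (\<lambda>y. (cmod (dcov_fst \<kappa> s (fst y)))\<^sup>2)"
      "integrable \<kappa> (\<lambda>y. (cmod (dcov_snd \<kappa> t (snd y)))\<^sup>2)" "integrable \<kappa> (\<lambda>y. (cmod (dcov_kernel \<kappa> z y))\<^sup>2)"
proof -
  have sq: "x\<^sup>2 \<le> b\<^sup>2" if "x \<le> b" "0 \<le> x" for x b :: real using that by (rule power_mono)
  show "integrable \<kappa> (\<lambda>y. dcov_fst \<kappa> s (fst y))"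
    by (rule integrable_const_bound[of _ 2]) (auto simp: dcov_norm_le)
  show "integrable \<kappa> (\<lambda>y. dcov_snd \<kappa> t (snd y))"
    by (rule integrable_const_bound[of _ 2]) (auto simp: dcov_norm_le)
  show "integrable \<kappa> (dcov_kernel \<kappa> z)"
    by (rule integrable_const_bound[of _ 4]) (auto simp: dcov_kernel_norm_le)
  show "integrable \<kappa> (\<lambda>y. (cmod (dcov_fst \<kappa> s (fst y)))\<^sup>2)"
    using sq[OF dcov_norm_le(1)] by (intro integrable_const_bound[of _ "2\<^sup>2"]) auto
  show "integrable \<kappa> (\<lambda>y. (cmod (dcov_snd \<kappa> t (snd y)))\<^sup>2)"
    using sq[OF dcov_norm_le(2)] by (intro integrable_const_bound[of _ "2\<^sup>2"]) auto
  show "integrable \<kappa> (\<lambda>y. (cmod (dcov_kernel \<kappa> z y))\<^sup>2)"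
    using sq[OF dcov_kernel_norm_le] by (intro integrable_const_bound[of _ "4\<^sup>2"]) auto
qed

lemma iexp_integrable: "f \<in> borel_measurable borel \<Longrightarrow> integrable \<kappa> (\<lambda>y. iexp (f y))"
  by (rule integrable_const_bound[of _ 1]) auto

lemma integral_iexp_minus_const:
  "f \<in> borel_measurable borel \<Longrightarrow> (CLINT y|\<kappa>. iexp (f y) - c) = (CLINT y|\<kappa>. iexp (f y)) - c"
  using iexp_integrable by (simp add: prob_space)

lemma integral_dcov_eq_0: "(CLINT y|\<kappa>. dcov_fst \<kappa> s (fst y)) = 0" "(CLINT y|\<kappa>. dcov_snd \<kappa> t (snd y)) = 0"
  unfolding dcov_fst_def dcov_snd_def
  by (subst integral_iexp_minus_const; simp add: cf_fst_def cf_snd_def)+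

lemma dcov_mean_eq:
  "dcov_mean \<kappa> (s, t) = (CLINT y|\<kappa>. iexp (s * fst y + t \<bullet> snd y)) - cf_fst \<kappa> s * cf_snd \<kappa> t"
proof -
  have i: "integrable \<kappa> (\<lambda>y. iexp (s * fst y + t \<bullet> snd y))" "integrable \<kappa> (\<lambda>y. iexp (s * fst y))"
    "integrable \<kappa> (\<lambda>y. iexp (t \<bullet> snd y))"
    by (intro iexp_integrable; measurable)+
  have "dcov_kernel \<kappa> (s, t) y = iexp (s * fst y + t \<bullet> snd y) - iexp (s * fst y) * cf_snd \<kappa> t
    - cf_fst \<kappa> s * iexp (t \<bullet> snd y) + cf_fst \<kappa> s * cf_snd \<kappa> t" for y
    by (simp add: dcov_kernel_def dcov_fst_def dcov_snd_def exp_add algebra_simps)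
  then have "dcov_mean \<kappa> (s, t) = (CLINT y|\<kappa>. iexp (s * fst y + t \<bullet> snd y)
    - iexp (s * fst y) * cf_snd \<kappa> t - cf_fst \<kappa> s * iexp (t \<bullet> snd y) + cf_fst \<kappa> s * cf_snd \<kappa> t)"
    unfolding dcov_mean_def by (intro Bochner_Integration.integral_cong refl)
  also have "\<dots> = (CLINT y|\<kappa>. iexp (s * fst y + t \<bullet> snd y)) - (CLINT y|\<kappa>. iexp (s * fst y)) * cf_snd \<kappa> t
      - cf_fst \<kappa> s * (CLINT y|\<kappa>. iexp (t \<bullet> snd y)) + cf_fst \<kappa> s * cf_snd \<kappa> t"
    using i by (simp add: prob_space del: of_real_add of_real_mult)
  finally show ?thesis by (simp add: cf_fst_def cf_snd_def)
qed

lemma dcov_mean_sq_le: "(cmod (dcov_mean \<kappa> z))\<^sup>2 \<le> (\<integral>y. (cmod (dcov_kernel \<kappa> z y))\<^sup>2 \<partial>\<kappa>)"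
  using norm_integral_mult_sq_le[of "dcov_kernel \<kappa> z" \<kappa> "\<lambda>_. 1"] dcov_integrable(6)[of z]
  by (simp add: dcov_mean_def prob_space)

text \<open>Both centred characters vanish at frequency 0. The kernel is therefore 0 wherever the
  weight is 0, and division by the root of the weight loses no mass.\<close>

lemma dcov_zero: "fst z = 0 \<or> snd z = 0 \<Longrightarrow> dcov_kernel \<kappa> z y = 0"
  by (auto simp: dcov_kernel_def dcov_fst_def dcov_snd_def cf_fst_def cf_snd_def prob_space)

lemma dcov_uminus: "dcov_kernel \<kappa> (- z) y = cnj (dcov_kernel \<kappa> z y)"
proof -
  have "cf_fst \<kappa> (- s) = cnj (cf_fst \<kappa> s)" "cf_snd \<kappa> (- t) = cnj (cf_snd \<kappa> t)" for s t
    unfolding cf_fst_def cf_snd_def by (simp_all add: exp_cnj flip: Bochner_Integration.integral_cnj)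
  then show ?thesis by (simp add: dcov_kernel_def dcov_fst_def dcov_snd_def exp_cnj)
qed

context
  fixes \<beta> C T :: real
  assumes \<beta>: "0 < \<beta>" "\<beta> \<le> 2" and T: "T > 0"
    and AE_law: "AE y in \<kappa>. fst y \<ge> 1 \<and> norm (snd y) \<le> T"
    and moment: "(\<integral>\<^sup>+y. ennreal (fst y powr \<beta>) \<partial>\<kappa>) \<le> ennreal C"
begin

lemma moment_integrable: "integrable \<kappa> (\<lambda>y. fst y powr \<beta>)"
  using moment by (intro integrableI_nonneg) (auto intro: le_less_trans)

lemma moment_le: "(\<integral>y. fst y powr \<beta> \<partial>\<kappa>) \<le> C" "C \<ge> 1"
proof -
  have 1: "1 \<le> (\<integral>y. fst y powr \<beta> \<partial>\<kappa>)"
  proof -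
    have "(\<integral>y. 1 \<partial>\<kappa>) \<le> (\<integral>y. fst y powr \<beta> \<partial>\<kappa>)"
      using AE_law \<beta> by (intro integral_mono_AE moment_integrable)
        (auto elim!: eventually_mono intro!: ge_one_powr_ge_zero)
    then show ?thesis by (simp add: prob_space)
  qed
  have "ennreal (\<integral>y. fst y powr \<beta> \<partial>\<kappa>) = (\<integral>\<^sup>+y. ennreal (fst y powr \<beta>) \<partial>\<kappa>)"
    by (rule nn_integral_eq_integral[symmetric, OF moment_integrable]) simp
  with moment have "ennreal (\<integral>y. fst y powr \<beta> \<partial>\<kappa>) \<le> ennreal C" by simp
  then show "(\<integral>y. fst y powr \<beta> \<partial>\<kappa>) \<le> C" using 1 by (subst (asm) ennreal_le_iff2) auto
  with 1 show "C \<ge> 1" by simp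
qed

text \<open>Centring costs a factor 4, as |A - a|^2 is at most 2|A - 1|^2 + 2 (E|A - 1|)^2 and the
  second term is bounded by Jensen. Uncentred, |exp(isx) - 1|^2 is at most 4 min(1, |s|^\<beta>)
  x^\<beta> for x at least 1, whence 16 C.\<close>

lemma dcov_fst_sq_le: "(\<integral>y. (cmod (dcov_fst \<kappa> s (fst y)))\<^sup>2 \<partial>\<kappa>) \<le> 16 * C * min 1 (\<bar>s\<bar> powr \<beta>)"
proof -
  define g where "g y = cmod (iexp (s * fst y) - 1)" for y :: "real \<times> 'v"
  have [measurable]: "g \<in> borel_measurable borel" unfolding g_def[abs_def] by measurable
  have g2: "g y \<le> 2" "0 \<le> g y" for y unfolding g_def by (auto intro!: cmod_diff_one_le_2)
  have gi: "integrable \<kappa> g" by (rule integrable_const_bound[of _ 2]) (auto simp: g2)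
  have gi2: "integrable \<kappa> (\<lambda>y. (g y)\<^sup>2)"
  proof (rule integrable_const_bound[of _ 4])
    show "AE y in \<kappa>. norm ((g y)\<^sup>2) \<le> 4"
      using power_mono[OF g2(1) g2(2), of _ 2] by simp
  qed simp
  have "(\<integral>y. g y \<partial>\<kappa>)\<^sup>2 \<le> (\<integral>y. (g y)\<^sup>2 \<partial>\<kappa>)"
    using norm_integral_mult_sq_le[of "\<lambda>y. complex_of_real (g y)" \<kappa> "\<lambda>_. 1"] gi2 g2
    by (simp add: prob_space)
  moreover have "cf_fst \<kappa> s - 1 = (CLINT y|\<kappa>. iexp (s * fst y) - 1)"
    by (subst integral_iexp_minus_const; simp add: cf_fst_def)
  then have "cmod (cf_fst \<kappa> s - 1) \<le> (\<integral>y. g y \<partial>\<kappa>)"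
    using integral_norm_bound[of \<kappa> "\<lambda>y. iexp (s * fst y) - 1"] by (simp add: g_def)
  then have "(cmod (dcov_fst \<kappa> s (fst y)))\<^sup>2 \<le> 2 * (g y)\<^sup>2 + 2 * (\<integral>y. g y \<partial>\<kappa>)\<^sup>2" for y
  proof -
    have "cmod (dcov_fst \<kappa> s (fst y)) = cmod ((iexp (s * fst y) - 1) - (cf_fst \<kappa> s - 1))"
      by (simp add: dcov_fst_def)
    also have "\<dots> \<le> g y + (\<integral>y. g y \<partial>\<kappa>)"
      using norm_triangle_ineq4[of "iexp (s * fst y) - 1"
        "cf_fst \<kappa> s - 1"] \<open>cmod (cf_fst \<kappa> s - 1) \<le> _\<close> unfolding g_def by linarith
    finally have "(cmod (dcov_fst \<kappa> s (fst y)))\<^sup>2 \<le> (g y + (\<integral>y. g y \<partial>\<kappa>))\<^sup>2" by (rule power_mono) simp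
    also have "\<dots> \<le> 2 * (g y)\<^sup>2 + 2 * (\<integral>y. g y \<partial>\<kappa>)\<^sup>2"
      using sum_squares_bound[of "g y" "\<integral>y. g y \<partial>\<kappa>"] by (simp add: power2_sum)
    finally show ?thesis .
  qed
  then have "(\<integral>y. (cmod (dcov_fst \<kappa> s (fst y)))\<^sup>2 \<partial>\<kappa>) \<le> (\<integral>y. 2 * (g y)\<^sup>2 + 2 * (\<integral>y. g y \<partial>\<kappa>)\<^sup>2 \<partial>\<kappa>)"
    using gi2 by (intro integral_mono dcov_integrable) auto
  ultimately have 1: "(\<integral>y. (cmod (dcov_fst \<kappa> s (fst y)))\<^sup>2 \<partial>\<kappa>) \<le> 4 * (\<integral>y. (g y)\<^sup>2 \<partial>\<kappa>)"
    using gi2 by (simp add: prob_space)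
  have "(\<integral>y. (g y)\<^sup>2 \<partial>\<kappa>) \<le> (\<integral>y. 4 * min 1 (\<bar>s\<bar> powr \<beta>) * fst y powr \<beta> \<partial>\<kappa>)"
  proof (rule integral_mono_AE[OF gi2])
    show "AE y in \<kappa>. (g y)\<^sup>2 \<le> 4 * min 1 (\<bar>s\<bar> powr \<beta>) * fst y powr \<beta>"
      using AE_law
    proof eventually_elim
      case (elim y)
      have x: "1 \<le> fst y powr \<beta>" using elim \<beta> by (intro ge_one_powr_ge_zero) auto
      have "(g y)\<^sup>2 \<le> 2\<^sup>2" using g2[of y] by (intro power_mono) auto
      then have a: "(g y)\<^sup>2 \<le> 4 * fst y powr \<beta>" using x by simp
      \<comment> \<open>If |s| x is at most 1, its square is at most its \<beta>-th power because
        \<beta> is at most 2; otherwise that power is at least 1 and the bound 4 suffices.\<close>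
      have b: "(g y)\<^sup>2 \<le> 4 * (\<bar>s\<bar> powr \<beta> * fst y powr \<beta>)"
      proof (cases "\<bar>s\<bar> * fst y \<le> 1")
        case True
        have "g y \<le> \<bar>s\<bar> * fst y" using norm_iexp_minus_one_le[of "s * fst y"] elim
          by (simp add: g_def abs_mult)
        then have "(g y)\<^sup>2 \<le> (\<bar>s\<bar> * fst y)\<^sup>2" using g2[of y] by (intro power_mono) auto
        also have "(\<bar>s\<bar> * fst y)\<^sup>2 \<le> (\<bar>s\<bar> * fst y) powr \<beta>"
        proof (cases "s = 0")
          case False
          then have pos: "\<bar>s\<bar> * fst y > 0" using elim by simp
          then have "(\<bar>s\<bar> * fst y)\<^sup>2 = (\<bar>s\<bar> * fst y) powr 2" by simp
          also have "\<dots> \<le> (\<bar>s\<bar> * fst y) powr \<beta>" using True pos \<beta> by (intro powr_mono') auto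
          finally show ?thesis .
        qed simp
        also have "\<dots> = \<bar>s\<bar> powr \<beta> * fst y powr \<beta>" by (rule powr_mult)
        also have "\<dots> \<le> 4 * (\<bar>s\<bar> powr \<beta> * fst y powr \<beta>)" by simp
        finally show ?thesis .
      next
        case False
        then have "1 \<le> (\<bar>s\<bar> * fst y) powr \<beta>" using \<beta> by (intro ge_one_powr_ge_zero) auto
        also have "\<dots> = \<bar>s\<bar> powr \<beta> * fst y powr \<beta>" by (rule powr_mult)
        finally show ?thesis using \<open>(g y)\<^sup>2 \<le> 2\<^sup>2\<close> by simp
      qed
      show ?case using a b by (auto simp: min_def mult.assoc)
    qed
  qed (use moment_integrable in auto)
  also have "\<dots> \<le> 4 * min 1 (\<bar>s\<bar> powr \<beta>) * C"
    using moment_le(1) by (simp add: mult_left_mono)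
  finally show ?thesis using 1 by (simp add: mult_ac)
qed

text \<open>The estimate is almost sure rather than integrated: angle and radius are dependent under
  \<kappa>, so the angular factor has to leave the integral as a constant. Bounded angles give
  |exp(it.\<theta>) - 1| \<le> min(2, T|t|), and centring doubles this.\<close>

lemma AE_dcov_snd_sq_le: "AE y in \<kappa>. (cmod (dcov_snd \<kappa> t (snd y)))\<^sup>2 \<le> 4 * (2 + T)\<^sup>2 * min 1 ((norm t)\<^sup>2)"
proof -
  define m where "m = (2 + T) * min 1 (norm t)"
  have le: "AE y in \<kappa>. cmod (iexp (t \<bullet> snd y) - 1) \<le> m"
    using AE_law
  proof eventually_elim
    case (elim y)
    have 2: "cmod (iexp (t \<bullet> snd y) - 1) \<le> 2" by (rule cmod_diff_one_le_2) auto
    have "cmod (iexp (t \<bullet> snd y) - 1) \<le> \<bar>t \<bullet> snd y\<bar>" by (rule norm_iexp_minus_one_le)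
    also have "\<dots> \<le> norm t * norm (snd y)" by (rule Cauchy_Schwarz_ineq2)
    also have "\<dots> \<le> norm t * T" using elim by (intro mult_left_mono) auto
    finally have "cmod (iexp (t \<bullet> snd y) - 1) \<le> norm t * T" .
    also have "\<dots> \<le> (2 + T) * norm t" by (simp add: algebra_simps)
    finally show ?case using 2 T by (auto simp: m_def min_def)
  qed
  have "cf_snd \<kappa> t - 1 = (CLINT y|\<kappa>. iexp (t \<bullet> snd y) - 1)"
    by (subst integral_iexp_minus_const; simp add: cf_snd_def)
  then have "cmod (cf_snd \<kappa> t - 1) \<le> (\<integral>y. cmod (iexp (t \<bullet> snd y) - 1) \<partial>\<kappa>)"
    using integral_norm_bound[of \<kappa> "\<lambda>y. iexp (t \<bullet> snd y) - 1"] by simp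
  also have "\<dots> \<le> (\<integral>y. m \<partial>\<kappa>)"
    using le by (intro integral_mono_AE)
      (auto intro!: integrable_norm Bochner_Integration.integrable_diff iexp_integrable)
  finally have m: "cmod (cf_snd \<kappa> t - 1) \<le> m" by (simp add: prob_space)
  have m0: "m \<ge> 0" using T by (simp add: m_def)
  have m2: "4 * m\<^sup>2 = 4 * (2 + T)\<^sup>2 * min 1 ((norm t)\<^sup>2)"
  proof -
    have "(min 1 (norm t))\<^sup>2 = min 1 ((norm t)\<^sup>2)"
    proof (cases "norm t \<le> 1")
      case True
      then have "(norm t)\<^sup>2 \<le> 1" by (intro power_le_one) auto
      with True show ?thesis by (simp add: min_absorb2)
    next
      case False
      then have "1 \<le> (norm t)\<^sup>2" by (intro one_le_power) auto
      with False show ?thesis by (simp add: min_absorb1)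
    qed
    then show ?thesis by (simp add: m_def power_mult_distrib)
  qed
  from le show ?thesis
  proof eventually_elim
    case (elim y)
    have "cmod (dcov_snd \<kappa> t (snd y)) = cmod ((iexp (t \<bullet> snd y) - 1) - (cf_snd \<kappa> t - 1))"
      by (simp add: dcov_snd_def)
    also have "\<dots> \<le> 2 * m" using norm_triangle_ineq4[of "iexp (t \<bullet> snd y) - 1"
      "cf_snd \<kappa> t - 1"] elim m by linarith
    finally have "(cmod (dcov_snd \<kappa> t (snd y)))\<^sup>2 \<le> (2 * m)\<^sup>2" by (rule power_mono) simp
    then show ?case using m2 by (simp add: power_mult_distrib)
  qed
qed

lemma dcov_snd_sq_le: "(\<integral>y. (cmod (dcov_snd \<kappa> t (snd y)))\<^sup>2 \<partial>\<kappa>) \<le> 4 * (2 + T)\<^sup>2 * min 1 ((norm t)\<^sup>2)"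
proof -
  have "(\<integral>y. (cmod (dcov_snd \<kappa> t (snd y)))\<^sup>2 \<partial>\<kappa>) \<le> (\<integral>y. 4 * (2 + T)\<^sup>2 * min 1 ((norm t)\<^sup>2) \<partial>\<kappa>)"
    by (intro integral_mono_AE dcov_integrable AE_dcov_snd_sq_le) auto
  then show ?thesis by (simp add: prob_space)
qed

text \<open>The angular factor is replaced by its almost sure bound, and the radial one is
  integrated; 64 is 16 times 4.\<close>

lemma dcov_kernel_sq_le: "(\<integral>y. (cmod (dcov_kernel \<kappa> z y))\<^sup>2 \<partial>\<kappa>) \<le> 64 * (2 + T)\<^sup>2 * C * dcov_weight \<beta> z"
proof -
  have "(\<integral>y. (cmod (dcov_kernel \<kappa> z y))\<^sup>2 \<partial>\<kappa>) \<le> (\<integral>y. (cmod (dcov_fst \<kappa> (fst z) (fst y)))\<^sup>2 * (4 * (2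
    + T)\<^sup>2 * min 1 ((norm (snd z))\<^sup>2)) \<partial>\<kappa>)"
  proof (rule integral_mono_AE[OF dcov_integrable(6)])
    show "AE y in \<kappa>. (cmod (dcov_kernel \<kappa> z y))\<^sup>2 \<le> (cmod (dcov_fst \<kappa> (fst z) (fst y)))\<^sup>2 * (4 * (2
      + T)\<^sup>2 * min 1 ((norm (snd z))\<^sup>2))"
      using AE_dcov_snd_sq_le[of "snd z"]
      by eventually_elim (simp add: dcov_kernel_def norm_mult power_mult_distrib mult_left_mono)
  qed (intro integrable_mult_left dcov_integrable)
  also have "\<dots> = (\<integral>y. (cmod (dcov_fst \<kappa> (fst z) (fst y)))\<^sup>2 \<partial>\<kappa>) * (4 * (2
    + T)\<^sup>2 * min 1 ((norm (snd z))\<^sup>2))" by simp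
  also have "\<dots> \<le> (16 * C * min 1 (\<bar>fst z\<bar> powr \<beta>)) * (4 * (2 + T)\<^sup>2 * min 1 ((norm (snd z))\<^sup>2))"
    by (intro mult_right_mono dcov_fst_sq_le) auto
  finally show ?thesis by (simp add: dcov_weight_def mult_ac)
qed

end

end

section \<open>Kernel moments along weakly convergent laws\<close>

locale weakly_convergent_laws =
  m: pair_law m for m :: "(real \<times> 'v::euclidean_space) measure" +
  fixes \<kappa> :: "nat \<Rightarrow> (real \<times> 'v) measure"
  assumes laws: "\<And>n. pair_law (\<kappa> n)"
    and weak: "\<And>F :: real \<times> 'v \<Rightarrow> real. continuous_on UNIV F \<Longrightarrow> bounded (range F) \<Longrightarrow> (\<lambda>n. \<integral>y. F y \<partial>\<kappa> n)
      \<longlonglongrightarrow> (\<integral>y. F y \<partial>m)"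
begin

text \<open>The kernel is centred by \<open>\<kappa> n\<close> itself, so the integrand moves
  together with the law. Only the centring constants depend on n, hence the convergence is uniform
  in y and adds an error of at most \<open>e n\<close>.\<close>

lemma weak_uniform:
  assumes F: "continuous_on UNIV F" "\<And>y. \<bar>F y\<bar> \<le> B"
    and [measurable]: "\<And>n. Fn n \<in> borel_measurable borel"
    and e: "\<And>n y. \<bar>Fn n y - F y\<bar> \<le> e n" "e \<longlonglongrightarrow> 0"
  shows "(\<lambda>n. \<integral>y. Fn n y \<partial>\<kappa> n) \<longlonglongrightarrow> (\<integral>y. F y \<partial>m :: real)"
proof -
  have [measurable]: "F \<in> borel_measurable borel" by (rule borel_measurable_continuous_onI[OF F(1)])
  have "(\<lambda>n. (\<integral>y. Fn n y \<partial>\<kappa> n) - (\<integral>y. F y \<partial>\<kappa> n)) \<longlonglongrightarrow> 0"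
  proof (rule Lim_null_comparison[OF _ e(2)], rule always_eventually, rule allI)
    fix n
    interpret pair_law "\<kappa> n" by (rule laws)
    have iF: "integrable (\<kappa> n) F" by (rule integrable_const_bound[of _ B]) (auto simp: F(2))
    have iFn: "integrable (\<kappa> n) (Fn n)"
    proof (rule integrable_const_bound[of _ "B + e n"])
      have "norm (Fn n y) \<le> B + e n" for y using F(2)[of y] e(1)[of n y] by (simp add: abs_le_iff)
      then show "AE y in \<kappa> n. norm (Fn n y) \<le> B + e n" by simp
    qed simp
    have "norm ((\<integral>y. Fn n y \<partial>\<kappa> n) - (\<integral>y. F y \<partial>\<kappa> n)) = norm (\<integral>y. Fn n y - F y \<partial>\<kappa> n)" using iF iFn by simp
    also have "\<dots> \<le> (\<integral>y. \<bar>Fn n y - F y\<bar> \<partial>\<kappa> n)" using integral_abs_bound by simp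
    also have "\<dots> \<le> (\<integral>y. e n \<partial>\<kappa> n)" using iF iFn e(1) by (intro integral_mono) auto
    finally show "norm ((\<integral>y. Fn n y \<partial>\<kappa> n) - (\<integral>y. F y \<partial>\<kappa> n)) \<le> e n" by (simp add: prob_space)
  qed
  moreover have "(\<lambda>n. \<integral>y. F y \<partial>\<kappa> n) \<longlonglongrightarrow> (\<integral>y. F y \<partial>m)"
    using F by (intro weak) (auto simp: bounded_iff)
  ultimately show ?thesis using tendsto_add by fastforce
qed

lemma weak_uniform_complex:
  fixes F :: "real \<times> 'v \<Rightarrow> complex"
  assumes F: "continuous_on UNIV F" "\<And>y. cmod (F y) \<le> B"
    and [measurable]: "\<And>n. Fn n \<in> borel_measurable borel"
    and e: "\<And>n y. cmod (Fn n y - F y) \<le> e n" "e \<longlonglongrightarrow> 0"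
  shows "(\<lambda>n. \<integral>y. Fn n y \<partial>\<kappa> n) \<longlonglongrightarrow> (\<integral>y. F y \<partial>m)"
proof -
  have [measurable]: "F \<in> borel_measurable borel" by (rule borel_measurable_continuous_onI[OF F(1)])
  have iF: "integrable m F" by (rule m.integrable_const_bound[of _ B]) (auto simp: F(2))
  have iFn: "integrable (\<kappa> n) (Fn n)" for n
  proof -
    interpret pair_law "\<kappa> n" by (rule laws)
    have "cmod (Fn n y) \<le> B + e n" for y using F(2)[of y] e(1)[of n y] norm_triangle_sub[of "Fn n y"
      "F y"] by linarith
    then show ?thesis by (intro integrable_const_bound[of _ "B + e n"]) auto
  qed
  have d: "\<bar>Re (Fn n y) - Re (F y)\<bar> \<le> e n" "\<bar>Im (Fn n y) - Im (F y)\<bar> \<le> e n" for n y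
    using e(1)[of n y] abs_Re_le_cmod[of "Fn n y - F y"] abs_Im_le_cmod[of "Fn n y - F y"] by auto
  have b: "\<bar>Re (F y)\<bar> \<le> B" "\<bar>Im (F y)\<bar> \<le> B" for y
    using F(2)[of y] abs_Re_le_cmod[of "F y"] abs_Im_le_cmod[of "F y"] by auto
  have "(\<lambda>n. \<integral>y. Re (Fn n y) \<partial>\<kappa> n) \<longlonglongrightarrow> (\<integral>y. Re (F y) \<partial>m)"
    by (rule weak_uniform[OF _ b(1) _ d(1) e(2)]) (auto intro!: continuous_intros F)
  moreover have "(\<lambda>n. \<integral>y. Im (Fn n y) \<partial>\<kappa> n) \<longlonglongrightarrow> (\<integral>y. Im (F y) \<partial>m)"
    by (rule weak_uniform[OF _ b(2) _ d(2) e(2)]) (auto intro!: continuous_intros F)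
  ultimately show ?thesis
    unfolding tendsto_complex_iff
    by (simp add: integral_Re[OF iF] integral_Im[OF iF] integral_Re[OF iFn] integral_Im[OF iFn])
qed

lemma cf_tendsto: "(\<lambda>n. cf_fst (\<kappa> n) s) \<longlonglongrightarrow> cf_fst m s" "(\<lambda>n. cf_snd (\<kappa> n) t) \<longlonglongrightarrow> cf_snd m t"
proof -
  have *: "(\<lambda>n. CLINT y|\<kappa> n. iexp (f y)) \<longlonglongrightarrow> (CLINT y|m. iexp (f y))" if f: "continuous_on UNIV f" for f
  proof (rule weak_uniform_complex[where B = 1 and e = "\<lambda>_. 0"])
    show c: "continuous_on UNIV (\<lambda>y. iexp (f y))" by (intro continuous_intros f)
    then show "(\<lambda>y. iexp (f y)) \<in> borel_measurable borel" by (rule borel_measurable_continuous_onI)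
  qed simp_all
  show "(\<lambda>n. cf_fst (\<kappa> n) s) \<longlonglongrightarrow> cf_fst m s" "(\<lambda>n. cf_snd (\<kappa> n) t) \<longlonglongrightarrow> cf_snd m t"
    unfolding cf_fst_def cf_snd_def by (intro * continuous_intros)+
qed

definition kernel_error :: "real \<times> 'v \<Rightarrow> nat \<Rightarrow> real" where
  "kernel_error z n = 2 * cmod (cf_fst (\<kappa> n) (fst z) - cf_fst m (fst z))
    + 2 * cmod (cf_snd (\<kappa> n) (snd z) - cf_snd m (snd z))"

lemma kernel_error_tendsto: "kernel_error z \<longlonglongrightarrow> 0"
proof -
  have "(\<lambda>n. kernel_error z n) \<longlonglongrightarrow> 2 * cmod (cf_fst m (fst z) - cf_fst m (fst z))
    + 2 * cmod (cf_snd m (snd z) - cf_snd m (snd z))"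
    unfolding kernel_error_def by (intro tendsto_intros cf_tendsto)
  then show ?thesis by simp
qed

lemma kernel_diff_le: "cmod (dcov_kernel (\<kappa> n) z y - dcov_kernel m z y) \<le> kernel_error z n"
proof -
  interpret n: pair_law "\<kappa> n" by (rule laws)
  let ?a = "dcov_fst (\<kappa> n) (fst z) (fst y)" and ?a' = "dcov_fst m (fst z) (fst y)"
  let ?b = "dcov_snd (\<kappa> n) (snd z) (snd y)" and ?b' = "dcov_snd m (snd z) (snd y)"
  have "?a * ?b - ?a' * ?b' = (?a - ?a') * ?b + ?a' * (?b - ?b')" by (simp add: algebra_simps)
  then have "cmod (?a * ?b - ?a' * ?b') \<le> cmod (?a - ?a') * cmod ?b + cmod ?a' * cmod (?b - ?b')"
    using norm_triangle_ineq[of "(?a - ?a') * ?b" "?a' * (?b - ?b')"] by (simp add: norm_mult)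
  also have "\<dots> \<le> cmod (?a - ?a') * 2 + 2 * cmod (?b - ?b')"
    by (intro add_mono mult_left_mono mult_right_mono n.dcov_norm_le m.dcov_norm_le) auto
  also have "cmod (?a - ?a') = cmod (cf_fst (\<kappa> n) (fst z) - cf_fst m (fst z))"
    by (simp add: dcov_fst_def norm_minus_commute)
  also have "cmod (?b - ?b') = cmod (cf_snd (\<kappa> n) (snd z) - cf_snd m (snd z))"
    by (simp add: dcov_snd_def norm_minus_commute)
  finally show ?thesis by (simp add: dcov_kernel_def kernel_error_def)
qed

lemma dcov_mean_tendsto: "(\<lambda>n. dcov_mean (\<kappa> n) z) \<longlonglongrightarrow> dcov_mean m z"
  unfolding dcov_mean_def
proof (rule weak_uniform_complex[where B = 4, OF _ _ _ kernel_diff_le kernel_error_tendsto])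
  show "dcov_kernel (\<kappa> n) z \<in> borel_measurable borel" for n
    using pair_law.dcov_measurable(3)[OF laws] .
qed (use m.dcov_kernel_continuous1 m.dcov_kernel_norm_le in auto)

text \<open>The real linear combinations of the Cramer-Wold device; complex coefficients reach real
  and imaginary parts at once.\<close>

definition kernel_comb :: "nat \<Rightarrow> (nat \<Rightarrow> complex) \<Rightarrow> (nat \<Rightarrow> real \<times> 'v) \<Rightarrow> (real \<times> 'v) measure \<Rightarrow> real \<times> 'v \<Rightarrow> real" where
  "kernel_comb k u z K y = (\<Sum>i<k. Re (u i * dcov_kernel K (z i) y))"

lemma kernel_comb_bound:
  assumes "pair_law K"
  shows "\<bar>kernel_comb k u z K y\<bar> \<le> (\<Sum>i<k. cmod (u i) * 4)"
proof -
  interpret pair_law K by fact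
  have "\<bar>kernel_comb k u z K y\<bar> \<le> (\<Sum>i<k. \<bar>Re (u i * dcov_kernel K (z i) y)\<bar>)"
    unfolding kernel_comb_def by (rule sum_abs)
  also have "\<dots> \<le> (\<Sum>i<k. cmod (u i) * 4)"
  proof (rule sum_mono)
    fix i
    have "\<bar>Re (u i * dcov_kernel K (z i) y)\<bar> \<le> cmod (u i * dcov_kernel K (z i) y)" by (rule abs_Re_le_cmod)
    also have "\<dots> \<le> cmod (u i) * 4" unfolding norm_mult by (intro mult_left_mono dcov_kernel_norm_le) simp
    finally show "\<bar>Re (u i * dcov_kernel K (z i) y)\<bar> \<le> cmod (u i) * 4" .
  qed
  finally show ?thesis .
qed

lemma kernel_comb_measurable: "pair_law K \<Longrightarrow> kernel_comb k u z K \<in> borel_measurable borel"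
proof -
  assume "pair_law K"
  then have [measurable]: "dcov_kernel K z \<in> borel_measurable borel" for z
    by (rule pair_law.dcov_measurable(3))
  show ?thesis unfolding kernel_comb_def[abs_def] by measurable
qed

lemma kernel_comb_sq_tendsto: "(\<lambda>n. \<integral>y. (kernel_comb k u z (\<kappa> n) y)\<^sup>2 \<partial>\<kappa> n)
  \<longlonglongrightarrow> (\<integral>y. (kernel_comb k u z m y)\<^sup>2 \<partial>m)"
proof -
  define B where "B = (\<Sum>i<k. cmod (u i) * 4)"
  define D where "D n = (\<Sum>i<k. cmod (u i) * kernel_error (z i) n)" for n
  have bd: "\<bar>kernel_comb k u z K y\<bar> \<le> B" if "pair_law K" for K y
    unfolding B_def by (rule kernel_comb_bound[OF that])
  have D: "\<bar>kernel_comb k u z (\<kappa> n) y - kernel_comb k u z m y\<bar> \<le> D n" for n y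
  proof -
    have "kernel_comb k u z (\<kappa> n) y - kernel_comb k u z m y
      = (\<Sum>i<k. Re (u i * (dcov_kernel (\<kappa> n) (z i) y - dcov_kernel m (z i) y)))"
      by (simp add: kernel_comb_def sum_subtractf[symmetric] right_diff_distrib del: times_complex.sel)
    also have "\<bar>\<dots>\<bar> \<le> (\<Sum>i<k. \<bar>Re (u i * (dcov_kernel (\<kappa> n) (z i) y - dcov_kernel m (z i) y))\<bar>)"
      by (rule sum_abs)
    also have "\<dots> \<le> D n" unfolding D_def
    proof (rule sum_mono)
      fix i
      have "\<bar>Re (u i * (dcov_kernel (\<kappa> n) (z i) y - dcov_kernel m (z i) y))\<bar>
        \<le> cmod (u i * (dcov_kernel (\<kappa> n) (z i) y - dcov_kernel m (z i) y))" by (rule abs_Re_le_cmod)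
      also have "\<dots> \<le> cmod (u i) * kernel_error (z i) n" unfolding norm_mult
        by (intro mult_left_mono kernel_diff_le) simp
      finally show "\<bar>Re (u i * (dcov_kernel (\<kappa> n) (z i) y - dcov_kernel m (z i) y))\<bar>
        \<le> cmod (u i) * kernel_error (z i) n" .
    qed
    finally show ?thesis .
  qed
  have B0: "0 \<le> B" unfolding B_def by (intro sum_nonneg) simp
  show ?thesis
  proof (rule weak_uniform)
    show "continuous_on UNIV (\<lambda>y. (kernel_comb k u z m y)\<^sup>2)"
      unfolding kernel_comb_def by (intro continuous_intros m.dcov_kernel_continuous1)
    show "\<bar>(kernel_comb k u z m y)\<^sup>2\<bar> \<le> B\<^sup>2" for y
      using power_mono[OF bd[OF m.pair_law_axioms, of y], of 2] by simp
    show "(\<lambda>y. (kernel_comb k u z (\<kappa> n) y)\<^sup>2) \<in> borel_measurable borel" for n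
      using kernel_comb_measurable[OF laws] by measurable
    show "\<bar>(kernel_comb k u z (\<kappa> n) y)\<^sup>2 - (kernel_comb k u z m y)\<^sup>2\<bar> \<le> D n * (B + B)" for n y
    proof -
      have "\<bar>(kernel_comb k u z (\<kappa> n) y)\<^sup>2 - (kernel_comb k u z m y)\<^sup>2\<bar> = \<bar>kernel_comb k u z (\<kappa> n) y
        - kernel_comb k u z m y\<bar> * \<bar>kernel_comb k u z (\<kappa> n) y + kernel_comb k u z m y\<bar>"
        unfolding abs_mult[symmetric] by (simp add: power2_eq_square algebra_simps)
      also have "\<dots> \<le> D n * (B + B)"
        using bd[OF laws, of n y] bd[OF m.pair_law_axioms, of y] D[of n y] by (intro mult_mono) linarith+
      finally show ?thesis .
    qed
    have "(\<lambda>n. D n * (B + B)) \<longlonglongrightarrow> (\<Sum>i<k. cmod (u i) * 0) * (B + B)"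
      unfolding D_def by (intro tendsto_intros kernel_error_tendsto)
    then show "(\<lambda>n. D n * (B + B)) \<longlonglongrightarrow> 0" by simp
  qed
qed

lemma kernel_comb_mean:
  "(\<integral>y. kernel_comb k u z (\<kappa> n) y \<partial>\<kappa> n) = (\<Sum>i<k. Re (u i * dcov_mean (\<kappa> n) (z i)))"
proof -
    interpret n: pair_law "\<kappa> n" by (rule laws)
    have i: "integrable (\<kappa> n) (\<lambda>y. u i * dcov_kernel (\<kappa> n) (z i) y)" for i
      by (intro integrable_mult_right n.dcov_integrable)
    have "(\<integral>y. kernel_comb k u z (\<kappa> n) y \<partial>\<kappa> n) = (\<Sum>i<k. \<integral>y. Re (u i * dcov_kernel (\<kappa> n) (z i) y) \<partial>\<kappa> n)"
      unfolding kernel_comb_def using i by (intro Bochner_Integration.integral_sum integrable_Re)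
    also have "\<dots> = (\<Sum>i<k. Re (u i * dcov_mean (\<kappa> n) (z i)))"
      using n.dcov_integrable(3) unfolding integral_Re[OF i] dcov_mean_def
      by (intro sum.cong refl arg_cong[where f = Re]) simp
    finally show ?thesis .
qed

text \<open>The coefficients 1 and -i extract the real and the imaginary part, so the squared
  modulus is a sum of two squared real combinations.\<close>

lemma dcov_kernel_sq_tendsto:
  "(\<lambda>n. \<integral>y. (cmod (dcov_kernel (\<kappa> n) z y))\<^sup>2 \<partial>\<kappa> n) \<longlonglongrightarrow> (\<integral>y. (cmod (dcov_kernel m z y))\<^sup>2 \<partial>m)"
proof -
  have eq: "(\<integral>y. (cmod (dcov_kernel K z y))\<^sup>2 \<partial>K) = (\<integral>y. (kernel_comb 1 (\<lambda>_. 1) (\<lambda>_. z) K y)\<^sup>2 \<partial>K)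
    + (\<integral>y. (kernel_comb 1 (\<lambda>_. - \<i>) (\<lambda>_. z) K y)\<^sup>2 \<partial>K)"
    if "pair_law K" for K
  proof -
    interpret pair_law K by fact
    have "integrable K (\<lambda>y. (Re (dcov_kernel K z y))\<^sup>2)" "integrable K (\<lambda>y. (Im (dcov_kernel K z y))\<^sup>2)"
      by (rule Bochner_Integration.integrable_bound[OF dcov_integrable(6)[of z]], measurable, simp add: cmod_power2)+
    then show ?thesis by (simp add: kernel_comb_def cmod_power2)
  qed
  show ?thesis unfolding eq[OF laws] eq[OF m.pair_law_axioms]
    by (intro tendsto_add kernel_comb_sq_tendsto)
qed

end

section \<open>The limit process\<close>

definition dense_seq :: "nat \<Rightarrow> 'a::second_countable_topology" where
  "dense_seq = from_nat_into (SOME D. countable D \<and> (\<forall>X. open X \<longrightarrow> X \<noteq> {} \<longrightarrow> (\<exists>d\<in>D. d \<in> X)))"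

lemma dense_seq:
  assumes "open X" "X \<noteq> {}"
  shows "\<exists>j. (dense_seq j :: 'a::second_countable_topology) \<in> X"
proof -
  define D where "D = (SOME D :: 'a set. countable D \<and> (\<forall>X. open X \<longrightarrow> X \<noteq> {} \<longrightarrow> (\<exists>d\<in>D. d \<in> X)))"
  have D: "countable D" "\<And>X. open X \<Longrightarrow> X \<noteq> {} \<Longrightarrow> \<exists>d\<in>D. d \<in> X"
    using someI_ex[OF countable_dense_exists[where 'a = 'a]] unfolding D_def by blast+
  from D(2)[OF assms] obtain d where d: "d \<in> D" "d \<in> X" by blast
  then have "D \<noteq> {}" by auto
  with D(1) have "range (from_nat_into D) = D" by (intro range_from_nat_into)
  with d obtain j where "from_nat_into D j = d" by (metis imageE)
  with d(2) show ?thesis unfolding dense_seq_def D_def by auto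
qed

lemma gaussian_variable_from_char:
  assumes P: "prob_space P" and [measurable]: "Y \<in> borel_measurable P" and v: "v \<ge> 0"
    and char: "\<And>t. (CLINT \<omega>|P. iexp (t * Y \<omega>)) = exp (- (v * t\<^sup>2) / 2)"
  shows "gaussian_variable P Y"
proof -
  interpret P: prob_space P by fact
  note eq = gaussian_measure_from_char(1)[OF P _ v char]
  show ?thesis
  proof (cases "v = 0")
    case True
    interpret N: prob_space "std_normal_distribution" by (rule prob_space_normal_density) simp
    have "AE y in distr std_normal_distribution borel (\<lambda>x. sqrt v * x). y = 0"
      using True by (subst AE_distr_iff) auto
    then have "AE y in distr P borel Y. y = 0" by (simp only: eq[OF assms(2)])
    then have "AE \<omega> in P. Y \<omega> = 0" by (subst (asm) AE_distr_iff) auto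
    then show ?thesis unfolding gaussian_variable_def by auto
  next
    case False
    with v have "v > 0" by simp
    have std: "distributed std_normal_distribution lborel (\<lambda>x. x) std_normal_density"
      by (auto simp: distributed_def distr_id2)
    interpret N: prob_space "std_normal_distribution" by (rule prob_space_normal_density) simp
    have "distributed std_normal_distribution lborel (\<lambda>x. 0 + sqrt v * x) (normal_density (0
      + sqrt v * 0) (\<bar>sqrt v\<bar> * 1))"
      using \<open>v > 0\<close> by (intro N.normal_density_affine std) auto
    then have "distr std_normal_distribution lborel (\<lambda>x. sqrt v * x)
      = density lborel (normal_density 0 (sqrt v))"
      using v by (simp add: distributed_def)
    moreover have "distr std_normal_distribution lborel (\<lambda>x. sqrt v * x)
      = distr std_normal_distribution borel (\<lambda>x. sqrt v * x)"
      "distr P lborel Y = distr P borel Y" by (auto intro!: distr_cong)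
    ultimately have "distr P lborel Y = density lborel (normal_density 0 (sqrt v))"
      using eq[OF assms(2)] by simp
    then have "distributed P lborel Y (\<lambda>y. ennreal (normal_density 0 (sqrt v) y))"
      by (simp add: distributed_def)
    then show ?thesis unfolding gaussian_variable_def using \<open>v > 0\<close>
      by (intro conjI disjI2 exI[of _ 0] exI[of _ "sqrt v"]) auto
  qed
qed

text \<open>The complex process is encoded as one real field indexed by pairs (u, z), where u = 1
  gives the real and u = -i the imaginary part. With u ranging over all of \<complex> the index type
  is second countable and the covariance is continuous on it.\<close>

definition dcov_part :: "(real \<times> 'v::euclidean_space) measure \<Rightarrow> complex \<times> (real \<times> 'v) \<Rightarrow> real \<times> 'v \<Rightarrow> real" where
  "dcov_part \<kappa> x y = Re (fst x * dcov_kernel \<kappa> (snd x) y)"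

definition dcov_cov :: "(real \<times> 'v::euclidean_space) measure \<Rightarrow> complex \<times> (real \<times> 'v) \<Rightarrow> complex \<times> (real \<times> 'v) \<Rightarrow> real" where
  "dcov_cov \<kappa> x x' = (\<integral>y. dcov_part \<kappa> x y * dcov_part \<kappa> x' y \<partial>\<kappa>)"

definition dcov_field :: "(real \<times> 'v::euclidean_space) measure \<Rightarrow> real \<times> 'v \<Rightarrow> (nat \<Rightarrow> real) \<Rightarrow> complex" where
  "dcov_field \<kappa> z g
    = Complex (gaussian_field (dcov_cov \<kappa>) dense_seq (1, z) g) (gaussian_field (dcov_cov \<kappa>) dense_seq (- \<i>, z) g)"

context pair_law
begin

lemma dcov_part_le: "\<bar>dcov_part \<kappa> x y\<bar> \<le> cmod (fst x) * 4"
  unfolding dcov_part_def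
  by (rule order_trans[OF abs_Re_le_cmod]) (simp add: norm_mult dcov_kernel_norm_le mult_left_mono)

lemma dcov_part_measurable [measurable]: "dcov_part \<kappa> x \<in> borel_measurable borel"
  unfolding dcov_part_def[abs_def] by measurable

lemma dcov_part_integrable: "integrable \<kappa> (\<lambda>y. dcov_part \<kappa> x y * dcov_part \<kappa> x' y)"
proof (rule integrable_const_bound)
  show "AE y in \<kappa>. norm (dcov_part \<kappa> x y * dcov_part \<kappa> x' y) \<le> (cmod (fst x) * 4) * (cmod (fst x') * 4)"
    by (intro AE_I2 norm_mult_le_mult) (simp_all add: dcov_part_le)
qed measurable

lemma dcov_cov_tendsto:
  assumes "x \<longlonglongrightarrow> a" "x' \<longlonglongrightarrow> a'"
  shows "(\<lambda>n. dcov_cov \<kappa> (x n) (x' n)) \<longlonglongrightarrow> dcov_cov \<kappa> a a'"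
proof -
  have part: "(\<lambda>n. dcov_part \<kappa> (x n) y) \<longlonglongrightarrow> dcov_part \<kappa> a y" if "x \<longlonglongrightarrow> a" for x a y
  proof -
    have "(\<lambda>n. dcov_kernel \<kappa> (snd (x n)) y) \<longlonglongrightarrow> dcov_kernel \<kappa> (snd a) y"
      by (rule continuous_on_tendsto_compose[OF dcov_kernel_continuous1(2) tendsto_snd[OF that]]) auto
    then show ?thesis unfolding dcov_part_def by (intro tendsto_intros that)
  qed
  have bdd: "\<exists>B. \<forall>n. cmod (fst (x n)) * 4 \<le> B" if "x \<longlonglongrightarrow> a" for x and a :: "complex \<times> (real \<times> 'v)"
  proof -
    have "Bseq (\<lambda>n. fst (x n))"
      by (rule convergent_imp_Bseq) (use tendsto_fst[OF that] in \<open>auto simp: convergent_def\<close>)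
    then obtain K where "\<And>n. cmod (fst (x n)) \<le> K" by (auto simp: Bseq_def)
    then show ?thesis by (intro exI[of _ "K * 4"]) auto
  qed
  from bdd[OF assms(1)] bdd[OF assms(2)] obtain B B' where
    B: "\<And>n. cmod (fst (x n)) * 4 \<le> B" "\<And>n. cmod (fst (x' n)) * 4 \<le> B'" by blast
  show ?thesis unfolding dcov_cov_def
  proof (rule integral_dominated_convergence[where w = "\<lambda>_. B * B'"])
    show "AE y in \<kappa>. (\<lambda>n. dcov_part \<kappa> (x n) y * dcov_part \<kappa> (x' n) y) \<longlonglongrightarrow> dcov_part \<kappa> a y * dcov_part \<kappa> a' y"
      by (intro AE_I2 tendsto_mult part assms)
    show "AE y in \<kappa>. norm (dcov_part \<kappa> (x n) y * dcov_part \<kappa> (x' n) y) \<le> B * B'" for n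
      by (intro AE_I2 norm_mult_le_mult) (auto intro: order_trans[OF dcov_part_le] B)
  qed auto
qed

lemma dcov_cov_continuous:
  "continuous_on UNIV (\<lambda>x. dcov_cov \<kappa> x x')" "continuous_on UNIV (\<lambda>x. dcov_cov \<kappa> x' x)"
    "continuous_on UNIV (\<lambda>x. dcov_cov \<kappa> x x)"
  unfolding continuous_on_sequentially comp_def
  by (auto intro!: dcov_cov_tendsto)

text \<open>The canonical distance to x is continuous and is 0 at x itself, so each of its balls is
  open and nonempty and contains a member of the dense sequence.\<close>

sublocale field: separable_psd_kernel "dcov_cov \<kappa>" dense_seq
proof
  show "psd_kernel (dcov_cov \<kappa>)"
    unfolding dcov_cov_def[abs_def] by (rule psd_kernel_integral[OF dcov_part_integrable])
  show "(\<lambda>x. dcov_cov \<kappa> x y) \<in> borel_measurable borel" "(\<lambda>x. dcov_cov \<kappa> x x) \<in> borel_measurable borel" for y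
    by (intro borel_measurable_continuous_onI dcov_cov_continuous)+
  show "\<exists>j. dcov_cov \<kappa> x x - 2 * dcov_cov \<kappa> x (dense_seq j)
    + dcov_cov \<kappa> (dense_seq j) (dense_seq j) < e" if "e > 0" for x e
  proof -
    let ?X = "{y. dcov_cov \<kappa> x x - 2 * dcov_cov \<kappa> x y + dcov_cov \<kappa> y y < e}"
    have "open ?X" by (intro open_Collect_less continuous_intros dcov_cov_continuous)
    moreover have "x \<in> ?X" using that by simp
    ultimately show ?thesis using dense_seq[of ?X] by blast
  qed
qed

lemma dcov_field_measurable: "(\<lambda>(z, g). dcov_field \<kappa> z g) \<in> borel_measurable (borel \<Otimes>\<^sub>M std_gaussian_seq)"
proof -
  have *: "(\<lambda>p. gaussian_field (dcov_cov \<kappa>) dense_seq (u, fst p) (snd p)) \<in> borel_measurable (borel \<Otimes>\<^sub>M std_gaussian_seq)"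
    for u
  proof -
    have "(\<lambda>z. (u, z)) \<in> borel_measurable (borel :: (real \<times> 'v) measure)"
      by (intro borel_measurable_Pair) auto
    then have "(\<lambda>p. ((u, fst p), snd p)) \<in> measurable ((borel :: (real \<times> 'v) measure) \<Otimes>\<^sub>M std_gaussian_seq) (borel \<Otimes>\<^sub>M std_gaussian_seq)"
      by measurable
    from measurable_compose[OF this field.W_measurable] show ?thesis by simp
  qed
  have "(\<lambda>p. of_real (gaussian_field (dcov_cov \<kappa>) dense_seq (1, fst p) (snd p))
    + \<i> * of_real (gaussian_field (dcov_cov \<kappa>) dense_seq (- \<i>, fst p) (snd p)))
      \<in> borel_measurable (borel \<Otimes>\<^sub>M std_gaussian_seq)"
    using *[of 1] *[of "- \<i>"] by measurable
  then show ?thesis by (simp add: dcov_field_def Complex_eq case_prod_unfold)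
qed

lemma dcov_field_measurable' [measurable]: "dcov_field \<kappa> z \<in> borel_measurable std_gaussian_seq"
  using measurable_compose[OF measurable_Pair1'[of z borel std_gaussian_seq] dcov_field_measurable] by simp

lemma dcov_field_uminus: "dcov_field \<kappa> (- z) g = cnj (dcov_field \<kappa> z g)"
proof -
  have "gaussian_field (dcov_cov \<kappa>) dense_seq (1, - z) g
    = 1 * gaussian_field (dcov_cov \<kappa>) dense_seq (1, z) g"
    by (rule field.gaussian_field_sign) (simp_all add: dcov_cov_def dcov_part_def dcov_uminus)
  moreover have "gaussian_field (dcov_cov \<kappa>) dense_seq (- \<i>, - z) g =
    - 1 * gaussian_field (dcov_cov \<kappa>) dense_seq (- \<i>, z) g"
    by (rule field.gaussian_field_sign) (simp_all add: dcov_cov_def dcov_part_def dcov_uminus)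
  ultimately show ?thesis by (simp add: dcov_field_def complex_eq_iff)
qed

lemma dcov_field_zero: "fst z = 0 \<or> snd z = 0 \<Longrightarrow> dcov_field \<kappa> z g = 0"
  using gaussian_field_zero[of "dcov_cov \<kappa>" "(_, z)"]
  by (simp add: dcov_field_def dcov_cov_def dcov_part_def dcov_zero complex_eq_iff)

text \<open>Splitting each Re(u Q) into real and imaginary parts doubles the index set to J times
  \<open>bool\<close>. The quadratic form of the Gram kernel then collapses to the integral of a
  square.\<close>

lemma dcov_field_char:
  assumes J: "finite J"
  shows "(CLINT g|std_gaussian_seq. iexp (\<Sum>i\<in>J. Re (u i * dcov_field \<kappa> (z i) g)))
    = exp (- (\<integral>y. (\<Sum>i\<in>J. Re (u i * dcov_kernel \<kappa> (z i) y))\<^sup>2 \<partial>\<kappa>) / 2)"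
proof -
  let ?A = "J \<times> (UNIV :: bool set)"
  define a where "a = (\<lambda>(i, b). if b then Re (u i) else - Im (u i))"
  define x where "x = (\<lambda>(i, b). (if b then 1 else - \<i> :: complex, z i))"
  have 1: "(\<Sum>i\<in>J. Re (u i * dcov_field \<kappa> (z i) g))
    = (\<Sum>i\<in>?A. a i * gaussian_field (dcov_cov \<kappa>) dense_seq (x i) g)" for g
    unfolding sum.cartesian_product[symmetric, of "\<lambda>i b. a (i, b) * gaussian_field (dcov_cov \<kappa>) dense_seq (x (i, b)) g", simplified]
    by (simp add: a_def x_def UNIV_bool dcov_field_def)
  have 2: "(\<Sum>i\<in>J. Re (u i * dcov_kernel \<kappa> (z i) y)) = (\<Sum>i\<in>?A. a i * dcov_part \<kappa> (x i) y)" for y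
    unfolding sum.cartesian_product[symmetric, of "\<lambda>i b. a (i, b) * dcov_part \<kappa> (x (i, b)) y", simplified]
    by (simp add: a_def x_def UNIV_bool dcov_part_def)
  have "(\<Sum>i\<in>?A. \<Sum>i'\<in>?A. a i * a i' * dcov_cov \<kappa> (x i) (x i'))
    = (\<integral>y. (\<Sum>i\<in>?A. \<Sum>i'\<in>?A. a i * a i' * (dcov_part \<kappa> (x i) y * dcov_part \<kappa> (x i') y)) \<partial>\<kappa>)"
    unfolding dcov_cov_def using dcov_part_integrable by simp
  also have "\<dots> = (\<integral>y. (\<Sum>i\<in>?A. a i * dcov_part \<kappa> (x i) y)\<^sup>2 \<partial>\<kappa>)"
    unfolding power2_eq_square sum_product
    by (intro Bochner_Integration.integral_cong sum.cong refl) (simp add: mult_ac)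
  finally show ?thesis
    unfolding 1 2 using field.gaussian_field_char[of ?A a x] J by simp
qed

lemma dcov_field_gaussian:
  fixes u :: "'i \<Rightarrow> complex" and z :: "'i \<Rightarrow> real \<times> 'v"
  assumes J: "finite J"
  defines "v \<equiv> \<integral>y. (\<Sum>i\<in>J. Re (u i * dcov_kernel \<kappa> (z i) y))\<^sup>2 \<partial>\<kappa>"
    and "Y \<equiv> \<lambda>g. \<Sum>i\<in>J. Re (u i * dcov_field \<kappa> (z i) g)"
  shows "gaussian_variable std_gaussian_seq Y"
    and "integrable std_gaussian_seq (\<lambda>g. (Y g)\<^sup>2)" "(\<integral>g. (Y g)\<^sup>2 \<partial>std_gaussian_seq) = v"
    and "integrable std_gaussian_seq Y" "(\<integral>g. Y g \<partial>std_gaussian_seq) = 0"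
proof -
  have char: "(CLINT g|std_gaussian_seq. iexp (t * Y g)) = exp (- (v * t\<^sup>2) / 2)" for t
  proof -
    have "t * Y g = (\<Sum>i\<in>J. Re ((of_real t * u i) * dcov_field \<kappa> (z i) g))" for g
      unfolding Y_def sum_distrib_left by (intro sum.cong refl) (simp add: algebra_simps)
    moreover have "(\<Sum>i\<in>J. Re ((of_real t * u i) * dcov_kernel \<kappa> (z i) y))
      = t * (\<Sum>i\<in>J. Re (u i * dcov_kernel \<kappa> (z i) y))" for y
      unfolding sum_distrib_left by (intro sum.cong refl) (simp add: algebra_simps)
    ultimately show ?thesis
      using dcov_field_char[OF J, of "\<lambda>i. of_real t * u i" z]
      by (simp only: v_def power_mult_distrib integral_mult_right_zero mult.commute)
  qed
  have v: "v \<ge> 0" unfolding v_def by simp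
  have Y: "Y \<in> borel_measurable std_gaussian_seq" unfolding Y_def by measurable
  show "gaussian_variable std_gaussian_seq Y"
    by (rule gaussian_variable_from_char[OF prob_space_std_gaussian_seq Y v char])
  show "integrable std_gaussian_seq (\<lambda>g. (Y g)\<^sup>2)" "(\<integral>g. (Y g)\<^sup>2 \<partial>std_gaussian_seq) = v"
    "integrable std_gaussian_seq Y" "(\<integral>g. Y g \<partial>std_gaussian_seq) = 0"
    by (rule gaussian_measure_from_char[OF prob_space_std_gaussian_seq Y v char])+
qed

text \<open>Polarisation: the product is half the difference between the square of the sum and the
  two squares, and the second moments of all three combinations are known from their characteristic
  functions.\<close>

lemma dcov_field_part_product:
  "integrable std_gaussian_seq (\<lambda>g. Re (u * dcov_field \<kappa> z g) * Re (u' * dcov_field \<kappa> z' g))" (is ?I)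
  "(\<integral>g. Re (u * dcov_field \<kappa> z g) * Re (u' * dcov_field \<kappa> z' g) \<partial>std_gaussian_seq)
    = (\<integral>y. Re (u * dcov_kernel \<kappa> z y) * Re (u' * dcov_kernel \<kappa> z' y) \<partial>\<kappa>)" (is ?E)
proof -
  define X where "X = (\<lambda>g. Re (u * dcov_field \<kappa> z g))"
  define Y where "Y = (\<lambda>g. Re (u' * dcov_field \<kappa> z' g))"
  define F where "F = (\<lambda>y. Re (u * dcov_kernel \<kappa> z y))"
  define G where "G = (\<lambda>y. Re (u' * dcov_kernel \<kappa> z' y))"
  have X: "integrable std_gaussian_seq (\<lambda>g. (X g)\<^sup>2)" "(\<integral>g. (X g)\<^sup>2 \<partial>std_gaussian_seq) = (\<integral>y. (F y)\<^sup>2 \<partial>\<kappa>)"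
    using dcov_field_gaussian(2,3)[of "{()}" "\<lambda>_. u" "\<lambda>_. z"] by (simp_all add: X_def F_def)
  have Y: "integrable std_gaussian_seq (\<lambda>g. (Y g)\<^sup>2)" "(\<integral>g. (Y g)\<^sup>2 \<partial>std_gaussian_seq) = (\<integral>y. (G y)\<^sup>2 \<partial>\<kappa>)"
    using dcov_field_gaussian(2,3)[of "{()}" "\<lambda>_. u'" "\<lambda>_. z'"] by (simp_all add: Y_def G_def)
  have S: "integrable std_gaussian_seq (\<lambda>g. (X g + Y g)\<^sup>2)"
    "(\<integral>g. (X g + Y g)\<^sup>2 \<partial>std_gaussian_seq) = (\<integral>y. (F y + G y)\<^sup>2 \<partial>\<kappa>)"
    using dcov_field_gaussian(2,3)[of "UNIV :: bool set" "\<lambda>b. if b then u' else u"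
      "\<lambda>b. if b then z' else z"]
    by (simp_all add: X_def Y_def F_def G_def UNIV_bool)
  have XY: "X g * Y g = ((X g + Y g)\<^sup>2 - (X g)\<^sup>2 - (Y g)\<^sup>2) / 2" for g
    by (simp add: power2_eq_square algebra_simps)
  have FG: "F g * G g = ((F g + G g)\<^sup>2 - (F g)\<^sup>2 - (G g)\<^sup>2) / 2" for g
    by (simp add: power2_eq_square algebra_simps)
  have iF: "integrable \<kappa> (\<lambda>y. (F y)\<^sup>2)" "integrable \<kappa> (\<lambda>y. (G y)\<^sup>2)" "integrable \<kappa> (\<lambda>y. F y * G y)"
    using dcov_part_integrable[of "(u, z)" "(u, z)"] dcov_part_integrable[of "(u', z')"
      "(u', z')"] dcov_part_integrable[of "(u, z)" "(u', z')"]
    by (simp_all add: F_def G_def dcov_part_def power2_eq_square)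
  then have iS: "integrable \<kappa> (\<lambda>y. (F y + G y)\<^sup>2)" by (simp add: power2_sum mult.assoc)
  have "integrable std_gaussian_seq (\<lambda>g. X g * Y g)" unfolding XY
    by (intro integrable_divide Bochner_Integration.integrable_diff X Y S)
  then show ?I by (simp add: X_def Y_def)
  have "(\<integral>g. X g * Y g \<partial>std_gaussian_seq) = (\<integral>y. F y * G y \<partial>\<kappa>)"
    unfolding XY FG using X Y S iF iS by (simp del: power2_sum)
  then show ?E by (simp add: X_def Y_def F_def G_def)
qed

lemma dcov_field_expectation: "(CLINT g|std_gaussian_seq. dcov_field \<kappa> z g) = 0"
proof -
  have i: "integrable std_gaussian_seq (\<lambda>g. Re (u * dcov_field \<kappa> z g))"
    and e: "(\<integral>g. Re (u * dcov_field \<kappa> z g) \<partial>std_gaussian_seq) = 0" for u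
    using dcov_field_gaussian(4,5)[of "{()}" "\<lambda>_. u" "\<lambda>_. z"] by simp_all
  have "(CLINT g|std_gaussian_seq. dcov_field \<kappa> z g)
    = (CLINT g|std_gaussian_seq. of_real (Re (1 * dcov_field \<kappa> z g)) + \<i> * of_real (Re (- \<i> * dcov_field \<kappa> z g)))"
    by (intro Bochner_Integration.integral_cong refl) (simp add: complex_eq_iff)
  also have "\<dots> = of_real (\<integral>g. Re (1 * dcov_field \<kappa> z g) \<partial>std_gaussian_seq)
    + \<i> * of_real (\<integral>g. Re (- \<i> * dcov_field \<kappa> z g) \<partial>std_gaussian_seq)"
    using i[of 1] i[of "- \<i>"] by (subst Bochner_Integration.integral_add) (auto simp del: times_complex.sel)
  finally show ?thesis by (simp only: e) simp
qed

lemma dcov_field_covariance: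
  "(CLINT g|std_gaussian_seq. dcov_field \<kappa> z g * cnj (dcov_field \<kappa> z' g))
    = (CLINT y|\<kappa>. dcov_kernel \<kappa> z y * cnj (dcov_kernel \<kappa> z' y))"
proof -
  have expand: "a * cnj b = of_real (Re (1 * a) * Re (1 * b)) + of_real (Re (- \<i> * a) * Re (- \<i> * b))
      + \<i> * (of_real (Re (- \<i> * a) * Re (1 * b)) - of_real (Re (1 * a) * Re (- \<i> * b)))" for a b :: complex
    by (simp add: complex_eq_iff)
  have lin: "(CLINT x|N. of_real (f1 x) + of_real (f2 x) + \<i> * (of_real (f3 x) - of_real (f4 x)))
      = of_real (integral\<^sup>L N f1) + of_real (integral\<^sup>L N f2) + \<i> * (of_real (integral\<^sup>L N f3) - of_real (integral\<^sup>L N f4))"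
    if "integrable N f1" "integrable N f2" "integrable N f3" "integrable N f4" for N :: "'n measure"
      and f1 f2 f3 f4
    using that by simp
  have i: "integrable \<kappa> (\<lambda>y. Re (u * dcov_kernel \<kappa> z y) * Re (u' * dcov_kernel \<kappa> z' y))" for u u'
    using dcov_part_integrable[of "(u, z)" "(u', z')"] by (simp only: dcov_part_def fst_conv snd_conv)
  show ?thesis unfolding expand
    by (subst (1 2) lin) (intro dcov_field_part_product(1) i refl | simp only: dcov_field_part_product(2))+
qed

lemma dcov_field_second_moment:
  "integrable std_gaussian_seq (\<lambda>g. (cmod (dcov_field \<kappa> z g))\<^sup>2)"
    "(\<integral>g. (cmod (dcov_field \<kappa> z g))\<^sup>2 \<partial>std_gaussian_seq) = (\<integral>y. (cmod (dcov_kernel \<kappa> z y))\<^sup>2 \<partial>\<kappa>)"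
proof -
  have eq: "(cmod a)\<^sup>2 = Re (1 * a) * Re (1 * a) + Re (- \<i> * a) * Re (- \<i> * a)" for a :: complex
    unfolding cmod_power2 by (simp add: power2_eq_square)
  show "integrable std_gaussian_seq (\<lambda>g. (cmod (dcov_field \<kappa> z g))\<^sup>2)"
    unfolding eq by (intro Bochner_Integration.integrable_add dcov_field_part_product)
  have "complex_of_real (\<integral>g. (cmod (dcov_field \<kappa> z g))\<^sup>2 \<partial>std_gaussian_seq)
    = complex_of_real (\<integral>y. (cmod (dcov_kernel \<kappa> z y))\<^sup>2 \<partial>\<kappa>)"
    using dcov_field_covariance[of z z]
    by (simp only: complex_norm_square[symmetric] integral_complex_of_real)
  then show "(\<integral>g. (cmod (dcov_field \<kappa> z g))\<^sup>2 \<partial>std_gaussian_seq) = (\<integral>y. (cmod (dcov_kernel \<kappa> z y))\<^sup>2 \<partial>\<kappa>)"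
    by (simp only: of_real_eq_iff)
qed

end

section \<open>The product limit law and its covariance\<close>

lemma prob_space_nu:
  assumes "\<alpha> > 0"
  shows "prob_space (nu \<alpha>)"
proof
  have "emeasure (nu \<alpha>) {..1} = (\<integral>\<^sup>+y. ennreal (indicator {1..} y * (\<alpha> * y powr (- \<alpha>
    - 1))) * indicator {..1} y \<partial>lborel)"
    unfolding nu_def by (subst emeasure_density) auto
  also have "\<dots> = (\<integral>\<^sup>+y. 0 \<partial>(lborel :: real measure))"
    using AE_lborel_singleton[of 1] by (intro nn_integral_cong_AE) (auto split: split_indicator)
  finally have 0: "emeasure (nu \<alpha>) {..1} = 0" by simp
  have "emeasure (nu \<alpha>) ({..1} \<union> {1<..}) = emeasure (nu \<alpha>) {..1} + emeasure (nu \<alpha>) {1<..}"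
    by (rule plus_emeasure[symmetric]) (auto simp: nu_def)
  also have "{..1} \<union> {1<..} = space (nu \<alpha>)" by (auto simp: nu_def)
  finally show "emeasure (nu \<alpha>) (space (nu \<alpha>)) = 1"
    using emeasure_nu[OF assms, of 1] 0 by simp
qed

lemma sets_nu [measurable_cong]: "sets (nu \<alpha>) = sets borel"
  by (simp add: nu_def)

lemma AE_nu: "AE x in nu \<alpha>. x \<ge> 1"
  unfolding nu_def by (subst AE_density) (auto split: split_indicator intro!: AE_I2)

locale product_limit =
  fixes \<alpha> :: real and S :: "(real^'d) measure"
  assumes \<alpha>: "\<alpha> > 0" and S: "prob_space S" and sets_S [measurable_cong]: "sets S = sets borel"
begin

sublocale A: prob_space "nu \<alpha>" by (rule prob_space_nu[OF \<alpha>])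
sublocale B: prob_space S by (rule S)
sublocale AB: pair_prob_space "nu \<alpha>" S ..

abbreviation "m \<equiv> nu \<alpha> \<Otimes>\<^sub>M S"

sublocale pair_law m
proof
  show "sets m = sets borel"
    unfolding sets_pair_measure_cong[OF sets_nu sets_S] borel_prod ..
qed

lemma integral_product:
  fixes g :: "real \<Rightarrow> complex" and h :: "real^'d \<Rightarrow> complex"
  assumes [measurable]: "g \<in> borel_measurable borel" "h \<in> borel_measurable borel"
    and bd: "\<And>x. cmod (g x) \<le> B" "\<And>\<theta>. cmod (h \<theta>) \<le> C"
  shows "(\<integral>y. g (fst y) * h (snd y) \<partial>m) = (\<integral>x. g x \<partial>nu \<alpha>) * (\<integral>\<theta>. h \<theta> \<partial>S)"
proof -
  have "integrable m (\<lambda>y. g (fst y) * h (snd y))"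
    by (rule AB.P.integrable_const_bound[of _ "B * C"]) (auto intro!: norm_mult_le_mult bd)
  from AB.integral_fst'[OF this] have "(\<integral>y. g (fst y) * h (snd y) \<partial>m)
    = (\<integral>x. (\<integral>\<theta>. g x * h \<theta> \<partial>S) \<partial>nu \<alpha>)" by simp
  then show ?thesis by simp
qed

lemma cf_R_eq: "cf_R \<alpha> s = (CLINT x|nu \<alpha>. iexp (s * x))"
  unfolding cf_R_def nu_def set_lebesgue_integral_def
  using \<alpha> by (subst integral_density)
    (auto intro!: Bochner_Integration.integral_cong split: split_indicator simp: mult.commute scaleR_conv_of_real)

lemma cf_fst_eq: "cf_fst m s = cf_R \<alpha> s"
  using integral_product[of "\<lambda>x. iexp (s * x)" "\<lambda>_. 1" 1 1] by (simp add: cf_fst_def cf_R_eq B.prob_space)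

lemma cf_snd_eq: "cf_snd m t = cf_Theta S t"
  using integral_product[of "\<lambda>_. 1" "\<lambda>\<theta>. iexp (t \<bullet> \<theta>)" 1 1]
  by (simp add: cf_snd_def cf_Theta_def A.prob_space)

text \<open>Radius and angle are independent under the limit law, so the joint characteristic
  function factorises. This asymptotic independence removes the bias in the limit.\<close>

lemma dcov_mean_eq_0: "dcov_mean m z = 0"
proof -
  have "(CLINT y|m. iexp (fst z * fst y + snd z \<bullet> snd y))
    = (CLINT y|m. iexp (fst z * fst y) * iexp (snd z \<bullet> snd y))"
    by (simp add: distrib_left exp_add)
  also have "\<dots> = cf_fst m (fst z) * cf_snd m (snd z)"
    unfolding cf_fst_eq cf_snd_eq cf_R_eq cf_Theta_def
    by (rule integral_product[where B = 1 and C = 1]) auto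
  finally show ?thesis using dcov_mean_eq[of "fst z" "snd z"] by simp
qed

lemma integral_centred_product:
  fixes e e' :: "'x \<Rightarrow> complex"
  assumes "prob_space N" "integrable N e" "integrable N e'" "integrable N (\<lambda>x. e x * cnj (e' x))"
  shows "(\<integral>x. (e x - integral\<^sup>L N e) * cnj (e' x - integral\<^sup>L N e') \<partial>N) = (\<integral>x. e x * cnj (e' x) \<partial>N)
    - integral\<^sup>L N e * cnj (integral\<^sup>L N e')"
proof -
  interpret N: prob_space N by fact
  have "(\<integral>x. (e x - integral\<^sup>L N e) * cnj (e' x - integral\<^sup>L N e') \<partial>N)
      = (\<integral>x. e x * cnj (e' x) - integral\<^sup>L N e * cnj (e' x) - e x * cnj (integral\<^sup>L N e') + integral\<^sup>L N e * cnj (integral\<^sup>L N e') \<partial>N)"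
    by (simp add: algebra_simps)
  also have "\<dots> = (\<integral>x. e x * cnj (e' x) \<partial>N) - integral\<^sup>L N e * cnj (integral\<^sup>L N e')
    - integral\<^sup>L N e * cnj (integral\<^sup>L N e') + integral\<^sup>L N e * cnj (integral\<^sup>L N e')"
    using assms by (simp add: N.prob_space)
  finally show ?thesis by simp
qed

lemma dcov_kernel_covariance:
  "(CLINT y|m. dcov_kernel m (s, t) y * cnj (dcov_kernel m (s', t') y)) =
    (cf_R \<alpha> (s - s') - cf_R \<alpha> s * cf_R \<alpha> (- s')) * (cf_Theta S (t - t') - cf_Theta S t * cf_Theta S (- t'))"
proof -
  have "(CLINT y|m. dcov_kernel m (s, t) y * cnj (dcov_kernel m (s', t') y))
      = (CLINT y|m. (dcov_fst m s (fst y) * cnj (dcov_fst m s' (fst y))) * (dcov_snd m t (snd y) * cnj (dcov_snd m t' (snd y))))"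
    by (simp add: dcov_kernel_def mult_ac)
  also have "\<dots> = (\<integral>x. dcov_fst m s x * cnj (dcov_fst m s' x) \<partial>nu \<alpha>) * (\<integral>\<theta>. dcov_snd m t \<theta> * cnj (dcov_snd m t' \<theta>) \<partial>S)"
    by (rule integral_product[where B = "2 * 2" and C = "2 * 2"])
      (auto intro!: norm_mult_le_mult simp: dcov_norm_le simp del: mult_2 mult_2_right numeral_times_numeral)
  also have "(\<integral>x. dcov_fst m s x * cnj (dcov_fst m s' x) \<partial>nu \<alpha>) = cf_R \<alpha> (s - s')
    - cf_R \<alpha> s * cf_R \<alpha> (- s')"
  proof -
    have i': "integrable (nu \<alpha>) (\<lambda>x. iexp (f x))" if [measurable]: "f \<in> borel_measurable borel" for f
    proof (rule A.integrable_const_bound[of _ 1])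
      show "(\<lambda>x. iexp (f x)) \<in> borel_measurable (nu \<alpha>)"
        unfolding measurable_cong_sets[OF sets_nu refl] by measurable
    qed simp
    have i: "integrable (nu \<alpha>) (\<lambda>x. iexp (s * x))" for s by (rule i') measurable
    have p: "iexp (s * x) * cnj (iexp (s' * x)) = iexp ((s - s') * x)" for x
      by (simp add: exp_cnj left_diff_distrib right_diff_distrib flip: exp_add)
    have c: "cnj (cf_R \<alpha> s') = cf_R \<alpha> (- s')"
      unfolding cf_R_eq by (simp add: exp_cnj flip: Bochner_Integration.integral_cnj)
    show ?thesis
      unfolding dcov_fst_def cf_fst_eq
      using integral_centred_product[OF A.prob_space_axioms i i, of s s'] i[of "s - s'"]
      unfolding p by (simp only: cf_R_eq[symmetric] c)
  qed
  also have "(\<integral>\<theta>. dcov_snd m t \<theta> * cnj (dcov_snd m t' \<theta>) \<partial>S) = cf_Theta S (t - t')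
    - cf_Theta S t * cf_Theta S (- t')"
  proof -
    have i': "integrable S (\<lambda>x. iexp (f x))" if [measurable]: "f \<in> borel_measurable borel" for f
      by (rule B.integrable_const_bound[of _ 1]) auto
    have i: "integrable S (\<lambda>\<theta>. iexp (t \<bullet> \<theta>))" for t by (rule i') measurable
    have p: "iexp (t \<bullet> \<theta>) * cnj (iexp (t' \<bullet> \<theta>)) = iexp ((t - t') \<bullet> \<theta>)" for \<theta>
      by (simp add: exp_cnj inner_diff_left right_diff_distrib flip: exp_add)
    have c: "cnj (cf_Theta S t') = cf_Theta S (- t')"
      unfolding cf_Theta_def by (simp add: exp_cnj flip: Bochner_Integration.integral_cnj)
    show ?thesis
      unfolding dcov_snd_def cf_snd_eq
      using integral_centred_product[OF B.prob_space_axioms i i, of t t'] i[of "t - t'"]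
      unfolding p by (simp only: cf_Theta_def[symmetric] c)
  qed
  finally show ?thesis .
qed

lemma limit_process_dcov_field: "limit_process \<alpha> S std_gaussian_seq (dcov_field m)"
  unfolding limit_process_def centered_complex_gaussian_process_def
proof (intro conjI allI ballI impI)
  show "prob_space std_gaussian_seq" by (rule prob_space_std_gaussian_seq)
  show "dcov_field m z \<in> borel_measurable std_gaussian_seq" for z by measurable
  show "(CLINT g|std_gaussian_seq. dcov_field m z g) = 0" for z by (rule dcov_field_expectation)
  show "(\<lambda>(z, g). dcov_field m z g) \<in> borel_measurable (borel \<Otimes>\<^sub>M std_gaussian_seq)"
    by (rule dcov_field_measurable)
  show "dcov_field m (- z) g = cnj (dcov_field m z g)" for z g by (rule dcov_field_uminus)
  show "(CLINT g|std_gaussian_seq. dcov_field m (s, t) g * cnj (dcov_field m (s', t') g)) =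
      (cf_R \<alpha> (s - s') - cf_R \<alpha> s * cf_R \<alpha> (- s')) * (cf_Theta S (t - t') - cf_Theta S t * cf_Theta S (- t'))" for s t s' t'
    unfolding dcov_field_covariance by (rule dcov_kernel_covariance)
  show "gaussian_variable std_gaussian_seq (\<lambda>g. \<Sum>z\<in>J. a z * Re (dcov_field m z g)
    + b z * Im (dcov_field m z g))"
    if "finite J" for J and a b :: "real \<times> (real^'d) \<Rightarrow> real"
    using dcov_field_gaussian(1)[OF that, of "\<lambda>z. Complex (a z) (- b z)" "\<lambda>z. z"] by simp
qed

end

section \<open>From regular variation to exceedance laws\<close>

text \<open>For an exponent \<gamma> strictly between \<beta> and \<alpha>, slow variation gives
  L(2x)/L(x) < 2^(\<alpha> - \<gamma>) for large x. This is the doubling inequality with rate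
  \<gamma>, valid at all points 2^k r once r is at least \<open>r0\<close>.\<close>

lemma mrv_exceedance:
  fixes X :: "'w \<Rightarrow> real^'d"
  assumes M: "prob_space M" and nm: "is_norm nm" and mrv: "multivariate_regularly_varying M nm \<alpha> S X"
    and \<beta>: "0 < \<beta>" "\<beta> < \<alpha>"
  obtains r0 C where "r0 > 0" "\<And>r. r \<ge> r0 \<Longrightarrow> exceedance M nm X r"
    "\<And>r. r \<ge> r0 \<Longrightarrow> (\<integral>\<^sup>+y. ennreal (fst y powr \<beta>) \<partial>exceed_law M nm X r) \<le> ennreal C"
proof -
  obtain L where L: "slowly_varying L" "\<And>r. r > 0 \<Longrightarrow> exceed_prob M nm X r = L r * r powr (- \<alpha>)"
    and [measurable]: "X \<in> borel_measurable M"
    using mrv unfolding multivariate_regularly_varying_def exceed_prob_def by blast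
  have exc: "exceedance M nm X r" if "r > 0" for r
  proof -
    have "L r > 0" using L(1) that by (simp add: slowly_varying_def)
    then show ?thesis
      using M nm that L(2)[OF that] by (simp add: exceedance_def exceedance_axioms_def)
  qed
  obtain \<gamma> where \<gamma>: "\<beta> < \<gamma>" "\<gamma> < \<alpha>" using dense[OF \<beta>(2)] by blast
  have "((\<lambda>x. L (2 * x) / L x) \<longlongrightarrow> 1) at_top" using L(1) by (simp add: slowly_varying_def)
  moreover have "1 < 2 powr (\<alpha> - \<gamma>)" using \<gamma> by simp
  ultimately have "\<forall>\<^sub>F x in at_top. L (2 * x) / L x < 2 powr (\<alpha> - \<gamma>)" by (rule order_tendstoD)
  then obtain r1 where r1: "\<And>x. x \<ge> r1 \<Longrightarrow> L (2 * x) / L x < 2 powr (\<alpha> - \<gamma>)"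
    by (auto simp: eventually_at_top_linorder)
  define r0 where "r0 = max 1 r1"
  have dbl: "exceed_prob M nm X (2 * x) \<le> 2 powr (- \<gamma>) * exceed_prob M nm X x" if "x \<ge> r0" for x
  proof -
    have x: "x > 0" "x \<ge> r1" using that by (auto simp: r0_def)
    have Lx: "L x > 0" using L(1) x by (simp add: slowly_varying_def)
    have "exceed_prob M nm X (2 * x) = L (2 * x) * (2 * x) powr (- \<alpha>)" using x by (intro L(2)) simp
    also have "\<dots> \<le> (2 powr (\<alpha> - \<gamma>) * L x) * (2 * x) powr (- \<alpha>)"
      using r1[OF x(2)] Lx by (intro mult_right_mono) (auto simp: pos_divide_less_eq)
    also have "\<dots> = 2 powr (- \<gamma>) * (L x * x powr (- \<alpha>))"
    proof -
      have "2 powr (\<alpha> - \<gamma>) * 2 powr (- \<alpha>) = 2 powr (- \<gamma> :: real)" unfolding powr_add[symmetric] by simp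
      then show ?thesis unfolding powr_mult by (simp add: mult_ac)
    qed
    finally show ?thesis using L(2)[OF x(1)] by simp
  qed
  show ?thesis
  proof (rule that)
    show "r0 > 0" by (simp add: r0_def)
    then show "exceedance M nm X r" if "r \<ge> r0" for r using that by (intro exc) simp
    show "(\<integral>\<^sup>+y. ennreal (fst y powr \<beta>) \<partial>exceed_law M nm X r) \<le> ennreal (2 powr \<beta> / (1 - 2 powr (\<beta>
      - \<gamma>)))" if r: "r \<ge> r0" for r
    proof -
      interpret exceedance M nm X r by (rule exc) (use r \<open>r0 > 0\<close> in simp)
      show ?thesis
      proof (rule exceed_law_moment[OF \<beta>(1) \<gamma>(1)])
        fix k :: nat
        have "1 * r \<le> 2 ^ k * r" using r \<open>r0 > 0\<close> by (intro mult_right_mono) auto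
        then have "2 ^ k * r \<ge> r0" using r by simp
        from dbl[OF this] show "exceed_prob M nm X (2 ^ Suc k * r)
          \<le> 2 powr (- \<gamma>) * exceed_prob M nm X (2 ^ k * r)" by (simp add: mult.assoc)
      qed
    qed
  qed
qed

text \<open>All the laws involved are carried by the product of [1, \<infinity>) and the sphere, so
  integrals over that subspace agree with integrals over the whole space and test functions need no
  extension.\<close>

lemma mrv_weak_conv:
  fixes X :: "'w \<Rightarrow> real^'d" and F :: "real \<times> (real^'d) \<Rightarrow> real"
  assumes nm: "is_norm nm" and mrv: "multivariate_regularly_varying M nm \<alpha> S X"
    and exc: "\<And>r. r \<ge> r0 \<Longrightarrow> exceedance M nm X r"
    and F: "continuous_on UNIV F" "bounded (range F)"
  shows "((\<lambda>r. \<integral>y. F y \<partial>exceed_law M nm X r) \<longlongrightarrow> (\<integral>y. F y \<partial>(nu \<alpha> \<Otimes>\<^sub>M S))) at_top"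
proof -
  let ?A = "{1::real..} \<times> unit_sphere nm"
  have SS: "prob_space S" "sets S = sets borel" "AE \<theta> in S. \<theta> \<in> unit_sphere nm" and \<alpha>: "\<alpha> > 0"
    and wc: "weak_conv_on ?A (exceed_law M nm X) (nu \<alpha> \<Otimes>\<^sub>M S) at_top"
    using mrv unfolding multivariate_regularly_varying_def exceed_law_def by auto
  interpret product_limit \<alpha> S by (rule product_limit.intro[OF \<alpha> SS(1,2)])
  have [measurable]: "F \<in> borel_measurable borel" by (rule borel_measurable_continuous_onI[OF F(1)])
  have A [measurable]: "?A \<in> sets borel"
    using closed_unit_sphere[OF nm] by (intro borel_closed closed_Times closed_atLeast)
  have conv: "((\<lambda>r. LINT y:?A|exceed_law M nm X r. F y) \<longlongrightarrow> (LINT y:?A|m. F y)) at_top"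
    using wc F unfolding weak_conv_on_def by (blast intro: continuous_on_subset bounded_subset)
  have eq: "(LINT y:?A|K. F y) = (\<integral>y. F y \<partial>K)" if [measurable_cong]: "sets K = sets borel"
    and AE: "AE y in K. y \<in> ?A" for K
    unfolding set_lebesgue_integral_def
  proof (rule integral_cong_AE)
    show "AE y in K. indicator ?A y *\<^sub>R F y = F y" using AE by eventually_elim simp
  qed measurable
  have "AE y in m. y \<in> ?A"
  proof -
    have [measurable]: "unit_sphere nm \<in> sets borel" by (rule borel_closed[OF closed_unit_sphere[OF nm]])
    have "AE y in m. fst y \<in> {1..} \<and> snd y \<in> unit_sphere nm"
      using AE_nu[of \<alpha>] SS(3) by (intro AB.AE_pair_measure) (auto elim!: eventually_mono)
    then show ?thesis by eventually_elim (simp add: mem_Times_iff)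
  qed
  then have 1: "(LINT y:?A|m. F y) = (\<integral>y. F y \<partial>m)" by (intro eq sets_law)
  have "\<forall>\<^sub>F r in at_top. (LINT y:?A|exceed_law M nm X r. F y) = (\<integral>y. F y \<partial>exceed_law M nm X r)"
    using eventually_ge_at_top[of r0]
  proof eventually_elim
    case (elim r)
    interpret exceedance M nm X r by (rule exc[OF elim])
    have "AE y in exceed_law M nm X r. y \<in> ?A"
      using AE_exceed_law by eventually_elim (simp add: mem_Times_iff unit_sphere_def)
    then show ?case by (intro eq sets_exceed_law)
  qed
  from Lim_transform_eventually[OF conv this] show ?thesis unfolding 1 .
qed

section \<open>The normalised empirical processes\<close>

text \<open>The index \<open>n0\<close> marks where the thresholds are high enough for the moment
  bound and the expected number of exceedances is at least 1. The assumptions are what regular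
  variation and the growth of the thresholds supply.\<close>

locale dcov_setting = prob_space M + lim: product_limit \<alpha> S
  for M :: "'w measure" and \<alpha> :: real and S :: "(real^'d) measure" +
  fixes nm :: "real^'d \<Rightarrow> real" and X :: "'w \<Rightarrow> real^'d" and Xs :: "nat \<Rightarrow> 'w \<Rightarrow> real^'d" and r :: "nat \<Rightarrow> real"
    and \<mu> :: "(real \<times> (real^'d)) measure" and \<beta> C T :: real and n0 :: nat
  assumes nm: "is_norm nm"
    and indep: "indep_vars (\<lambda>_. borel) Xs {1..}"
    and law: "\<And>j. j \<ge> 1 \<Longrightarrow> distr M borel (Xs j) = distr M borel X"
    and \<beta>: "0 < \<beta>" "\<beta> \<le> 2" and T: "T > 0" "\<And>x. norm x \<le> T * nm x"
    and exc: "\<And>n. n \<ge> n0 \<Longrightarrow> exceedance M nm X (r n)"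
    and moment: "\<And>n. n \<ge> n0 \<Longrightarrow> (\<integral>\<^sup>+y. ennreal (fst y powr \<beta>) \<partial>exceed_law M nm X (r n)) \<le> ennreal C"
    and np_ge_1: "\<And>n. n \<ge> n0 \<Longrightarrow> real n * exceed_prob M nm X (r n) \<ge> 1"
    and np_at_top: "filterlim (\<lambda>n. real n * exceed_prob M nm X (r n)) at_top sequentially"
    and weak_law: "\<And>F :: real \<times> (real^'d) \<Rightarrow> real. continuous_on UNIV F \<Longrightarrow> bounded (range F) \<Longrightarrow>
      (\<lambda>n. \<integral>y. F y \<partial>exceed_law M nm X (r n)) \<longlonglongrightarrow> (\<integral>y. F y \<partial>(nu \<alpha> \<Otimes>\<^sub>M S))"
    and sets_\<mu> [measurable_cong]: "sets \<mu> = sets borel"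
    and weight_finite: "(\<integral>\<^sup>+z. ennreal (dcov_weight \<beta> z) \<partial>\<mu>) < \<infinity>"
begin

lemmas nm_measurable [measurable] = is_norm_measurable[OF nm]
lemmas angle_measurable' [measurable] = angle_measurable[OF nm]

abbreviation "m \<equiv> nu \<alpha> \<Otimes>\<^sub>M S"
abbreviation "D \<equiv> distr M borel X"
abbreviation "w \<equiv> dcov_weight \<beta> :: real \<times> (real^'d) \<Rightarrow> real"

definition "p n = exceed_prob M nm X (r n)"
definition "a n = real n * p n"
text \<open>Below \<open>n0\<close> the limit law is substituted, so that the kernel is centred by a
  probability law for every n and its mean is 0 there.\<close>

definition "\<kappa> n = (if n \<ge> n0 then exceed_law M nm X (r n) else m)"
text \<open>The constant in the second-moment bound of the kernel, 16 C from the radial factor times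
  4 (2 + T)^2 from the angular one.\<close>

definition "K1 = 64 * (2 + T)\<^sup>2 * C"

text \<open>A function of the normalised exceedance becomes a summand of the full sample, equal to 0
  for observations that do not exceed. Row sums then have the deterministic length n, and the random
  number of exceedances enters only through normalisation.\<close>

definition lift :: "nat \<Rightarrow> (real \<times> (real^'d) \<Rightarrow> 'b::zero) \<Rightarrow> real^'d \<Rightarrow> 'b" where
  "lift n g x = (if nm x > r n then g (nm x / r n, angle nm x) else 0)"

sublocale iid: iid_sample M borel Xs D
  by unfold_locales (use indep law in auto)

lemma laws: "pair_law (\<kappa> n)"
proof (cases "n \<ge> n0")
  case True
  then interpret e: exceedance M nm X "r n" by (rule exc)
  show ?thesis using True e.prob_space_exceed_law
    by (simp add: \<kappa>_def pair_law_def pair_law_axioms_def e.sets_exceed_law)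
qed (simp add: \<kappa>_def lim.pair_law_axioms)

sublocale wk: weakly_convergent_laws m \<kappa>
proof (rule weakly_convergent_laws.intro[OF lim.pair_law_axioms weakly_convergent_laws_axioms.intro])
  fix F :: "real \<times> (real^'d) \<Rightarrow> real" assume F: "continuous_on UNIV F" "bounded (range F)"
  show "(\<lambda>n. \<integral>y. F y \<partial>\<kappa> n) \<longlonglongrightarrow> (\<integral>y. F y \<partial>m)"
  proof (rule Lim_transform_eventually[OF weak_law[OF F]])
    show "\<forall>\<^sub>F n in sequentially. (\<integral>y. F y \<partial>exceed_law M nm X (r n)) = (\<integral>y. F y \<partial>\<kappa> n)"
      using eventually_ge_at_top[of n0] by eventually_elim (simp add: \<kappa>_def)
  qed
qed (rule laws)

lemma lift_measurable [measurable]: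
  fixes g :: "real \<times> (real^'d) \<Rightarrow> 'b::{second_countable_topology, banach}"
  assumes [measurable]: "g \<in> borel_measurable borel"
  shows "lift n g \<in> borel_measurable borel"
proof -
  have "(\<lambda>x. (nm x / r n, angle nm x)) \<in> borel_measurable borel" by (rule borel_measurable_Pair) measurable
  from measurable_compose[OF this assms] have [measurable]: "(\<lambda>x. g (nm x / r n, angle nm x)) \<in> borel_measurable borel" .
  show ?thesis unfolding lift_def[abs_def] by measurable
qed

lemma lift_norm_le: "(\<And>y. norm (g y) \<le> B) \<Longrightarrow> norm (lift n g x) \<le> B"
  for g :: "real \<times> (real^'d) \<Rightarrow> 'b::real_normed_vector"
proof -
  assume *: "\<And>y. norm (g y) \<le> B"
  from order_trans[OF norm_ge_zero *] have "0 \<le> B" .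
  with * show ?thesis by (simp add: lift_def)
qed

lemma integral_lift:
  fixes g :: "real \<times> (real^'d) \<Rightarrow> 'b::{second_countable_topology, banach}"
  assumes "n \<ge> n0" "g \<in> borel_measurable borel"
  shows "(\<integral>x. lift n g x \<partial>D) = p n *\<^sub>R (\<integral>y. g y \<partial>\<kappa> n)"
proof -
  interpret e: exceedance M nm X "r n" by (rule exc[OF assms(1)])
  show ?thesis using e.integral_exceed_law[OF assms(2)] assms(1) by (simp add: lift_def p_def \<kappa>_def)
qed

lemma p_bounds: "n \<ge> n0 \<Longrightarrow> 0 < p n" "p n \<le> 1" "n \<ge> n0 \<Longrightarrow> 1 \<le> a n" "n \<ge> n0 \<Longrightarrow> n \<ge> 1"
proof -
  show "p n \<le> 1" unfolding p_def exceed_prob_def by simp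
  assume n: "n \<ge> n0"
  show "0 < p n" using exceedance.p_pos[OF exc[OF n]] by (simp add: p_def)
  show "1 \<le> a n" using np_ge_1[OF n] by (simp add: a_def p_def)
  then show "n \<ge> 1" by (cases n) (auto simp: a_def)
qed

lemma a_at_top: "filterlim a at_top sequentially"
  using np_at_top by (simp add: a_def[abs_def] p_def)

lemma AE_law: "n \<ge> n0 \<Longrightarrow> AE y in \<kappa> n. 1 \<le> fst y \<and> norm (snd y) \<le> T"
proof -
  assume n: "n \<ge> n0"
  interpret e: exceedance M nm X "r n" by (rule exc[OF n])
  have "AE y in exceed_law M nm X (r n). 1 \<le> fst y \<and> norm (snd y) \<le> T"
    using e.AE_exceed_law
  proof eventually_elim
    case (elim y)
    then show ?case using T(2)[of "snd y"] by auto
  qed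
  moreover have "\<kappa> n = exceed_law M nm X (r n)" using n by (simp add: \<kappa>_def)
  ultimately show ?thesis by (simp only:)
qed

lemma moment': "n \<ge> n0 \<Longrightarrow> (\<integral>\<^sup>+y. ennreal (fst y powr \<beta>) \<partial>\<kappa> n) \<le> ennreal C"
  using moment by (simp add: \<kappa>_def)

lemma C_ge_1: "C \<ge> 1"
  using pair_law.moment_le(2)[OF laws \<beta> T(1) AE_law[OF order_refl] moment'[OF order_refl]] .

lemma K1_pos: "K1 > 0"
  using T C_ge_1 by (simp add: K1_def)

lemma kernel_sq_le: "n \<ge> n0 \<Longrightarrow> (\<integral>y. (cmod (dcov_kernel (\<kappa> n) z y))\<^sup>2 \<partial>\<kappa> n) \<le> K1 * w z"
  unfolding K1_def by (rule pair_law.dcov_kernel_sq_le[OF laws \<beta> T(1) AE_law moment'])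

lemma marginal_sq_le:
  assumes n: "n \<ge> n0"
  shows "(\<integral>y. (cmod (dcov_fst (\<kappa> n) (fst z) (fst y)))\<^sup>2 \<partial>\<kappa> n) * (\<integral>y. (cmod (dcov_snd (\<kappa> n) (snd z) (snd y)))\<^sup>2 \<partial>\<kappa> n)
    \<le> K1 * w z"
proof -
  have "(\<integral>y. (cmod (dcov_fst (\<kappa> n) (fst z) (fst y)))\<^sup>2 \<partial>\<kappa> n) * (\<integral>y. (cmod (dcov_snd (\<kappa> n) (snd z) (snd y)))\<^sup>2 \<partial>\<kappa> n)
      \<le> (16 * C * min 1 (\<bar>fst z\<bar> powr \<beta>)) * (4 * (2 + T)\<^sup>2 * min 1 ((norm (snd z))\<^sup>2))"
    using C_ge_1
    by (intro mult_mono pair_law.dcov_fst_sq_le[OF laws \<beta> T(1) AE_law[OF n] moment'[OF n]]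
        pair_law.dcov_snd_sq_le[OF laws \<beta> T(1) AE_law[OF n] moment'[OF n]]) auto
  then show ?thesis by (simp add: K1_def dcov_weight_def mult_ac)
qed

text \<open>The variance of a function observed with probability \<open>p n\<close>: E|g|^2 enters
  with p and |E g|^2 with p^2.\<close>

lemma integral_centred_lift_sq:
  fixes g :: "real \<times> (real^'d) \<Rightarrow> complex"
  assumes n: "n \<ge> n0" and [measurable]: "g \<in> borel_measurable borel" and B: "\<And>y. cmod (g y) \<le> B"
  shows "(\<integral>x. (cmod (lift n g x - p n * (\<integral>y. g y \<partial>\<kappa> n)))\<^sup>2 \<partial>D) = p n * (\<integral>y. (cmod (g y))\<^sup>2 \<partial>\<kappa> n)
    - (p n)\<^sup>2 * (cmod (\<integral>y. g y \<partial>\<kappa> n))\<^sup>2"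
proof -
  let ?d = "\<integral>y. g y \<partial>\<kappa> n"
  let ?c = "complex_of_real (p n) * ?d"
  have expand: "(cmod (x - c))\<^sup>2 = (cmod x)\<^sup>2 - 2 * Re (x * cnj c) + (cmod c)\<^sup>2" for x c :: complex
    unfolding cmod_power2 by (simp add: power2_eq_square algebra_simps)
  have i1: "integrable D (lift n g)" by (rule iid.D.integrable_const_bound[of _ B])
    (auto simp: lift_norm_le B)
  have sq: "(cmod (lift n g x))\<^sup>2 = lift n (\<lambda>y. (cmod (g y))\<^sup>2) x" for x by (simp add: lift_def)
  have i2: "integrable D (\<lambda>x. (cmod (lift n g x))\<^sup>2)"
  proof (rule iid.D.integrable_const_bound[of _ "B\<^sup>2"])
    show "AE x in D. norm ((cmod (lift n g x))\<^sup>2) \<le> B\<^sup>2"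
      using power_mono[OF lift_norm_le[of g B n] norm_ge_zero, OF B, of _ 2] by simp
  qed measurable
  have "(\<integral>x. (cmod (lift n g x - ?c))\<^sup>2 \<partial>D) = (\<integral>x. (cmod (lift n g x))\<^sup>2 \<partial>D)
    - 2 * Re ((\<integral>x. lift n g x \<partial>D) * cnj ?c) + (cmod ?c)\<^sup>2"
  proof -
    have i3: "integrable D (\<lambda>x. lift n g x * cnj ?c)" using i1 by (rule integrable_mult_left)
    have "(\<integral>x. (cmod (lift n g x - ?c))\<^sup>2 \<partial>D) = (\<integral>x. (cmod (lift n g x))\<^sup>2
      - 2 * Re (lift n g x * cnj ?c) + (cmod ?c)\<^sup>2 \<partial>D)"
      unfolding expand ..
    also have "\<dots> = (\<integral>x. (cmod (lift n g x))\<^sup>2 \<partial>D) - 2 * (\<integral>x. Re (lift n g x * cnj ?c) \<partial>D) + (cmod ?c)\<^sup>2"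
      using i2 integrable_Re[OF i3] iid.D.prob_space by (simp del: times_complex.sel complex_cnj_mult)
    also have "(\<integral>x. Re (lift n g x * cnj ?c) \<partial>D) = Re ((\<integral>x. lift n g x \<partial>D) * cnj ?c)"
      unfolding integral_Re[OF i3] using i1 by (simp del: times_complex.sel complex_cnj_mult)
    finally show ?thesis .
  qed
  also have "(\<integral>x. (cmod (lift n g x))\<^sup>2 \<partial>D) = p n * (\<integral>y. (cmod (g y))\<^sup>2 \<partial>\<kappa> n)"
    unfolding sq using integral_lift[OF n, of "\<lambda>y. (cmod (g y))\<^sup>2"] by simp
  also have "(\<integral>x. lift n g x \<partial>D) = ?c" using integral_lift[OF n, of g] by (simp add: scaleR_conv_of_real)
  also have "Re (?c * cnj ?c) = (cmod ?c)\<^sup>2"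
    by (simp only: complex_norm_square[symmetric] Re_complex_of_real)
  finally show ?thesis by (simp add: norm_mult power_mult_distrib)
qed

definition centred :: "nat \<Rightarrow> real \<times> (real^'d) \<Rightarrow> real^'d \<Rightarrow> complex" where
  "centred n z x = lift n (dcov_kernel (\<kappa> n) z) x - of_real (p n) * dcov_mean (\<kappa> n) z"

definition G :: "nat \<Rightarrow> real \<times> (real^'d) \<Rightarrow> 'w \<Rightarrow> complex" where
  "G n z \<omega> = (if n \<ge> n0 then (\<Sum>j=1..n. centred n z (Xs j \<omega>)) / of_real (sqrt (a n)) else 0)"

text \<open>No further centring is required here or for \<open>V\<close>: the summands already have
  conditional mean 0 given an exceedance.\<close>

definition U :: "nat \<Rightarrow> real \<Rightarrow> 'w \<Rightarrow> complex" where
  "U n s \<omega> = (\<Sum>j=1..n. lift n (\<lambda>y. dcov_fst (\<kappa> n) s (fst y)) (Xs j \<omega>))"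

definition V :: "nat \<Rightarrow> real^'d \<Rightarrow> 'w \<Rightarrow> complex" where
  "V n t \<omega> = (\<Sum>j=1..n. lift n (\<lambda>y. dcov_snd (\<kappa> n) t (snd y)) (Xs j \<omega>))"

text \<open>The product of the two sums has mean square of order a^2, so division by a^(3/2) makes
  the mean square O(1/a); this is the scale on which it stands next to \<open>G n\<close>.\<close>

definition H :: "nat \<Rightarrow> real \<times> (real^'d) \<Rightarrow> 'w \<Rightarrow> complex" where
  "H n z \<omega> = (if n \<ge> n0 then U n (fst z) \<omega> * V n (snd z) \<omega> / of_real (a n * sqrt (a n)) else 0)"

lemma kernel_meas: "dcov_kernel (\<kappa> n) z \<in> borel_measurable borel"
  "dcov_fst (\<kappa> n) s \<in> borel_measurable borel" "dcov_snd (\<kappa> n) t \<in> borel_measurable borel"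
  by (rule pair_law.dcov_measurable[OF laws])+

lemma dcov_mean_norm: "cmod (dcov_mean (\<kappa> n) z) \<le> 4"
proof -
  interpret k: pair_law "\<kappa> n" by (rule laws)
  have "cmod (dcov_mean (\<kappa> n) z) \<le> (\<integral>y. cmod (dcov_kernel (\<kappa> n) z y) \<partial>\<kappa> n)" unfolding dcov_mean_def
    by (rule integral_norm_bound)
  also have "\<dots> \<le> (\<integral>y. 4 \<partial>\<kappa> n)"
    by (intro integral_mono integrable_norm k.dcov_integrable k.dcov_kernel_norm_le) simp
  finally show ?thesis by (simp add: k.prob_space)
qed

lemma centred_measurable: "centred n z \<in> borel_measurable borel"
proof -
  note kernel_meas [measurable]
  show ?thesis unfolding centred_def[abs_def] by measurable
qed

lemma centred_norm: "cmod (centred n z x) \<le> 8"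
proof -
  have "cmod (lift n (dcov_kernel (\<kappa> n) z) x) \<le> 4"
    by (rule lift_norm_le, rule pair_law.dcov_kernel_norm_le[OF laws])
  moreover have "cmod (of_real (p n) * dcov_mean (\<kappa> n) z) \<le> 1 * 4"
  proof (rule norm_mult_le_mult[OF _ dcov_mean_norm])
    show "norm (complex_of_real (p n)) \<le> 1" using p_bounds(2)[of n] by (simp add: p_def exceed_prob_def)
  qed
  ultimately show ?thesis unfolding centred_def
    using norm_triangle_ineq4[of "lift n (dcov_kernel (\<kappa> n) z) x"
    "of_real (p n) * dcov_mean (\<kappa> n) z"] by linarith
qed

lemma centred_mean: "n \<ge> n0 \<Longrightarrow> (\<integral>x. centred n z x \<partial>D) = 0"
proof -
  assume n: "n \<ge> n0"
  note kernel_meas [measurable]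
  have "integrable D (lift n (dcov_kernel (\<kappa> n) z))"
    by (rule iid.D.integrable_const_bound[of _ 4])
      (auto intro!: AE_I2 lift_norm_le pair_law.dcov_kernel_norm_le[OF laws])
  then show ?thesis
    unfolding centred_def using integral_lift[OF n kernel_meas(1)[of n z]] iid.D.prob_space
    by (simp add: dcov_mean_def scaleR_conv_of_real)
qed

lemma centred_sq: "n \<ge> n0 \<Longrightarrow> (\<integral>x. (cmod (centred n z x))\<^sup>2 \<partial>D)
  = p n * (\<integral>y. (cmod (dcov_kernel (\<kappa> n) z y))\<^sup>2 \<partial>\<kappa> n) - (p n)\<^sup>2 * (cmod (dcov_mean (\<kappa> n) z))\<^sup>2"
  unfolding centred_def dcov_mean_def
  by (rule integral_centred_lift_sq[where B = 4])
    (auto intro: kernel_meas pair_law.dcov_kernel_norm_le[OF laws])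

lemma bounded_rv_psum_centred: "bounded_rv (\<lambda>\<omega>. \<Sum>j=1..n. centred n z (Xs j \<omega>))"
  by (rule iid.psum_bounded_rv(1)[OF centred_measurable centred_norm])

lemma G_sq:
  "integrable M (\<lambda>\<omega>. (cmod (G n z \<omega>))\<^sup>2)"
  "n \<ge> n0 \<Longrightarrow> (\<integral>\<omega>. (cmod (G n z \<omega>))\<^sup>2 \<partial>M) = (\<integral>y. (cmod (dcov_kernel (\<kappa> n) z y))\<^sup>2 \<partial>\<kappa> n)
    - p n * (cmod (dcov_mean (\<kappa> n) z))\<^sup>2"
proof -
  have eq: "(cmod (G n z \<omega>))\<^sup>2 = (cmod (\<Sum>j=1..n. centred n z (Xs j \<omega>)))\<^sup>2 / a n" if "n \<ge> n0" for \<omega>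
    using p_bounds(3)[OF that] that by (simp add: G_def norm_divide power_divide)
  have i: "integrable M (\<lambda>\<omega>. (cmod (\<Sum>j=1..n. centred n z (Xs j \<omega>)))\<^sup>2)"
    by (intro bounded_rv_integrable bounded_rv_cmod_sq bounded_rv_psum_centred)
  show "integrable M (\<lambda>\<omega>. (cmod (G n z \<omega>))\<^sup>2)"
    using i by (cases "n \<ge> n0") (simp_all add: eq, simp add: G_def)
  assume n: "n \<ge> n0"
  have "(\<integral>\<omega>. (cmod (G n z \<omega>))\<^sup>2 \<partial>M) = real n * (\<integral>x. (cmod (centred n z x))\<^sup>2 \<partial>D) / a n"
    unfolding eq[OF n] using iid.expectation_cmod_psum_sq[of "centred n z" 8 n, OF centred_measurable centred_norm centred_mean[OF n]]
    by simp
  also have "\<dots> = (\<integral>y. (cmod (dcov_kernel (\<kappa> n) z y))\<^sup>2 \<partial>\<kappa> n) - p n * (cmod (dcov_mean (\<kappa> n) z))\<^sup>2"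
    unfolding centred_sq[OF n] a_def using p_bounds(1,4)[OF n] by (simp add: field_simps power2_eq_square)
  finally show "(\<integral>\<omega>. (cmod (G n z \<omega>))\<^sup>2 \<partial>M) = (\<integral>y. (cmod (dcov_kernel (\<kappa> n) z y))\<^sup>2 \<partial>\<kappa> n)
    - p n * (cmod (dcov_mean (\<kappa> n) z))\<^sup>2" .
qed

lemma weight_nonneg: "w z \<ge> 0"
  by (simp add: dcov_weight_def)

lemma G_sq_le: "(\<integral>\<omega>. (cmod (G n z \<omega>))\<^sup>2 \<partial>M) \<le> K1 * w z"
proof (cases "n \<ge> n0")
  case True
  then show ?thesis using G_sq(2)[OF True, of z] kernel_sq_le[OF True, of z] p_bounds(1)[OF True]
    by (smt (verit) mult_nonneg_nonneg zero_le_power2)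
next
  case False
  then show ?thesis using K1_pos weight_nonneg by (simp add: G_def)
qed

lemma dcov_mean_sq_le: "n \<ge> n0 \<Longrightarrow> (cmod (dcov_mean (\<kappa> n) z))\<^sup>2 \<le> K1 * w z"
  using pair_law.dcov_mean_sq_le[OF laws[of n], of z] kernel_sq_le[of n z] by linarith

lemma G_sq_tendsto: "(\<lambda>n. \<integral>\<omega>. (cmod (G n z \<omega>))\<^sup>2 \<partial>M) \<longlonglongrightarrow> (\<integral>y. (cmod (dcov_kernel m z y))\<^sup>2 \<partial>m)"
proof -
  have d: "(\<lambda>n. (cmod (dcov_mean (\<kappa> n) z))\<^sup>2) \<longlonglongrightarrow> 0"
  proof -
    have "(\<lambda>n. (cmod (dcov_mean (\<kappa> n) z))\<^sup>2) \<longlonglongrightarrow> (cmod (dcov_mean m z))\<^sup>2"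
      by (intro tendsto_intros wk.dcov_mean_tendsto)
    then show ?thesis by (simp add: lim.dcov_mean_eq_0)
  qed
  have "(\<lambda>n. p n * (cmod (dcov_mean (\<kappa> n) z))\<^sup>2) \<longlonglongrightarrow> 0"
  proof (rule Lim_null_comparison[OF always_eventually d], rule allI)
    fix n
    have "0 \<le> p n" by (simp add: p_def exceed_prob_def)
    then show "norm (p n * (cmod (dcov_mean (\<kappa> n) z))\<^sup>2) \<le> (cmod (dcov_mean (\<kappa> n) z))\<^sup>2"
      using mult_right_mono[OF p_bounds(2)[of n], of "(cmod (dcov_mean (\<kappa> n) z))\<^sup>2"] by simp
  qed
  from tendsto_diff[OF wk.dcov_kernel_sq_tendsto[of z] this]
  have "(\<lambda>n. (\<integral>y. (cmod (dcov_kernel (\<kappa> n) z y))\<^sup>2 \<partial>\<kappa> n) - p n * (cmod (dcov_mean (\<kappa> n) z))\<^sup>2)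
    \<longlonglongrightarrow> (\<integral>y. (cmod (dcov_kernel m z y))\<^sup>2 \<partial>m)" by simp
  then show ?thesis
  proof (rule Lim_transform_eventually)
    show "\<forall>\<^sub>F n in sequentially. (\<integral>y. (cmod (dcov_kernel (\<kappa> n) z y))\<^sup>2 \<partial>\<kappa> n)
      - p n * (cmod (dcov_mean (\<kappa> n) z))\<^sup>2 = (\<integral>\<omega>. (cmod (G n z \<omega>))\<^sup>2 \<partial>M)"
      using eventually_ge_at_top[of n0] by eventually_elim (simp add: G_sq(2))
  qed
qed

text \<open>The fourth-order bound for the two lifts, whose product is the lifted kernel. After
  division by a^3 both terms are at most a multiple of the weight over \<open>a n\<close>.\<close>

lemma H_sq:
  "integrable M (\<lambda>\<omega>. (cmod (H n z \<omega>))\<^sup>2)"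
  "n \<ge> n0 \<Longrightarrow> (\<integral>\<omega>. (cmod (H n z \<omega>))\<^sup>2 \<partial>M) \<le> 7 * K1 * w z / a n"
proof -
  note kernel_meas [measurable]
  let ?u = "lift n (\<lambda>y. dcov_fst (\<kappa> n) (fst z) (fst y))"
    and ?v = "lift n (\<lambda>y. dcov_snd (\<kappa> n) (snd z) (snd y))"
  interpret k: pair_law "\<kappa> n" by (rule laws)
  have um: "?u \<in> borel_measurable borel" and vm: "?v \<in> borel_measurable borel" by measurable
  have ub: "cmod (?u x) \<le> 2" and vb: "cmod (?v x) \<le> 2" for x by (intro lift_norm_le k.dcov_norm_le)+
  have eq: "(cmod (H n z \<omega>))\<^sup>2
    = (cmod ((\<Sum>j=1..n. ?u (Xs j \<omega>)) * (\<Sum>j=1..n. ?v (Xs j \<omega>))))\<^sup>2 / (a n) ^ 3" if "n \<ge> n0" for \<omega>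
    using p_bounds(3)[OF that] that
    by (simp add: H_def U_def V_def norm_divide power_divide norm_mult power_mult_distrib power2_eq_square power3_eq_cube)
  have i: "integrable M (\<lambda>\<omega>. (cmod ((\<Sum>j=1..n. ?u (Xs j \<omega>)) * (\<Sum>j=1..n. ?v (Xs j \<omega>))))\<^sup>2)"
    by (intro bounded_rv_integrable bounded_rv_cmod_sq bounded_rv_mult iid.psum_bounded_rv(1)[OF um ub] iid.psum_bounded_rv(1)[OF vm vb])
  show "integrable M (\<lambda>\<omega>. (cmod (H n z \<omega>))\<^sup>2)"
    using i by (cases "n \<ge> n0") (simp_all add: eq, simp add: H_def)
  assume n: "n \<ge> n0"
  have a1: "a n \<ge> 1" by (rule p_bounds(3)[OF n])
  have mean: "(\<integral>x. ?u x \<partial>D) = 0" "(\<integral>x. ?v x \<partial>D) = 0"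
    using integral_lift[OF n, of "\<lambda>y. dcov_fst (\<kappa> n) (fst z) (fst y)"] integral_lift[OF n, of "\<lambda>y. dcov_snd (\<kappa> n) (snd z) (snd y)"] k.integral_dcov_eq_0
    by simp_all
  have sq: "(\<integral>x. (cmod (lift n g x))\<^sup>2 \<partial>D) = p n * (\<integral>y. (cmod (g y))\<^sup>2 \<partial>\<kappa> n)"
    if [measurable]: "g \<in> borel_measurable borel" for g :: "real \<times> (real^'d) \<Rightarrow> complex"
  proof -
    have "(\<integral>x. (cmod (lift n g x))\<^sup>2 \<partial>D) = (\<integral>x. lift n (\<lambda>y. (cmod (g y))\<^sup>2) x \<partial>D)"
      by (rule Bochner_Integration.integral_cong) (auto simp: lift_def)
    then show ?thesis using integral_lift[OF n, of "\<lambda>y. (cmod (g y))\<^sup>2"] by simp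
  qed
  have uv: "?u x * ?v x = lift n (dcov_kernel (\<kappa> n) z) x" for x by (simp add: lift_def dcov_kernel_def)
  have "(\<integral>\<omega>. (cmod (H n z \<omega>))\<^sup>2 \<partial>M)
    = (\<integral>\<omega>. (cmod ((\<Sum>j=1..n. ?u (Xs j \<omega>)) * (\<Sum>j=1..n. ?v (Xs j \<omega>))))\<^sup>2 \<partial>M) / (a n) ^ 3"
    unfolding eq[OF n] by simp
  also have "\<dots> \<le> (3 * real n * (p n * (\<integral>y. (cmod (dcov_kernel (\<kappa> n) z y))\<^sup>2 \<partial>\<kappa> n))
      + 4 * (real n)\<^sup>2 * ((p n * (\<integral>y. (cmod (dcov_fst (\<kappa> n) (fst z) (fst y)))\<^sup>2 \<partial>\<kappa> n)) * (p n * (\<integral>y. (cmod (dcov_snd (\<kappa> n) (snd z) (snd y)))\<^sup>2 \<partial>\<kappa> n)))) / (a n) ^ 3"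
    using iid.expectation_cmod_psum_mult_sq_le[OF um vm ub vb mean, of n] a1 unfolding uv
    by (subst (asm) (1 2 3) sq) (auto intro!: divide_right_mono)
  also have "\<dots> = (3 * a n * (\<integral>y. (cmod (dcov_kernel (\<kappa> n) z y))\<^sup>2 \<partial>\<kappa> n)
      + 4 * (a n)\<^sup>2 * ((\<integral>y. (cmod (dcov_fst (\<kappa> n) (fst z) (fst y)))\<^sup>2 \<partial>\<kappa> n) * (\<integral>y. (cmod (dcov_snd (\<kappa> n) (snd z) (snd y)))\<^sup>2 \<partial>\<kappa> n))) / (a n) ^ 3"
    by (simp add: a_def power2_eq_square mult_ac)
  also have "\<dots> \<le> (3 * a n * (K1 * w z) + 4 * (a n)\<^sup>2 * (K1 * w z)) / (a n) ^ 3"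
    using a1 by (intro divide_right_mono add_mono mult_left_mono kernel_sq_le[OF n] marginal_sq_le[OF n]) auto
  \<comment> \<open>As \<open>a n\<close> is at least 1, a may be raised to a^2, and 7 = 3 +
    4.\<close>
  also have "\<dots> \<le> (3 * (a n)\<^sup>2 * (K1 * w z) + 4 * (a n)\<^sup>2 * (K1 * w z)) / (a n) ^ 3"
    using a1 K1_pos weight_nonneg[of z] by (intro divide_right_mono add_mono mult_right_mono)
      (auto simp: power2_eq_square)
  also have "\<dots> = 7 * K1 * w z / a n"
    using a1 by (simp add: power2_eq_square power3_eq_cube field_simps)
  finally show "(\<integral>\<omega>. (cmod (H n z \<omega>))\<^sup>2 \<partial>M) \<le> 7 * K1 * w z / a n" .
qed

text \<open>Cramer-Wold: the linear combination is a row sum of one bounded real function h. Its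
  variance over \<open>p n\<close> is the second moment of the kernel combination minus p times a
  squared mean, and that mean tends to 0 by asymptotic independence.\<close>

lemma G_char_tendsto:
  fixes k :: nat
  shows
  "(\<lambda>n. CLINT \<omega>|M. iexp (\<Sum>i<k. Re (u i * G n (z i) \<omega>)))
    \<longlonglongrightarrow> (CLINT g|std_gaussian_seq. iexp (\<Sum>i<k. Re (u i * dcov_field m (z i) g)))"
proof -
  define h where "h n x = (if n \<ge> n0 then \<Sum>i<k. Re (u i * centred n (z i) x) else 0)" for n x
  let ?v = "\<integral>y. (wk.kernel_comb k u z m y)\<^sup>2 \<partial>m"
  have h_bd: "\<bar>h n x\<bar> \<le> (\<Sum>i<k. cmod (u i) * 8)" for n x
  proof -
    have "\<bar>\<Sum>i<k. Re (u i * centred n (z i) x)\<bar> \<le> (\<Sum>i<k. \<bar>Re (u i * centred n (z i) x)\<bar>)" by (rule sum_abs)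
    also have "\<dots> \<le> (\<Sum>i<k. cmod (u i) * 8)"
    proof (rule sum_mono)
      fix i
      show "\<bar>Re (u i * centred n (z i) x)\<bar> \<le> cmod (u i) * 8"
        by (rule order_trans[OF abs_Re_le_cmod norm_mult_le_mult[OF order_refl centred_norm]])
    qed
    finally show ?thesis using sum_nonneg[of "{..<k}" "\<lambda>i. cmod (u i) * 8"] by (simp add: h_def)
  qed
  have h_meas: "h n \<in> borel_measurable borel" for n
  proof -
    note centred_measurable [measurable]
    show ?thesis unfolding h_def[abs_def] by measurable
  qed
  have comb: "h n x = lift n (wk.kernel_comb k u z (\<kappa> n)) x
    - p n * (\<Sum>i<k. Re (u i * dcov_mean (\<kappa> n) (z i)))" if "n \<ge> n0" for n x
  proof -
    have lin: "Re (c * (K - of_real q * e)) = Re (c * K) - q * Re (c * e)" for c K e :: complex and q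
      by (simp add: algebra_simps)
    have "h n x = (\<Sum>i<k. Re (u i * lift n (dcov_kernel (\<kappa> n) (z i)) x))
      - p n * (\<Sum>i<k. Re (u i * dcov_mean (\<kappa> n) (z i)))"
      using that unfolding h_def centred_def lin by (simp only: if_True sum_subtractf sum_distrib_left)
    also have "(\<Sum>i<k. Re (u i * lift n (dcov_kernel (\<kappa> n) (z i)) x))
      = lift n (wk.kernel_comb k u z (\<kappa> n)) x"
      by (cases "nm x > r n") (simp_all add: lift_def wk.kernel_comb_def)
    finally show ?thesis .
  qed
  have h_mean: "(\<integral>x. h n x \<partial>D) = 0" for n
  proof (cases "n \<ge> n0")
    case True
    have i: "integrable D (\<lambda>x. u i * centred n (z i) x)" for i
      using centred_measurable centred_norm
      by (intro integrable_mult_right iid.D.integrable_const_bound[of _ 8]) auto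
    have "(\<integral>x. h n x \<partial>D) = (\<Sum>i<k. \<integral>x. Re (u i * centred n (z i) x) \<partial>D)"
      using True i unfolding h_def by (simp del: times_complex.sel)
    also have "\<dots> = (\<Sum>i<k. Re (\<integral>x. u i * centred n (z i) x \<partial>D))" by (simp only: integral_Re[OF i])
    also have "\<dots> = 0" using centred_mean[OF True] by simp
    finally show ?thesis .
  qed (simp add: h_def)
  have mean_comb: "(\<integral>y. wk.kernel_comb k u z (\<kappa> n) y \<partial>\<kappa> n) = (\<Sum>i<k. Re (u i * dcov_mean (\<kappa> n) (z i)))" for n
    by (rule wk.kernel_comb_mean)
  have var: "(\<lambda>n. real n * (\<integral>x. (h n x)\<^sup>2 \<partial>D) / a n) \<longlonglongrightarrow> ?v"
  proof -
    let ?e = "\<lambda>n. \<Sum>i<k. Re (u i * dcov_mean (\<kappa> n) (z i))"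
    have e0: "(\<lambda>n. (?e n)\<^sup>2) \<longlonglongrightarrow> 0"
    proof -
      have "(\<lambda>n. (?e n)\<^sup>2) \<longlonglongrightarrow> (\<Sum>i<k. Re (u i * dcov_mean m (z i)))\<^sup>2"
        by (intro tendsto_intros wk.dcov_mean_tendsto)
      then show ?thesis by (simp add: lim.dcov_mean_eq_0)
    qed
    have "(\<lambda>n. p n * (?e n)\<^sup>2) \<longlonglongrightarrow> 0"
    proof (rule Lim_null_comparison[OF always_eventually e0], rule allI)
      fix n
      have "0 \<le> p n" by (simp add: p_def exceed_prob_def)
      then show "norm (p n * (?e n)\<^sup>2) \<le> (?e n)\<^sup>2"
        using mult_right_mono[OF p_bounds(2)[of n], of "(?e n)\<^sup>2"] by simp
    qed
    from tendsto_diff[OF wk.kernel_comb_sq_tendsto[of k u z] this]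
    have lim: "(\<lambda>n. (\<integral>y. (wk.kernel_comb k u z (\<kappa> n) y)\<^sup>2 \<partial>\<kappa> n) - p n * (?e n)\<^sup>2) \<longlonglongrightarrow> ?v" by simp
    have eqn: "(\<integral>y. (wk.kernel_comb k u z (\<kappa> n) y)\<^sup>2 \<partial>\<kappa> n) - p n * (?e n)\<^sup>2
      = real n * (\<integral>x. (h n x)\<^sup>2 \<partial>D) / a n" if n: "n \<ge> n0" for n
    proof -
      let ?g = "wk.kernel_comb k u z (\<kappa> n)"
      have [measurable]: "?g \<in> borel_measurable borel" by (rule wk.kernel_comb_measurable[OF laws])
      have "(\<integral>x. (cmod (lift n (\<lambda>y. complex_of_real (?g y)) x
        - p n * (\<integral>y. complex_of_real (?g y) \<partial>\<kappa> n)))\<^sup>2 \<partial>D)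
          = p n * (\<integral>y. (cmod (complex_of_real (?g y)))\<^sup>2 \<partial>\<kappa> n) - (p n)\<^sup>2 * (cmod (\<integral>y. complex_of_real (?g y) \<partial>\<kappa> n))\<^sup>2"
        by (rule integral_centred_lift_sq[OF n, where B = "\<Sum>i<k. cmod (u i) * 4"])
          (auto intro: wk.kernel_comb_bound[OF laws])
      moreover have "(cmod (lift n (\<lambda>y. complex_of_real (?g y)) x
        - p n * (\<integral>y. complex_of_real (?g y) \<partial>\<kappa> n)))\<^sup>2 = (h n x)\<^sup>2" for x
      proof -
        have "lift n (\<lambda>y. complex_of_real (?g y)) x - p n * (\<integral>y. complex_of_real (?g y) \<partial>\<kappa> n)
          = complex_of_real (h n x)"
          unfolding comb[OF n] integral_complex_of_real mean_comb by (simp add: lift_def)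
        then show ?thesis by simp
      qed
      ultimately have "(\<integral>x. (h n x)\<^sup>2 \<partial>D) = p n * (\<integral>y. (?g y)\<^sup>2 \<partial>\<kappa> n) - (p n)\<^sup>2 * (?e n)\<^sup>2"
        by (simp only: integral_complex_of_real mean_comb norm_of_real power2_abs)
      then show ?thesis using p_bounds(1,4)[OF n] by (simp add: a_def field_simps power2_eq_square)
    qed
    have "\<forall>\<^sub>F n in sequentially. (\<integral>y. (wk.kernel_comb k u z (\<kappa> n) y)\<^sup>2 \<partial>\<kappa> n) - p n * (?e n)\<^sup>2
      = real n * (\<integral>x. (h n x)\<^sup>2 \<partial>D) / a n"
      using eventually_ge_at_top[of n0] by eventually_elim (rule eqn)
    from Lim_transform_eventually[OF lim this] show ?thesis .
  qed
  have sum_eq: "(\<Sum>i<k. Re (u i * G n (z i) \<omega>)) = (1 / sqrt (a n)) * (\<Sum>j=1..n. h n (Xs j \<omega>))" for n \<omega>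
  proof (cases "n \<ge> n0")
    case True
    have "(\<Sum>i<k. Re (u i * G n (z i) \<omega>))
      = (\<Sum>i<k. \<Sum>j=1..n. (1 / sqrt (a n)) * Re (u i * centred n (z i) (Xs j \<omega>)))"
    proof (rule sum.cong[OF refl])
      fix i
      have "u i * G n (z i) \<omega> = (\<Sum>j=1..n. of_real (1 / sqrt (a n)) * (u i * centred n (z i) (Xs j \<omega>)))"
        using True by (simp add: G_def sum_distrib_left sum_divide_distrib)
      then show "Re (u i * G n (z i) \<omega>) = (\<Sum>j=1..n. (1 / sqrt (a n)) * Re (u i * centred n (z i) (Xs j \<omega>)))"
        by (simp only: Re_sum Re_complex_of_real times_complex.sel(1)[of "of_real _"] Im_complex_of_real mult_zero_left diff_zero)
    qed
    also have "\<dots> = (\<Sum>j=1..n. \<Sum>i<k. (1 / sqrt (a n)) * Re (u i * centred n (z i) (Xs j \<omega>)))"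
      by (rule sum.swap)
    also have "\<dots> = (1 / sqrt (a n)) * (\<Sum>j=1..n. h n (Xs j \<omega>))"
      using True by (simp add: h_def sum_distrib_left del: times_complex.sel)
    finally show ?thesis .
  qed (simp add: G_def h_def)
  have "(\<lambda>n. CLINT \<omega>|M. iexp (\<Sum>i<k. Re (u i * G n (z i) \<omega>))) \<longlonglongrightarrow> exp (- ?v / 2)"
    unfolding sum_eq by (rule iid.row_clt_char[OF h_meas h_bd h_mean a_at_top var])
  also have "complex_of_real (exp (- ?v / 2))
    = (CLINT g|std_gaussian_seq. iexp (\<Sum>i<k. Re (u i * dcov_field m (z i) g)))"
    unfolding wk.kernel_comb_def lim.dcov_field_char[OF finite_lessThan] ..
  finally show ?thesis .
qed

end

text \<open>Young's inequality with parameter \<eta>: the small factor goes to the main term, which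
  is only bounded in mean, and the large factor 1 + 1/\<eta> to the perturbation, which tends to
  0.\<close>

lemma norm_sq_add_diff_le:
  fixes x y :: complex assumes "\<eta> > 0"
  shows "\<bar>(cmod (x + y))\<^sup>2 - (cmod x)\<^sup>2\<bar> \<le> \<eta> * (cmod x)\<^sup>2 + (1 + 1 / \<eta>) * (cmod y)\<^sup>2"
proof -
  have "\<bar>cmod (x + y) - cmod x\<bar> \<le> cmod y"
    using norm_triangle_ineq3[of "x + y" x] by simp
  moreover have "cmod (x + y) + cmod x \<le> 2 * cmod x + cmod y" using norm_triangle_ineq[of x y] by simp
  ultimately have "\<bar>cmod (x + y) - cmod x\<bar> * (cmod (x + y) + cmod x) \<le> cmod y * (2 * cmod x + cmod y)"
    by (intro mult_mono) auto
  moreover have "(cmod (x + y))\<^sup>2 - (cmod x)\<^sup>2 = (cmod (x + y) - cmod x) * (cmod (x + y) + cmod x)"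
    by (simp add: power2_eq_square algebra_simps)
  then have "\<bar>(cmod (x + y))\<^sup>2 - (cmod x)\<^sup>2\<bar> = \<bar>cmod (x + y) - cmod x\<bar> * (cmod (x + y) + cmod x)"
    by (simp add: abs_mult)
  moreover have "2 * (cmod x * cmod y) \<le> \<eta> * (cmod x)\<^sup>2 + (1 / \<eta>) * (cmod y)\<^sup>2"
  proof -
    have "0 \<le> (sqrt \<eta> * cmod x - cmod y / sqrt \<eta>)\<^sup>2" by simp
    also have "\<dots> = \<eta> * (cmod x)\<^sup>2 - 2 * (cmod x * cmod y) + (1 / \<eta>) * (cmod y)\<^sup>2"
      using assms by (simp add: power2_diff power_mult_distrib power_divide)
    finally show ?thesis by simp
  qed
  ultimately show ?thesis by (simp add: algebra_simps power2_eq_square)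
qed

lemma integral_norm_sq_add_diff_le:
  fixes x y :: "'z \<Rightarrow> complex"
  assumes [measurable]: "x \<in> borel_measurable N" "y \<in> borel_measurable N"
    and x: "integrable N (\<lambda>z. (cmod (x z))\<^sup>2)" and y: "integrable N (\<lambda>z. (cmod (y z))\<^sup>2)" and \<eta>: "\<eta> > 0"
  shows "integrable N (\<lambda>z. (cmod (x z + y z))\<^sup>2)"
    and "\<bar>(\<integral>z. (cmod (x z + y z))\<^sup>2 \<partial>N) - (\<integral>z. (cmod (x z))\<^sup>2 \<partial>N)\<bar> \<le> \<eta> * (\<integral>z. (cmod (x z))\<^sup>2 \<partial>N) + (1
      + 1 / \<eta>) * (\<integral>z. (cmod (y z))\<^sup>2 \<partial>N)"
proof -
  have "integrable N (\<lambda>z. 2 * (cmod (x z))\<^sup>2 + 2 * (cmod (y z))\<^sup>2)" using x y by simp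
  then show i: "integrable N (\<lambda>z. (cmod (x z + y z))\<^sup>2)"
  proof (rule Bochner_Integration.integrable_bound)
    show "AE z in N. norm ((cmod (x z + y z))\<^sup>2) \<le> norm (2 * (cmod (x z))\<^sup>2 + 2 * (cmod (y z))\<^sup>2)"
    proof (rule AE_I2)
      fix z
      have "(cmod (x z + y z))\<^sup>2 \<le> 2 * (cmod (x z))\<^sup>2 + 2 * (cmod (y z))\<^sup>2"
        using norm_sq_add_diff_le[of 1 "x z" "y z"] by (simp add: abs_le_iff)
      then show "norm ((cmod (x z + y z))\<^sup>2) \<le> norm (2 * (cmod (x z))\<^sup>2 + 2 * (cmod (y z))\<^sup>2)" by simp
    qed
  qed simp
  have "\<bar>(\<integral>z. (cmod (x z + y z))\<^sup>2 \<partial>N) - (\<integral>z. (cmod (x z))\<^sup>2 \<partial>N)\<bar> = \<bar>\<integral>z. (cmod (x z + y z))\<^sup>2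
    - (cmod (x z))\<^sup>2 \<partial>N\<bar>"
    using i x by simp
  also have "\<dots> \<le> (\<integral>z. \<bar>(cmod (x z + y z))\<^sup>2 - (cmod (x z))\<^sup>2\<bar> \<partial>N)" by (rule integral_abs_bound)
  also have "\<dots> \<le> (\<integral>z. \<eta> * (cmod (x z))\<^sup>2 + (1 + 1 / \<eta>) * (cmod (y z))\<^sup>2 \<partial>N)"
    using i x y by (intro integral_mono norm_sq_add_diff_le \<eta>) auto
  also have "\<dots> = \<eta> * (\<integral>z. (cmod (x z))\<^sup>2 \<partial>N) + (1 + 1 / \<eta>) * (\<integral>z. (cmod (y z))\<^sup>2 \<partial>N)"
    using x y by simp
  finally show "\<bar>(\<integral>z. (cmod (x z + y z))\<^sup>2 \<partial>N) - (\<integral>z. (cmod (x z))\<^sup>2 \<partial>N)\<bar> \<le> \<eta> * (\<integral>z. (cmod (x z))\<^sup>2 \<partial>N)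
    + (1 + 1 / \<eta>) * (\<integral>z. (cmod (y z))\<^sup>2 \<partial>N)" .
qed

section \<open>Passage to the finite weighted measure\<close>

context dcov_setting
begin

definition "N = density \<mu> (\<lambda>z. ennreal (w z))"

text \<open>Division by the root of the density turns |f|^2 d\<mu> into the squared modulus
  integrated over N. Where the weight is 0 the value is 0 by division by zero, which is correct for
  functions that vanish there.\<close>

definition scaled :: "(real \<times> (real^'d) \<Rightarrow> complex) \<Rightarrow> real \<times> (real^'d) \<Rightarrow> complex" where
  "scaled f z = f z / of_real (sqrt (w z))"

lemma w_measurable [measurable]: "w \<in> borel_measurable borel"
  unfolding dcov_weight_def[abs_def] by measurable

lemma sqrt_w_measurable [measurable]: "(\<lambda>z. sqrt (w z)) \<in> borel_measurable borel"
  by (rule borel_measurable_continuous_on[OF _ w_measurable]) (intro continuous_intros)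

lemma sets_N [measurable_cong]: "sets N = sets borel"
  by (simp add: N_def sets_\<mu>)

lemma finite_N: "finite_measure N"
proof
  have "emeasure N (space N) = (\<integral>\<^sup>+z. ennreal (w z) \<partial>\<mu>)"
    unfolding N_def using sets_eq_imp_space_eq[OF sets_\<mu>]
    by (subst emeasure_density) (auto simp: sets_\<mu> intro!: nn_integral_cong)
  then show "emeasure N (space N) \<noteq> \<infinity>" using weight_finite by simp
qed

abbreviation "B \<equiv> measure N (space N)"

lemma w_eq_0: "w z = 0 \<Longrightarrow> fst z = 0 \<or> snd z = 0"
  using \<beta> by (auto simp: dcov_weight_def min_def split: if_splits)

lemma cmod_scaled_sq: "(cmod (scaled f z))\<^sup>2 = (cmod (f z))\<^sup>2 / w z"
  using weight_nonneg[of z] by (simp add: scaled_def norm_divide power_divide)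

lemma scaled_sq_le: "(cmod (f z))\<^sup>2 \<le> c * w z \<Longrightarrow> c \<ge> 0 \<Longrightarrow> (cmod (scaled f z))\<^sup>2 \<le> c"
  unfolding cmod_scaled_sq using weight_nonneg[of z] by (cases "w z = 0") (auto simp: field_simps)

lemma scaled_measurable: "f \<in> borel_measurable borel \<Longrightarrow> scaled f \<in> borel_measurable borel"
  unfolding scaled_def[abs_def]
  by (rule borel_measurable_divide[OF _ measurable_compose[OF sqrt_w_measurable borel_measurable_of_real]])

lemma integral_scaled:
  assumes [measurable]: "f \<in> borel_measurable borel" and f: "\<And>z. fst z = 0 \<or> snd z = 0 \<Longrightarrow> f z = 0"
  shows "(\<integral>z. (cmod (scaled f z))\<^sup>2 \<partial>N) = (\<integral>z. (cmod (f z))\<^sup>2 \<partial>\<mu>)"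
    and "integrable N (\<lambda>z. (cmod (scaled f z))\<^sup>2) \<longleftrightarrow> integrable \<mu> (\<lambda>z. (cmod (f z))\<^sup>2)"
proof -
  have [measurable]: "scaled f \<in> borel_measurable borel" by (rule scaled_measurable) fact
  have eq: "w z *\<^sub>R (cmod (scaled f z))\<^sup>2 = (cmod (f z))\<^sup>2" for z
    using f[OF w_eq_0[of z]] by (cases "w z = 0") (simp_all add: cmod_scaled_sq)
  show "(\<integral>z. (cmod (scaled f z))\<^sup>2 \<partial>N) = (\<integral>z. (cmod (f z))\<^sup>2 \<partial>\<mu>)"
    unfolding N_def by (subst integral_density) (auto simp: eq weight_nonneg simp del: real_scaleR_def)
  show "integrable N (\<lambda>z. (cmod (scaled f z))\<^sup>2) \<longleftrightarrow> integrable \<mu> (\<lambda>z. (cmod (f z))\<^sup>2)"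
    unfolding N_def by (subst integrable_density) (auto simp: eq weight_nonneg simp del: real_scaleR_def)
qed

lemma lift_pair_measurable:
  fixes F :: "real \<times> (real^'d) \<Rightarrow> real \<times> (real^'d) \<Rightarrow> complex"
  assumes F: "(\<lambda>q. F (fst q) (snd q)) \<in> borel_measurable borel" and j: "j \<ge> 1"
  shows "(\<lambda>q. lift n (F (fst q)) (Xs j (snd q))) \<in> borel_measurable (borel \<Otimes>\<^sub>M M)"
proof -
  have [measurable]: "Xs j \<in> borel_measurable M" by (rule iid.rv[OF j])
  have "(\<lambda>q. (fst q, (nm (Xs j (snd q)) / r n, angle nm (Xs j (snd q))))) \<in> borel_measurable ((borel :: (real \<times> (real^'d)) measure) \<Otimes>\<^sub>M M)"
    by (intro borel_measurable_Pair) measurable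
  from measurable_compose[OF this F]
  have [measurable]: "(\<lambda>q. F (fst q) (nm (Xs j (snd q)) / r n, angle nm (Xs j (snd q)))) \<in> borel_measurable (borel \<Otimes>\<^sub>M M)"
    by simp
  show ?thesis unfolding lift_def by measurable
qed

lemma kernel_pair_measurable: "(\<lambda>q. dcov_kernel (\<kappa> n) (fst q) (snd q)) \<in> borel_measurable borel"
  by (rule borel_measurable_continuous_onI[OF pair_law.dcov_kernel_continuous[OF laws]])

lemma dcov_mean_measurable [measurable]: "dcov_mean (\<kappa> n) \<in> borel_measurable borel"
proof -
  interpret k: pair_law "\<kappa> n" by (rule laws)
  have "(\<lambda>q. dcov_kernel (\<kappa> n) (fst q) (snd q)) \<in> borel_measurable (borel \<Otimes>\<^sub>M \<kappa> n)"
    using kernel_pair_measurable[of n]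
    unfolding measurable_cong_sets[OF sets_pair_measure_cong[OF refl k.sets_law] refl] borel_prod .
  then have "(\<lambda>z. \<integral>y. dcov_kernel (\<kappa> n) z y \<partial>\<kappa> n) \<in> borel_measurable borel"
    by (intro k.borel_measurable_lebesgue_integral) (simp add: case_prod_unfold)
  then show ?thesis by (simp add: dcov_mean_def[abs_def])
qed

lemma G_pair_measurable: "(\<lambda>q. G n (fst q) (snd q)) \<in> borel_measurable (borel \<Otimes>\<^sub>M M)"
proof -
  have [measurable]: "(\<lambda>q. centred n (fst q) (Xs j (snd q))) \<in> borel_measurable (borel \<Otimes>\<^sub>M M)"
    if "j \<in> {1..n}" for j
  proof -
    have [measurable]: "(\<lambda>q. lift n (dcov_kernel (\<kappa> n) (fst q)) (Xs j (snd q))) \<in> borel_measurable (borel \<Otimes>\<^sub>M M)"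
      by (rule lift_pair_measurable[OF kernel_pair_measurable]) (use that in auto)
    show ?thesis unfolding centred_def by measurable
  qed
  have [measurable]: "(\<lambda>q. \<Sum>j=1..n. centred n (fst q) (Xs j (snd q))) \<in> borel_measurable (borel \<Otimes>\<^sub>M M)"
    by (rule borel_measurable_sum) fact
  show ?thesis unfolding G_def by measurable
qed

lemma H_pair_measurable: "(\<lambda>q. H n (fst q) (snd q)) \<in> borel_measurable (borel \<Otimes>\<^sub>M M)"
proof -
  interpret k: pair_law "\<kappa> n" by (rule laws)
  have c1: "(\<lambda>q :: (real \<times> (real^'d)) \<times> (real \<times> (real^'d)). dcov_fst (\<kappa> n) (fst (fst q)) (fst (snd q))) \<in> borel_measurable borel"
  proof (rule borel_measurable_continuous_onI)
    have "continuous_on UNIV (\<lambda>q :: (real \<times> (real^'d)) \<times> (real \<times> (real^'d)). (fst (fst q), fst (snd q)))"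
      by (intro continuous_intros)
    from continuous_on_compose2[OF k.dcov_fst_continuous this]
    show "continuous_on UNIV (\<lambda>q :: (real \<times> (real^'d)) \<times> (real \<times> (real^'d)). dcov_fst (\<kappa> n) (fst (fst q)) (fst (snd q)))"
      by simp
  qed
  have c2: "(\<lambda>q :: (real \<times> (real^'d)) \<times> (real \<times> (real^'d)). dcov_snd (\<kappa> n) (snd (fst q)) (snd (snd q))) \<in> borel_measurable borel"
  proof (rule borel_measurable_continuous_onI)
    have "continuous_on UNIV (\<lambda>q :: (real \<times> (real^'d)) \<times> (real \<times> (real^'d)). (snd (fst q), snd (snd q)))"
      by (intro continuous_intros)
    from continuous_on_compose2[OF k.dcov_snd_continuous this]
    show "continuous_on UNIV (\<lambda>q :: (real \<times> (real^'d)) \<times> (real \<times> (real^'d)). dcov_snd (\<kappa> n) (snd (fst q)) (snd (snd q)))"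
      by simp
  qed
  have [measurable]: "(\<lambda>q. U n (fst (fst q)) (snd q)) \<in> borel_measurable ((borel :: (real \<times> (real^'d)) measure) \<Otimes>\<^sub>M M)"
    unfolding U_def
    by (intro borel_measurable_sum lift_pair_measurable[of "\<lambda>z y. dcov_fst (\<kappa> n) (fst z) (fst y)", OF c1]) auto
  have [measurable]: "(\<lambda>q. V n (snd (fst q)) (snd q)) \<in> borel_measurable ((borel :: (real \<times> (real^'d)) measure) \<Otimes>\<^sub>M M)"
    unfolding V_def
    by (intro borel_measurable_sum lift_pair_measurable[of "\<lambda>z y. dcov_snd (\<kappa> n) (snd z) (snd y)", OF c2]) auto
  show ?thesis unfolding H_def by measurable
qed

definition cnt :: "nat \<Rightarrow> 'w \<Rightarrow> real" where
  "cnt n \<omega> = (\<Sum>j=1..n. if nm (Xs j \<omega>) > r n then 1 else 0)"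

abbreviation "sample \<omega> \<equiv> (\<lambda>j. Xs j \<omega>)"

lemma emp_cf_eq:
  "emp_cf nm n (r n) (sample \<omega>) s t
    = (1 / of_real (cnt n \<omega>)) * (\<Sum>j=1..n. lift n (\<lambda>y. iexp (s * fst y + t \<bullet> snd y)) (Xs j \<omega>))"
proof -
  have "(\<Sum>j=1..n. if nm (Xs j \<omega>) > r n then 1 else 0) = complex_of_real (cnt n \<omega>)"
    unfolding cnt_def of_real_sum by (intro sum.cong) auto
  moreover have "(if nm (Xs j \<omega>) > r n then iexp (s * (nm (Xs j \<omega>) / r n) + t \<bullet> angle nm (Xs j \<omega>)) else 0)
      = lift n (\<lambda>y. iexp (s * fst y + t \<bullet> snd y)) (Xs j \<omega>)" for j
    by (simp add: lift_def)
  ultimately show ?thesis unfolding emp_cf_def by (simp only:)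
qed

lemma cnt_nonneg: "cnt n \<omega> \<ge> 0"
  unfolding cnt_def by (intro sum_nonneg) auto

lemma n_p_hat: "real n * p_hat nm n (r n) (sample \<omega>) = cnt n \<omega>"
  by (cases "n = 0") (simp_all add: p_hat_def cnt_def)

lemma p_hat_eq_0: "p_hat nm n (r n) (sample \<omega>) = 0 \<longleftrightarrow> cnt n \<omega> = 0"
  using n_p_hat[of n \<omega>] by (cases "n = 0") (auto simp: cnt_def p_hat_def)

text \<open>At frequency (0, 0) the empirical characteristic function is 1, or 0 when no observation
  exceeds; in both cases the difference cancels exactly. This is required for every sample, since
  \<mu> may be infinite on these sets.\<close>

lemma emp_C_zero: "s = 0 \<or> t = 0 \<Longrightarrow> emp_C nm n (r n) (sample \<omega>) s t = 0"
proof -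
  have 1: "emp_cf nm n (r n) (sample \<omega>) 0 0 = (if cnt n \<omega> = 0 then 0 else 1)"
  proof -
    have "(\<Sum>j=1..n. lift n (\<lambda>y. iexp (0 * fst y + 0 \<bullet> snd y)) (Xs j \<omega>)) = of_real (cnt n \<omega>)"
      unfolding cnt_def of_real_sum by (intro sum.cong) (auto simp: lift_def)
    then show ?thesis unfolding emp_cf_eq by simp
  qed
  have 2: "cnt n \<omega> = 0 \<Longrightarrow> emp_cf nm n (r n) (sample \<omega>) s t = 0" for s t by (simp add: emp_cf_eq)
  show "s = 0 \<or> t = 0 \<Longrightarrow> emp_C nm n (r n) (sample \<omega>) s t = 0"
    using 1 2 by (cases "cnt n \<omega> = 0") (auto simp: emp_C_def)
qed

lemma emp_C_measurable:
  "(\<lambda>q. emp_C nm n (r n) (sample (snd q)) (fst (fst q)) (snd (fst q))) \<in> borel_measurable (borel \<Otimes>\<^sub>M M)"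
proof -
  have meas: "(\<lambda>q. emp_cf nm n (r n) (sample (snd q)) (f (fst q)) (g (fst q))) \<in> borel_measurable (borel \<Otimes>\<^sub>M M)"
    if f: "continuous_on UNIV f" and g: "continuous_on UNIV g" for f :: "real \<times> (real^'d) \<Rightarrow> real"
      and g :: "real \<times> (real^'d) \<Rightarrow> real^'d"
  proof -
    have c: "(\<lambda>q :: (real \<times> (real^'d)) \<times> (real \<times> (real^'d)). iexp (f (fst q) * fst (snd q)
      + g (fst q) \<bullet> snd (snd q))) \<in> borel_measurable borel"
      by (intro borel_measurable_continuous_onI continuous_intros continuous_on_compose2[OF f] continuous_on_compose2[OF g]) auto
    have [measurable]: "(\<lambda>q. \<Sum>j=1..n. lift n (\<lambda>y. iexp (f (fst q) * fst y
      + g (fst q) \<bullet> snd y)) (Xs j (snd q))) \<in> borel_measurable (borel \<Otimes>\<^sub>M M)"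
      by (intro borel_measurable_sum lift_pair_measurable[of "\<lambda>z y. iexp (f z * fst y
        + g z \<bullet> snd y)", OF c]) auto
    have [measurable]: "(\<lambda>q. cnt n (snd q)) \<in> borel_measurable ((borel :: (real \<times> (real^'d)) measure) \<Otimes>\<^sub>M M)"
    proof -
      have "(\<lambda>q. if nm (Xs j (snd q)) > r n then 1 else 0 :: real) \<in> borel_measurable ((borel :: (real \<times> (real^'d)) measure) \<Otimes>\<^sub>M M)"
        if "j \<in> {1..n}" for j
      proof -
        have [measurable]: "Xs j \<in> borel_measurable M" by (rule iid.rv) (use that in auto)
        show ?thesis by measurable
      qed
      then show ?thesis unfolding cnt_def by (intro borel_measurable_sum)
    qed
    show ?thesis unfolding emp_cf_eq by measurable
  qed
  have [measurable]: "(\<lambda>q. emp_cf nm n (r n) (sample (snd q)) (fst (fst q)) (snd (fst q))) \<in> borel_measurable (borel \<Otimes>\<^sub>M M)"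
    "(\<lambda>q. emp_cf nm n (r n) (sample (snd q)) (fst (fst q)) 0) \<in> borel_measurable ((borel :: (real \<times> (real^'d)) measure) \<Otimes>\<^sub>M M)"
    "(\<lambda>q. emp_cf nm n (r n) (sample (snd q)) 0 (snd (fst q))) \<in> borel_measurable ((borel :: (real \<times> (real^'d)) measure) \<Otimes>\<^sub>M M)"
    by (intro meas continuous_intros)+
  show ?thesis unfolding emp_C_def by measurable
qed

lemma cnt_measurable [measurable]: "cnt n \<in> borel_measurable M"
proof -
  have "(\<lambda>\<omega>. if nm (Xs j \<omega>) > r n then 1 else 0 :: real) \<in> borel_measurable M" if "j \<in> {1..n}" for j
  proof -
    have [measurable]: "Xs j \<in> borel_measurable M" by (rule iid.rv) (use that in auto)
    show ?thesis by measurable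
  qed
  then show ?thesis unfolding cnt_def[abs_def] by (intro borel_measurable_sum)
qed

definition Tn :: "nat \<Rightarrow> 'w \<Rightarrow> real" where
  "Tn n \<omega> = emp_dcov nm \<mu> n (r n) (sample \<omega>)"

lemma Tn_eq:
  assumes \<omega>: "\<omega> \<in> space M"
  shows "Tn n \<omega> = (if cnt n \<omega>
    = 0 then 0 else \<integral>z. (cmod (scaled (\<lambda>z. emp_C nm n (r n) (sample \<omega>) (fst z) (snd z)) z))\<^sup>2 \<partial>N)"
proof -
  have "(\<lambda>z. emp_C nm n (r n) (sample \<omega>) (fst z) (snd z)) \<in> borel_measurable borel"
    using measurable_compose[OF measurable_Pair2'[OF \<omega>] emp_C_measurable[of n]] by simp
  then show ?thesis
    unfolding Tn_def emp_dcov_def p_hat_eq_0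
    by (subst integral_scaled) (auto simp: emp_C_zero case_prod_unfold)
qed

text \<open>The measure \<mu> may fail to be sigma-finite, so measurability of the parametrised
  integral is obtained over the finite measure N.\<close>

lemma Tn_measurable [measurable]: "Tn n \<in> borel_measurable M"
proof -
  interpret N: finite_measure N by (rule finite_N)
  have sw: "sets (M \<Otimes>\<^sub>M N) = sets (M \<Otimes>\<^sub>M borel)" by (rule sets_pair_measure_cong[OF refl sets_N])
  have "(\<lambda>q. emp_C nm n (r n) (sample (fst q)) (fst (snd q)) (snd (snd q))) \<in> borel_measurable (M \<Otimes>\<^sub>M borel)"
    using measurable_compose[OF measurable_pair_swap' emp_C_measurable[of n]]
    by (simp add: case_prod_unfold)
  then have [measurable]: "(\<lambda>q. emp_C nm n (r n) (sample (fst q)) (fst (snd q)) (snd (snd q))) \<in> borel_measurable (M \<Otimes>\<^sub>M N)"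
    unfolding measurable_cong_sets[OF sw refl] .
  have "(\<lambda>\<omega>. \<integral>z. (cmod (scaled (\<lambda>z. emp_C nm n (r n) (sample \<omega>) (fst z) (snd z)) z))\<^sup>2 \<partial>N) \<in> borel_measurable M"
    unfolding scaled_def by (intro N.borel_measurable_lebesgue_integral)
      (simp add: case_prod_unfold, measurable)
  then have "(\<lambda>\<omega>. if cnt n \<omega>
    = 0 then 0 else \<integral>z. (cmod (scaled (\<lambda>z. emp_C nm n (r n) (sample \<omega>) (fst z) (snd z)) z))\<^sup>2 \<partial>N) \<in> borel_measurable M"
    by measurable
  then show ?thesis by (subst measurable_cong[OF Tn_eq])
qed

lemma Tn_nonneg: "Tn n \<omega> \<ge> 0"
  unfolding Tn_def emp_dcov_def by (auto intro!: Bochner_Integration.integral_nonneg)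

lemma centred_zero: "fst z = 0 \<or> snd z = 0 \<Longrightarrow> dcov_mean (\<kappa> n) z = 0"
  "fst z = 0 \<or> snd z = 0 \<Longrightarrow> G n z \<omega> = 0" "fst z = 0 \<or> snd z = 0 \<Longrightarrow> H n z \<omega> = 0"
proof -
  assume z: "fst z = 0 \<or> snd z = 0"
  interpret k: pair_law "\<kappa> n" by (rule laws)
  have k0: "dcov_kernel (\<kappa> n) z y = 0" for y by (rule k.dcov_zero[OF z])
  show d: "dcov_mean (\<kappa> n) z = 0" by (simp add: dcov_mean_def k0)
  have "centred n z x = 0" for x by (simp add: centred_def lift_def k0 d)
  then show "G n z \<omega> = 0" by (simp add: G_def)
  have "dcov_fst (\<kappa> n) 0 x = 0" "dcov_snd (\<kappa> n) 0 \<theta> = 0" for x \<theta>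
    by (simp_all add: dcov_fst_def dcov_snd_def cf_fst_def cf_snd_def k.prob_space)
  then have "U n 0 \<omega> = 0" "V n 0 \<omega> = 0" by (simp_all add: U_def V_def lift_def)
  then show "H n z \<omega> = 0" using z by (auto simp: H_def)
qed

text \<open>An exact identity on the event of at least one exceedance: the empirical difference does
  not change when the characters are recentred by the constants of \<open>\<kappa> n\<close>. The
  bias appears because \<open>G n\<close> is centred by its unconditional mean.\<close>

lemma emp_C_decomposition:
  assumes n: "n \<ge> n0" and c: "cnt n \<omega> \<noteq> 0"
  shows "emp_C nm n (r n) (sample \<omega>) s t = of_real (sqrt (a n) / cnt n \<omega>) *
    (G n (s, t) \<omega> + (of_real (sqrt (a n)) * dcov_mean (\<kappa> n) (s, t) - of_real (a n / cnt n \<omega>) * H n (s, t) \<omega>))"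
proof -
  define E where "E = (\<Sum>j=1..n. lift n (\<lambda>y. iexp (s * fst y + t \<bullet> snd y)) (Xs j \<omega>))"
  define E1 where "E1 = (\<Sum>j=1..n. lift n (\<lambda>y. iexp (s * fst y)) (Xs j \<omega>))"
  define E2 where "E2 = (\<Sum>j=1..n. lift n (\<lambda>y. iexp (t \<bullet> snd y)) (Xs j \<omega>))"
  define c1 where "c1 = cf_fst (\<kappa> n) s"
  define c2 where "c2 = cf_snd (\<kappa> n) t"
  define N' where "N' = complex_of_real (cnt n \<omega>)"
  have N': "(\<Sum>j=1..n. lift n (\<lambda>_. 1) (Xs j \<omega>)) = N'"
    unfolding N'_def cnt_def of_real_sum by (intro sum.cong) (auto simp: lift_def)
  have a1: "a n \<ge> 1" by (rule p_bounds(3)[OF n])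
  have U: "U n s \<omega> = E1 - c1 * N'"
  proof -
    have "lift n (\<lambda>y. dcov_fst (\<kappa> n) s (fst y)) x = lift n (\<lambda>y. iexp (s * fst y)) x
      - c1 * lift n (\<lambda>_. 1) x" for x
      by (simp add: lift_def dcov_fst_def c1_def)
    then show ?thesis by (simp add: U_def E1_def N'[symmetric] sum_subtractf sum_distrib_left)
  qed
  have V: "V n t \<omega> = E2 - c2 * N'"
  proof -
    have "lift n (\<lambda>y. dcov_snd (\<kappa> n) t (snd y)) x = lift n (\<lambda>y. iexp (t \<bullet> snd y)) x
      - c2 * lift n (\<lambda>_. 1) x" for x
      by (simp add: lift_def dcov_snd_def c2_def)
    then show ?thesis by (simp add: V_def E2_def N'[symmetric] sum_subtractf sum_distrib_left)
  qed
  have K: "(\<Sum>j=1..n. lift n (dcov_kernel (\<kappa> n) (s, t)) (Xs j \<omega>)) = E - c2 * E1 - c1 * E2 + c1 * c2 * N'"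
  proof -
    have "lift n (dcov_kernel (\<kappa> n) (s, t)) x = lift n (\<lambda>y. iexp (s * fst y + t \<bullet> snd y)) x
      - c2 * lift n (\<lambda>y. iexp (s * fst y)) x
        - c1 * lift n (\<lambda>y. iexp (t \<bullet> snd y)) x + c1 * c2 * lift n (\<lambda>_. 1) x" for x
      by (simp add: lift_def dcov_kernel_def dcov_fst_def dcov_snd_def c1_def c2_def exp_add algebra_simps)
    then show ?thesis by (simp add: E_def E1_def E2_def N'[symmetric] sum_subtractf sum.distrib sum_distrib_left)
  qed
  have sa: "complex_of_real (sqrt (a n)) * complex_of_real (sqrt (a n)) = of_real (a n)"
    "complex_of_real (sqrt (a n)) \<noteq> 0" "complex_of_real (a n) \<noteq> 0"
    using a1 by (simp_all flip: of_real_mult)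
  have G: "of_real (sqrt (a n)) * G n (s, t) \<omega> = (E - c2 * E1 - c1 * E2 + c1 * c2 * N')
    - of_real (a n) * dcov_mean (\<kappa> n) (s, t)"
    using n sa unfolding K[symmetric] by (simp add: G_def centred_def sum_subtractf a_def)
  have H: "of_real (sqrt (a n)) * (of_real (a n) * H n (s, t) \<omega>) = (E1 - c1 * N') * (E2 - c2 * N')"
    using n sa by (simp add: H_def U V)
  have emp: "emp_C nm n (r n) (sample \<omega>) s t = E / N' - (E1 / N') * (E2 / N')"
    unfolding emp_C_def emp_cf_eq by (simp add: E_def E1_def E2_def N'_def)
  have N0: "N' \<noteq> 0" using c by (simp add: N'_def)
  have "of_real (sqrt (a n) / cnt n \<omega>) * (G n (s, t) \<omega>
    + (of_real (sqrt (a n)) * dcov_mean (\<kappa> n) (s, t) - of_real (a n / cnt n \<omega>) * H n (s, t) \<omega>))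
      = (of_real (sqrt (a n)) * G n (s, t) \<omega> + of_real (sqrt (a n)) * of_real (sqrt (a n)) * dcov_mean (\<kappa> n) (s, t)) / N'
        - of_real (sqrt (a n)) * (of_real (a n) * H n (s, t) \<omega>) / (N' * N')"
    using N0 by (simp add: N'_def field_simps)
  also have "\<dots> = (E - c2 * E1 - c1 * E2 + c1 * c2 * N') / N' - (E1 - c1 * N') * (E2 - c2 * N') / (N' * N')"
    unfolding sa G H by simp
  also have "\<dots> = E / N' - (E1 / N') * (E2 / N')" using N0 by (simp add: field_simps)
  finally show ?thesis unfolding emp ..
qed

text \<open>The count is binomial with mean \<open>a n\<close>, and its variance is at most its
  mean; it is treated as a row sum of the lifted constant 1.\<close>

lemma cnt_second_moment:
  assumes n: "n \<ge> n0"
  shows "integrable M (\<lambda>\<omega>. (cnt n \<omega> / a n - 1)\<^sup>2)" "(\<integral>\<omega>. (cnt n \<omega> / a n - 1)\<^sup>2 \<partial>M) \<le> 1 / a n"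
proof -
  define u where "u x = lift n (\<lambda>_. 1) x - complex_of_real (p n)" for x
  have k: "prob_space (\<kappa> n)" using laws[of n] by (simp add: pair_law_def)
  have um: "u \<in> borel_measurable borel" unfolding u_def[abs_def] by measurable
  have ub: "cmod (u x) \<le> 2" for x
    unfolding u_def using p_bounds(1)[OF n] p_bounds(2)[of n]
    by (intro cmod_diff_one_le_2) (auto simp: lift_def)
  have i1: "(\<integral>y. 1 \<partial>\<kappa> n) = (1 :: complex)" using prob_space.prob_space[OF k] by simp
  have "integrable D (lift n (\<lambda>_. 1 :: complex))" by (rule iid.D.integrable_const_bound[of _ 1])
    (auto simp: lift_def)
  then have mean: "(\<integral>x. u x \<partial>D) = 0"
    unfolding u_def using integral_lift[OF n, of "\<lambda>_. 1 :: complex"] iid.D.prob_space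
    by (simp add: i1 scaleR_conv_of_real prob_space.prob_space[OF k])
  have sq: "(\<integral>x. (cmod (u x))\<^sup>2 \<partial>D) \<le> p n"
    using integral_centred_lift_sq[OF n, of "\<lambda>_. 1" 1] prob_space.prob_space[OF k] by (simp add: u_def)
  have eq: "(cnt n \<omega> / a n - 1)\<^sup>2 = (cmod (\<Sum>j=1..n. u (Xs j \<omega>)))\<^sup>2 / (a n)\<^sup>2" for \<omega>
  proof -
    have "(\<Sum>j=1..n. u (Xs j \<omega>)) = complex_of_real (cnt n \<omega> - a n)"
      unfolding cnt_def of_real_diff of_real_sum a_def u_def sum_subtractf
      by (simp add: lift_def if_distrib cong: if_cong)
    then have "(cmod (\<Sum>j=1..n. u (Xs j \<omega>)))\<^sup>2 = (cnt n \<omega> - a n)\<^sup>2" by (simp only: norm_of_real power2_abs)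
    moreover have "cnt n \<omega> / a n - 1 = (cnt n \<omega> - a n) / a n" using p_bounds(3)[OF n]
      by (simp add: field_simps)
    ultimately show ?thesis by (simp add: power_divide)
  qed
  show "integrable M (\<lambda>\<omega>. (cnt n \<omega> / a n - 1)\<^sup>2)"
    unfolding eq by (intro integrable_divide bounded_rv_integrable bounded_rv_cmod_sq iid.psum_bounded_rv(1)[OF um ub])
  have "(\<integral>\<omega>. (cnt n \<omega> / a n - 1)\<^sup>2 \<partial>M) = real n * (\<integral>x. (cmod (u x))\<^sup>2 \<partial>D) / (a n)\<^sup>2"
    unfolding eq using iid.expectation_cmod_psum_sq[OF um ub mean, of n] by simp
  also have "\<dots> \<le> real n * p n / (a n)\<^sup>2" using sq by (intro divide_right_mono mult_left_mono) auto
  also have "\<dots> = 1 / a n" using p_bounds(3)[OF n] by (simp add: a_def[symmetric] power2_eq_square)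
  finally show "(\<integral>\<omega>. (cnt n \<omega> / a n - 1)\<^sup>2 \<partial>M) \<le> 1 / a n" .
qed

text \<open>\<open>W\<close> is the main term, \<open>h\<close> the quadratic remainder and
  \<open>d\<close> the deterministic bias, each measured by its squared norm over N. The three are
  kept apart because they vanish, or fail to vanish, for different reasons.\<close>

definition W where "W n \<omega> = (\<integral>z. (cmod (scaled (\<lambda>z. G n z \<omega>) z))\<^sup>2 \<partial>N)"
definition h where "h n \<omega> = (\<integral>z. (cmod (scaled (\<lambda>z. H n z \<omega>) z))\<^sup>2 \<partial>N)"
definition d where "d n = (\<integral>z. (cmod (scaled (dcov_mean (\<kappa> n)) z))\<^sup>2 \<partial>N)"

lemma scaled_pair_measurable:
  assumes "(\<lambda>q. F (fst q) (snd q)) \<in> borel_measurable (borel \<Otimes>\<^sub>M K)"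
  shows "(\<lambda>(z, \<omega>). scaled (\<lambda>z. F z \<omega>) z) \<in> borel_measurable (N \<Otimes>\<^sub>M K)"
proof -
  note assms [measurable]
  have "(\<lambda>q. F (fst q) (snd q) / of_real (sqrt (w (fst q)))) \<in> borel_measurable (borel \<Otimes>\<^sub>M K)" by measurable
  then show ?thesis
    unfolding measurable_cong_sets[OF sets_pair_measure_cong[OF sets_N refl] refl]
    by (simp add: scaled_def case_prod_unfold)
qed

lemma scaled_second_moment:
  assumes "integrable K (\<lambda>\<omega>. (cmod (F z \<omega>))\<^sup>2)" "(\<integral>\<omega>. (cmod (F z \<omega>))\<^sup>2 \<partial>K) \<le> c * w z" "c \<ge> 0"
  shows "integrable K (\<lambda>\<omega>. (cmod (scaled (\<lambda>z. F z \<omega>) z))\<^sup>2)" "(\<integral>\<omega>. (cmod (scaled (\<lambda>z. F z \<omega>) z))\<^sup>2 \<partial>K) \<le> c"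
proof -
  show "integrable K (\<lambda>\<omega>. (cmod (scaled (\<lambda>z. F z \<omega>) z))\<^sup>2)" unfolding cmod_scaled_sq using assms(1) by simp
  show "(\<integral>\<omega>. (cmod (scaled (\<lambda>z. F z \<omega>) z))\<^sup>2 \<partial>K) \<le> c"
    unfolding cmod_scaled_sq using assms weight_nonneg[of z] by (cases "w z = 0") (auto simp: field_simps)
qed

lemma G_process:
  "AE \<omega> in M. integrable N (\<lambda>z. (cmod (scaled (\<lambda>z. G n z \<omega>) z))\<^sup>2)"
  "(\<integral>\<omega>. W n \<omega> \<partial>M) \<le> K1 * B" "integrable M (W n)"
  using AE_integrable_second_moment_process(2,3,4)[OF finite_N prob_space_axioms scaled_pair_measurable[OF G_pair_measurable] scaled_second_moment[OF G_sq(1) G_sq_le]]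
    K1_pos by (simp_all add: W_def[abs_def] less_imp_le)

lemma H_process:
  assumes n: "n \<ge> n0"
  shows "AE \<omega> in M. integrable N (\<lambda>z. (cmod (scaled (\<lambda>z. H n z \<omega>) z))\<^sup>2)"
  "(\<integral>\<omega>. h n \<omega> \<partial>M) \<le> (7 * K1 / a n) * B" "integrable M (h n)"
proof -
  have le: "(\<integral>\<omega>. (cmod (H n z \<omega>))\<^sup>2 \<partial>M) \<le> (7 * K1 / a n) * w z" for z using H_sq(2)[OF n, of z] by simp
  have "0 \<le> 7 * K1 / a n" using K1_pos p_bounds(3)[OF n] by simp
  then show "AE \<omega> in M. integrable N (\<lambda>z. (cmod (scaled (\<lambda>z. H n z \<omega>) z))\<^sup>2)"
    "(\<integral>\<omega>. h n \<omega> \<partial>M) \<le> (7 * K1 / a n) * B" "integrable M (h n)"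
    using AE_integrable_second_moment_process(2,3,4)[OF finite_N prob_space_axioms scaled_pair_measurable[OF H_pair_measurable] scaled_second_moment[OF H_sq(1) le]]
    by (simp_all add: h_def[abs_def])
qed

lemma scaled_dcov_mean_sq_le: "(cmod (scaled (dcov_mean (\<kappa> n)) z))\<^sup>2 \<le> K1"
proof (cases "n \<ge> n0")
  case True
  show ?thesis by (rule scaled_sq_le[OF dcov_mean_sq_le[OF True]]) (use K1_pos in simp)
next
  case False
  then show ?thesis using K1_pos by (simp add: scaled_def \<kappa>_def lim.dcov_mean_eq_0)
qed

lemma d_integrable: "integrable N (\<lambda>z. (cmod (scaled (dcov_mean (\<kappa> n)) z))\<^sup>2)"
proof -
  interpret N: finite_measure N by (rule finite_N)
  have [measurable]: "scaled (dcov_mean (\<kappa> n)) \<in> borel_measurable borel"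
    by (rule scaled_measurable) measurable
  show ?thesis by (rule N.integrable_const_bound[of _ K1]) (simp_all add: scaled_dcov_mean_sq_le)
qed

text \<open>Pointwise asymptotic independence and the bound \<open>K1\<close> on the finite measure
  give convergence without a rate, which is all that (1) requires.\<close>

lemma d_tendsto: "d \<longlonglongrightarrow> 0"
proof -
  interpret N: finite_measure N by (rule finite_N)
  have [measurable]: "scaled (dcov_mean (\<kappa> n)) \<in> borel_measurable borel" for n
    by (rule scaled_measurable) measurable
  have "(\<lambda>n. \<integral>z. (cmod (scaled (dcov_mean (\<kappa> n)) z))\<^sup>2 \<partial>N) \<longlonglongrightarrow> (\<integral>z. 0 \<partial>N)"
  proof (rule integral_dominated_convergence[where w = "\<lambda>_. K1"])
    show "AE z in N. (\<lambda>n. (cmod (scaled (dcov_mean (\<kappa> n)) z))\<^sup>2) \<longlonglongrightarrow> 0"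
    proof (rule AE_I2)
      fix z
      have "(\<lambda>n. (cmod (dcov_mean (\<kappa> n) z))\<^sup>2 / w z) \<longlonglongrightarrow> (cmod (dcov_mean m z))\<^sup>2 / w z"
        unfolding divide_inverse by (intro tendsto_intros wk.dcov_mean_tendsto)
      then show "(\<lambda>n. (cmod (scaled (dcov_mean (\<kappa> n)) z))\<^sup>2) \<longlonglongrightarrow> 0"
        by (simp add: cmod_scaled_sq lim.dcov_mean_eq_0)
    qed
  qed (simp_all add: scaled_dcov_mean_sq_le)
  then show ?thesis by (simp add: d_def[abs_def])
qed

end

section \<open>Convergence of the empirical distance covariance\<close>

text \<open>Here \<rho> is the count over its mean. Since \<rho> is at least 1/2, dividing by it
  changes S by at most 2\<eta>S. Then 5\<eta> is \<eta> + 4\<eta>, and 4\<eta> \<le> 2 raises 1 +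
  1/\<eta> to 3 + 1/\<eta>.\<close>

lemma inverse_ratio_bound:
  fixes \<rho> \<eta> S W Y :: real
  assumes \<rho>: "\<bar>\<rho> - 1\<bar> \<le> \<eta>" and \<eta>: "0 < \<eta>" "\<eta> \<le> 1 / 2"
    and S: "S \<ge> 0" "\<bar>S - W\<bar> \<le> \<eta> * W + (1 + 1 / \<eta>) * Y" "S \<le> 2 * W + 2 * Y" and Y: "Y \<ge> 0" and W: "W \<ge> 0"
  shows "\<bar>S / \<rho> - W\<bar> \<le> 5 * \<eta> * W + (3 + 1 / \<eta>) * Y"
proof -
  have \<rho>2: "\<rho> \<ge> 1 / 2" using \<rho> \<eta> by linarith
  have "\<bar>S / \<rho> - S\<bar> = \<bar>\<rho> - 1\<bar> / \<rho> * S"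
  proof -
    have "S / \<rho> - S = - ((\<rho> - 1) / \<rho> * S)" using \<rho>2 by (simp add: field_simps)
    then show ?thesis using \<rho>2 S(1) by (simp add: abs_mult)
  qed
  also have "\<dots> \<le> (2 * \<eta>) * S"
  proof (rule mult_right_mono[OF _ S(1)])
    have "2 * \<eta> * (1 / 2) \<le> 2 * \<eta> * \<rho>" using \<rho>2 \<eta> by (intro mult_left_mono) auto
    then have "\<bar>\<rho> - 1\<bar> \<le> 2 * \<eta> * \<rho>" using \<rho> by linarith
    then show "\<bar>\<rho> - 1\<bar> / \<rho> \<le> 2 * \<eta>" using \<rho>2 by (simp add: pos_divide_le_eq)
  qed
  also have "\<dots> \<le> (2 * \<eta>) * (2 * W + 2 * Y)" using S(3) \<eta> by (intro mult_left_mono) auto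
  finally have "\<bar>S / \<rho> - W\<bar> \<le> \<eta> * W + (1 + 1 / \<eta>) * Y + (2 * \<eta>) * (2 * W + 2 * Y)" using S(2) by linarith
  also have "\<dots> = 5 * \<eta> * W + (1 + 1 / \<eta>) * Y + (4 * \<eta>) * Y" by (simp add: algebra_simps)
  also have "\<dots> \<le> 5 * \<eta> * W + (1 + 1 / \<eta>) * Y + 2 * Y" using \<eta> Y
    by (intro add_left_mono mult_right_mono) auto
  finally show ?thesis by (simp add: algebra_simps)
qed

context dcov_setting
begin

abbreviation "Vn n \<omega> \<equiv> cnt n \<omega> * Tn n \<omega>"

lemma W_nonneg: "W n \<omega> \<ge> 0" and h_nonneg: "h n \<omega> \<ge> 0" and d_nonneg: "d n \<ge> 0"
  unfolding W_def h_def d_def by (auto intro!: Bochner_Integration.integral_nonneg)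

text \<open>On the event that the count is close to its mean, the decomposition writes count times
  statistic as the squared norm of \<open>G n\<close> plus a perturbation, divided by the ratio of
  the count to its mean. The perturbation consists of the bias and of \<open>H n\<close>.\<close>

lemma Vn_minus_W_le:
  assumes n: "n \<ge> n0" and \<eta>: "0 < \<eta>" "\<eta> \<le> 1 / 2" and \<omega>: "\<omega> \<in> space M"
    and iG: "integrable N (\<lambda>z. (cmod (scaled (\<lambda>z. G n z \<omega>) z))\<^sup>2)"
    and iH: "integrable N (\<lambda>z. (cmod (scaled (\<lambda>z. H n z \<omega>) z))\<^sup>2)"
    and \<rho>: "\<bar>cnt n \<omega> / a n - 1\<bar> \<le> \<eta>"
  shows "\<bar>Vn n \<omega> - W n \<omega>\<bar> \<le> 5 * \<eta> * W n \<omega> + (3 + 1 / \<eta>) * (2 * a n * d n + 8 * h n \<omega>)"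
    and "Tn n \<omega> \<le> 2 / a n * Vn n \<omega>"
proof -
  have a1: "a n \<ge> 1" by (rule p_bounds(3)[OF n])
  have r2: "cnt n \<omega> / a n \<ge> 1 / 2" using \<rho> \<eta> by linarith
  then have c2: "cnt n \<omega> \<ge> a n / 2" using a1 by (simp add: field_simps)
  then have c0: "cnt n \<omega> > 0" using a1 by linarith
  define x where "x z = scaled (\<lambda>z. G n z \<omega>) z" for z
  define y where "y z = of_real (sqrt (a n)) * scaled (dcov_mean (\<kappa> n)) z
    - of_real (a n / cnt n \<omega>) * scaled (\<lambda>z. H n z \<omega>) z" for z
  have [measurable]: "x \<in> borel_measurable borel" unfolding x_def[abs_def]
    using measurable_compose[OF measurable_Pair2'[OF \<omega>] G_pair_measurable[of n]]
    by (intro scaled_measurable) simp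
  have Hm [measurable]: "scaled (\<lambda>z. H n z \<omega>) \<in> borel_measurable borel"
    using measurable_compose[OF measurable_Pair2'[OF \<omega>] H_pair_measurable[of n]]
    by (intro scaled_measurable) simp
  have [measurable]: "scaled (dcov_mean (\<kappa> n)) \<in> borel_measurable borel"
    by (rule scaled_measurable) measurable
  have [measurable]: "y \<in> borel_measurable borel" unfolding y_def[abs_def] by measurable
  have ac: "a n / cnt n \<omega> \<le> 2" using c2 c0 by (simp add: pos_divide_le_eq)
  \<comment> \<open>The factor 8 is 2 times 2^2: on this event \<open>a n\<close> is at most twice
    the count.\<close>
  have y_le: "(cmod (y z))\<^sup>2 \<le> 2 * a n * (cmod (scaled (dcov_mean (\<kappa> n)) z))\<^sup>2
    + 8 * (cmod (scaled (\<lambda>z. H n z \<omega>) z))\<^sup>2" for z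
  proof -
    let ?u = "of_real (sqrt (a n)) * scaled (dcov_mean (\<kappa> n)) z"
      and ?v = "of_real (a n / cnt n \<omega>) * scaled (\<lambda>z. H n z \<omega>) z"
    have "(cmod (y z))\<^sup>2 \<le> 2 * (cmod ?u)\<^sup>2 + 2 * (cmod ?v)\<^sup>2"
      using norm_sq_add_diff_le[of 1 ?u "- ?v"] unfolding y_def by (simp add: abs_le_iff)
    moreover have "(cmod ?u)\<^sup>2 = a n * (cmod (scaled (dcov_mean (\<kappa> n)) z))\<^sup>2" using a1
      by (simp add: norm_mult power_mult_distrib)
    moreover have "(cmod ?v)\<^sup>2 \<le> 2\<^sup>2 * (cmod (scaled (\<lambda>z. H n z \<omega>) z))\<^sup>2"
      unfolding norm_mult power_mult_distrib norm_of_real using ac a1 c0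
      by (intro mult_right_mono power_mono) auto
    ultimately show ?thesis by simp
  qed
  have iyb: "integrable N (\<lambda>z. 2 * a n * (cmod (scaled (dcov_mean (\<kappa> n)) z))\<^sup>2
    + 8 * (cmod (scaled (\<lambda>z. H n z \<omega>) z))\<^sup>2)"
    using d_integrable iH by simp
  have iy: "integrable N (\<lambda>z. (cmod (y z))\<^sup>2)"
    by (rule Bochner_Integration.integrable_bound[OF iyb])
      (use y_le a1 in \<open>auto intro!: AE_I2 order_trans[OF y_le]\<close>)
  have ix: "integrable N (\<lambda>z. (cmod (x z))\<^sup>2)" using iG by (simp add: x_def)
  let ?S = "\<integral>z. (cmod (x z + y z))\<^sup>2 \<partial>N" and ?Y = "\<integral>z. (cmod (y z))\<^sup>2 \<partial>N"
  have Y: "?Y \<le> 2 * a n * d n + 8 * h n \<omega>"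
  proof -
    have "?Y \<le> (\<integral>z. 2 * a n * (cmod (scaled (dcov_mean (\<kappa> n)) z))\<^sup>2
      + 8 * (cmod (scaled (\<lambda>z. H n z \<omega>) z))\<^sup>2 \<partial>N)"
      by (rule integral_mono[OF iy iyb y_le])
    also have "\<dots> = 2 * a n * d n + 8 * h n \<omega>" using d_integrable[of n] iH by (simp add: d_def h_def)
    finally show ?thesis .
  qed
  have W: "W n \<omega> = (\<integral>z. (cmod (x z))\<^sup>2 \<partial>N)" by (simp add: W_def x_def)
  have xm: "x \<in> borel_measurable N" and ym: "y \<in> borel_measurable N" by measurable
  have "(cmod (scaled (\<lambda>z. emp_C nm n (r n) (sample \<omega>) (fst z) (snd z)) z))\<^sup>2
    = a n / (cnt n \<omega>)\<^sup>2 * (cmod (x z + y z))\<^sup>2" for z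
  proof -
    have "scaled (\<lambda>z. emp_C nm n (r n) (sample \<omega>) (fst z) (snd z)) z
      = of_real (sqrt (a n) / cnt n \<omega>) * (x z + y z)"
      unfolding scaled_def x_def y_def emp_C_decomposition[OF n less_imp_neq[OF c0, symmetric]] prod.collapse
      by (simp only: times_divide_eq_right[symmetric] add_divide_distrib diff_divide_distrib)
    then show ?thesis using a1
      by (simp only: norm_mult power_mult_distrib norm_of_real power2_abs power_divide) simp
  qed
  then have T: "Tn n \<omega> = a n / (cnt n \<omega>)\<^sup>2 * ?S" using c0 by (simp add: Tn_eq[OF \<omega>])
  then have V: "Vn n \<omega> = ?S / (cnt n \<omega> / a n)" using c0 a1 by (simp add: field_simps power2_eq_square)
  have "\<bar>?S / (cnt n \<omega> / a n) - W n \<omega>\<bar> \<le> 5 * \<eta> * W n \<omega> + (3 + 1 / \<eta>) * ?Y"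
  proof (rule inverse_ratio_bound[OF \<rho> \<eta>])
    show "\<bar>?S - W n \<omega>\<bar> \<le> \<eta> * W n \<omega> + (1 + 1 / \<eta>) * ?Y"
      unfolding W by (rule integral_norm_sq_add_diff_le(2)[OF xm ym ix iy \<eta>(1)])
    show "?S \<le> 2 * W n \<omega> + 2 * ?Y"
      using integral_norm_sq_add_diff_le(2)[OF xm ym ix iy, of 1] unfolding W by (simp add: abs_le_iff)
  qed (auto simp: W_nonneg intro!: Bochner_Integration.integral_nonneg)
  also have "\<dots> \<le> 5 * \<eta> * W n \<omega> + (3 + 1 / \<eta>) * (2 * a n * d n + 8 * h n \<omega>)"
    using Y \<eta> by (intro add_left_mono mult_left_mono) auto
  finally show "\<bar>Vn n \<omega> - W n \<omega>\<bar> \<le> 5 * \<eta> * W n \<omega> + (3 + 1 / \<eta>) * (2 * a n * d n + 8 * h n \<omega>)" unfolding V .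
  have "1 \<le> 2 / a n * cnt n \<omega>" using c2 a1 by (simp add: field_simps)
  then show "Tn n \<omega> \<le> 2 / a n * Vn n \<omega>"
    using mult_right_mono[of 1 "2 / a n * cnt n \<omega>" "Tn n \<omega>"] Tn_nonneg[of n \<omega>] by (simp add: mult.assoc)
qed

lemma W_measurable [measurable]: "W n \<in> borel_measurable M"
  and h_measurable: "n \<ge> n0 \<Longrightarrow> h n \<in> borel_measurable M"
  using G_process(3) H_process(3) by (auto dest: borel_measurable_integrable)

text \<open>Chebyshev under the integral: outside the good event the truncated difference is at most
  1, and there \<eta>^-2 times the squared relative deviation is at least 1. The constant 56 is 8
  times the 7 from the moment of \<open>H n\<close>.\<close>

lemma expectation_Vn_minus_W_le:
  assumes n: "n \<ge> n0" and \<eta>: "0 < \<eta>" "\<eta> \<le> 1 / 2"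
  shows "(\<integral>\<omega>. min 1 \<bar>Vn n \<omega> - W n \<omega>\<bar> \<partial>M) \<le> 1 / \<eta>\<^sup>2 * (1 / a n) + 5 * \<eta> * (K1 * B) + (3
    + 1 / \<eta>) * (2 * (a n * d n) + 56 * K1 * B * (1 / a n))"
proof -
  have a1: "a n \<ge> 1" by (rule p_bounds(3)[OF n])
  note hm [measurable] = h_measurable[OF n]
  let ?R = "\<lambda>\<omega>. 1 / \<eta>\<^sup>2 * (cnt n \<omega> / a n - 1)\<^sup>2 + 5 * \<eta> * W n \<omega> + (3 + 1 / \<eta>) * (2 * a n * d n + 8 * h n \<omega>)"
  have iR: "integrable M ?R" using cnt_second_moment(1)[OF n] G_process(3)[of n] H_process(3)[OF n] by simp
  have "(\<integral>\<omega>. min 1 \<bar>Vn n \<omega> - W n \<omega>\<bar> \<partial>M) \<le> (\<integral>\<omega>. ?R \<omega> \<partial>M)"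
  proof (rule integral_mono_AE[OF _ iR])
    show "integrable M (\<lambda>\<omega>. min 1 \<bar>Vn n \<omega> - W n \<omega>\<bar>)" by (rule integrable_const_bound[of _ 1]) auto
    show "AE \<omega> in M. min 1 \<bar>Vn n \<omega> - W n \<omega>\<bar> \<le> ?R \<omega>"
      using G_process(1)[of n] H_process(1)[OF n] AE_space
    proof eventually_elim
      case (elim \<omega>)
      have nn: "0 \<le> 5 * \<eta> * W n \<omega>" "0 \<le> (3 + 1 / \<eta>) * (2 * a n * d n + 8 * h n \<omega>)"
        "0 \<le> 1 / \<eta>\<^sup>2 * (cnt n \<omega> / a n - 1)\<^sup>2"
        using W_nonneg h_nonneg d_nonneg \<eta> a1 by auto
      show ?case
      proof (cases "\<bar>cnt n \<omega> / a n - 1\<bar> \<le> \<eta>")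
        case True
        from Vn_minus_W_le(1)[OF n \<eta> elim(3,1,2) True] nn show ?thesis by linarith
      next
        case False
        then have "\<eta>\<^sup>2 \<le> \<bar>cnt n \<omega> / a n - 1\<bar>\<^sup>2" using \<eta> by (intro power_mono) auto
        then have "1 \<le> 1 / \<eta>\<^sup>2 * (cnt n \<omega> / a n - 1)\<^sup>2" using \<eta> by (simp add: field_simps)
        with nn show ?thesis by linarith
      qed
    qed
  qed
  also have "\<dots> = 1 / \<eta>\<^sup>2 * (\<integral>\<omega>. (cnt n \<omega> / a n - 1)\<^sup>2 \<partial>M) + 5 * \<eta> * (\<integral>\<omega>. W n \<omega> \<partial>M) + (3
    + 1 / \<eta>) * (2 * a n * d n + 8 * (\<integral>\<omega>. h n \<omega> \<partial>M))"
    using cnt_second_moment(1)[OF n] G_process(3)[of n] H_process(3)[OF n] by (simp add: prob_space)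
  also have "\<dots> \<le> 1 / \<eta>\<^sup>2 * (1 / a n) + 5 * \<eta> * (K1 * B) + (3 + 1 / \<eta>) * (2 * a n * d n
    + 8 * ((7 * K1 / a n) * B))"
    using \<eta> a1 by (intro add_mono mult_left_mono cnt_second_moment(2)[OF n] G_process(2) H_process(2)[OF n]) auto
  finally show ?thesis by (simp add: mult_ac)
qed

text \<open>The same argument at \<eta> = 1/2, where the statistic is at most 2/a times 7/2 W + 5 (2
  a d + 8 h); on the complement the factor is (1/2)^-2 = 4. The bias enters as d without the factor
  a, so no rate is asked of it.\<close>

lemma expectation_Tn_le:
  assumes n: "n \<ge> n0"
  shows "(\<integral>\<omega>. min 1 (Tn n \<omega>) \<partial>M) \<le> 4 * (1 / a n) + 7 * K1 * B * (1 / a n) + 20 * d n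
    + 560 * K1 * B * ((1 / a n) * (1 / a n))"
proof -
  have a1: "a n \<ge> 1" by (rule p_bounds(3)[OF n])
  note hm [measurable] = h_measurable[OF n]
  let ?R = "\<lambda>\<omega>. 4 * (cnt n \<omega> / a n - 1)\<^sup>2 + 7 / a n * W n \<omega> + 20 * d n + 80 / a n * h n \<omega>"
  have iR: "integrable M ?R" using cnt_second_moment(1)[OF n] G_process(3)[of n] H_process(3)[OF n] by simp
  have "(\<integral>\<omega>. min 1 (Tn n \<omega>) \<partial>M) \<le> (\<integral>\<omega>. ?R \<omega> \<partial>M)"
  proof (rule integral_mono_AE[OF _ iR])
    show "integrable M (\<lambda>\<omega>. min 1 (Tn n \<omega>))" by (rule integrable_const_bound[of _ 1]) (auto simp: Tn_nonneg)
    show "AE \<omega> in M. min 1 (Tn n \<omega>) \<le> ?R \<omega>"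
      using G_process(1)[of n] H_process(1)[OF n] AE_space
    proof eventually_elim
      case (elim \<omega>)
      have nn: "0 \<le> 7 / a n * W n \<omega>" "0 \<le> 20 * d n" "0 \<le> 80 / a n * h n \<omega>" "0 \<le> 4 * (cnt n \<omega> / a n - 1)\<^sup>2"
        using W_nonneg h_nonneg d_nonneg a1 by auto
      show ?case
      proof (cases "\<bar>cnt n \<omega> / a n - 1\<bar> \<le> 1 / 2")
        case True
        note B = Vn_minus_W_le[OF n _ _ elim(3,1,2) True]
        have "Tn n \<omega> \<le> 2 / a n * Vn n \<omega>" by (rule B(2)) auto
        also have "\<dots> \<le> 2 / a n * (7 / 2 * W n \<omega> + 5 * (2 * a n * d n + 8 * h n \<omega>))"
          using B(1) a1 by (intro mult_left_mono) (auto simp: abs_le_iff)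
        also have "\<dots> = 7 / a n * W n \<omega> + 20 * d n + 80 / a n * h n \<omega>" using a1 by (simp add: field_simps)
        finally show ?thesis using nn by linarith
      next
        case False
        then have "(1 / 2)\<^sup>2 \<le> \<bar>cnt n \<omega> / a n - 1\<bar>\<^sup>2" by (intro power_mono) auto
        then have "1 \<le> 4 * (cnt n \<omega> / a n - 1)\<^sup>2" by (simp add: power_divide)
        with nn show ?thesis by linarith
      qed
    qed
  qed
  also have "\<dots> = 4 * (\<integral>\<omega>. (cnt n \<omega> / a n - 1)\<^sup>2 \<partial>M) + 7 / a n * (\<integral>\<omega>. W n \<omega> \<partial>M) + 20 * d n
    + 80 / a n * (\<integral>\<omega>. h n \<omega> \<partial>M)"
    using cnt_second_moment(1)[OF n] G_process(3)[of n] H_process(3)[OF n] by (simp add: prob_space)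
  also have "\<dots> \<le> 4 * (1 / a n) + 7 / a n * (K1 * B) + 20 * d n + 80 / a n * ((7 * K1 / a n) * B)"
    using a1 by (intro add_mono mult_left_mono cnt_second_moment(2)[OF n] G_process(2) H_process(2)[OF n]) auto
  finally show ?thesis by (simp add: mult_ac)
qed

lemma inverse_a_tendsto: "(\<lambda>n. 1 / a n) \<longlonglongrightarrow> 0"
  by (rule real_tendsto_divide_at_top[OF tendsto_const a_at_top])

theorem Tn_tendsto_in_probability: "tendsto_in_probability M Tn 0"
  unfolding tendsto_in_probability_def
proof (intro conjI allI impI)
  show "Tn n \<in> borel_measurable M" for n by measurable
  fix \<epsilon> :: real assume \<epsilon>: "\<epsilon> > 0"
  have "(\<lambda>n. 4 * (1 / a n) + 7 * K1 * B * (1 / a n) + 20 * d n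
    + 560 * K1 * B * ((1 / a n) * (1 / a n))) \<longlonglongrightarrow> 4 * 0 + 7 * K1 * B * 0 + 20 * 0 + 560 * K1 * B * (0 * 0)"
    by (intro tendsto_intros inverse_a_tendsto d_tendsto)
  then have lim0: "(\<lambda>n. 1 / min 1 \<epsilon> * (4 * (1 / a n) + 7 * K1 * B * (1 / a n) + 20 * d n
    + 560 * K1 * B * ((1 / a n) * (1 / a n)))) \<longlonglongrightarrow> 0"
    by (intro tendsto_mult_right_zero) simp
  show "(\<lambda>n. prob {\<omega> \<in> space M. \<epsilon> < \<bar>Tn n \<omega> - 0\<bar>}) \<longlonglongrightarrow> 0"
  proof (rule Lim_null_comparison[OF _ lim0])
    show "\<forall>\<^sub>F n in sequentially. norm (prob {\<omega> \<in> space M. \<epsilon> < \<bar>Tn n \<omega> - 0\<bar>})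
      \<le> 1 / min 1 \<epsilon> * (4 * (1 / a n) + 7 * K1 * B * (1 / a n) + 20 * d n + 560 * K1 * B * ((1 / a n) * (1 / a n)))"
      using eventually_ge_at_top[of n0]
    proof eventually_elim
      case (elim n)
      let ?E = "{\<omega> \<in> space M. \<epsilon> < \<bar>Tn n \<omega> - 0\<bar>}"
      have "prob ?E = (\<integral>\<omega>. indicator ?E \<omega> \<partial>M)" by simp
      also have "\<dots> \<le> (\<integral>\<omega>. 1 / min 1 \<epsilon> * min 1 (Tn n \<omega>) \<partial>M)"
      proof (rule integral_mono)
        show "integrable M (\<lambda>\<omega>. 1 / min 1 \<epsilon> * min 1 (Tn n \<omega>))"
          by (intro integrable_mult_right integrable_const_bound[of _ 1]) (auto simp: Tn_nonneg)
        \<comment> \<open>Markov's inequality for the truncated variable; the minimum with 1 in the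
          denominator covers \<epsilon> above 1.\<close>
        show "indicator ?E \<omega> \<le> 1 / min 1 \<epsilon> * min 1 (Tn n \<omega>)" for \<omega>
          using \<epsilon> Tn_nonneg[of n \<omega>] by (auto simp: indicator_def field_simps min_def)
      qed (simp add: integrable_real_indicator emeasure_eq_measure)
      also have "\<dots> = 1 / min 1 \<epsilon> * (\<integral>\<omega>. min 1 (Tn n \<omega>) \<partial>M)" by simp
      also have "\<dots> \<le> 1 / min 1 \<epsilon> * (4 * (1 / a n) + 7 * K1 * B * (1 / a n) + 20 * d n
        + 560 * K1 * B * ((1 / a n) * (1 / a n)))"
        using \<epsilon> by (intro mult_left_mono expectation_Tn_le[OF elim]) auto
      finally show ?case by simp
    qed
  qed
qed

lemma Vn_minus_W_tendsto:
  assumes ad: "(\<lambda>n. a n * d n) \<longlonglongrightarrow> 0"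
  shows "(\<lambda>n. \<integral>\<omega>. min 1 \<bar>Vn n \<omega> - W n \<omega>\<bar> \<partial>M) \<longlonglongrightarrow> 0"
proof (rule tendsto_approxI)
  fix e :: real assume e: "e > 0"
  have KB: "K1 * B \<ge> 0" using K1_pos by simp
  \<comment> \<open>Chosen so that the one term not vanishing in n, 5\<eta> times
    \<open>K1 * B\<close>, is below e. Adding 1 in the denominator covers the case that N has mass
    0.\<close>
  define \<eta> where "\<eta> = min (1 / 2) (e / (5 * (K1 * B + 1)))"
  have "0 < \<eta>" using e KB by (simp add: \<eta>_def)
  moreover have "\<eta> \<le> 1 / 2" unfolding \<eta>_def by (rule min.cobounded1)
  ultimately have \<eta>: "0 < \<eta>" "\<eta> \<le> 1 / 2" .
  have \<eta>e: "5 * \<eta> * (K1 * B) < e"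
  proof -
    have "5 * \<eta> * (K1 * B) < 5 * \<eta> * (K1 * B + 1)" using \<eta> by (intro mult_strict_left_mono) auto
    also have "\<dots> \<le> 5 * (e / (5 * (K1 * B + 1))) * (K1 * B + 1)" using KB
      by (intro mult_right_mono mult_left_mono) (auto simp: \<eta>_def)
    also have "\<dots> = e"
    proof -
      have "5 * (e / (5 * k)) * k = e" if "k > 0" for k :: real using that by simp
      then show ?thesis using KB by (meson add_nonneg_pos zero_less_one)
    qed
    finally show ?thesis .
  qed
  let ?b = "\<lambda>n. 1 / \<eta>\<^sup>2 * (1 / a n) + 5 * \<eta> * (K1 * B) + (3 + 1 / \<eta>) * (2 * (a n * d n)
    + 56 * K1 * B * (1 / a n))"
  have "?b \<longlonglongrightarrow> 1 / \<eta>\<^sup>2 * 0 + 5 * \<eta> * (K1 * B) + (3 + 1 / \<eta>) * (2 * 0 + 56 * K1 * B * 0)"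
    by (intro tendsto_intros inverse_a_tendsto ad)
  then have "?b \<longlonglongrightarrow> 5 * \<eta> * (K1 * B)" by simp
  then have "\<forall>\<^sub>F n in sequentially. ?b n < e" using \<eta>e by (rule order_tendstoD)
  then have "\<forall>\<^sub>F n in sequentially. dist (\<integral>\<omega>. min 1 \<bar>Vn n \<omega> - W n \<omega>\<bar> \<partial>M) 0 \<le> e"
    using eventually_ge_at_top[of n0]
  proof eventually_elim
    case (elim n)
    have "0 \<le> (\<integral>\<omega>. min 1 \<bar>Vn n \<omega> - W n \<omega>\<bar> \<partial>M)" by (intro Bochner_Integration.integral_nonneg) auto
    then show ?case using expectation_Vn_minus_W_le[OF elim(2) \<eta>] elim(1) by simp
  qed
  then show "\<exists>b l. b \<longlonglongrightarrow> l \<and> (\<forall>\<^sub>F n in sequentially. dist (\<integral>\<omega>. min 1 \<bar>Vn n \<omega> - W n \<omega>\<bar> \<partial>M) (b n)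
    \<le> e) \<and> dist 0 l \<le> e"
    using e by (intro exI[of _ "\<lambda>_. 0"] exI[of _ 0]) auto
qed

section \<open>Identification of the limit\<close>

abbreviation "Q \<equiv> dcov_field m"

lemma Q_pair_measurable: "(\<lambda>q. Q (fst q) (snd q)) \<in> borel_measurable (borel \<Otimes>\<^sub>M std_gaussian_seq)"
  using lim.dcov_field_measurable by (simp add: case_prod_unfold)

text \<open>The bound passes to the limit from the second moments of \<open>G n\<close>, which
  avoids a moment estimate under the limit law itself.\<close>

lemma Q_sq_le: "(\<integral>g. (cmod (Q z g))\<^sup>2 \<partial>std_gaussian_seq) \<le> K1 * w z"
  unfolding lim.dcov_field_second_moment(2)
  by (rule LIMSEQ_le_const2[OF G_sq_tendsto]) (use G_sq_le in auto)

lemma Q_process: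
  "AE g in std_gaussian_seq. integrable N (\<lambda>z. (cmod (scaled (\<lambda>z. Q z g) z))\<^sup>2)"
  "integrable std_gaussian_seq (\<lambda>g. \<integral>z. (cmod (scaled (\<lambda>z. Q z g) z))\<^sup>2 \<partial>N)"
  using AE_integrable_second_moment_process(2,4)[OF finite_N prob_space_std_gaussian_seq scaled_pair_measurable[OF Q_pair_measurable]
      scaled_second_moment[OF lim.dcov_field_second_moment(1) Q_sq_le]] K1_pos
  by (simp_all add: less_imp_le)

lemma Q_integral:
  assumes "g \<in> space std_gaussian_seq"
  shows "(\<integral>z. (cmod (scaled (\<lambda>z. Q z g) z))\<^sup>2 \<partial>N) = (\<integral>z. (cmod (Q z g))\<^sup>2 \<partial>\<mu>)"
    "integrable N (\<lambda>z. (cmod (scaled (\<lambda>z. Q z g) z))\<^sup>2) \<longleftrightarrow> integrable \<mu> (\<lambda>z. (cmod (Q z g))\<^sup>2)"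
proof -
  have "(\<lambda>z. Q z g) \<in> borel_measurable borel"
    using measurable_compose[OF measurable_Pair2'[OF assms] Q_pair_measurable] by simp
  from integral_scaled[OF this lim.dcov_field_zero]
  show "(\<integral>z. (cmod (scaled (\<lambda>z. Q z g) z))\<^sup>2 \<partial>N) = (\<integral>z. (cmod (Q z g))\<^sup>2 \<partial>\<mu>)"
    "integrable N (\<lambda>z. (cmod (scaled (\<lambda>z. Q z g) z))\<^sup>2) \<longleftrightarrow> integrable \<mu> (\<lambda>z. (cmod (Q z g))\<^sup>2)" by auto
qed

lemma W_laplace_tendsto:
  assumes l: "l > 0"
  shows "(\<lambda>n. \<integral>\<omega>. exp (- l * W n \<omega>) \<partial>M)
    \<longlonglongrightarrow> (\<integral>g. exp (- l * (\<integral>z. (cmod (scaled (\<lambda>z. Q z g) z))\<^sup>2 \<partial>N)) \<partial>std_gaussian_seq)"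
  unfolding W_def
proof (rule integral_process_laplace_tendsto[where C = K1, OF finite_N prob_space_axioms prob_space_std_gaussian_seq])
  show "(\<lambda>(z, \<omega>). scaled (\<lambda>z. G n z \<omega>) z) \<in> borel_measurable (N \<Otimes>\<^sub>M M)" for n
    by (rule scaled_pair_measurable[OF G_pair_measurable])
  show "(\<lambda>(z, g). scaled (\<lambda>z. Q z g) z) \<in> borel_measurable (N \<Otimes>\<^sub>M std_gaussian_seq)"
    by (rule scaled_pair_measurable[OF Q_pair_measurable])
  show "integrable M (\<lambda>\<omega>. (cmod (scaled (\<lambda>z. G n z \<omega>) z))\<^sup>2)"
    "(\<integral>\<omega>. (cmod (scaled (\<lambda>z. G n z \<omega>) z))\<^sup>2 \<partial>M) \<le> K1" for n z
    using scaled_second_moment[where c = K1 and K = M and F = "G n"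
      and z = z] G_sq(1)[of n z] G_sq_le[of n z] K1_pos by (simp_all add: less_imp_le)
  show "integrable std_gaussian_seq (\<lambda>g. (cmod (scaled (\<lambda>z. Q z g) z))\<^sup>2)" for z
    using lim.dcov_field_second_moment(1) by (simp add: cmod_scaled_sq)
  show "(\<lambda>n. \<integral>\<omega>. (cmod (scaled (\<lambda>z. G n z \<omega>) z))\<^sup>2 \<partial>M)
    \<longlonglongrightarrow> (\<integral>g. (cmod (scaled (\<lambda>z. Q z g) z))\<^sup>2 \<partial>std_gaussian_seq)" for z
  proof -
    have "(\<lambda>n. (\<integral>\<omega>. (cmod (G n z \<omega>))\<^sup>2 \<partial>M) / w z) \<longlonglongrightarrow> (\<integral>g. (cmod (Q z g))\<^sup>2 \<partial>std_gaussian_seq) / w z"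
      unfolding divide_inverse lim.dcov_field_second_moment(2) by (intro tendsto_intros G_sq_tendsto)
    then show ?thesis by (simp add: cmod_scaled_sq)
  qed
  show "(\<lambda>n. CLINT \<omega>|M. iexp (\<Sum>i<k. Re (u i * scaled (\<lambda>z. G n z \<omega>) (z i))))
    \<longlonglongrightarrow> (CLINT g|std_gaussian_seq. iexp (\<Sum>i<k. Re (u i * scaled (\<lambda>z. Q z g) (z i))))" for k :: nat and z u
  proof -
    \<comment> \<open>The deterministic scaling is absorbed into the coefficients of the linear
      combination.\<close>
    have eq: "u i * scaled F (z i) = (u i / of_real (sqrt (w (z i)))) * F (z i)" for i F
      by (simp add: scaled_def)
    show ?thesis unfolding eq
      using G_char_tendsto[where k = k and z = z and u = "\<lambda>i. u i / of_real (sqrt (w (z i)))"] .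
  qed
  show "l > 0" by fact
qed

text \<open>The analogue of Slutsky's lemma for Laplace transforms: exp(-l x) is bounded by 1 and
  l-Lipschitz on the half-line, so the difference is controlled by the truncated distance, whose
  mean tends to 0.\<close>

lemma Vn_laplace_tendsto:
  assumes ad: "(\<lambda>n. a n * d n) \<longlonglongrightarrow> 0" and l: "l > 0"
  shows "(\<lambda>n. \<integral>\<omega>. exp (- l * Vn n \<omega>) \<partial>M)
    \<longlonglongrightarrow> (\<integral>g. exp (- l * (\<integral>z. (cmod (scaled (\<lambda>z. Q z g) z))\<^sup>2 \<partial>N)) \<partial>std_gaussian_seq)"
proof -
  have Vm [measurable]: "(\<lambda>\<omega>. Vn n \<omega>) \<in> borel_measurable M" for n by measurable
  have V0: "Vn n \<omega> \<ge> 0" for n \<omega> using cnt_nonneg Tn_nonneg by simp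
  have i: "integrable M (\<lambda>\<omega>. exp (- l * Vn n \<omega>))" "integrable M (\<lambda>\<omega>. exp (- l * W n \<omega>))" for n
    using l V0 W_nonneg by (intro integrable_const_bound[of _ 1]; simp)+
  have le: "\<bar>exp (- l * Vn n \<omega>) - exp (- l * W n \<omega>)\<bar> \<le> max 1 l * min 1 \<bar>Vn n \<omega> - W n \<omega>\<bar>" for n \<omega>
  proof -
    have "\<bar>exp (- (l * Vn n \<omega>)) - exp (- (l * W n \<omega>))\<bar> \<le> \<bar>l * Vn n \<omega> - l * W n \<omega>\<bar>"
      using l V0 W_nonneg by (intro exp_neg_lipschitz) auto
    also have "\<dots> = l * \<bar>Vn n \<omega> - W n \<omega>\<bar>" using l unfolding right_diff_distrib[symmetric] abs_mult by simp
    also have "\<dots> \<le> max 1 l * \<bar>Vn n \<omega> - W n \<omega>\<bar>" by (intro mult_right_mono) auto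
    finally have 1: "\<bar>exp (- (l * Vn n \<omega>)) - exp (- (l * W n \<omega>))\<bar> \<le> max 1 l * \<bar>Vn n \<omega> - W n \<omega>\<bar>" .
    have "exp (- (l * Vn n \<omega>)) \<le> 1" "exp (- (l * W n \<omega>)) \<le> 1" using l V0[of n \<omega>] W_nonneg[of n \<omega>] by auto
    then have 2: "\<bar>exp (- (l * Vn n \<omega>)) - exp (- (l * W n \<omega>))\<bar> \<le> max 1 l * 1"
      using exp_gt_zero[of "- (l * Vn n \<omega>)"] exp_gt_zero[of "- (l * W n \<omega>)"] by linarith
    show ?thesis using 1 2 by (auto simp: min_def)
  qed
  have "(\<lambda>n. (\<integral>\<omega>. exp (- l * Vn n \<omega>) \<partial>M) - (\<integral>\<omega>. exp (- l * W n \<omega>) \<partial>M)) \<longlonglongrightarrow> 0"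
  proof (rule Lim_null_comparison)
    show "\<forall>\<^sub>F n in sequentially. norm ((\<integral>\<omega>. exp (- l * Vn n \<omega>) \<partial>M) - (\<integral>\<omega>. exp (- l * W n \<omega>) \<partial>M))
      \<le> max 1 l * (\<integral>\<omega>. min 1 \<bar>Vn n \<omega> - W n \<omega>\<bar> \<partial>M)"
    proof (intro always_eventually allI)
      fix n
      have "norm ((\<integral>\<omega>. exp (- l * Vn n \<omega>) \<partial>M) - (\<integral>\<omega>. exp (- l * W n \<omega>) \<partial>M))
        = \<bar>\<integral>\<omega>. exp (- l * Vn n \<omega>) - exp (- l * W n \<omega>) \<partial>M\<bar>"
        by (subst Bochner_Integration.integral_diff[OF i]) simp
      also have "\<dots> \<le> (\<integral>\<omega>. \<bar>exp (- l * Vn n \<omega>) - exp (- l * W n \<omega>)\<bar> \<partial>M)" by (rule integral_abs_bound)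
      also have "\<dots> \<le> (\<integral>\<omega>. max 1 l * min 1 \<bar>Vn n \<omega> - W n \<omega>\<bar> \<partial>M)"
      proof (rule integral_mono[OF _ _ le])
        show "integrable M (\<lambda>\<omega>. \<bar>exp (- l * Vn n \<omega>) - exp (- l * W n \<omega>)\<bar>)"
          by (intro integrable_abs Bochner_Integration.integrable_diff i)
        show "integrable M (\<lambda>\<omega>. max 1 l * min 1 \<bar>Vn n \<omega> - W n \<omega>\<bar>)"
          by (intro integrable_mult_right integrable_const_bound[of _ 1]) auto
      qed
      also have "\<dots> = max 1 l * (\<integral>\<omega>. min 1 \<bar>Vn n \<omega> - W n \<omega>\<bar> \<partial>M)" by simp
      finally show "norm ((\<integral>\<omega>. exp (- l * Vn n \<omega>) \<partial>M) - (\<integral>\<omega>. exp (- l * W n \<omega>) \<partial>M))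
        \<le> max 1 l * (\<integral>\<omega>. min 1 \<bar>Vn n \<omega> - W n \<omega>\<bar> \<partial>M)" .
    qed
    show "(\<lambda>n. max 1 l * (\<integral>\<omega>. min 1 \<bar>Vn n \<omega> - W n \<omega>\<bar> \<partial>M)) \<longlonglongrightarrow> 0"
      by (intro tendsto_mult_right_zero Vn_minus_W_tendsto ad)
  qed
  from tendsto_add[OF this W_laplace_tendsto[OF l]] show ?thesis by simp
qed

theorem Vn_tendsto_in_distribution:
  assumes ad: "(\<lambda>n. a n * d n) \<longlonglongrightarrow> 0"
  shows "tendsto_in_distribution M (\<lambda>n \<omega>. Vn n \<omega>) std_gaussian_seq (\<lambda>g. \<integral>z. (cmod (Q z g))\<^sup>2 \<partial>\<mu>)"
proof -
  have Vm: "(\<lambda>\<omega>. Vn n \<omega>) \<in> borel_measurable M" for n by measurable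
  have "(\<lambda>g. \<integral>z. (cmod (scaled (\<lambda>z. Q z g) z))\<^sup>2 \<partial>N) \<in> borel_measurable std_gaussian_seq"
    using Q_process(2) by (rule borel_measurable_integrable)
  then have Zm: "(\<lambda>g. \<integral>z. (cmod (Q z g))\<^sup>2 \<partial>\<mu>) \<in> borel_measurable std_gaussian_seq"
    by (subst (asm) measurable_cong[OF Q_integral(1)])
  have "weak_conv_m (\<lambda>n. distr M borel (\<lambda>\<omega>. Vn n \<omega>)) (distr std_gaussian_seq borel (\<lambda>g. \<integral>z. (cmod (Q z g))\<^sup>2 \<partial>\<mu>))"
  proof (rule laplace_tendsto_imp_weak_conv[OF prob_space_axioms prob_space_std_gaussian_seq Vm Zm])
    show "Vn n \<omega> \<ge> 0" for n \<omega> using cnt_nonneg Tn_nonneg by simp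
    fix l :: real assume "l > 0"
    from Vn_laplace_tendsto[OF ad this]
    show "(\<lambda>n. \<integral>\<omega>. exp (- l * Vn n \<omega>) \<partial>M) \<longlonglongrightarrow> (\<integral>g. exp (- l * (\<integral>z. (cmod (Q z g))\<^sup>2 \<partial>\<mu>)) \<partial>std_gaussian_seq)"
      using Q_integral(1) by (simp cong: Bochner_Integration.integral_cong)
  qed simp
  with Vm Zm show ?thesis by (simp add: tendsto_in_distribution_def)
qed

text \<open>Identifies the bias with the theoretical distance covariance, so the extra assumption of
  (2) reads a d -> 0.\<close>

lemma d_eq:
  assumes n: "n \<ge> n0"
  shows "d n = (LINT (s, t)|\<mu>. (cmod (cond_cf M nm X (r n) s t
    - cond_cf M nm X (r n) s 0 * cond_cf M nm X (r n) 0 t))\<^sup>2)"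
proof -
  interpret e: exceedance M nm X "r n" by (rule exc[OF n])
  interpret k: pair_law "\<kappa> n" by (rule laws)
  have "dcov_mean (\<kappa> n) (s, t) = cond_cf M nm X (r n) s t
    - cond_cf M nm X (r n) s 0 * cond_cf M nm X (r n) 0 t" for s t
    unfolding k.dcov_mean_eq cf_fst_def cf_snd_def e.cond_cf_exceed_law using n by (simp add: \<kappa>_def)
  then have "dcov_mean (\<kappa> n) z = cond_cf M nm X (r n) (fst z) (snd z)
    - cond_cf M nm X (r n) (fst z) 0 * cond_cf M nm X (r n) 0 (snd z)" for z
    by (cases z) simp
  then show ?thesis
    unfolding d_def by (subst integral_scaled(1)[OF _ centred_zero(1)]) (simp_all add: case_prod_unfold)
qed

end

text \<open>The Gaussian sequence space carries \<open>Q\<close>. Almost sure integrability is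
  asserted together with the convergence, because otherwise the Bochner integral that represents the
  limit could be its default value 0.\<close>

theorem theorem4p1:
  fixes M :: "'w measure"
    and nm :: "real^'d \<Rightarrow> real"
    and X :: "'w \<Rightarrow> real^'d"
    and Xs :: "nat \<Rightarrow> 'w \<Rightarrow> real^'d"
    and \<alpha> :: real
    and S :: "(real^'d) measure"
    and r :: "nat \<Rightarrow> real"
    and \<mu> :: "(real \<times> (real^'d)) measure"
  assumes "prob_space M"
    and "is_norm nm"
    and "\<alpha> > 1"
    and "multivariate_regularly_varying M nm \<alpha> S X"
    and "prob_space.indep_vars M (\<lambda>_. borel) Xs {1..}"
    and "\<And>j. j \<ge> 1 \<Longrightarrow> distr M borel (Xs j) = distr M borel X"
    and "filterlim r at_top sequentially"
    and "sets \<mu> = sets borel"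
    and "filterlim (\<lambda>n. real n * exceed_prob M nm X (r n)) at_top sequentially"
    and "\<exists>\<beta>. 1 < \<beta> \<and> \<beta> < min 2 \<alpha> \<and>
           (\<integral>\<^sup>+(s, t). ennreal (min 1 (\<bar>s\<bar> powr \<beta>) * min 1 ((norm t)\<^sup>2)) \<partial>\<mu>) < \<infinity>"
  shows "tendsto_in_probability M (\<lambda>n \<omega>. emp_dcov nm \<mu> n (r n) (\<lambda>j. Xs j \<omega>)) 0 \<and>
    ((\<lambda>n. real n * exceed_prob M nm X (r n) *
         (LINT (s, t)|\<mu>. (cmod (cond_cf M nm X (r n) s t
            - cond_cf M nm X (r n) s 0 * cond_cf M nm X (r n) 0 t))\<^sup>2)) \<longlonglongrightarrow> 0 \<longrightarrow>
     (\<exists>(P :: (nat \<Rightarrow> real) measure) Q.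
        limit_process \<alpha> S P Q \<and>
        (AE \<omega> in P. integrable \<mu> (\<lambda>z. (cmod (Q z \<omega>))\<^sup>2)) \<and>
        tendsto_in_distribution M
          (\<lambda>n \<omega>. real n * p_hat nm n (r n) (\<lambda>j. Xs j \<omega>) * emp_dcov nm \<mu> n (r n) (\<lambda>j. Xs j \<omega>))
          P (\<lambda>\<omega>. LINT z|\<mu>. (cmod (Q z \<omega>))\<^sup>2)))"
proof -
  note M = assms(1) and nm = assms(2) and mrv = assms(4) and r = assms(7)
  obtain \<beta> where \<beta>: "1 < \<beta>" "\<beta> < min 2 \<alpha>"
    and wf: "(\<integral>\<^sup>+(s, t). ennreal (min 1 (\<bar>s\<bar> powr \<beta>) * min 1 ((norm t)\<^sup>2)) \<partial>\<mu>) < \<infinity>"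
    using assms(10) by blast
  have \<beta>': "0 < \<beta>" "\<beta> \<le> 2" "\<beta> < \<alpha>" using \<beta> by auto
  obtain r0 C where r0: "r0 > 0" and exc: "\<And>\<rho>. \<rho> \<ge> r0 \<Longrightarrow> exceedance M nm X \<rho>"
    and mom: "\<And>\<rho>. \<rho> \<ge> r0 \<Longrightarrow> (\<integral>\<^sup>+y. ennreal (fst y powr \<beta>) \<partial>exceed_law M nm X \<rho>) \<le> ennreal C"
    using mrv_exceedance[OF M nm mrv \<beta>'(1,3)] by metis
  obtain T where T: "T > 0" "\<And>x. norm x \<le> T * nm x" using norm_le_is_norm[OF nm] by blast
  have "\<forall>\<^sub>F n in sequentially. r n \<ge> r0 \<and> real n * exceed_prob M nm X (r n) \<ge> 1"
    using r assms(9) by (auto simp: filterlim_at_top intro: eventually_conj)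
  then obtain n0 where n0: "\<And>n. n \<ge> n0 \<Longrightarrow> r n \<ge> r0" "\<And>n. n \<ge> n0 \<Longrightarrow> real n * exceed_prob M nm X (r n) \<ge> 1"
    by (auto simp: eventually_sequentially)
  have S: "prob_space S" "sets S = sets borel" using mrv by (auto simp: multivariate_regularly_varying_def)
  have lim: "product_limit \<alpha> S" using assms(3) S by (intro product_limit.intro) auto
  interpret dcov_setting M \<alpha> S nm X Xs r \<mu> \<beta> C T n0
  proof (rule dcov_setting.intro[OF M lim dcov_setting_axioms.intro])
    show "(\<lambda>n. \<integral>y. F y \<partial>exceed_law M nm X (r n)) \<longlonglongrightarrow> (\<integral>y. F y \<partial>(nu \<alpha> \<Otimes>\<^sub>M S))"
      if "continuous_on UNIV F" "bounded (range F)" for F :: "real \<times> (real^'d) \<Rightarrow> real"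
      using filterlim_compose[OF mrv_weak_conv[OF nm mrv exc that] r] .
    show "(\<integral>\<^sup>+z. ennreal (dcov_weight \<beta> z) \<partial>\<mu>) < \<infinity>"
      using wf by (simp add: dcov_weight_def case_prod_unfold)
  qed (fact nm assms(5,6,8,9) \<beta>' T n0(2) | (rule exc mom, erule n0(1)))+
  show ?thesis
  proof (intro conjI impI)
    show "tendsto_in_probability M (\<lambda>n \<omega>. emp_dcov nm \<mu> n (r n) (\<lambda>j. Xs j \<omega>)) 0"
      using Tn_tendsto_in_probability unfolding Tn_def[abs_def] .
  next
    assume bias: "(\<lambda>n. real n * exceed_prob M nm X (r n) *
         (LINT (s, t)|\<mu>. (cmod (cond_cf M nm X (r n) s t
            - cond_cf M nm X (r n) s 0 * cond_cf M nm X (r n) 0 t))\<^sup>2)) \<longlonglongrightarrow> 0"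
    have "(\<lambda>n. a n * d n) \<longlonglongrightarrow> 0"
    proof (rule Lim_transform_eventually[OF bias])
      show "\<forall>\<^sub>F n in sequentially. real n * exceed_prob M nm X (r n) *
         (LINT (s, t)|\<mu>. (cmod (cond_cf M nm X (r n) s t
            - cond_cf M nm X (r n) s 0 * cond_cf M nm X (r n) 0 t))\<^sup>2) = a n * d n"
        using eventually_ge_at_top[of n0] by eventually_elim (simp add: d_eq a_def p_def)
    qed
    from Vn_tendsto_in_distribution[OF this]
    have "tendsto_in_distribution M
        (\<lambda>n \<omega>. real n * p_hat nm n (r n) (\<lambda>j. Xs j \<omega>) * emp_dcov nm \<mu> n (r n) (\<lambda>j. Xs j \<omega>))
        std_gaussian_seq (\<lambda>g. LINT z|\<mu>. (cmod (Q z g))\<^sup>2)"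
      unfolding Tn_def n_p_hat[symmetric] .
    moreover have "AE g in std_gaussian_seq. integrable \<mu> (\<lambda>z. (cmod (Q z g))\<^sup>2)"
      using Q_process(1) AE_space by eventually_elim (simp add: Q_integral(2))
    ultimately show "\<exists>(P :: (nat \<Rightarrow> real) measure) Q.
        limit_process \<alpha> S P Q \<and>
        (AE \<omega> in P. integrable \<mu> (\<lambda>z. (cmod (Q z \<omega>))\<^sup>2)) \<and>
        tendsto_in_distribution M
          (\<lambda>n \<omega>. real n * p_hat nm n (r n) (\<lambda>j. Xs j \<omega>) * emp_dcov nm \<mu> n (r n) (\<lambda>j. Xs j \<omega>))
          P (\<lambda>\<omega>. LINT z|\<mu>. (cmod (Q z \<omega>))\<^sup>2)"
      using lim.limit_process_dcov_field by blast
  qed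
qed

end
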